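(* Let $K$ be a number field and let $\mathscr{D}G_K:=\varprojlim_{L/K}D_{L/K}$, the inverse limit over finite Galois extensions $L/K$ (inside a fixed algebraic closure $\bar K$) of the finite monoids $D_{L/K}$. There is a bijective correspondence between the idempotents of $\mathscr{D}G_K$ and the subsets of $P_K$.
   Context: $P_K$ is the set of non-zero maximal ideals of $O_K$, $I_K$ the monoid of non-zero integral ideals of $K$; $\mathbb{N}$ contains $0$. For a finite Galois extension $L/K$ define $\mathfrak{f}=\mathfrak{f}_{L/K}\in I_K$ by $v_{\mathfrak p}(\mathfrak f):=\min\{e\in\mathbb{N}\mid \mathrm{Gal}^e(L_{\mathfrak P}/K_{\mathfrak p})=1\}$ for each $\mathfrak p\in P_K$, where $\mathfrak P$ is any prime of $L$ over $\mathfrak p$ and $\mathrm{Gal}^e$ denotes the ramification subgroup in the upper numbering. For $\mathfrak d\mid\mathfrak f$ let $L^{(\mathfrak f/\mathfrak d)}$ be the subfield of $L$ fixed by the subgroup of $\mathrm{Gal}(L/K)$ generated by the ramification subgroups $\mathrm{Gal}^{v_{\mathfrak p}(\mathfrak f/\mathfrak d)}(L_{\mathfrak P}/K_{\mathfrak p})$ for all $\mathfrak p\in P_K$ and all $\mathfrak P\mid\mathfrak p$; it is Galois over $K$. $D_{L/K}:=\coprod_{\mathfrak d\mid\mathfrak f}\{\mathfrak d\}\times \mathrm{Gal}(L^{(\mathfrak f/\mathfrak d)}/K)$ is a finite monoid under $(\mathfrak d,\sigma)\cdot(\mathfrak d',\sigma'):=(\mathfrak d'',\sigma\sigma')$, where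 $\mathfrak d''=\gcd(\mathfrak f,\mathfrak d\mathfrak d')$ and the product $\sigma\sigma'$ is taken in $\mathrm{Gal}(L^{(\mathfrak f/\mathfrak d'')}/K)$ after restricting both factors. For $L'\supseteq L\supseteq K$ the transition map $D_{L'/K}\to D_{L/K}$ is $(\mathfrak d',\sigma')\mapsto(\gcd(\mathfrak d',\mathfrak f_{L/K}),\sigma'|)$, with $\sigma'|$ the restriction of $\sigma'$ to $L^{(\mathfrak f_{L/K}/\gcd(\mathfrak d',\mathfrak f_{L/K}))}$. *)

theory Defs
  imports
    "HOL-Analysis.Analysis"
    "HOL-Algebra.Algebra"
    "HOL-Algebra.Algebraic_Closure_Type"
begin

text \<open>
  The ambient field is a type \<open>'a :: field_char_0\<close>, viewed as a HOL-Algebra ring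
  through \<^const>\<open>ring_of_type_algebra\<close>.  In the theorem it is an algebraic closure of the
  number field \<open>K\<close>; all fields are subfields of it, given by their carrier sets.
\<close>

abbreviation \<Omega> :: "'a :: field_char_0 ring"
  where "\<Omega> \<equiv> ring_of_type_algebra"

definition number_field :: "'a :: field_char_0 set \<Rightarrow> bool"
  where "number_field K \<longleftrightarrow> subfield K \<Omega> \<and> ring.finite_dimension \<Omega> \<rat> K"


section \<open>Integers and ideals\<close>

definition integers :: "'a :: field_char_0 set \<Rightarrow> 'a ring"
  where "integers K = \<Omega>\<lparr>carrier := {x \<in> K. algebraic_int x}\<rparr>"

definition primes :: "'a :: field_char_0 set \<Rightarrow> 'a set set"
  where "primes K = {p. maximalideal p (integers K) \<and> p \<noteq> {0}}"

definition ideal_monoid :: "'a :: field_char_0 set \<Rightarrow> 'a set ring"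
  where "ideal_monoid K =
    (ideals_set (integers K))\<lparr>carrier := {I. ideal I (integers K) \<and> I \<noteq> {0}}\<rparr>"

definition ideal_val :: "'a :: field_char_0 set \<Rightarrow> 'a set \<Rightarrow> 'a set \<Rightarrow> nat"
  where "ideal_val K p I =
    (GREATEST n. (p [^]\<^bsub>ideal_monoid K\<^esub> n) divides\<^bsub>ideal_monoid K\<^esub> I)"

text \<open>In \<^const>\<open>ideal_monoid\<close> associated elements are equal, so \<^const>\<open>somegcd\<close> is the gcd.\<close>

abbreviation ideal_gcd :: "'a :: field_char_0 set \<Rightarrow> 'a set \<Rightarrow> 'a set \<Rightarrow> 'a set"
  where "ideal_gcd K I J \<equiv> somegcd (ideal_monoid K) I J"

definition ideal_quot :: "'a :: field_char_0 set \<Rightarrow> 'a set \<Rightarrow> 'a set \<Rightarrow> 'a set"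
  where "ideal_quot K I J =
    (THE C. C \<in> carrier (ideal_monoid K) \<and> J \<otimes>\<^bsub>ideal_monoid K\<^esub> C = I)"

definition primes_above :: "'a :: field_char_0 set \<Rightarrow> 'a set \<Rightarrow> 'a set \<Rightarrow> 'a set set"
  where "primes_above K L p = {P \<in> primes L. P \<inter> carrier (integers K) = p}"


section \<open>Galois groups\<close>

text \<open>Automorphisms of \<open>L\<close> are functions on the ambient field that are \<open>undefined\<close> off \<open>L\<close>.\<close>

definition Gal :: "'a :: field_char_0 set \<Rightarrow> 'a set \<Rightarrow> ('a \<Rightarrow> 'a) monoid"
  where "Gal K L = (BijGroup L)\<lparr>carrier :=
    {\<sigma> \<in> Bij L. \<sigma> \<in> ring_hom (\<Omega>\<lparr>carrier := L\<rparr>) (\<Omega>\<lparr>carrier := L\<rparr>) \<and> (\<forall>x\<in>K. \<sigma> x = x)}\<rparr>"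

definition fixed_field :: "'a set \<Rightarrow> ('a \<Rightarrow> 'a) set \<Rightarrow> 'a set"
  where "fixed_field L H = {x \<in> L. \<forall>\<sigma>\<in>H. \<sigma> x = x}"

definition finite_galois :: "'a :: field_char_0 set \<Rightarrow> 'a set \<Rightarrow> bool"
  where "finite_galois K L \<longleftrightarrow>
    subfield L \<Omega> \<and> K \<subseteq> L \<and> ring.finite_dimension \<Omega> K L \<and>
    fixed_field L (carrier (Gal K L)) = K"


section \<open>Ramification groups\<close>

text \<open>
  For \<open>P\<close> above \<open>p\<close>, the local Galois group \<open>Gal(L\<^sub>P/K\<^sub>p)\<close> is regarded as a subgroup of
  \<open>Gal(L/K)\<close>, namely the decomposition group of \<open>P\<close> (the image of restriction to \<open>L\<close>).
  Since the integers of \<open>L\<close> are dense in those of \<open>L\<^sub>P\<close>, the lower ramification group at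
  \<open>i\<close> consists of those elements that act trivially on the integers of \<open>L\<close> modulo
  \<open>P\<^sup>i\<^sup>+\<^sup>1\<close>.  For real \<open>t \<ge> -1\<close> one puts \<open>G\<^sub>t = G\<^sub>i\<close> with \<open>i\<close> the ceiling of \<open>t\<close>.
\<close>

definition decomposition_group ::
    "'a :: field_char_0 set \<Rightarrow> 'a set \<Rightarrow> 'a set \<Rightarrow> ('a \<Rightarrow> 'a) set"
  where "decomposition_group K L P = {\<sigma> \<in> carrier (Gal K L). \<sigma> ` P = P}"

definition ram_lower ::
    "'a :: field_char_0 set \<Rightarrow> 'a set \<Rightarrow> 'a set \<Rightarrow> real \<Rightarrow> ('a \<Rightarrow> 'a) set"
  where "ram_lower K L P t =
    {\<sigma> \<in> decomposition_group K L P.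
       \<forall>x\<in>carrier (integers L). \<sigma> x - x \<in> P [^]\<^bsub>ideal_monoid L\<^esub> nat (\<lceil>t\<rceil> + 1)}"

text \<open>
  Herbrand's function: \<open>\<phi>(u)\<close> is the integral from \<open>0\<close> to \<open>u\<close> of \<open>1 / [G\<^sub>0 : G\<^sub>t]\<close>, and the upper
  numbering is \<open>G\<^sup>v = G\<^sub>u\<close> with \<open>\<phi>(u) = v\<close>.  Only \<open>u, v \<ge> 0\<close> are used; in particular
  \<open>G\<^sup>0 = G\<^sub>0\<close> is the inertia group.
\<close>

definition herbrand_phi ::
    "'a :: field_char_0 set \<Rightarrow> 'a set \<Rightarrow> 'a set \<Rightarrow> real \<Rightarrow> real"
  where "herbrand_phi K L P u =
    integral {0..u} (\<lambda>t. real (card (ram_lower K L P t)) / real (card (ram_lower K L P 0)))"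

definition herbrand_psi ::
    "'a :: field_char_0 set \<Rightarrow> 'a set \<Rightarrow> 'a set \<Rightarrow> real \<Rightarrow> real"
  where "herbrand_psi K L P v = (THE u. 0 \<le> u \<and> herbrand_phi K L P u = v)"

definition ram_upper ::
    "'a :: field_char_0 set \<Rightarrow> 'a set \<Rightarrow> 'a set \<Rightarrow> real \<Rightarrow> ('a \<Rightarrow> 'a) set"
  where "ram_upper K L P v = ram_lower K L P (herbrand_psi K L P v)"


section \<open>The monoids \<open>D\<^bsub>L/K\<^esub>\<close> and their inverse limit\<close>

definition conductor :: "'a :: field_char_0 set \<Rightarrow> 'a set \<Rightarrow> 'a set"
  where "conductor K L =
    (THE f. f \<in> carrier (ideal_monoid K) \<and>
       (\<forall>p\<in>primes K. \<forall>P\<in>primes_above K L p.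
          ideal_val K p f = (LEAST e. ram_upper K L P (real e) = {\<one>\<^bsub>Gal K L\<^esub>})))"

text \<open>\<open>ram_field K L \<cc>\<close> is \<open>L\<^bsup>(\<cc>)\<^esup>\<close>.\<close>

definition ram_field :: "'a :: field_char_0 set \<Rightarrow> 'a set \<Rightarrow> 'a set \<Rightarrow> 'a set"
  where "ram_field K L \<cc> = fixed_field L (generate (Gal K L)
    (\<Union>p\<in>primes K. \<Union>P\<in>primes_above K L p. ram_upper K L P (real (ideal_val K p \<cc>))))"

abbreviation codivisor_field :: "'a :: field_char_0 set \<Rightarrow> 'a set \<Rightarrow> 'a set \<Rightarrow> 'a set"
  where "codivisor_field K L \<dd> \<equiv> ram_field K L (ideal_quot K (conductor K L) \<dd>)"

definition D_monoid ::
    "'a :: field_char_0 set \<Rightarrow> 'a set \<Rightarrow> ('a set \<times> ('a \<Rightarrow> 'a)) monoid"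
  where "D_monoid K L = \<lparr>
    carrier = (SIGMA \<dd> : {\<dd> \<in> carrier (ideal_monoid K). \<dd> divides\<^bsub>ideal_monoid K\<^esub> conductor K L}.
      carrier (Gal K (codivisor_field K L \<dd>))),
    monoid.mult = (\<lambda>(\<dd>, \<sigma>) (\<dd>', \<sigma>').
      let \<dd>'' = ideal_gcd K (conductor K L) (\<dd> \<otimes>\<^bsub>ideal_monoid K\<^esub> \<dd>');
          M = codivisor_field K L \<dd>''
      in (\<dd>'', restrict \<sigma> M \<otimes>\<^bsub>Gal K M\<^esub> restrict \<sigma>' M)),
    one = (\<one>\<^bsub>ideal_monoid K\<^esub>, \<one>\<^bsub>Gal K (codivisor_field K L \<one>\<^bsub>ideal_monoid K\<^esub>)\<^esub>)\<rparr>"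

text \<open>The transition map \<open>D\<^bsub>L'/K\<^esub> \<rightarrow> D\<^bsub>L/K\<^esub>\<close>; it depends on \<open>L'\<close> only through its domain.\<close>

definition D_transition ::
    "'a :: field_char_0 set \<Rightarrow> 'a set \<Rightarrow> 'a set \<times> ('a \<Rightarrow> 'a) \<Rightarrow> 'a set \<times> ('a \<Rightarrow> 'a)"
  where "D_transition K L = (\<lambda>(\<dd>', \<sigma>').
    let \<dd> = ideal_gcd K \<dd>' (conductor K L) in (\<dd>, restrict \<sigma>' (codivisor_field K L \<dd>)))"

definition DG :: "'a :: field_char_0 set \<Rightarrow> ('a set \<Rightarrow> 'a set \<times> ('a \<Rightarrow> 'a)) monoid"
  where "DG K = (let D = product_group {L. finite_galois K L} (D_monoid K) in
    D\<lparr>carrier := {x \<in> carrier D.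
        \<forall>L L'. finite_galois K L \<and> finite_galois K L' \<and> L \<subseteq> L' \<longrightarrow>
          D_transition K L (x L') = x L}\<rparr>)"

definition idempotents :: "('b, 'c) monoid_scheme \<Rightarrow> 'b set"
  where "idempotents M = {x \<in> carrier M. x \<otimes>\<^bsub>M\<^esub> x = x}"

end

theory Submission
  imports Defs "Jordan_Normal_Form.Char_Poly"
begin

text \<open>
  An idempotent \<open>x\<close> of the limit has components \<open>(d, 1)\<close> in which \<open>d\<close> is a divisor of the conductor \<open>f\<close> of \<open>L\<close> with
  \<open>gcd(f, d\<^sup>2) = d\<close>, that is, \<open>v(d) \<in> {0, v(f)}\<close> at every prime: at each level \<open>x\<close> selects a set of ramified primes.
  A prime \<open>p\<close> ramifies in \<open>K(\<surd>a)\<close> for \<open>a \<in> p - p\<^sup>2\<close>, and \<open>L(\<surd>a)\<close> contains both \<open>L\<close> and \<open>K(\<surd>a)\<close>.  Since transition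
  maps take minima with \<open>v(f)\<close>, whether \<open>p\<close> is selected at a level where it ramifies is decided at \<open>K(\<surd>a)\<close>, hence
  does not depend on the level; so \<open>x\<close> is determined by a subset of the primes.

  Conversely, that the choice \<open>v(d) = v(f)\<close> at the primes of \<open>S\<close> and \<open>0\<close> elsewhere is compatible with the
  transition maps requires conductors to grow with \<open>L\<close>.  If \<open>i\<close> denotes the largest exponent of \<open>P\<close> modulo which an
  automorphism is trivial, triviality of an upper ramification group at an integer is an inequality between sums of
  the numbers \<open>i(\<sigma>)\<close> and the order of the inertia group.  It passes from \<open>L'\<close> to \<open>L\<close> by Herbrand's estimate
  \<open>h i(\<sigma>) \<le> \<Sum> i(s)\<close>, where \<open>s\<close> runs over the lifts of \<open>\<sigma>\<close> to \<open>L'\<close> and \<open>h\<close> is the order of the inertia group of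
  \<open>L'/L\<close>; this comes from evaluating the minimal polynomial over \<open>L\<close> of a local generator of \<open>L'\<close>.
\<close>

section \<open>Algebraic integers\<close>

text \<open>No completion is formed: statements about the local extension become congruences modulo
  powers of a prime of the global field. The estimate for \<open>h\<close> rests on the fact that an
  element of the prime below has valuation at least \<open>h\<close> at the prime above. The
  obstacle is wild ramification, where averaging over the inertia group fails because the residue
  characteristic divides its order; integers fixed by the group come instead from an elementary
  symmetric function whose degree is the largest power of that characteristic dividing the order.
  The group components demand that the fixed fields attached to the chosen divisors grow with
  \<open>L\<close>. For idempotents the exponents of the upper ramification groups are 0 at the
  selected primes and the full conductor exponent elsewhere, so that only inertia groups and trivial
  groups are compared. The quadratic extension is a hub: each level is enlarged by one square root
  instead of being joined with another level. That it ramifies follows from parity of valuations,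
  which treats the primes above 2 like all others.\<close>

lemma algebraic_int_matrix:
  fixes x :: "'a :: field_char_0" and v :: "nat \<Rightarrow> 'a" and a :: "nat \<Rightarrow> nat \<Rightarrow> int"
  assumes ev: "\<And>i. i < n \<Longrightarrow> x * v i = (\<Sum>j<n. of_int (a i j) * v j)"
    and nz: "k < n" "v k \<noteq> 0"
  shows "algebraic_int x"
proof -
  define A :: "int mat" where "A = Matrix.mat n n (\<lambda>(i, j). a i j)"
  have A: "A \<in> carrier_mat n n" by (simp add: A_def)
  define B where "B = map_mat (of_int :: int \<Rightarrow> 'a) A"
  have B: "B \<in> carrier_mat n n" using A by (simp add: B_def)
  define w where "w = Matrix.vec n v"
  have w: "w \<in> carrier_vec n" by (simp add: w_def)
  have "w \<noteq> 0\<^sub>v n"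
  proof
    assume "w = 0\<^sub>v n"
    then have "vec_index w k = vec_index (0\<^sub>v n) k" by simp
    then show False using nz by (simp add: w_def)
  qed
  moreover have "mult_mat_vec B w = smult_vec x w"
  proof (rule eq_vecI)
    fix i assume "i < dim_vec (smult_vec x w)"
    then have i: "i < n" by (simp add: w_def)
    have "vec_index (mult_mat_vec B w) i = (\<Sum>j<n. of_int (a i j) * v j)"
      using i A by (simp add: B_def A_def w_def scalar_prod_def lessThan_atLeast0)
    then show "vec_index (mult_mat_vec B w) i = vec_index (smult_vec x w) i"
      using i ev[OF i] by (simp add: w_def)
  qed (use A in \<open>simp add: B_def w_def\<close>)
  \<comment> \<open>An eigenvalue of an integer matrix is a root of its characteristic polynomial,
    which is monic with integer coefficients.\<close>
  ultimately have "eigenvalue B x"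
    using w B unfolding eigenvalue_def eigenvector_def by auto
  then have "poly (char_poly B) x = 0"
    using eigenvalue_root_char_poly[OF B] by simp
  then have "poly (map_poly of_int (char_poly A)) x = 0"
    by (simp add: B_def of_int_hom.char_poly_hom[OF A])
  moreover have "Polynomial.lead_coeff (char_poly A) = 1"
    using degree_monic_char_poly[OF A] by simp
  ultimately show ?thesis
    unfolding algebraic_int_altdef_ipoly by blast
qed

section \<open>Module criterion for integrality; sums, products and transitivity\<close>

definition zspan :: "'a :: field_char_0 set \<Rightarrow> 'a set"
  where "zspan B = {z. \<exists>c :: 'a \<Rightarrow> int. z = (\<Sum>b\<in>B. of_int (c b) * b)}"

lemma zspan_base:
  fixes b :: "'a :: field_char_0"
  assumes "finite B" "b \<in> B" shows "b \<in> zspan B"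
proof -
  have "(\<Sum>x\<in>B. of_int (if x = b then 1 else 0) * x) = (\<Sum>x\<in>B. if x = b then x else 0)"
    by (rule sum.cong) auto
  also have "\<dots> = b" using assms by simp
  finally show ?thesis unfolding zspan_def by (intro CollectI exI) (erule sym)
qed

lemma zspan_0: "0 \<in> zspan B"
  unfolding zspan_def by (auto intro!: exI[of _ "\<lambda>_. 0"])

lemma zspan_add:
  assumes "x \<in> zspan B" "y \<in> zspan B" shows "x + y \<in> zspan B"
proof -
  obtain c d :: "'a \<Rightarrow> int"
    where "x = (\<Sum>b\<in>B. of_int (c b) * b)" "y = (\<Sum>b\<in>B. of_int (d b) * b)"
    using assms unfolding zspan_def by blast
  then have "x + y = (\<Sum>b\<in>B. of_int (c b + d b) * b)"
    by (simp add: sum.distrib distrib_right)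
  then show ?thesis unfolding zspan_def by (auto intro: exI[of _ "\<lambda>b. c b + d b"])
qed

lemma zspan_of_int_mult:
  assumes "x \<in> zspan B" shows "of_int k * x \<in> zspan B"
proof -
  obtain c :: "'a \<Rightarrow> int" where "x = (\<Sum>b\<in>B. of_int (c b) * b)"
    using assms unfolding zspan_def by blast
  then have "of_int k * x = (\<Sum>b\<in>B. of_int (k * c b) * b)"
    by (simp add: sum_distrib_left mult.assoc)
  then show ?thesis unfolding zspan_def by (auto intro: exI[of _ "\<lambda>b. k * c b"])
qed

lemma zspan_sum: "(\<And>i. i \<in> A \<Longrightarrow> f i \<in> zspan B) \<Longrightarrow> sum f A \<in> zspan B"
  by (induction A rule: infinite_finite_induct) (auto intro: zspan_0 zspan_add)

lemma zspan_mult: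
  assumes "z \<in> zspan B" "\<And>b. b \<in> B \<Longrightarrow> x * b \<in> zspan C"
  shows "x * z \<in> zspan C"
proof -
  obtain c :: "'a \<Rightarrow> int" where "z = (\<Sum>b\<in>B. of_int (c b) * b)"
    using assms(1) unfolding zspan_def by blast
  then have "x * z = (\<Sum>b\<in>B. of_int (c b) * (x * b))"
    by (simp add: sum_distrib_left mult.left_commute)
  then show ?thesis using assms(2) by (auto intro!: zspan_sum zspan_of_int_mult)
qed

text \<open>For a finite \<open>B\<close> containing 1 this is the module criterion for integrality:
  multiplication by \<open>x\<close> preserves a finitely generated group that contains 1. A finite
  set stands for the module, so that one \<open>B\<close> can serve several elements.\<close>

definition stabilizes :: "'a :: field_char_0 \<Rightarrow> 'a set \<Rightarrow> bool"
  where "stabilizes x B \<longleftrightarrow> (\<forall>b\<in>B. x * b \<in> zspan B)"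

lemma algebraic_int_stabilizes:
  assumes B: "finite B" "1 \<in> B" and x: "stabilizes x B"
  shows "algebraic_int x"
proof -
  obtain v where v: "bij_betw v {..<card B} B"
    using B(1) ex_bij_betw_nat_finite by (metis lessThan_atLeast0)
  have "\<exists>c :: 'a \<Rightarrow> int. x * v i = (\<Sum>b\<in>B. of_int (c b) * b)" if "i < card B" for i
    using x bij_betwE[OF v] that unfolding stabilizes_def zspan_def by fast
  then obtain c :: "nat \<Rightarrow> 'a \<Rightarrow> int"
    where c: "\<And>i. i < card B \<Longrightarrow> x * v i = (\<Sum>b\<in>B. of_int (c i b) * b)" by metis
  \<comment> \<open>The entry 1 makes the eigenvector formed by the elements of \<open>B\<close>
    nonzero.\<close>
  obtain k where k: "k < card B" "v k = 1"
    using v B(2) by (metis bij_betw_iff_bijections lessThan_iff)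
  show ?thesis
  proof (rule algebraic_int_matrix[where n = "card B" and v = v and a = "\<lambda>i j. c i (v j)"])
    show "x * v i = (\<Sum>j<card B. of_int (c i (v j)) * v j)" if "i < card B" for i
      unfolding c[OF that] by (rule sum.reindex_bij_betw[OF v, symmetric])
  qed (use k in auto)
qed

lemma stabilizes_zspan: "stabilizes x B \<Longrightarrow> z \<in> zspan B \<Longrightarrow> x * z \<in> zspan B"
  unfolding stabilizes_def by (erule zspan_mult) blast

lemma stabilizes_add: "stabilizes x B \<Longrightarrow> stabilizes y B \<Longrightarrow> stabilizes (x + y) B"
  unfolding stabilizes_def by (auto simp: distrib_right intro: zspan_add)

lemma stabilizes_mult: "stabilizes x B \<Longrightarrow> stabilizes y B \<Longrightarrow> stabilizes (x * y) B"
  using stabilizes_zspan unfolding stabilizes_def by (metis mult.assoc)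

text \<open>Passing to the products of \<open>B\<close> with \<open>x ^ j\<close> for
  \<open>j < n\<close> adjoins \<open>x\<close> while keeping every element stabilized so far; the
  equation rewrites \<open>x ^ n\<close>, the only power that leaves the list.\<close>

lemma stabilizes_root:
  fixes x :: "'a :: field_char_0"
  assumes B: "finite B" "1 \<in> B" and c: "\<And>i. i < n \<Longrightarrow> stabilizes (c i) B"
    and x: "x ^ n = (\<Sum>i<n. c i * x ^ i)"
  defines "C \<equiv> (\<lambda>(b, j). b * x ^ j) ` (B \<times> {..<n})"
  shows "finite C" "1 \<in> C" "stabilizes x C"
    and "\<And>y. stabilizes y B \<Longrightarrow> stabilizes y C"
proof -
  show fin: "finite C" using B by (simp add: C_def)
  have "n > 0" using x by (cases n) auto
  then have "(\<lambda>(b, j). b * x ^ j) (1, 0) \<in> C" unfolding C_def using B by (intro imageI) auto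
  then show "1 \<in> C" by simp
  have zC: "x ^ j * z \<in> zspan C" if "z \<in> zspan B" "j < n" for z j
  proof (rule zspan_mult[OF that(1)])
    fix b assume b: "b \<in> B"
    have "(\<lambda>(b, j). b * x ^ j) (b, j) \<in> C" unfolding C_def using b that(2) by (intro imageI) auto
    then show "x ^ j * b \<in> zspan C" by (intro zspan_base fin) (simp add: mult.commute)
  qed
  show "stabilizes y C" if y: "stabilizes y B" for y
    unfolding stabilizes_def
  proof
    fix z assume "z \<in> C"
    then obtain b j where b: "b \<in> B" "j < n" "z = b * x ^ j" by (auto simp: C_def)
    then have "y * b \<in> zspan B" using y by (auto simp: stabilizes_def)
    from zC[OF this b(2)] show "y * z \<in> zspan C" by (simp add: b(3) mult_ac)
  qed
  show "stabilizes x C" unfolding stabilizes_def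
  proof
    fix z assume "z \<in> C"
    then obtain b j where b: "b \<in> B" "j < n" "z = b * x ^ j" by (auto simp: C_def)
    show "x * z \<in> zspan C"
    proof (cases "Suc j < n")
      case True
      then show ?thesis using zC[OF zspan_base[OF B(1) b(1)] True] by (simp add: b(3) mult_ac)
    next
      case False
      then have "n = Suc j" using b by simp
      then have "x * z = b * x ^ n" by (simp add: b(3) mult_ac)
      also have "\<dots> = (\<Sum>i<n. x ^ i * (c i * b))" by (simp add: x sum_distrib_left mult_ac)
      also have "\<dots> \<in> zspan C"
        using c b(1) by (intro zspan_sum zC) (auto simp: stabilizes_def)
      finally show ?thesis .
    qed
  qed
qed

lemma stabilizes_of_int: "finite B \<Longrightarrow> stabilizes (of_int k) B"
  unfolding stabilizes_def by (auto intro: zspan_of_int_mult zspan_base)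

lemma algebraic_int_monic:
  fixes x :: "'a :: field_char_0"
  assumes "algebraic_int x"
  obtains n and c :: "nat \<Rightarrow> int" where "x ^ n = (\<Sum>i<n. of_int (c i) * x ^ i)"
proof -
  obtain p :: "int poly" where p: "poly (map_poly of_int p) x = 0" "Polynomial.lead_coeff p = 1"
    using assms unfolding algebraic_int_altdef_ipoly by blast
  define n where "n = Polynomial.degree p"
  have "0 = (\<Sum>i\<le>n. of_int (Polynomial.coeff p i) * x ^ i)"
    using p(1) unfolding poly_altdef n_def by (simp add: coeff_map_poly of_int_hom.degree_map_poly_hom)
  also have "\<dots> = x ^ n + (\<Sum>i<n. of_int (Polynomial.coeff p i) * x ^ i)"
    using p(2) by (simp add: n_def lessThan_Suc_atMost[symmetric])
  finally have "x ^ n = (\<Sum>i<n. of_int (- Polynomial.coeff p i) * x ^ i)"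
    by (simp add: sum_negf eq_neg_iff_add_eq_0)
  then show ?thesis by (rule that)
qed

text \<open>Sums and products of algebraic integers are integral because a single \<open>B\<close>
  works for both factors; the set is enlarged once for each element.\<close>

lemma ex_stabilized:
  fixes S :: "'a :: field_char_0 set"
  assumes "finite S" "\<And>x. x \<in> S \<Longrightarrow> algebraic_int x"
  shows "\<exists>B. finite B \<and> 1 \<in> B \<and> (\<forall>x\<in>S. stabilizes x B)"
  using assms
proof (induction S)
  case empty
  show ?case by (rule exI[of _ "{1}"]) auto
next
  case (insert x S)
  then obtain B where B: "finite B" "1 \<in> B" "\<forall>x\<in>S. stabilizes x B" by auto
  obtain n and c :: "nat \<Rightarrow> int" where "x ^ n = (\<Sum>i<n. of_int (c i) * x ^ i)"
    using algebraic_int_monic[of x] insert.prems by blast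
  note C = stabilizes_root[OF B(1,2) stabilizes_of_int[OF B(1)] this]
  show ?case using C(1,2,3) C(4) B(3) by (intro exI conjI ballI) auto
qed

lemma algebraic_int_add [simp]:
  fixes x :: "'a :: field_char_0"
  shows "algebraic_int x \<Longrightarrow> algebraic_int y \<Longrightarrow> algebraic_int (x + y)"
  using ex_stabilized[of "{x, y}"] stabilizes_add algebraic_int_stabilizes by blast

lemma algebraic_int_mult [simp]:
  fixes x :: "'a :: field_char_0"
  shows "algebraic_int x \<Longrightarrow> algebraic_int y \<Longrightarrow> algebraic_int (x * y)"
  using ex_stabilized[of "{x, y}"] stabilizes_mult algebraic_int_stabilizes by blast

text \<open>Transitivity of integrality: a set stabilized by all coefficients is enlarged by the
  powers of \<open>x\<close>.\<close>

lemma algebraic_int_integral: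
  fixes x :: "'a :: field_char_0"
  assumes "x ^ n = (\<Sum>i<n. c i * x ^ i)" "\<And>i. i < n \<Longrightarrow> algebraic_int (c i)"
  shows "algebraic_int x"
proof -
  obtain B where "finite B" "1 \<in> B" "\<And>i. i < n \<Longrightarrow> stabilizes (c i) B"
    using ex_stabilized[of "c ` {..<n}"] assms(2) by auto
  note C = stabilizes_root[OF this assms(1)]
  show ?thesis by (rule algebraic_int_stabilizes[OF C(1-3)])
qed

lemma algebraic_int_of_int [simp]: "algebraic_int (of_int k)"
  by (simp add: int_imp_algebraic_int)

section \<open>Subfields and number fields\<close>

lemma Omega_simps [simp]:
  "carrier \<Omega> = UNIV" "x \<otimes>\<^bsub>\<Omega>\<^esub> y = x * y" "x \<oplus>\<^bsub>\<Omega>\<^esub> y = x + y" "\<one>\<^bsub>\<Omega>\<^esub> = 1" "\<zero>\<^bsub>\<Omega>\<^esub> = 0"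
  by (simp_all add: ring_of_type_algebra_def)

lemma field_Omega: "field (\<Omega> :: 'a :: field_char_0 ring)"
  by (rule field_from_type_algebra)

interpretation Omega: cring "\<Omega> :: 'a :: field_char_0 ring"
  by (rule cring_from_type_algebra)

lemma domain_Omega: "domain (\<Omega> :: 'a :: field_char_0 ring)"
  using field_Omega by (rule field.axioms)

lemma Omega_a_inv [simp]: "\<ominus>\<^bsub>\<Omega>\<^esub> x = - (x :: 'a :: field_char_0)"
  by (rule Omega.minus_equality) auto

lemma Omega_m_inv: "x \<noteq> 0 \<Longrightarrow> inv\<^bsub>\<Omega>\<^esub> x = inverse (x :: 'a :: field_char_0)"
  by (rule Omega.comm_inv_char) auto

lemma subfield_Omega_iff:
  fixes K :: "'a :: field_char_0 set"
  shows "subfield K \<Omega> \<longleftrightarrow> 1 \<in> K \<and> (\<forall>x\<in>K. \<forall>y\<in>K. x + y \<in> K) \<and> (\<forall>x\<in>K. \<forall>y\<in>K. x * y \<in> K) \<and>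
    (\<forall>x\<in>K. - x \<in> K) \<and> (\<forall>x\<in>K. inverse x \<in> K)" (is "_ \<longleftrightarrow> ?R")
proof
  assume K: "subfield K \<Omega>"
  have "inverse x \<in> K" if "x \<in> K" for x
  proof (cases "x = 0")
    case False
    then show ?thesis using Omega.subfield_m_inv(1)[OF K, of x] that by (simp add: Omega_m_inv)
  qed (use that in auto)
  then show ?R using subringE[OF subfieldE(1)[OF K]] by auto
next
  assume R: ?R
  show "subfield K \<Omega>"
  proof (rule field.subfieldI'[OF field_Omega])
    show "subring K \<Omega>" using R by (intro Omega.subringI) auto
  qed (use R in \<open>auto simp: Omega_m_inv\<close>)
qed

locale sub_field =
  fixes K :: "'a :: field_char_0 set"
  assumes subfield_K: "subfield K \<Omega>"
begin

lemma one_mem [simp]: "1 \<in> K"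
  and add_mem [simp]: "x \<in> K \<Longrightarrow> y \<in> K \<Longrightarrow> x + y \<in> K"
  and mult_mem [simp]: "x \<in> K \<Longrightarrow> y \<in> K \<Longrightarrow> x * y \<in> K"
  and uminus_mem [simp]: "x \<in> K \<Longrightarrow> - x \<in> K"
  and inverse_mem [simp]: "x \<in> K \<Longrightarrow> inverse x \<in> K"
  using subfield_K unfolding subfield_Omega_iff by auto

lemma diff_mem [simp]: "x \<in> K \<Longrightarrow> y \<in> K \<Longrightarrow> x - y \<in> K"
  using add_mem[of x "- y"] uminus_mem by simp

lemma divide_mem [simp]: "x \<in> K \<Longrightarrow> y \<in> K \<Longrightarrow> x / y \<in> K"
  unfolding divide_inverse by auto

lemma zero_mem [simp]: "0 \<in> K"
  using diff_mem[of 1 1] by simp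

lemma power_mem [simp]: "x \<in> K \<Longrightarrow> x ^ n \<in> K"
  by (induction n) auto

lemma sum_mem [simp]: "(\<And>i. i \<in> A \<Longrightarrow> f i \<in> K) \<Longrightarrow> sum f A \<in> K"
  by (induction A rule: infinite_finite_induct) auto

lemma prod_mem [simp]: "(\<And>i. i \<in> A \<Longrightarrow> f i \<in> K) \<Longrightarrow> prod f A \<in> K"
  by (induction A rule: infinite_finite_induct) auto

lemma of_nat_mem [simp]: "of_nat n \<in> K"
  by (induction n) auto

lemma of_int_mem [simp]: "of_int n \<in> K"
  by (cases n rule: int_cases2) auto

lemmas closed = one_mem zero_mem of_int_mem of_nat_mem add_mem mult_mem uminus_mem inverse_mem diff_mem divide_mem power_mem sum_mem prod_mem

end

lemma subfield_Rats: "subfield \<rat> (\<Omega> :: 'a :: field_char_0 ring)"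
  unfolding subfield_Omega_iff by auto

section \<open>Finite dimension over the rationals as integer relations\<close>

lemma Omega_combine:
  "length c = length v \<Longrightarrow> Omega.combine c v = (\<Sum>i<length v. c ! i * (v ! i :: 'a :: field_char_0))"
proof (induction c v rule: list_induct2)
  case (Cons x xs y ys)
  then show ?case by (simp add: sum.lessThan_Suc_shift del: sum.lessThan_Suc)
qed simp

lemma Rats_common_denominator:
  assumes "finite A" "A \<subseteq> (\<rat> :: 'a :: field_char_0 set)"
  shows "\<exists>d :: int. d \<noteq> 0 \<and> (\<forall>q\<in>A. of_int d * q \<in> \<int>)"
  using assms
proof (induction A)
  case empty
  show ?case by (rule exI[of _ 1]) auto
next
  case (insert q A)
  then obtain d :: int where d: "d \<noteq> 0" "\<forall>q\<in>A. of_int d * q \<in> \<int>" by auto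
  from insert.prems obtain a b :: int where ab: "b > 0" "q = of_int a / of_int b"
    using Rats_cases' by (metis insert_subset)
  have "of_int (d * b) * r \<in> \<int>" if "r \<in> insert q A" for r
  proof (cases "r = q")
    case True
    then have "of_int (d * b) * r = of_int (d * a)" using ab by simp
    then show ?thesis using Ints_of_int by metis
  next
    case False
    then have "of_int d * r \<in> \<int>" using that d by auto
    then have "of_int b * (of_int d * r) \<in> \<int>" by (rule Ints_mult[OF Ints_of_int])
    then show ?thesis by (metis of_int_mult mult.assoc mult.commute)
  qed
  then show ?case using d ab by (intro exI[of _ "d * b"]) auto
qed

text \<open>Among more elements than the dimension there is a rational relation, and its
  denominators are cleared. Integer coefficients are wanted because the relation is later reduced
  modulo a prime number.\<close>

lemma number_field_bound:
  assumes "number_field (K :: 'a :: field_char_0 set)"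
  obtains n where "\<And>y :: nat \<Rightarrow> 'a. (\<And>i. i \<le> n \<Longrightarrow> y i \<in> K) \<Longrightarrow>
    \<exists>c :: nat \<Rightarrow> int. (\<exists>i\<le>n. c i \<noteq> 0) \<and> (\<Sum>i\<le>n. of_int (c i) * y i) = 0"
proof -
  obtain n where n: "Omega.dimension n \<rat> K"
    using assms unfolding number_field_def Omega.finite_dimension_def by blast
  show ?thesis
  proof (rule that)
    fix y :: "nat \<Rightarrow> 'a" assume y: "\<And>i. i \<le> n \<Longrightarrow> y i \<in> K"
    define Us where "Us = map y [0..<Suc n]"
    have len: "length Us = Suc n" by (simp add: Us_def)
    have "set Us \<subseteq> K" using y by (auto simp: Us_def)
    then have "\<not> Omega.independent \<rat> Us"
      using Omega.independent_length_le_dimension[OF subfield_Rats n, of Us] len by auto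
    then obtain Ks where Ks: "length Ks = length Us" "Omega.combine Ks Us = 0"
      "set Ks \<subseteq> \<rat>" "set Ks \<noteq> {0}"
      using Omega.dependent_imp_non_trivial_combine[OF subfield_Rats, of Us]
      by (metis Omega_simps(1,5) subset_UNIV)
    obtain d :: int where d: "d \<noteq> 0" "\<And>q. q \<in> set Ks \<Longrightarrow> of_int d * q \<in> \<int>"
      using Rats_common_denominator[of "set Ks"] Ks(3) by auto
    have "\<exists>m :: int. of_int d * Ks ! i = of_int m" if "i \<le> n" for i
      using d(2)[of "Ks ! i"] that Ks(1) len by (auto elim!: Ints_cases)
    then obtain c :: "nat \<Rightarrow> int" where c: "\<And>i. i \<le> n \<Longrightarrow> of_int d * Ks ! i = of_int (c i)"
      by metis
    have "(\<Sum>i\<le>n. of_int (c i) * y i) = (\<Sum>i\<le>n. of_int d * (Ks ! i * Us ! i))"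
      by (rule sum.cong) (auto simp: c[symmetric] Us_def simp del: upt_Suc)
    also have "\<dots> = of_int d * Omega.combine Ks Us"
      by (simp add: Omega_combine[OF Ks(1)] len sum_distrib_left lessThan_Suc_atMost)
    finally have "(\<Sum>i\<le>n. of_int (c i) * y i) = 0" using Ks(2) by simp
    moreover obtain i where i: "i \<le> n" "Ks ! i \<noteq> 0"
    proof -
      have "set Ks \<noteq> {}" using Ks(1) len by auto
      then have "\<not> set Ks \<subseteq> {0}" using Ks(4) by (simp add: subset_singleton_iff)
      then obtain q where "q \<in> set Ks" "q \<noteq> 0" by blast
      then obtain i where "i < length Ks" "Ks ! i \<noteq> 0" by (auto simp: in_set_conv_nth)
      then show ?thesis using that[of i] Ks(1) len by auto
    qed
    have "c i \<noteq> 0" using c[OF i(1)] i(2) d(1) by auto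
    ultimately show "\<exists>c :: nat \<Rightarrow> int. (\<exists>i\<le>n. c i \<noteq> 0) \<and> (\<Sum>i\<le>n. of_int (c i) * y i) = 0"
      using i(1) by blast
  qed
qed

text \<open>Multiplying the equation by \<open>c n ^ (n - 1)\<close> turns it into a monic one for
  \<open>of_int (c n) * x\<close>.\<close>

lemma algebraic_int_lead_coeff:
  fixes x :: "'a :: field_char_0" and c :: "nat \<Rightarrow> int"
  assumes "(\<Sum>i\<le>n. of_int (c i) * x ^ i) = 0"
  shows "algebraic_int (of_int (c n) * x)"
proof (cases n)
  case 0
  then show ?thesis using assms by auto
next
  case (Suc m)
  define a :: 'a where "a = of_int (c n)"
  have "(a * x) ^ n = a ^ m * (a * x ^ n)" by (simp add: Suc power_mult_distrib)
  also have "a * x ^ n = (\<Sum>i<n. - of_int (c i) * x ^ i)"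
    using assms by (simp add: a_def lessThan_Suc_atMost[symmetric] sum_negf eq_neg_iff_add_eq_0 add.commute)
  also have "a ^ m * \<dots> = (\<Sum>i<n. - (of_int (c i) * a ^ (m - i)) * (a * x) ^ i)"
    unfolding sum_distrib_left
  proof (rule sum.cong)
    fix i assume "i \<in> {..<n}"
    then have "a ^ m = a ^ (m - i) * a ^ i" by (simp add: Suc power_add[symmetric])
    then show "a ^ m * (- of_int (c i) * x ^ i) = - (of_int (c i) * a ^ (m - i)) * (a * x) ^ i"
      by (simp add: power_mult_distrib)
  qed simp
  finally have eq: "(a * x) ^ n = (\<Sum>i<n. - (of_int (c i) * a ^ (m - i)) * (a * x) ^ i)" .
  have "algebraic_int (a * x)"
  proof (rule algebraic_int_integral[OF eq])
    show "algebraic_int (- (of_int (c i) * a ^ (m - i)))" for i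
      unfolding a_def by (metis algebraic_int_of_int of_int_minus of_int_mult of_int_power)
  qed
  then show ?thesis by (simp add: a_def)
qed

lemma number_field_algebraic:
  assumes K: "number_field K" and x: "x \<in> K"
  obtains m :: int where "m \<noteq> 0" "algebraic_int (of_int m * x)"
proof -
  interpret sub_field K using K by (intro sub_field.intro) (simp add: number_field_def)
  obtain n where n: "\<And>y :: nat \<Rightarrow> 'a. (\<And>i. i \<le> n \<Longrightarrow> y i \<in> K) \<Longrightarrow>
    \<exists>c :: nat \<Rightarrow> int. (\<exists>i\<le>n. c i \<noteq> 0) \<and> (\<Sum>i\<le>n. of_int (c i) * y i) = 0"
    using number_field_bound[OF K] by metis
  obtain c :: "nat \<Rightarrow> int" where c: "\<exists>i\<le>n. c i \<noteq> 0" "(\<Sum>i\<le>n. of_int (c i) * x ^ i) = 0"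
    using n[of "\<lambda>i. x ^ i"] x by auto
  \<comment> \<open>The relation found may end in zeros; its last nonzero coefficient serves as the
    leading one.\<close>
  define k where "k = Max {i. i \<le> n \<and> c i \<noteq> 0}"
  have k: "k \<le> n" "c k \<noteq> 0" using Max_in[of "{i. i \<le> n \<and> c i \<noteq> 0}"] c(1) by (auto simp: k_def)
  have "(\<Sum>i\<le>k. of_int (c i) * x ^ i) = (\<Sum>i\<le>n. of_int (c i) * x ^ i)"
  proof (rule sum.mono_neutral_left)
    show "\<forall>i\<in>{..n} - {..k}. of_int (c i) * x ^ i = 0"
      using Max_ge[of "{i. i \<le> n \<and> c i \<noteq> 0}"] by (force simp: k_def)
  qed (use k in auto)
  then have "algebraic_int (of_int (c k) * x)" using c(2) by (intro algebraic_int_lead_coeff) simp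
  then show ?thesis using k(2) that by blast
qed

section \<open>Rings of integers and their ideals in terms of elements\<close>

locale nfield =
  fixes K :: "'a :: field_char_0 set"
  assumes nf: "number_field K"

sublocale nfield \<subseteq> sub_field
  using nf by (intro sub_field.intro) (simp add: number_field_def)

abbreviation ints :: "'a :: field_char_0 set \<Rightarrow> 'a set"
  where "ints K \<equiv> carrier (integers K)"

lemma integers_simps [simp]:
  "x \<otimes>\<^bsub>integers K\<^esub> y = x * y" "x \<oplus>\<^bsub>integers K\<^esub> y = x + y" "\<one>\<^bsub>integers K\<^esub> = 1" "\<zero>\<^bsub>integers K\<^esub> = 0"
  by (simp_all add: integers_def)

lemma ints_iff: "x \<in> ints K \<longleftrightarrow> x \<in> K \<and> algebraic_int x"
  by (simp add: integers_def)

context nfield begin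

lemma ints_mem: "x \<in> ints K \<Longrightarrow> x \<in> K"
  by (simp add: ints_iff)

lemma ints_one [simp]: "1 \<in> ints K"
  and ints_zero [simp]: "0 \<in> ints K"
  and ints_add [simp]: "x \<in> ints K \<Longrightarrow> y \<in> ints K \<Longrightarrow> x + y \<in> ints K"
  and ints_mult [simp]: "x \<in> ints K \<Longrightarrow> y \<in> ints K \<Longrightarrow> x * y \<in> ints K"
  and ints_uminus [simp]: "x \<in> ints K \<Longrightarrow> - x \<in> ints K"
  and ints_of_int [simp]: "of_int k \<in> ints K"
  and ints_of_nat [simp]: "of_nat n \<in> ints K"
  using algebraic_int_of_int[of 1] algebraic_int_of_int[of "int n"] unfolding ints_iff by auto

lemma ints_diff [simp]: "x \<in> ints K \<Longrightarrow> y \<in> ints K \<Longrightarrow> x - y \<in> ints K"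
  using ints_add[of x "- y"] ints_uminus by simp

lemma ints_power [simp]: "x \<in> ints K \<Longrightarrow> x ^ n \<in> ints K"
  by (induction n) auto

lemma ints_sum [simp]: "(\<And>i. i \<in> A \<Longrightarrow> f i \<in> ints K) \<Longrightarrow> sum f A \<in> ints K"
  by (induction A rule: infinite_finite_induct) auto

lemma ints_prod [simp]: "(\<And>i. i \<in> A \<Longrightarrow> f i \<in> ints K) \<Longrightarrow> prod f A \<in> ints K"
  by (induction A rule: infinite_finite_induct) auto

lemmas ints_closed = ints_one ints_zero ints_of_int ints_of_nat ints_add ints_mult ints_uminus ints_diff ints_power ints_sum ints_prod

lemma subring_ints: "subring (ints K) \<Omega>"
  by (rule Omega.subringI) auto

lemma domain_integers: "domain (integers K)"
proof -
  have "integers K = \<Omega>\<lparr>carrier := ints K\<rparr>" by (simp add: integers_def)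
  then show ?thesis using domain.subring_is_domain[OF domain_Omega subring_ints] by simp
qed

end

sublocale nfield \<subseteq> OK: cring "integers K"
  using domain_integers by (simp add: domain_def)

context nfield begin

lemma integers_a_inv [simp]: "x \<in> ints K \<Longrightarrow> \<ominus>\<^bsub>integers K\<^esub> x = - x"
  by (rule OK.minus_equality) auto

lemma idealD:
  assumes "ideal I (integers K)"
  shows "I \<subseteq> ints K" "0 \<in> I" "x \<in> I \<Longrightarrow> y \<in> I \<Longrightarrow> x + y \<in> I"
    "r \<in> ints K \<Longrightarrow> x \<in> I \<Longrightarrow> r * x \<in> I" "r \<in> ints K \<Longrightarrow> x \<in> I \<Longrightarrow> x * r \<in> I"
    "x \<in> I \<Longrightarrow> - x \<in> I" "x \<in> I \<Longrightarrow> y \<in> I \<Longrightarrow> x - y \<in> I"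
proof -
  interpret ideal I "integers K" by fact
  show 1: "I \<subseteq> ints K" by (rule a_subset)
  show "0 \<in> I" using additive_subgroup.zero_closed[OF is_additive_subgroup] by simp
  show add: "x + y \<in> I" if "x \<in> I" "y \<in> I" for x y
    using a_closed[OF that] by simp
  show mult: "r * x \<in> I" if "r \<in> ints K" "x \<in> I" for r x
    using I_l_closed[OF that(2,1)] by simp
  show "x * r \<in> I" if "r \<in> ints K" "x \<in> I"
    using I_r_closed[OF that(2,1)] by simp
  show neg: "- x \<in> I" if "x \<in> I" for x
    using mult[of "-1" x] that ints_uminus[OF ints_one] by simp
  show "x - y \<in> I" if "x \<in> I" "y \<in> I" using add[OF that(1) neg[OF that(2)]] by simp
qed

lemma ideal_sum: "ideal I (integers K) \<Longrightarrow> (\<And>i. i \<in> A \<Longrightarrow> f i \<in> I) \<Longrightarrow> sum f A \<in> I"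
  by (induction A rule: infinite_finite_induct) (auto intro: idealD)

lemma idealI':
  assumes "I \<subseteq> ints K" "0 \<in> I" "\<And>x y. x \<in> I \<Longrightarrow> y \<in> I \<Longrightarrow> x + y \<in> I"
    "\<And>r x. r \<in> ints K \<Longrightarrow> x \<in> I \<Longrightarrow> r * x \<in> I"
  shows "ideal I (integers K)"
proof (rule idealI)
  show "ring (integers K)" by (rule OK.ring_axioms)
  show "subgroup I (add_monoid (integers K))"
  proof (rule OK.add.subgroupI)
    fix a assume "a \<in> I"
    then have "a \<in> ints K" "-1 * a \<in> I" using assms(1,4) ints_uminus[OF ints_one] by blast+
    then show "\<ominus>\<^bsub>integers K\<^esub> a \<in> I" by simp
  qed (use assms in auto)
  show "a \<otimes>\<^bsub>integers K\<^esub> x \<in> I" if "a \<in> I" "x \<in> ints K" for a x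
    using assms(4)[OF that(2,1)] by (simp add: mult.commute)
qed (use assms(4) in auto)

definition princ :: "'a \<Rightarrow> 'a set" where "princ a = (\<lambda>r. a * r) ` ints K"

lemma princ_ideal: "a \<in> ints K \<Longrightarrow> ideal (princ a) (integers K)"
proof (rule idealI')
  assume a: "a \<in> ints K"
  show "x + y \<in> princ a" if "x \<in> princ a" "y \<in> princ a" for x y
    using that unfolding princ_def by (auto simp: distrib_left[symmetric])
  show "r * x \<in> princ a" if "r \<in> ints K" "x \<in> princ a" for x r
    using that unfolding princ_def by (auto simp: mult.left_commute)
  show "0 \<in> princ a" unfolding princ_def by (intro image_eqI[of _ _ 0]) auto
qed (auto simp: princ_def)

lemma princ_self: "a \<in> princ a"
  unfolding princ_def by (intro image_eqI[of _ _ 1]) auto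

lemma princ_le: "ideal I (integers K) \<Longrightarrow> princ a \<subseteq> I \<longleftrightarrow> a \<in> I"
  using princ_self[of a] idealD(5) by (auto simp: princ_def)

lemma princ_1: "princ 1 = ints K"
  by (simp add: princ_def)

lemma ideal_eq_ints: "ideal I (integers K) \<Longrightarrow> 1 \<in> I \<Longrightarrow> I = ints K"
  using idealD(1)[of I] idealD(4)[of I _ 1] by auto

end

section \<open>Ideals and primes\<close>

context nfield begin

text \<open>Modulo \<open>p\<close> the integers form a vector space over the field with
  \<open>p\<close> elements, and \<open>indep\<close> is linear independence there. A family longer
  than the bound from \<open>number_field_bound\<close> has an integer relation, which can be made
  primitive and so stays nontrivial modulo \<open>p\<close>. A family of maximal length therefore
  spans, and its combinations with coefficients in \<open>{0..<int p}\<close> represent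
  everything.\<close>

lemma finite_mod_prime:
  assumes p: "Factorial_Ring.prime (p :: nat)"
  shows "\<exists>S. finite S \<and> S \<subseteq> ints K \<and> (\<forall>z\<in>ints K. \<exists>s\<in>S. \<exists>w\<in>ints K. z = s + of_nat p * w)"
proof -
  define indep where "indep = (\<lambda>k (y :: nat \<Rightarrow> 'a). (\<forall>i<k. y i \<in> ints K) \<and>
    (\<forall>c :: nat \<Rightarrow> int. (\<exists>w\<in>ints K. (\<Sum>i<k. of_int (c i) * y i) = of_nat p * w) \<longrightarrow> (\<forall>i<k. int p dvd c i)))"
  obtain n where n: "\<And>y :: nat \<Rightarrow> 'a. (\<And>i. i \<le> n \<Longrightarrow> y i \<in> K) \<Longrightarrow>
    \<exists>c :: nat \<Rightarrow> int. (\<exists>i\<le>n. c i \<noteq> 0) \<and> (\<Sum>i\<le>n. of_int (c i) * y i) = 0"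
    using number_field_bound[OF nf] by metis
  have bound: "k \<le> n" if y: "indep k y" for k y
  proof (rule ccontr)
    assume "\<not> k \<le> n"
    then have nk: "n < k" by simp
    then have "\<And>i. i \<le> n \<Longrightarrow> y i \<in> K" using y ints_mem by (auto simp: indep_def)
    then obtain c :: "nat \<Rightarrow> int" where c: "\<exists>i\<le>n. c i \<noteq> 0" "(\<Sum>i\<le>n. of_int (c i) * y i) = 0"
      using n by blast
    define g where "g = Gcd (c ` {..n})"
    have g0: "g \<noteq> 0" using c(1) by (auto simp: g_def Gcd_0_iff)
    define d where "d = (\<lambda>i. if i \<le> n then c i div g else 0)"
    have cd: "c i = g * d i" if "i \<le> n" for i
      using that by (simp add: d_def g_def)
    have d0: "d i = 0" if "\<not> i \<le> n" for i
      using that by (simp add: d_def)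
    have "of_int g * (\<Sum>i<k. of_int (d i) * y i) = (\<Sum>i<k. of_int (if i \<le> n then c i else 0) * y i)"
      unfolding sum_distrib_left by (rule sum.cong) (simp_all add: cd d0 mult.assoc)
    also have "\<dots> = (\<Sum>i\<le>n. of_int (c i) * y i)"
      using nk by (intro sum.mono_neutral_cong_right) auto
    finally have "(\<Sum>i<k. of_int (d i) * y i) = of_nat p * 0" using c(2) g0 by simp
    moreover have "(\<exists>w\<in>ints K. (\<Sum>i<k. of_int (d i) * y i) = of_nat p * w) \<longrightarrow> (\<forall>i<k. int p dvd d i)"
      using y unfolding indep_def by blast
    ultimately have pd: "\<forall>i<k. int p dvd d i" using ints_zero by blast
    \<comment> \<open>If \<open>p\<close> divided all coefficients of the reduced relation, it could
      be split off once more from the gcd of the original ones.\<close>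
    have "g * int p dvd g"
    proof -
      have "g * int p dvd c i" if "i \<le> n" for i
        using pd that nk cd by (simp add: mult_dvd_mono)
      then show ?thesis unfolding g_def[symmetric] by (subst (2) g_def, intro Gcd_greatest) auto
    qed
    then have "int p dvd 1" using g0 by simp
    then show False using p by simp
  qed
  have "indep 0 (\<lambda>_. 0)" by (simp add: indep_def)
  then obtain k y where ky: "indep k y" and kmax: "\<And>k' y'. indep k' y' \<Longrightarrow> k' \<le> k"
  proof -
    have "{k. \<exists>y. indep k y} \<subseteq> {..n}" using bound by blast
    then have "finite {k. \<exists>y. indep k y}" by (rule finite_subset) simp
    moreover have "0 \<in> {k. \<exists>y. indep k y}" using \<open>indep 0 (\<lambda>_. 0)\<close> by auto
    ultimately show ?thesis using that Max_in[of "{k. \<exists>y. indep k y}"] Max_ge[of "{k. \<exists>y. indep k y}"]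
      by blast
  qed
  have yi: "y i \<in> ints K" if "i < k" for i using ky that by (auto simp: indep_def)
  define S where "S = (\<lambda>a. \<Sum>i<k. of_int (a i) * y i) ` (PiE {..<k} (\<lambda>_. {0..<int p}))"
  have "\<exists>s\<in>S. \<exists>w\<in>ints K. z = s + of_nat p * w" if z: "z \<in> ints K" for z
  proof -
    have "\<not> indep (Suc k) (y(k := z))" using kmax[of "Suc k" "y(k := z)"] by auto
    then obtain c :: "nat \<Rightarrow> int" and w where w: "w \<in> ints K"
      "(\<Sum>i<Suc k. of_int (c i) * (y(k := z)) i) = of_nat p * w" and nd: "\<exists>i<Suc k. \<not> int p dvd c i"
      using yi z unfolding indep_def by (auto simp: less_Suc_eq)
    have "(\<Sum>i<k. of_int (c i) * (y(k := z)) i) = (\<Sum>i<k. of_int (c i) * y i)"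
      by (rule sum.cong) auto
    with w(2) have eq: "(\<Sum>i<k. of_int (c i) * y i) = of_nat p * w - of_int (c k) * z"
      by (simp add: algebra_simps)
    have "\<not> int p dvd c k"
    proof
      assume "int p dvd c k"
      then obtain e where e: "c k = int p * e" by blast
      have "(\<Sum>i<k. of_int (c i) * y i) = of_nat p * (w - of_int e * z)"
        unfolding eq by (simp add: e algebra_simps)
      moreover have "w - of_int e * z \<in> ints K" using w(1) z by auto
      ultimately have "\<forall>i<k. int p dvd c i" using ky unfolding indep_def by blast
      with nd \<open>int p dvd c k\<close> show False by (auto simp: less_Suc_eq)
    qed
    then have "coprime (c k) (int p)"
      using p by (simp add: coprime_commute prime_imp_coprime)
    then obtain u v' where "u * c k + v' * int p = 1"
      using bezout_int[of "c k" "int p"] by auto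
    \<comment> \<open>\<open>u\<close> inverts \<open>c k\<close> modulo \<open>p\<close>, which
      solves the relation for \<open>z\<close>.\<close>
    then have uv: "c k * u = 1 + int p * (- v')" by (simp add: algebra_simps)
    define v where "v = - v'"
    note uv = uv[folded v_def]
    \<comment> \<open>Remainders of the coefficients modulo \<open>p\<close> select an element of
      \<open>S\<close>; the quotients \<open>q\<close> are absorbed into the multiple of
      \<open>p\<close>.\<close>
    define a where "a = (\<lambda>i. if i < k then (- u * c i) mod int p else undefined)"
    define q where "q = (\<lambda>i. (- u * c i) div int p)"
    have aq: "- u * c i = a i + int p * q i" if "i < k" for i using that by (simp add: a_def q_def)
    have "0 < int p" using prime_gt_0_nat[OF p] by simp
    then have "a \<in> PiE {..<k} (\<lambda>_. {0..<int p})" by (intro PiE_I) (simp_all add: a_def)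
    then have aS: "(\<Sum>i<k. of_int (a i) * y i) \<in> S" unfolding S_def by (rule imageI)
    have sneg: "(\<Sum>i<k. of_int (- u * c i) * y i) = - (of_int u * (\<Sum>i<k. of_int (c i) * y i))"
      by (simp add: sum_distrib_left sum_negf mult.assoc)
    have "of_int (c k * u) * z = of_int (1 + int p * v) * z" using uv by simp
    then have "z = of_int u * (of_int (c k) * z) - of_nat p * (of_int v * z)" by (simp add: algebra_simps)
    also have "of_int (c k) * z = of_nat p * w - (\<Sum>i<k. of_int (c i) * y i)" using eq by simp
    also have "of_int u * (of_nat p * w - (\<Sum>i<k. of_int (c i) * y i)) =
      of_nat p * (of_int u * w) + (\<Sum>i<k. of_int (- u * c i) * y i)"
      unfolding sneg by (simp add: right_diff_distrib mult.left_commute)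
    also have "(\<Sum>i<k. of_int (- u * c i) * y i) =
        (\<Sum>i<k. of_int (a i) * y i + of_nat p * (of_int (q i) * y i))"
      by (rule sum.cong) (auto simp only: aq lessThan_iff of_int_add of_int_mult of_int_of_nat_eq distrib_right mult.assoc)
    also have "\<dots> = (\<Sum>i<k. of_int (a i) * y i) + of_nat p * (\<Sum>i<k. of_int (q i) * y i)"
      by (simp add: sum.distrib sum_distrib_left)
    finally have "z = (\<Sum>i<k. of_int (a i) * y i) +
       of_nat p * (of_int u * w + (\<Sum>i<k. of_int (q i) * y i) - of_int v * z)"
      by (simp add: algebra_simps)
    moreover have "of_int u * w + (\<Sum>i<k. of_int (q i) * y i) - of_int v * z \<in> ints K"
      using w(1) z yi by (intro ints_diff ints_add ints_sum ints_mult) auto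
    ultimately show ?thesis using aS by blast
  qed
  moreover have "finite S" unfolding S_def by (intro finite_imageI finite_PiE) auto
  moreover have "S \<subseteq> ints K" using yi unfolding S_def by (auto intro!: ints_sum)
  ultimately show ?thesis by blast
qed

text \<open>Induction on prime factors: representatives modulo \<open>l * p\<close> are
  \<open>s + l * t\<close>, with \<open>s\<close> taken modulo \<open>l\<close> and \<open>t\<close>
  modulo \<open>p\<close>.\<close>

lemma finite_mod_nat:
  assumes "m > 0"
  shows "\<exists>S. finite S \<and> S \<subseteq> ints K \<and> (\<forall>z\<in>ints K. \<exists>s\<in>S. \<exists>w\<in>ints K. z = s + of_nat m * w)"
  using assms
proof (induction m rule: less_induct)
  case (less m)
  show ?case
  proof (cases "m = 1")
    case True
    show ?thesis by (rule exI[of _ "{0}"]) (use True in auto)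
  next
    case False
    then obtain p where p: "Factorial_Ring.prime p" "p dvd m" using prime_factor_nat by blast
    then obtain l where l: "m = l * p" by (metis dvd_div_mult_self)
    have "l < m" "l > 0" using l less.prems prime_gt_1_nat[OF p(1)] by auto
    from less.IH[OF this] obtain S where S: "finite S" "S \<subseteq> ints K"
      "\<forall>z\<in>ints K. \<exists>s\<in>S. \<exists>w\<in>ints K. z = s + of_nat l * w" by blast
    obtain T where T: "finite T" "T \<subseteq> ints K"
      "\<forall>z\<in>ints K. \<exists>s\<in>T. \<exists>w\<in>ints K. z = s + of_nat p * w" using finite_mod_prime[OF p(1)] by blast
    have "\<exists>s\<in>(\<lambda>(s, t). s + of_nat l * t) ` (S \<times> T). \<exists>w\<in>ints K. z = s + of_nat m * w"
      if z: "z \<in> ints K" for z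
    proof -
      obtain s w where s: "s \<in> S" "w \<in> ints K" "z = s + of_nat l * w" using S(3) z by blast
      obtain t v where t: "t \<in> T" "v \<in> ints K" "w = t + of_nat p * v" using T(3) s(2) by blast
      have "z = (s + of_nat l * t) + of_nat m * v" by (simp add: s t l algebra_simps)
      then show ?thesis using s(1) t(1,2) by (intro bexI[of _ "s + of_nat l * t"] bexI[of _ v]) (auto intro: ints_closed)
    qed
    moreover have "finite ((\<lambda>(s, t). s + of_nat l * t) ` (S \<times> T))" using S T by blast
    moreover have "(\<lambda>(s, t). s + of_nat l * t) ` (S \<times> T) \<subseteq> ints K" using S(2) T(2) by (auto intro: ints_closed)
    ultimately show ?thesis by blast
  qed
qed

text \<open>In an integral equation for \<open>a\<close>, powers of \<open>a\<close> are cancelled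
  until the constant term is nonzero; that term is an integer and a multiple of \<open>a\<close>.
  Consequently every nonzero ideal contains a positive integer.\<close>

lemma nat_in_princ:
  assumes a: "a \<in> ints K" "a \<noteq> 0"
  obtains m :: nat where "m > 0" "of_nat m \<in> princ a"
proof -
  obtain n and c :: "nat \<Rightarrow> int" where c: "a ^ n = (\<Sum>i<n. of_int (c i) * a ^ i)"
    using a(1) algebraic_int_monic[of a] unfolding ints_iff by blast
  define d where "d = (\<lambda>i. if i = n then 1 else - c i)"
  have "(\<Sum>i\<le>n. of_int (d i) * a ^ i) = 0"
    using c by (simp add: d_def lessThan_Suc_atMost[symmetric] sum_negf)
  define k where "k = (LEAST i. d i \<noteq> 0)"
  have dn: "d n \<noteq> 0" by (simp add: d_def)
  have dk: "d k \<noteq> 0" "k \<le> n" unfolding k_def using LeastI[of "\<lambda>i. d i \<noteq> 0", OF dn] Least_le[of "\<lambda>i. d i \<noteq> 0", OF dn] by auto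
  have d0: "d i = 0" if "i < k" for i
    using not_less_Least[of i "\<lambda>i. d i \<noteq> 0"] that unfolding k_def by blast
  have "(\<Sum>i\<le>n. of_int (d i) * a ^ i) = (\<Sum>i\<in>{k..n}. of_int (d i) * a ^ i)"
    by (rule sum.mono_neutral_right) (auto simp: d0)
  also have "\<dots> = (\<Sum>j\<in>{0..n - k}. of_int (d (j + k)) * a ^ (j + k))"
    using sum.shift_bounds_cl_nat_ivl[of "\<lambda>i. of_int (d i) * a ^ i" 0 k "n - k"] dk(2) by simp
  also have "\<dots> = a ^ k * (\<Sum>j\<in>{0..n - k}. of_int (d (j + k)) * a ^ j)"
    by (simp add: sum_distrib_left power_add mult_ac)
  also have "(\<Sum>j\<in>{0..n - k}. of_int (d (j + k)) * a ^ j) =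
     of_int (d k) + (\<Sum>j\<in>{Suc 0..n - k}. of_int (d (j + k)) * a ^ j)"
    by (subst sum.atLeast_Suc_atMost) auto
  also have "(\<Sum>j\<in>{Suc 0..n - k}. of_int (d (j + k)) * a ^ j) =
      a * (\<Sum>j\<in>{Suc 0..n - k}. of_int (d (j + k)) * a ^ (j - 1))"
    unfolding sum_distrib_left by (rule sum.cong) (auto simp: power_eq_if)
  finally have "of_int (d k) = a * - (\<Sum>j\<in>{Suc 0..n - k}. of_int (d (j + k)) * a ^ (j - 1))"
    using \<open>(\<Sum>i\<le>n. of_int (d i) * a ^ i) = 0\<close> a(2) by (simp add: eq_neg_iff_add_eq_0)
  moreover have "- (\<Sum>j\<in>{Suc 0..n - k}. of_int (d (j + k)) * a ^ (j - 1)) \<in> ints K"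
    using a(1) by auto
  ultimately have "of_int (d k) \<in> princ a" unfolding princ_def by blast
  then have "of_int (sgn (d k)) * of_int (d k) \<in> princ a"
    by (rule idealD(4)[OF princ_ideal[OF a(1)] ints_of_int])
  moreover have "sgn (d k) * d k = \<bar>d k\<bar>" by (simp add: abs_sgn mult.commute)
  then have "of_int (sgn (d k)) * of_int (d k) = (of_nat (nat \<bar>d k\<bar>) :: 'a)"
    by (subst of_int_mult[symmetric]) simp
  ultimately have "of_nat (nat \<bar>d k\<bar>) \<in> princ a" by simp
  then show ?thesis using that[of "nat \<bar>d k\<bar>"] dk(1) by auto
qed

lemma ideal_nonzero: "ideal I (integers K) \<Longrightarrow> I \<noteq> {0} \<Longrightarrow> \<exists>a\<in>I. a \<noteq> 0 \<and> a \<in> ints K"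
  using idealD(1,2) by blast

lemma finite_representatives:
  assumes I: "ideal I (integers K)" "I \<noteq> {0}"
  obtains S where "finite S" "S \<subseteq> ints K" "\<And>z. z \<in> ints K \<Longrightarrow> \<exists>s\<in>S. z - s \<in> I"
proof -
  obtain a where a: "a \<in> I" "a \<noteq> 0" "a \<in> ints K" using ideal_nonzero[OF I] by blast
  obtain m where m: "m > 0" "of_nat m \<in> princ a" using nat_in_princ[OF a(3,2)] by blast
  then have mI: "of_nat m \<in> I" using princ_le[OF I(1)] a(1) by blast
  obtain S where S: "finite S" "S \<subseteq> ints K" "\<forall>z\<in>ints K. \<exists>s\<in>S. \<exists>w\<in>ints K. z = s + of_nat m * w"
    using finite_mod_nat[OF m(1)] by blast
  have "\<exists>s\<in>S. z - s \<in> I" if "z \<in> ints K" for z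
    using S(3) that idealD(5)[OF I(1) _ mI] by (metis add_diff_cancel_left')
  then show ?thesis using that S(1,2) by blast
qed

text \<open>An ideal above \<open>A\<close> is a union of classes modulo \<open>A\<close>, so its
  intersection with finitely many representatives determines it. This finiteness takes the place of
  the ascending chain condition.\<close>

lemma finite_ideals_above:
  assumes A: "ideal A (integers K)" "A \<noteq> {0}"
  shows "finite {J. ideal J (integers K) \<and> A \<subseteq> J}"
proof -
  obtain S where S: "finite S" "S \<subseteq> ints K" "\<And>z. z \<in> ints K \<Longrightarrow> \<exists>s\<in>S. z - s \<in> A"
    using finite_representatives[OF A] by metis
  have eq: "J = {z \<in> ints K. \<exists>s\<in>J \<inter> S. z - s \<in> A}" if J: "ideal J (integers K)" "A \<subseteq> J" for J
  proof (intro Set.set_eqI iffI)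
    fix z assume z: "z \<in> J"
    then have "z \<in> ints K" using idealD(1)[OF J(1)] by blast
    then obtain s where s: "s \<in> S" "z - s \<in> A" using S(3) by blast
    then have "z - (z - s) \<in> J" using idealD(7)[OF J(1) z] J(2) by blast
    then show "z \<in> {z \<in> ints K. \<exists>s\<in>J \<inter> S. z - s \<in> A}" using s \<open>z \<in> ints K\<close> by auto
  next
    fix z assume "z \<in> {z \<in> ints K. \<exists>s\<in>J \<inter> S. z - s \<in> A}"
    then obtain s where "s \<in> J" "z - s \<in> A" by blast
    then have "z - s + s \<in> J" using J by (blast intro: idealD(3))
    then show "z \<in> J" by simp
  qed
  have "inj_on (\<lambda>J. J \<inter> S) {J. ideal J (integers K) \<and> A \<subseteq> J}"
  proof (rule inj_onI)
    fix I J assume I: "I \<in> {J. ideal J (integers K) \<and> A \<subseteq> J}" and J: "J \<in> {J. ideal J (integers K) \<and> A \<subseteq> J}"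
      and IJ: "I \<inter> S = J \<inter> S"
    have "I = {z \<in> ints K. \<exists>s\<in>I \<inter> S. z - s \<in> A}" by (rule eq) (use I in auto)
    also have "\<dots> = J" unfolding IJ by (rule eq[symmetric]) (use J in auto)
    finally show "I = J" .
  qed
  moreover have "finite ((\<lambda>J. J \<inter> S) ` {J. ideal J (integers K) \<and> A \<subseteq> J})"
    by (rule finite_subset[of _ "Pow S"]) (use S(1) in auto)
  ultimately show ?thesis by (rule finite_imageD[rotated])
qed

lemma nonzero_mono:
  assumes "A \<noteq> {0}" "ideal A (integers K)" "A \<subseteq> J" shows "J \<noteq> {0}"
proof -
  obtain a where "a \<in> A" "a \<noteq> 0" using ideal_nonzero[OF assms(2,1)] by blast
  then show ?thesis using assms(3) by auto
qed

text \<open>Noetherian induction: passing to a strictly larger ideal lowers the finite number of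
  ideals above it.\<close>

lemma ideal_induct [consumes 2]:
  assumes I: "ideal I (integers K)" "I \<noteq> {0}"
    and step: "\<And>I. ideal I (integers K) \<Longrightarrow> I \<noteq> {0} \<Longrightarrow>
      (\<And>J. ideal J (integers K) \<Longrightarrow> I \<subset> J \<Longrightarrow> P J) \<Longrightarrow> P I"
  shows "P I"
  using I
proof (induction "card {J. ideal J (integers K) \<and> I \<subseteq> J}" arbitrary: I rule: less_induct)
  case less
  show ?case
  proof (rule step[OF less.prems])
    fix J assume J: "ideal J (integers K)" "I \<subset> J"
    have "{J'. ideal J' (integers K) \<and> J \<subseteq> J'} \<subset> {J. ideal J (integers K) \<and> I \<subseteq> J}"
      using J less.prems by blast
    then show "P J" using finite_ideals_above[OF less.prems] J nonzero_mono[OF less.prems(2,1)]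
      by (intro less.hyps psubset_card_mono) auto
  qed
qed

section \<open>Nonzero primes and their maximality\<close>

lemma ex_prime_above:
  assumes "ideal I (integers K)" "I \<noteq> {0}" "1 \<notin> I"
  shows "\<exists>P\<in>primes K. I \<subseteq> P"
  using assms
proof (induction rule: ideal_induct)
  case (1 I)
  show ?case
  proof (cases "maximalideal I (integers K)")
    case True
    then show ?thesis using 1 by (auto simp: primes_def)
  next
    case False
    have "ints K \<noteq> I" using 1 by auto
    with False obtain J where "ideal J (integers K)" "I \<subseteq> J" "J \<noteq> I" "J \<noteq> ints K"
      using maximalidealI[OF 1(1)] by blast
    then show ?thesis using 1(3)[of J] ideal_eq_ints[of J] by blast
  qed
qed

lemma primesD:
  assumes "P \<in> primes K"
  shows "ideal P (integers K)" "P \<noteq> {0}" "1 \<notin> P" "P \<subseteq> ints K"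
    "\<And>J. ideal J (integers K) \<Longrightarrow> P \<subseteq> J \<Longrightarrow> J = P \<or> J = ints K"
    "\<And>x y. x \<in> ints K \<Longrightarrow> y \<in> ints K \<Longrightarrow> x * y \<in> P \<Longrightarrow> x \<in> P \<or> y \<in> P"
proof -
  have m: "maximalideal P (integers K)" and "P \<noteq> {0}" using assms by (auto simp: primes_def)
  show i: "ideal P (integers K)" using m by (rule maximalideal.axioms)
  show "P \<noteq> {0}" by fact
  show "P \<subseteq> ints K" using idealD(1)[OF i] .
  have "ints K \<noteq> P" using m by (simp add: maximalideal_def maximalideal_axioms_def)
  then show "1 \<notin> P" using ideal_eq_ints[OF i] by auto
  show "\<And>J. ideal J (integers K) \<Longrightarrow> P \<subseteq> J \<Longrightarrow> J = P \<or> J = ints K"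
    using m idealD(1) by (simp add: maximalideal_def maximalideal_axioms_def)
  have "primeideal P (integers K)" by (rule OK.maximalideal_prime[OF m])
  then show "\<And>x y. x \<in> ints K \<Longrightarrow> y \<in> ints K \<Longrightarrow> x * y \<in> P \<Longrightarrow> x \<in> P \<or> y \<in> P"
    using primeideal.I_prime by fastforce
qed

lemma prime_sub_eq: "P \<in> primes K \<Longrightarrow> Q \<in> primes K \<Longrightarrow> P \<subseteq> Q \<Longrightarrow> P = Q"
  using primesD(5)[of P Q] primesD(1,3)[of Q] by auto

lemma prime_power_mem: "P \<in> primes K \<Longrightarrow> x \<in> ints K \<Longrightarrow> x ^ n \<in> P \<Longrightarrow> x \<in> P"
proof (induction n)
  case (Suc n)
  then show ?case using primesD(6)[of P x "x ^ n"] by auto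
qed (use primesD(3) in auto)

lemma prime_prod_mem:
  assumes "finite A" "P \<in> primes K" "\<And>i. i \<in> A \<Longrightarrow> f i \<in> ints K" "prod f A \<in> P"
  shows "\<exists>i\<in>A. f i \<in> P"
  using assms
proof (induction A rule: finite_induct)
  case (insert i A)
  have "f i * prod f A \<in> P" using insert by simp
  moreover have "f i \<in> ints K" "prod f A \<in> ints K" using insert by auto
  ultimately have "f i \<in> P \<or> prod f A \<in> P" using primesD(6)[OF insert.prems(1)] by blast
  then show ?case using insert by auto
qed (use primesD(3) in auto)

lemma ideal_add_princ:
  assumes I: "ideal I (integers K)" and b: "b \<in> ints K"
  shows "ideal {x + r * b | x r. x \<in> I \<and> r \<in> ints K} (integers K)" (is "ideal ?J _")
    and "I \<subseteq> {x + r * b | x r. x \<in> I \<and> r \<in> ints K}"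
    and "b \<in> {x + r * b | x r. x \<in> I \<and> r \<in> ints K}"
proof -
  show "ideal ?J (integers K)"
  proof (rule idealI')
    show "?J \<subseteq> ints K" using idealD(1)[OF I] b by auto
    have "0 + 0 * b \<in> ?J" using idealD(2)[OF I] ints_zero by blast
    then show "0 \<in> ?J" by simp
    fix x y assume "x \<in> ?J" "y \<in> ?J"
    then obtain x1 r1 x2 r2 where *: "x = x1 + r1 * b" "x1 \<in> I" "r1 \<in> ints K"
      "y = x2 + r2 * b" "x2 \<in> I" "r2 \<in> ints K" by auto
    then have "x + y = (x1 + x2) + (r1 + r2) * b" by (simp add: algebra_simps)
    moreover have "x1 + x2 \<in> I" "r1 + r2 \<in> ints K" using * idealD(3)[OF I] by simp_all
    ultimately show "x + y \<in> ?J" by blast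
  next
    fix s x assume "s \<in> ints K" "x \<in> ?J"
    then obtain x1 r1 where *: "x = x1 + r1 * b" "x1 \<in> I" "r1 \<in> ints K" by auto
    then have "s * x = s * x1 + (s * r1) * b" by (simp add: algebra_simps)
    moreover have "s * x1 \<in> I" "s * r1 \<in> ints K" using * \<open>s \<in> ints K\<close> idealD(4)[OF I] by simp_all
    ultimately show "s * x \<in> ?J" by blast
  qed
  have "x + 0 * b \<in> ?J" if "x \<in> I" for x using that ints_zero by blast
  then show "I \<subseteq> ?J" by auto
  have "0 + 1 * b \<in> ?J" using idealD(2)[OF I] ints_one by blast
  then show "b \<in> ?J" by simp
qed

lemma prime_coprime_elt:
  assumes P: "P \<in> primes K" and b: "b \<in> ints K" "b \<notin> P"
  obtains r where "r \<in> ints K" "1 - r * b \<in> P"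
proof -
  let ?J = "{x + r * b | x r. x \<in> P \<and> r \<in> ints K}"
  have "?J = ints K"
    using primesD(5)[OF P ideal_add_princ(1,2)[OF primesD(1)[OF P] b(1)]]
      ideal_add_princ(3)[OF primesD(1)[OF P] b(1)] b(2) by blast
  then have "1 \<in> ?J" by simp
  then obtain x r where "1 = x + r * b" "x \<in> P" "r \<in> ints K" by blast
  then show ?thesis using that by (metis add_diff_cancel_right')
qed

text \<open>The residue ring is finite, so two powers of an element \<open>b\<close> outside
  \<open>P\<close> agree modulo \<open>P\<close>; cancelling shows that \<open>b\<close> is
  invertible there, which makes a nonzero prime ideal maximal.\<close>

lemma primeI:
  assumes P: "ideal P (integers K)" "P \<noteq> {0}" "1 \<notin> P"
    and pr: "\<And>x y. x \<in> ints K \<Longrightarrow> y \<in> ints K \<Longrightarrow> x * y \<in> P \<Longrightarrow> x \<in> P \<or> y \<in> P"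
  shows "P \<in> primes K"
proof -
  have "J = P \<or> J = ints K" if J: "ideal J (integers K)" "P \<subseteq> J" for J
  proof (rule ccontr)
    assume "\<not> (J = P \<or> J = ints K)"
    then obtain b where b: "b \<in> J" "b \<notin> P" "b \<in> ints K" using J idealD(1) by blast
    obtain S where S: "finite S" "S \<subseteq> ints K" "\<And>z. z \<in> ints K \<Longrightarrow> \<exists>s\<in>S. z - s \<in> P"
      using finite_representatives[OF P(1,2)] by metis
    have "\<forall>i :: nat. \<exists>s. s \<in> S \<and> b ^ i - s \<in> P" using S(3) ints_power[OF b(3)] by blast
    from choice[OF this] obtain f where f: "\<And>i :: nat. f i \<in> S" "\<And>i. b ^ i - f i \<in> P" by blast
    have "finite (range f)" using f(1) S(1) by (intro finite_subset[of "range f" S]) auto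
    then have "\<not> inj f" using finite_imageD infinite_UNIV_nat by blast
    then obtain i j where "i \<noteq> j" "f i = f j" unfolding inj_def by blast
    then obtain i j where ij: "i < j" "f i = f j" by (metis linorder_neqE_nat)
    have "(b ^ i - f i) - (b ^ j - f j) \<in> P" using idealD(7)[OF P(1)] f(2) by blast
    then have "b ^ i * (1 - b ^ (j - i)) \<in> P" using ij
      by (simp add: algebra_simps power_add[symmetric])
    moreover have "b ^ i \<notin> P"
    proof (induction i)
      case (Suc i)
      then show ?case using pr[of b "b ^ i"] b by auto
    qed (use P in simp)
    ultimately have "1 - b ^ (j - i) \<in> P" using pr b(3) by (meson ints_diff ints_one ints_power)
    then have "1 - b ^ (j - i) \<in> J" using J by blast
    moreover have "b ^ (j - i) = b ^ (j - i - 1) * b" using ij by (simp add: power_eq_if mult.commute)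
    then have "b ^ (j - i) \<in> J" using idealD(4)[OF J(1) ints_power[OF b(3)] b(1)] by simp
    ultimately have "1 - b ^ (j - i) + b ^ (j - i) \<in> J" using idealD(3)[OF J(1)] by blast
    then have "1 \<in> J" by simp
    then show False using ideal_eq_ints[OF J(1)] \<open>\<not> (J = P \<or> J = ints K)\<close> by blast
  qed
  moreover have "ints K \<noteq> P" using P(3) by auto
  ultimately have "maximalideal P (integers K)" by (intro maximalidealI P(1)) auto
  then show ?thesis using P(2) by (simp add: primes_def)
qed


section \<open>Complete integral closedness and inverses of primes\<close>

lemma almost_integral:
  assumes a: "a \<in> ints K" "a \<noteq> 0" and x: "x \<in> K" and ax: "\<And>n. a * x ^ n \<in> ints K"
  shows "x \<in> ints K"
proof -
  define J where "J = (\<lambda>n. {\<Sum>i\<le>n. r i * (a * x ^ i) | r. \<forall>i\<le>n. r i \<in> ints K})"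
  have J: "ideal (J n) (integers K)" for n
  proof (rule idealI')
    show "J n \<subseteq> ints K" unfolding J_def using ax by (auto intro!: ints_sum)
    show "0 \<in> J n" unfolding J_def by (intro CollectI exI[of _ "\<lambda>_. 0"]) simp
    fix y z assume "y \<in> J n" "z \<in> J n"
    then obtain r s where "y = (\<Sum>i\<le>n. r i * (a * x ^ i))" "z = (\<Sum>i\<le>n. s i * (a * x ^ i))"
      "\<forall>i\<le>n. r i \<in> ints K" "\<forall>i\<le>n. s i \<in> ints K" unfolding J_def by blast
    then show "y + z \<in> J n" unfolding J_def
      by (intro CollectI exI[of _ "\<lambda>i. r i + s i"]) (simp only: distrib_right sum.distrib, auto)
  next
    fix t y assume t: "t \<in> ints K" and "y \<in> J n"
    then obtain r where "y = (\<Sum>i\<le>n. r i * (a * x ^ i))" "\<forall>i\<le>n. r i \<in> ints K" unfolding J_def by blast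
    then show "t * y \<in> J n" unfolding J_def using t
      by (intro CollectI exI[of _ "\<lambda>i. t * r i"]) (simp only: sum_distrib_left mult.assoc, auto)
  qed
  have mem: "a * x ^ i \<in> J n" if "i \<le> n" for i n
  proof -
    have "(\<Sum>k\<le>n. (if k = i then 1 else 0) * (a * x ^ k)) = (\<Sum>k\<le>n. if k = i then a * x ^ k else 0)"
      by (rule sum.cong) auto
    also have "\<dots> = a * x ^ i" using that by simp
    finally have "a * x ^ i = (\<Sum>k\<le>n. (if k = i then 1 else 0) * (a * x ^ k))" ..
    then show ?thesis unfolding J_def by (intro CollectI exI[of _ "\<lambda>k. if k = i then 1 else 0"]) simp
  qed
  \<comment> \<open>All \<open>J n\<close> contain the nonzero ideal generated by \<open>a\<close>,
    so they take finitely many values and two of them coincide.\<close>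
  have "princ a \<subseteq> J n" for n using princ_le[OF J] mem[of 0 n] by simp
  then have "range J \<subseteq> {I. ideal I (integers K) \<and> princ a \<subseteq> I}" using J by blast
  moreover have "princ a \<noteq> {0}" using princ_self[of a] a(2) by auto
  ultimately have "finite (range J)"
    using finite_ideals_above[OF princ_ideal[OF a(1)]] finite_subset by blast
  then have "\<not> inj J" using finite_imageD infinite_UNIV_nat by blast
  then obtain i j where "i \<noteq> j" "J i = J j" unfolding inj_def by blast
  then have "\<exists>i j. i < j \<and> J i = J j" by (cases i j rule: linorder_cases) auto
  then obtain i j where ij: "i < j" "J i = J j" by blast
  \<comment> \<open>Cancelling \<open>a\<close> from this membership gives a monic equation for
    \<open>x\<close> over the integers of \<open>K\<close>.\<close>
  have "a * x ^ j \<in> J i" using mem[of j j] ij(2) by simp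
  then obtain r where r: "a * x ^ j = (\<Sum>k\<le>i. r k * (a * x ^ k))" "\<forall>k\<le>i. r k \<in> ints K"
    unfolding J_def by blast
  have "a * x ^ j = a * (\<Sum>k\<le>i. r k * x ^ k)" unfolding r(1) by (simp add: sum_distrib_left mult.left_commute)
  then have "x ^ j = (\<Sum>k\<le>i. r k * x ^ k)" using a(2) by simp
  also have "\<dots> = (\<Sum>k<j. (if k \<le> i then r k else 0) * x ^ k)"
    using ij(1) by (intro sum.mono_neutral_cong_left) auto
  finally have "algebraic_int x"
    by (rule algebraic_int_integral) (use r(2) in \<open>simp add: ints_iff\<close>)
  then show ?thesis using x by (simp add: ints_iff)
qed

text \<open>\<open>P\<close> is an associated prime of the ideal generated by \<open>a\<close>. A
  maximal annihilator modulo an ideal is prime, but it might be another prime above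
  \<open>a\<close>; replacing the ideal by the contraction \<open>C\<close> of its localization at
  \<open>P\<close> forces the annihilator into \<open>P\<close>, hence to equal
  \<open>P\<close>.\<close>

lemma ex_colon_elt:
  assumes P: "P \<in> primes K" and a: "a \<in> P" "a \<noteq> 0"
  obtains b where "b \<in> ints K" "b \<notin> princ a" "\<And>p. p \<in> P \<Longrightarrow> b * p \<in> princ a"
proof -
  note PD = primesD[OF P]
  have aK: "a \<in> ints K" using a PD(4) by blast
  define A where "A = princ a"
  have A: "ideal A (integers K)" "A \<noteq> {0}" "A \<subseteq> P"
    using princ_ideal[OF aK] princ_self[of a] a princ_le[OF PD(1)] unfolding A_def by auto
  define C where "C = {z \<in> ints K. \<exists>r\<in>ints K - P. r * z \<in> A}"
  have notP_mult: "r * s \<in> ints K - P" if "r \<in> ints K - P" "s \<in> ints K - P" for r s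
    using that PD(6)[of r s] by auto
  have C: "ideal C (integers K)"
  proof (rule idealI')
    show "0 \<in> C" unfolding C_def using idealD(2)[OF A(1)] PD(3) by (auto intro!: bexI[of _ 1])
    fix y z assume "y \<in> C" "z \<in> C"
    then obtain r s where rs: "r \<in> ints K - P" "s \<in> ints K - P" "r * y \<in> A" "s * z \<in> A" "y \<in> ints K" "z \<in> ints K"
      unfolding C_def by blast
    have "s * (r * y) \<in> A" "r * (s * z) \<in> A" using rs idealD(4)[OF A(1)] by blast+
    then have "s * (r * y) + r * (s * z) \<in> A" by (rule idealD(3)[OF A(1)])
    then have "(r * s) * (y + z) \<in> A" by (simp add: algebra_simps)
    then show "y + z \<in> C" unfolding C_def using notP_mult[OF rs(1,2)] rs(5,6) by auto
  next
    fix t y assume t: "t \<in> ints K" and "y \<in> C"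
    then obtain r where r: "r \<in> ints K - P" "r * y \<in> A" "y \<in> ints K" unfolding C_def by blast
    have "r * (t * y) \<in> A" using idealD(4)[OF A(1) t r(2)] by (simp add: mult.left_commute)
    then show "t * y \<in> C" unfolding C_def using r t by auto
  qed (auto simp: C_def)
  have AC: "A \<subseteq> C" unfolding C_def using idealD(1)[OF A(1)] PD(3) by (auto intro!: bexI[of _ 1])
  have CP: "C \<subseteq> P" unfolding C_def using A(3) PD(6) by blast
  have C0: "C \<noteq> {0}" using nonzero_mono[OF A(2,1) AC] .
  define colon where "colon = (\<lambda>x. {z \<in> ints K. x * z \<in> C})"
  have colon: "ideal (colon x) (integers K)" if "x \<in> ints K" for x
  proof (rule idealI')
    show "0 \<in> colon x" using idealD(2)[OF C] by (simp add: colon_def)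
    show "y + z \<in> colon x" if "y \<in> colon x" "z \<in> colon x" for y z
      using that idealD(3)[OF C] by (auto simp: colon_def distrib_left)
    show "t * y \<in> colon x" if "t \<in> ints K" "y \<in> colon x" for t y
      using that idealD(4)[OF C, of t "x * y"] by (auto simp: colon_def mult.left_commute)
  qed (auto simp: colon_def)
  have colC: "C \<subseteq> colon x" if "x \<in> ints K" for x
    using that idealD(1)[OF C] idealD(4)[OF C] by (auto simp: colon_def)
  define F where "F = colon ` (ints K - C)"
  have "F \<subseteq> {J. ideal J (integers K) \<and> C \<subseteq> J}" unfolding F_def using colon colC by blast
  then have "finite F" using finite_ideals_above[OF C C0] finite_subset by blast
  moreover have "1 \<in> ints K - C" using CP PD(3) by auto
  then have "F \<noteq> {}" unfolding F_def by blast
  ultimately obtain B where B: "B \<in> F" "\<And>J. J \<in> F \<Longrightarrow> B \<subseteq> J \<Longrightarrow> B = J"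
    using finite_has_maximal[of F] by blast
  then obtain x where x: "x \<in> ints K" "x \<notin> C" "B = colon x" unfolding F_def by blast
  have Bid: "ideal B (integers K)" using colon x by simp
  have BP: "B \<subseteq> P"
  proof
    fix z assume "z \<in> B"
    then have z: "z \<in> ints K" "x * z \<in> C" using x by (auto simp: colon_def)
    then obtain r where r: "r \<in> ints K - P" "r * (x * z) \<in> A" unfolding C_def by blast
    show "z \<in> P"
    proof (rule ccontr)
      assume "z \<notin> P"
      then have "r * z \<in> ints K - P" using notP_mult[OF r(1)] z(1) by blast
      moreover have "(r * z) * x \<in> A" using r(2) by (simp add: mult_ac)
      ultimately have "x \<in> C" unfolding C_def using x(1) by blast
      then show False using x(2) by blast
    qed
  qed
  have "B \<in> primes K"
  proof (rule primeI[OF Bid])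
    show "B \<noteq> {0}" using nonzero_mono[OF C0 C] colC x by simp
    show "1 \<notin> B" using x by (simp add: colon_def)
    fix u v assume uv: "u \<in> ints K" "v \<in> ints K" "u * v \<in> B"
    show "u \<in> B \<or> v \<in> B"
    proof (rule ccontr)
      assume "\<not> (u \<in> B \<or> v \<in> B)"
      then have "x * u \<notin> C" using uv x by (simp add: colon_def)
      then have "colon (x * u) \<in> F" unfolding F_def using x uv by simp
      moreover have "B \<subseteq> colon (x * u)"
      proof
        fix z assume "z \<in> B"
        then have "z \<in> ints K" "u * (x * z) \<in> C" using x uv idealD(4)[OF C] by (simp_all add: colon_def)
        moreover have "u * (x * z) = x * u * z" by simp
        ultimately show "z \<in> colon (x * u)" by (simp add: colon_def)
      qed
      ultimately have "B = colon (x * u)" using B(2) by blast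
      moreover have "v \<in> colon (x * u)" using uv x by (simp add: colon_def mult.assoc)
      ultimately show False using \<open>\<not> (u \<in> B \<or> v \<in> B)\<close> by blast
    qed
  qed
  then have BeqP: "B = P" using prime_sub_eq[OF _ P BP] by blast
  obtain S where S: "finite S" "S \<subseteq> ints K" "\<And>z. z \<in> ints K \<Longrightarrow> \<exists>s\<in>S. z - s \<in> A"
    using finite_representatives[OF A(1,2)] by blast
  \<comment> \<open>The denominators of finitely many representatives modulo \<open>A\<close>
    multiply to one \<open>r0\<close> outside \<open>P\<close> that carries all of \<open>C\<close>
    into \<open>A\<close>; multiplying \<open>x\<close> by it returns from \<open>C\<close> to
    \<open>A\<close>.\<close>
  define T where "T = {s \<in> S. \<exists>r\<in>ints K - P. r * s \<in> A}"
  have "\<forall>s\<in>T. \<exists>r. r \<in> ints K - P \<and> r * s \<in> A" by (auto simp: T_def)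
  from bchoice[OF this] obtain \<rho> where \<rho>: "\<And>s. s \<in> T \<Longrightarrow> \<rho> s \<in> ints K - P" "\<And>s. s \<in> T \<Longrightarrow> \<rho> s * s \<in> A"
    by blast
  have Tfin: "finite T" using S(1) by (simp add: T_def)
  define r0 where "r0 = prod \<rho> T"
  have r0: "r0 \<in> ints K" unfolding r0_def using \<rho>(1) by (intro ints_prod) auto
  have r0P: "r0 \<notin> P" using prime_prod_mem[OF Tfin P, of \<rho>] \<rho>(1) unfolding r0_def by blast
  have r0C: "r0 * c \<in> A" if c: "c \<in> C" for c
  proof -
    obtain r where r: "r \<in> ints K - P" "r * c \<in> A" "c \<in> ints K" using c unfolding C_def by blast
    obtain s where s: "s \<in> S" "c - s \<in> A" using S(3)[OF r(3)] by blast
    have "r * c - r * (c - s) \<in> A" using r(1,2) s(2) idealD(4,7)[OF A(1)] by blast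
    then have "r * s \<in> A" by (simp add: algebra_simps)
    then have sT: "s \<in> T" using r(1) s(1) by (auto simp: T_def)
    have "r0 * s = prod \<rho> (T - {s}) * (\<rho> s * s)" unfolding r0_def
      using prod.remove[OF Tfin sT, of \<rho>] by (simp add: mult_ac)
    moreover have "prod \<rho> (T - {s}) \<in> ints K" using \<rho>(1) by (intro ints_prod) auto
    then have "prod \<rho> (T - {s}) * (\<rho> s * s) \<in> A" by (rule idealD(4)[OF A(1) _ \<rho>(2)[OF sT]])
    ultimately have "r0 * s \<in> A" by (simp only:)
    then have "r0 * (c - s) + r0 * s \<in> A" using idealD(3,4)[OF A(1)] s(2) r0 by blast
    then show ?thesis by (simp add: algebra_simps)
  qed
  show ?thesis
  proof (rule that[of "r0 * x"])
    show "r0 * x \<in> ints K" using r0 x by simp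
    show "r0 * x \<notin> princ a"
    proof
      assume "r0 * x \<in> princ a"
      then have "x \<in> C" unfolding C_def A_def[symmetric] using r0 r0P x by blast
      then show False using x by blast
    qed
    fix p assume "p \<in> P"
    then have "x * p \<in> C" using BeqP x by (auto simp: colon_def)
    then show "r0 * x * p \<in> princ a" using r0C by (simp add: A_def mult.assoc)
  qed
qed

text \<open>The fraction \<open>\<gamma> = b / a\<close> from \<open>ex_colon_elt\<close> carries
  \<open>P\<close> into the integers without being integral. If the ideal \<open>Q\<close> of all
  \<open>p + \<gamma> * q\<close> were \<open>P\<close>, then \<gamma> would preserve
  \<open>P\<close> and be integral by \<open>almost_integral\<close>; by maximality it is the whole
  ring. The identity \<open>p + \<gamma> * q = 1\<close> expresses invertibility of \<open>P\<close>
  by elements instead of fractional ideals.\<close>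

lemma prime_inverse:
  assumes P: "P \<in> primes K"
  obtains \<gamma> p q where "\<gamma> \<in> K" "\<gamma> \<notin> ints K" "\<forall>x\<in>P. \<gamma> * x \<in> ints K" "p \<in> P" "q \<in> P" "p + \<gamma> * q = 1"
proof -
  note PD = primesD[OF P]
  obtain a where a: "a \<in> P" "a \<noteq> 0" "a \<in> ints K" using ideal_nonzero[OF PD(1,2)] by blast
  obtain b where b: "b \<in> ints K" "b \<notin> princ a" "\<And>p. p \<in> P \<Longrightarrow> b * p \<in> princ a"
    using ex_colon_elt[OF P a(1,2)] by blast
  define \<gamma> where "\<gamma> = b / a"
  have \<gamma>K: "\<gamma> \<in> K" unfolding \<gamma>_def using a(3) b(1) by (simp add: ints_mem)
  have \<gamma>P: "\<gamma> * x \<in> ints K" if x: "x \<in> P" for x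
  proof -
    obtain r where "r \<in> ints K" "b * x = a * r" using b(3)[OF x] unfolding princ_def by blast
    then show ?thesis using a(2) by (simp add: \<gamma>_def)
  qed
  have \<gamma>n: "\<gamma> \<notin> ints K"
  proof
    assume "\<gamma> \<in> ints K"
    then have "a * \<gamma> \<in> princ a" unfolding princ_def by (rule imageI)
    then show False using a(2) b(2) by (simp add: \<gamma>_def)
  qed
  define Q where "Q = {p + \<gamma> * q | p q. p \<in> P \<and> q \<in> P}"
  have Q: "ideal Q (integers K)"
  proof (rule idealI')
    show "Q \<subseteq> ints K" unfolding Q_def using PD(4) \<gamma>P by auto
    have "0 + \<gamma> * 0 \<in> Q" unfolding Q_def using idealD(2)[OF PD(1)] by blast
    then show "0 \<in> Q" by simp
    fix y z assume "y \<in> Q" "z \<in> Q"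
    then obtain p q p' q' where *: "y = p + \<gamma> * q" "z = p' + \<gamma> * q'" "p \<in> P" "q \<in> P" "p' \<in> P" "q' \<in> P"
      unfolding Q_def by blast
    then have "y + z = (p + p') + \<gamma> * (q + q')" by (simp add: algebra_simps)
    moreover have "p + p' \<in> P" "q + q' \<in> P" using * idealD(3)[OF PD(1)] by simp_all
    ultimately show "y + z \<in> Q" unfolding Q_def by blast
  next
    fix t y assume t: "t \<in> ints K" and "y \<in> Q"
    then obtain p q where *: "y = p + \<gamma> * q" "p \<in> P" "q \<in> P" unfolding Q_def by blast
    then have "t * y = t * p + \<gamma> * (t * q)" by (simp add: algebra_simps)
    moreover have "t * p \<in> P" "t * q \<in> P" using * t idealD(4)[OF PD(1)] by simp_all
    ultimately show "t * y \<in> Q" unfolding Q_def by blast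
  qed
  have PQ: "P \<subseteq> Q"
  proof
    fix x assume "x \<in> P"
    then have "x + \<gamma> * 0 \<in> Q" unfolding Q_def using idealD(2)[OF PD(1)] by blast
    then show "x \<in> Q" by simp
  qed
  have "Q \<noteq> P"
  proof
    assume eq: "Q = P"
    have st: "\<gamma> * x \<in> P" if "x \<in> P" for x
    proof -
      have "0 + \<gamma> * x \<in> Q" unfolding Q_def using idealD(2)[OF PD(1)] that by blast
      then show ?thesis using eq by simp
    qed
    have "a * \<gamma> ^ n \<in> P" for n
    proof (induction n)
      case (Suc n)
      then show ?case using st[of "a * \<gamma> ^ n"] by (simp add: mult_ac)
    qed (use a in simp)
    then have "a * \<gamma> ^ n \<in> ints K" for n using PD(4) by blast
    then have "\<gamma> \<in> ints K" by (rule almost_integral[OF a(3,2) \<gamma>K])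
    then show False using \<gamma>n by blast
  qed
  then have "1 \<in> Q" using PD(5)[OF Q PQ] by auto
  then obtain p q where pq: "1 = p + \<gamma> * q" "p \<in> P" "q \<in> P" unfolding Q_def by blast
  show ?thesis by (rule that[OF \<gamma>K \<gamma>n _ pq(2,3) pq(1)[symmetric]]) (use \<gamma>P in blast)
qed

section \<open>Products of ideals and division by a prime\<close>

abbreviation iprod :: "'a set \<Rightarrow> 'a set \<Rightarrow> 'a set" where "iprod I J \<equiv> ideal_prod (integers K) I J"

lemma iprod_mem: "x \<in> I \<Longrightarrow> y \<in> J \<Longrightarrow> x * y \<in> iprod I J"
  using ideal_prod.prod[of x I y J "integers K"] by simp

lemma iprod_le:
  assumes "ideal A (integers K)" "\<And>x y. x \<in> I \<Longrightarrow> y \<in> J \<Longrightarrow> x * y \<in> A"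
  shows "iprod I J \<subseteq> A"
proof
  fix z assume "z \<in> iprod I J"
  then show "z \<in> A"
    by (induction rule: ideal_prod.induct) (use assms idealD(3) in auto)
qed

lemma iprod_ideal: "ideal I (integers K) \<Longrightarrow> ideal J (integers K) \<Longrightarrow> ideal (iprod I J) (integers K)"
  by (rule OK.ideal_prod_is_ideal)

lemma iprod_nonzero:
  assumes "ideal I (integers K)" "ideal J (integers K)" "I \<noteq> {0}" "J \<noteq> {0}"
  shows "iprod I J \<noteq> {0}"
proof -
  obtain x y where "x \<in> I" "x \<noteq> 0" "y \<in> J" "y \<noteq> 0"
    using ideal_nonzero[OF assms(1,3)] ideal_nonzero[OF assms(2,4)] by blast
  then have "x * y \<in> iprod I J" "x * y \<noteq> 0" by (simp_all add: iprod_mem)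
  then show ?thesis by (metis singletonD)
qed

lemma iprod_le_left: "ideal I (integers K) \<Longrightarrow> ideal J (integers K) \<Longrightarrow> iprod I J \<subseteq> I"
  using OK.ideal_prod_inter[of I J] by simp

lemma iprod_le_right: "ideal I (integers K) \<Longrightarrow> ideal J (integers K) \<Longrightarrow> iprod I J \<subseteq> J"
  using OK.ideal_prod_inter[of I J] by simp

text \<open>Since \<gamma> maps \<open>iprod P I\<close> into \<open>I\<close>, both terms of
  \<open>x = x * p + \<gamma> * (x * q)\<close> lie in \<open>I\<close>. This is the cancellation
  law for \<open>P\<close>.\<close>

lemma prime_iprod_colon:
  assumes P: "P \<in> primes K" and I: "ideal I (integers K)" and x: "x \<in> K" "\<And>p. p \<in> P \<Longrightarrow> x * p \<in> iprod P I"
  shows "x \<in> I"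
proof -
  note PD = primesD[OF P]
  obtain \<gamma> p q where "\<gamma> \<in> K" "\<gamma> \<notin> ints K" and g: "\<forall>x\<in>P. \<gamma> * x \<in> ints K" "p \<in> P" "q \<in> P" "p + \<gamma> * q = 1"
    using prime_inverse[OF P] by blast
  have "\<gamma> * z \<in> I" if "z \<in> iprod P I" for z
    using that
  proof (induction rule: ideal_prod.induct)
    case (prod i j)
    then show ?case using idealD(4)[OF I g(1)[rule_format]] by (simp add: mult.assoc)
  next
    case (sum s t)
    then show ?case using idealD(3)[OF I] by (simp add: distrib_left)
  qed
  then have "\<gamma> * (x * q) \<in> I" using x(2) g(3) by blast
  moreover have "x * p \<in> I" using x(2)[OF g(2)] iprod_le_right[OF PD(1) I] by blast
  ultimately have "x * p + \<gamma> * (x * q) \<in> I" using idealD(3)[OF I] by blast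
  also have "x * p + \<gamma> * (x * q) = x * (p + \<gamma> * q)" by (simp add: algebra_simps)
  finally show ?thesis using g(4) by simp
qed

lemma prime_iprod_le_iff:
  assumes P: "P \<in> primes K" and I: "ideal I (integers K)" and J: "ideal J (integers K)"
  shows "iprod P I \<subseteq> iprod P J \<longleftrightarrow> I \<subseteq> J"
proof
  assume le: "iprod P I \<subseteq> iprod P J"
  show "I \<subseteq> J"
  proof
    fix x assume x: "x \<in> I"
    then have "x \<in> K" using idealD(1)[OF I] ints_mem by blast
    moreover have "x * p \<in> iprod P J" if "p \<in> P" for p
      using iprod_mem[OF that x] le by (auto simp: mult.commute)
    ultimately show "x \<in> J" by (rule prime_iprod_colon[OF P J])
  qed
next
  assume "I \<subseteq> J"
  then show "iprod P I \<subseteq> iprod P J"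
    by (intro iprod_le[OF iprod_ideal[OF primesD(1)[OF P] J]] iprod_mem) auto
qed

text \<open>\<open>J\<close> is the product of the inverse of \<open>P\<close> with
  \<open>I\<close>, written as a colon. It is strictly larger than \<open>I\<close>, since otherwise
  \<gamma> would preserve \<open>I\<close> and be integral; the strictness drives the induction in
  \<open>M_induct\<close>.\<close>

lemma prime_factor_ideal:
  assumes P: "P \<in> primes K" and I: "ideal I (integers K)" "I \<noteq> {0}" "I \<subseteq> P"
  obtains J where "ideal J (integers K)" "I = iprod P J" "I \<subset> J"
proof -
  note PD = primesD[OF P]
  obtain \<gamma> p q where g: "\<gamma> \<in> K" "\<gamma> \<notin> ints K" "\<forall>x\<in>P. \<gamma> * x \<in> ints K" "p \<in> P" "q \<in> P" "p + \<gamma> * q = 1"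
    using prime_inverse[OF P] by blast
  obtain a where a: "a \<in> P" "a \<noteq> 0" "a \<in> ints K" using ideal_nonzero[OF PD(1,2)] by blast
  define J where "J = {x \<in> K. \<forall>p\<in>P. x * p \<in> I}"
  have Jint: "x \<in> ints K" if x: "x \<in> J" for x
  proof -
    have st: "x * p \<in> P" if "p \<in> P" for p using x that I(3) by (auto simp: J_def)
    have "a * x ^ n \<in> P" for n
    proof (induction n)
      case (Suc n)
      then show ?case using st[of "a * x ^ n"] by (simp add: mult_ac)
    qed (use a in simp)
    then have "a * x ^ n \<in> ints K" for n using PD(4) by blast
    from almost_integral[OF a(3,2) _ this] show ?thesis using x by (simp add: J_def)
  qed
  have J: "ideal J (integers K)"
  proof (rule idealI')
    show "J \<subseteq> ints K" using Jint by blast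
    show "0 \<in> J" using idealD(2)[OF I(1)] by (simp add: J_def)
    show "x + y \<in> J" if "x \<in> J" "y \<in> J" for x y
      using that idealD(3)[OF I(1)] by (simp add: J_def distrib_right)
    show "r * x \<in> J" if "r \<in> ints K" "x \<in> J" for r x
      using that idealD(4)[OF I(1)] by (simp add: J_def mult.assoc ints_mem)
  qed
  have IJ: "I \<subseteq> J"
  proof
    fix x assume "x \<in> I"
    then have "x \<in> K" "\<And>p. p \<in> P \<Longrightarrow> x * p \<in> I"
      using idealD(1,5)[OF I(1)] PD(4) ints_mem by blast+
    then show "x \<in> J" by (simp add: J_def)
  qed
  have gJ: "\<gamma> * z \<in> J" if z: "z \<in> I" for z
  proof -
    have zK: "z \<in> K" using z idealD(1)[OF I(1)] ints_mem by blast
    have "\<gamma> * z * p \<in> I" if "p \<in> P" for p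
      using idealD(4)[OF I(1) g(3)[rule_format, OF that] z] by (simp add: mult_ac)
    then show ?thesis using zK g(1) by (simp add: J_def)
  qed
  have eq: "I = iprod P J"
  proof
    show "iprod P J \<subseteq> I"
      by (rule iprod_le[OF I(1)]) (auto simp: J_def mult.commute)
    show "I \<subseteq> iprod P J"
    proof
      fix z assume z: "z \<in> I"
      have "p * z + q * (\<gamma> * z) \<in> iprod P J"
        using idealD(3)[OF iprod_ideal[OF PD(1) J]] iprod_mem[OF g(4)] iprod_mem[OF g(5) gJ[OF z]] IJ z by blast
      also have "p * z + q * (\<gamma> * z) = (p + \<gamma> * q) * z" by (simp add: algebra_simps)
      finally show "z \<in> iprod P J" using g(6) by simp
    qed
  qed
  have "I \<noteq> J"
  proof
    assume IJeq: "I = J"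
    obtain z where z: "z \<in> I" "z \<noteq> 0" "z \<in> ints K" using ideal_nonzero[OF I(1,2)] by blast
    have "z * \<gamma> ^ n \<in> I" for n
    proof (induction n)
      case (Suc n)
      then show ?case using gJ[OF Suc] IJeq by (simp add: mult_ac)
    qed (use z in simp)
    then have "z * \<gamma> ^ n \<in> ints K" for n using idealD(1)[OF I(1)] by blast
    then have "\<gamma> \<in> ints K" by (rule almost_integral[OF z(3,2) g(1)])
    then show False using g(2) by blast
  qed
  then show ?thesis using that J eq IJ by blast
qed

end

section \<open>Unique factorization of ideals\<close>

context nfield begin

abbreviation M where "M \<equiv> ideal_monoid K"

lemma M_mult [simp]: "I \<otimes>\<^bsub>M\<^esub> J = iprod I J"
  and M_one [simp]: "\<one>\<^bsub>M\<^esub> = ints K"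
  and M_carrier: "I \<in> carrier M \<longleftrightarrow> ideal I (integers K) \<and> I \<noteq> {0}"
  by (simp_all add: ideal_monoid_def ideals_set_def)

lemma ints_ideal: "ideal (ints K) (integers K)"
  by (rule OK.oneideal)

lemma ints_nonzero: "ints K \<noteq> {0}"
  using ints_one by (metis one_neq_zero singletonD)

lemma M_comm_monoid: "comm_monoid M"
proof -
  interpret I: comm_monoid "ideals_set (integers K)" by (rule OK.ideals_set_is_comm_monoid)
  have c: "I \<in> carrier (ideals_set (integers K)) \<longleftrightarrow> ideal I (integers K)" for I
    by (simp add: ideals_set_def)
  have m: "I \<otimes>\<^bsub>ideals_set (integers K)\<^esub> J = iprod I J" for I J by (simp add: ideals_set_def)
  have o: "\<one>\<^bsub>ideals_set (integers K)\<^esub> = ints K" by (simp add: ideals_set_def)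
  show ?thesis
  proof (rule comm_monoidI)
    fix I J L assume "I \<in> carrier M" "J \<in> carrier M" "L \<in> carrier M"
    then show "I \<otimes>\<^bsub>M\<^esub> J \<otimes>\<^bsub>M\<^esub> L = I \<otimes>\<^bsub>M\<^esub> (J \<otimes>\<^bsub>M\<^esub> L)"
      using I.m_assoc[of I J L] by (simp add: M_carrier c m)
  next
    fix I J assume "I \<in> carrier M" "J \<in> carrier M"
    then show "I \<otimes>\<^bsub>M\<^esub> J \<in> carrier M" "I \<otimes>\<^bsub>M\<^esub> J = J \<otimes>\<^bsub>M\<^esub> I"
      using I.m_comm[of I J] iprod_ideal[of I J] iprod_nonzero[of I J] by (simp_all add: M_carrier c m)
  next
    fix I assume "I \<in> carrier M"
    then show "\<one>\<^bsub>M\<^esub> \<otimes>\<^bsub>M\<^esub> I = I" using I.l_one[of I] by (simp add: M_carrier c m o)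
  qed (simp add: M_carrier ints_ideal ints_nonzero)
qed

end

sublocale nfield \<subseteq> M: comm_monoid "ideal_monoid K"
  by (rule M_comm_monoid)

context nfield begin

lemma prime_M: "P \<in> primes K \<Longrightarrow> P \<in> carrier M"
  using primesD(1,2) by (simp add: M_carrier)

text \<open>Existence of prime factorizations, packaged as an induction rule.\<close>

lemma M_induct [consumes 1]:
  assumes "I \<in> carrier M"
    and one: "Q (ints K)"
    and step: "\<And>P I. P \<in> primes K \<Longrightarrow> I \<in> carrier M \<Longrightarrow> Q I \<Longrightarrow> Q (P \<otimes>\<^bsub>M\<^esub> I)"
  shows "Q I"
proof -
  have "ideal I (integers K)" "I \<noteq> {0}" using assms(1) by (simp_all add: M_carrier)
  then show ?thesis
  proof (induction rule: ideal_induct)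
    case (1 I)
    show ?case
    proof (cases "1 \<in> I")
      case True
      then show ?thesis using ideal_eq_ints[OF 1(1)] one by simp
    next
      case False
      then obtain P where P: "P \<in> primes K" "I \<subseteq> P" using ex_prime_above[OF 1(1,2)] by blast
      obtain J where J: "ideal J (integers K)" "I = iprod P J" "I \<subset> J"
        using prime_factor_ideal[OF P(1) 1(1,2) P(2)] by blast
      then have "J \<in> carrier M" using nonzero_mono[OF 1(2,1)] by (simp add: M_carrier)
      then show ?thesis using step[OF P(1) _ 1(3)[OF J(1,3)]] J(2) by simp
    qed
  qed
qed

lemma M_prime_le_iff:
  assumes "P \<in> primes K" "I \<in> carrier M" "J \<in> carrier M"
  shows "P \<otimes>\<^bsub>M\<^esub> I \<subseteq> P \<otimes>\<^bsub>M\<^esub> J \<longleftrightarrow> I \<subseteq> J"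
  using prime_iprod_le_iff assms by (simp add: M_carrier)

lemma M_le_iff:
  assumes "A \<in> carrier M" "I \<in> carrier M" "J \<in> carrier M"
  shows "A \<otimes>\<^bsub>M\<^esub> I \<subseteq> A \<otimes>\<^bsub>M\<^esub> J \<longleftrightarrow> I \<subseteq> J"
  using assms(1)
proof (induction rule: M_induct)
  case 1
  then show ?case using M.l_one[OF assms(2)] M.l_one[OF assms(3)] by simp
next
  case (2 P A)
  have "P \<otimes>\<^bsub>M\<^esub> A \<otimes>\<^bsub>M\<^esub> I \<subseteq> P \<otimes>\<^bsub>M\<^esub> A \<otimes>\<^bsub>M\<^esub> J \<longleftrightarrow> P \<otimes>\<^bsub>M\<^esub> (A \<otimes>\<^bsub>M\<^esub> I) \<subseteq> P \<otimes>\<^bsub>M\<^esub> (A \<otimes>\<^bsub>M\<^esub> J)"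
    using M.m_assoc prime_M[OF 2(1)] 2(2) assms(2,3) by simp
  also have "\<dots> \<longleftrightarrow> A \<otimes>\<^bsub>M\<^esub> I \<subseteq> A \<otimes>\<^bsub>M\<^esub> J"
    using M_prime_le_iff[OF 2(1) M.m_closed[OF 2(2) assms(2)] M.m_closed[OF 2(2) assms(3)]] .
  finally show ?case using 2(3) by blast
qed

lemma M_cancel:
  assumes "A \<in> carrier M" "I \<in> carrier M" "J \<in> carrier M" "A \<otimes>\<^bsub>M\<^esub> I = A \<otimes>\<^bsub>M\<^esub> J"
  shows "I = J"
  using M_le_iff[OF assms(1-3)] M_le_iff[OF assms(1,3,2)] assms(4) by blast

lemma M_mult_le: "I \<in> carrier M \<Longrightarrow> J \<in> carrier M \<Longrightarrow> I \<otimes>\<^bsub>M\<^esub> J \<subseteq> I"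
  using iprod_le_left by (simp add: M_carrier)

text \<open>To contain is to divide: the prime factors of \<open>J\<close> are cancelled from both
  ideals one at a time.\<close>

lemma M_le_imp_factor:
  assumes "J \<in> carrier M" "I \<in> carrier M" "I \<subseteq> J"
  shows "\<exists>C\<in>carrier M. I = J \<otimes>\<^bsub>M\<^esub> C"
  using assms
proof (induction arbitrary: I rule: M_induct)
  case 1
  then show ?case using M.l_one[of I] by (auto intro!: bexI[of _ I])
next
  case (2 P J I)
  note PM = prime_M[OF 2(1)]
  have "I \<subseteq> P" using 2(5) M_mult_le[OF PM 2(2)] by blast
  then obtain I' where I': "ideal I' (integers K)" "I = iprod P I'" "I \<subset> I'"
    using prime_factor_ideal[OF 2(1) _ _ \<open>I \<subseteq> P\<close>] 2(4) unfolding M_carrier by blast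
  then have I'M: "I' \<in> carrier M" using nonzero_mono[of I I'] 2(4) by (simp add: M_carrier)
  have "I' \<subseteq> J" using 2(5) I'(2) M_prime_le_iff[OF 2(1) I'M 2(2)] by simp
  then obtain C where C: "C \<in> carrier M" "I' = J \<otimes>\<^bsub>M\<^esub> C" using 2(3)[OF I'M] by blast
  then have "I = P \<otimes>\<^bsub>M\<^esub> J \<otimes>\<^bsub>M\<^esub> C" using I'(2) M.m_assoc[OF PM 2(2) C(1)] by simp
  then show ?case using C(1) by blast
qed

lemma M_divides_iff:
  assumes "I \<in> carrier M" "J \<in> carrier M"
  shows "J divides\<^bsub>M\<^esub> I \<longleftrightarrow> I \<subseteq> J"
  using M_le_imp_factor[OF assms(2,1)] M_mult_le[OF assms(2)] unfolding factor_def by blast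

section \<open>Powers of primes and valuations of ideals\<close>

abbreviation pw where "pw P n \<equiv> P [^]\<^bsub>M\<^esub> (n :: nat)"

lemma pw_M: "P \<in> primes K \<Longrightarrow> pw P n \<in> carrier M"
  by (rule M.nat_pow_closed[OF prime_M])

lemma pw_ideal: "P \<in> primes K \<Longrightarrow> ideal (pw P n) (integers K)"
  using pw_M by (simp add: M_carrier)

lemma pw_1: "P \<in> primes K \<Longrightarrow> pw P (Suc 0) = P"
  using M.l_one[OF prime_M] by simp

lemma pw_antimono: "P \<in> primes K \<Longrightarrow> m \<le> n \<Longrightarrow> pw P n \<subseteq> pw P m"
  using M_mult_le[OF pw_M pw_M, of P P m "n - m"] M.nat_pow_mult[OF prime_M, of P m "n - m"] by simp

lemma pw_mult_mem:
  assumes "P \<in> primes K" "x \<in> pw P m" "y \<in> pw P n" shows "x * y \<in> pw P (m + n)"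
  using iprod_mem[OF assms(2,3)] M.nat_pow_mult[OF prime_M[OF assms(1)], of m n] by simp

lemma prime_iprod_sub:
  assumes P: "P \<in> primes K" and I: "I \<in> carrier M" "J \<in> carrier M" and le: "I \<otimes>\<^bsub>M\<^esub> J \<subseteq> P"
  shows "I \<subseteq> P \<or> J \<subseteq> P"
proof (rule ccontr)
  assume "\<not> (I \<subseteq> P \<or> J \<subseteq> P)"
  then obtain x y where xy: "x \<in> I" "x \<notin> P" "y \<in> J" "y \<notin> P" by blast
  then have "x * y \<in> P" using iprod_mem[of x I y J] le by auto
  moreover have "x \<in> ints K" "y \<in> ints K" using xy I idealD(1) by (auto simp: M_carrier)
  ultimately show False using primesD(6)[OF P] xy by blast
qed

lemma not_one_prime: "P \<in> primes K \<Longrightarrow> \<not> ints K \<subseteq> P"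
  using primesD(3)[of P] ints_one by blast

lemma pw_mult_le_iff:
  assumes P: "P \<in> primes K" and I: "I \<in> carrier M"
  shows "pw P n \<otimes>\<^bsub>M\<^esub> I \<subseteq> pw P (Suc n) \<longleftrightarrow> I \<subseteq> P"
  using M_le_iff[OF pw_M[OF P] I prime_M[OF P], of n] by simp

text \<open>Two equal powers would put some power inside the next one, and cancelling it would place
  the whole ring inside \<open>P\<close>.\<close>

lemma pw_inj: "P \<in> primes K \<Longrightarrow> inj (pw P)"
proof (rule injI)
  fix m n assume P: "P \<in> primes K" and eq: "pw P m = pw P n"
  have *: False if "m < n" "pw P m = pw P n" for m n
  proof -
    have "pw P m \<subseteq> pw P (Suc m)" using pw_antimono[OF P, of "Suc m" n] that by simp
    then have "pw P m \<otimes>\<^bsub>M\<^esub> \<one>\<^bsub>M\<^esub> \<subseteq> pw P (Suc m)" using M.r_one[OF pw_M[OF P]] by simp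
    then have "ints K \<subseteq> P" using pw_mult_le_iff[OF P M.one_closed] by simp
    then show False using not_one_prime[OF P] by blast
  qed
  show "m = n" using *[of m n] *[of n m] eq by (cases m n rule: linorder_cases) auto
qed

lemma pw_bound:
  assumes P: "P \<in> primes K" and I: "I \<in> carrier M"
  obtains b where "\<And>n. I \<subseteq> pw P n \<Longrightarrow> n \<le> b"
proof -
  have "finite {J. ideal J (integers K) \<and> I \<subseteq> J}" using finite_ideals_above I by (simp add: M_carrier)
  moreover have "pw P ` {n. I \<subseteq> pw P n} \<subseteq> {J. ideal J (integers K) \<and> I \<subseteq> J}"
    using pw_ideal[OF P] by blast
  ultimately have "finite (pw P ` {n. I \<subseteq> pw P n})" by (rule finite_subset[rotated])
  then have "finite {n. I \<subseteq> pw P n}"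
    by (rule finite_imageD) (rule inj_on_subset[OF pw_inj[OF P]], simp)
  then show ?thesis using that[of "Max {n. I \<subseteq> pw P n}"] Max_ge by blast
qed

text \<open>Only finitely many ideals lie above \<open>I\<close> and the powers of \<open>P\<close>
  are distinct, so the maximum in \<open>ideal_val\<close> is attained.\<close>

lemma val_ge_iff:
  assumes P: "P \<in> primes K" and I: "I \<in> carrier M"
  shows "n \<le> ideal_val K P I \<longleftrightarrow> I \<subseteq> pw P n"
proof -
  obtain b where b: "\<And>n. I \<subseteq> pw P n \<Longrightarrow> n \<le> b" using pw_bound[OF P I] by blast
  have eq: "ideal_val K P I = (GREATEST n. I \<subseteq> pw P n)"
    unfolding ideal_val_def using M_divides_iff[OF I pw_M[OF P]] by simp
  have "I \<subseteq> pw P 0" using idealD(1) I by (simp add: M_carrier)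
  then have max: "I \<subseteq> pw P (ideal_val K P I)"
    unfolding eq by (rule GreatestI_nat[where P = "\<lambda>n. I \<subseteq> pw P n"]) (use b in blast)
  show ?thesis
  proof
    show "n \<le> ideal_val K P I \<Longrightarrow> I \<subseteq> pw P n" using max pw_antimono[OF P] by blast
    show "I \<subseteq> pw P n \<Longrightarrow> n \<le> ideal_val K P I"
      unfolding eq by (rule Greatest_le_nat[where P = "\<lambda>n. I \<subseteq> pw P n"]) (use b in blast)+
  qed
qed

lemma val_pos_iff: "P \<in> primes K \<Longrightarrow> I \<in> carrier M \<Longrightarrow> 0 < ideal_val K P I \<longleftrightarrow> I \<subseteq> P"
  using val_ge_iff[of P I 1] pw_1[of P] by (simp add: Suc_le_eq)

lemma val_decomp:
  assumes P: "P \<in> primes K" and I: "I \<in> carrier M"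
  obtains J where "J \<in> carrier M" "I = pw P (ideal_val K P I) \<otimes>\<^bsub>M\<^esub> J" "\<not> J \<subseteq> P"
proof -
  define n where "n = ideal_val K P I"
  have "I \<subseteq> pw P n" using val_ge_iff[OF P I, of n] by (simp add: n_def)
  then obtain J where J: "J \<in> carrier M" "I = pw P n \<otimes>\<^bsub>M\<^esub> J"
    using M_le_imp_factor[OF pw_M[OF P] I] by blast
  have "\<not> I \<subseteq> pw P (Suc n)" using val_ge_iff[OF P I, of "Suc n"] by (simp add: n_def)
  then have "\<not> J \<subseteq> P" using pw_mult_le_iff[OF P J(1), of n] J(2) by simp
  then show ?thesis by (rule that[OF J(1) J(2)[unfolded n_def]])
qed

lemma val_pw_mult:
  assumes P: "P \<in> primes K" and J: "J \<in> carrier M" "\<not> J \<subseteq> P"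
  shows "ideal_val K P (pw P n \<otimes>\<^bsub>M\<^esub> J) = n"
proof -
  have c: "pw P n \<otimes>\<^bsub>M\<^esub> J \<in> carrier M" by (rule M.m_closed[OF pw_M[OF P] J(1)])
  have "n \<le> ideal_val K P (pw P n \<otimes>\<^bsub>M\<^esub> J)"
    using val_ge_iff[OF P c] M_mult_le[OF pw_M[OF P] J(1)] by blast
  moreover have "\<not> Suc n \<le> ideal_val K P (pw P n \<otimes>\<^bsub>M\<^esub> J)"
    using val_ge_iff[OF P c] pw_mult_le_iff[OF P J(1)] J(2) by blast
  ultimately show ?thesis by simp
qed

lemma val_mult:
  assumes P: "P \<in> primes K" and I: "I \<in> carrier M" "J \<in> carrier M"
  shows "ideal_val K P (I \<otimes>\<^bsub>M\<^esub> J) = ideal_val K P I + ideal_val K P J"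
proof -
  obtain I' where I': "I' \<in> carrier M" "I = pw P (ideal_val K P I) \<otimes>\<^bsub>M\<^esub> I'" "\<not> I' \<subseteq> P"
    using val_decomp[OF P I(1)] by blast
  obtain J' where J': "J' \<in> carrier M" "J = pw P (ideal_val K P J) \<otimes>\<^bsub>M\<^esub> J'" "\<not> J' \<subseteq> P"
    using val_decomp[OF P I(2)] by blast
  define a b where "a = ideal_val K P I" and "b = ideal_val K P J"
  have "I \<otimes>\<^bsub>M\<^esub> J = (pw P a \<otimes>\<^bsub>M\<^esub> I') \<otimes>\<^bsub>M\<^esub> (pw P b \<otimes>\<^bsub>M\<^esub> J')"
    using I'(2) J'(2) by (simp only: a_def b_def)
  also have "\<dots> = (pw P a \<otimes>\<^bsub>M\<^esub> pw P b) \<otimes>\<^bsub>M\<^esub> (I' \<otimes>\<^bsub>M\<^esub> J')"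
    using I'(1) J'(1) pw_M[OF P] M.m_assoc M.m_lcomm M.m_closed by presburger
  also have "pw P a \<otimes>\<^bsub>M\<^esub> pw P b = pw P (a + b)" by (rule M.nat_pow_mult[OF prime_M[OF P]])
  finally have "I \<otimes>\<^bsub>M\<^esub> J = pw P (a + b) \<otimes>\<^bsub>M\<^esub> (I' \<otimes>\<^bsub>M\<^esub> J')" .
  moreover have "\<not> I' \<otimes>\<^bsub>M\<^esub> J' \<subseteq> P" using prime_iprod_sub[OF P I'(1) J'(1)] I'(3) J'(3) by blast
  ultimately show ?thesis using val_pw_mult[OF P M.m_closed[OF I'(1) J'(1)]] by (simp add: a_def b_def)
qed

lemma val_one: "P \<in> primes K \<Longrightarrow> ideal_val K P (ints K) = 0"
  using val_pos_iff[OF _ M.one_closed, of P] not_one_prime[of P] by simp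

lemma val_prime: "P \<in> primes K \<Longrightarrow> Q \<in> primes K \<Longrightarrow> ideal_val K P Q = (if P = Q then 1 else 0)"
proof (cases "P = Q")
  case True
  assume P: "P \<in> primes K" "Q \<in> primes K"
  have "ideal_val K P (pw P 1 \<otimes>\<^bsub>M\<^esub> \<one>\<^bsub>M\<^esub>) = 1"
    by (rule val_pw_mult[OF P(1) M.one_closed]) (use not_one_prime[OF P(1)] in simp)
  moreover have "pw P 1 \<otimes>\<^bsub>M\<^esub> \<one>\<^bsub>M\<^esub> = P"
    using M.r_one[OF prime_M[OF P(1)]] M.l_one[OF prime_M[OF P(1)]] by simp
  ultimately show ?thesis using True by simp
next
  case False
  assume P: "P \<in> primes K" "Q \<in> primes K"
  then have "\<not> Q \<subseteq> P" using prime_sub_eq False by blast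
  then show ?thesis using val_pos_iff[OF P(1) prime_M[OF P(2)]] False by simp
qed

lemma val_pw: "P \<in> primes K \<Longrightarrow> Q \<in> primes K \<Longrightarrow> ideal_val K P (pw Q n) = (if P = Q then n else 0)"
proof (induction n)
  case (Suc n)
  have "pw Q (Suc n) = pw Q n \<otimes>\<^bsub>M\<^esub> Q" by simp
  then show ?case using Suc val_mult[OF Suc.prems(1) pw_M[OF Suc.prems(2)] prime_M[OF Suc.prems(2)]]
    by (simp add: val_prime)
qed (simp add: val_one)

text \<open>Each prime factor of \<open>J\<close> also divides \<open>I\<close> and is removed from
  both.\<close>

lemma val_le_imp_le:
  assumes "J \<in> carrier M" "I \<in> carrier M" "\<And>P. P \<in> primes K \<Longrightarrow> ideal_val K P J \<le> ideal_val K P I"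
  shows "I \<subseteq> J"
  using assms
proof (induction arbitrary: I rule: M_induct)
  case 1
  then show ?case using idealD(1) by (simp add: M_carrier)
next
  case (2 P J I)
  note PM = prime_M[OF 2(1)]
  have "1 \<le> ideal_val K P I" using 2(5)[OF 2(1)] val_mult[OF 2(1) PM 2(2)] val_prime[OF 2(1,1)] by simp
  then have "I \<subseteq> P" using val_pos_iff[OF 2(1,4)] by simp
  then obtain I' where I': "I' \<in> carrier M" "I = P \<otimes>\<^bsub>M\<^esub> I'" using M_le_imp_factor[OF PM 2(4)] by blast
  have "ideal_val K Q J \<le> ideal_val K Q I'" if Q: "Q \<in> primes K" for Q
    using 2(5)[OF Q] val_mult[OF Q PM 2(2)] val_mult[OF Q PM I'(1)] I'(2) by simp
  then have "I' \<subseteq> J" using 2(3)[OF I'(1)] by blast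
  then show ?case using M_prime_le_iff[OF 2(1) I'(1) 2(2)] I'(2) by simp
qed

lemma le_iff_val:
  assumes "J \<in> carrier M" "I \<in> carrier M"
  shows "I \<subseteq> J \<longleftrightarrow> (\<forall>P\<in>primes K. ideal_val K P J \<le> ideal_val K P I)"
proof
  assume "I \<subseteq> J"
  then show "\<forall>P\<in>primes K. ideal_val K P J \<le> ideal_val K P I"
    using val_ge_iff assms by (metis order_refl subset_trans)
qed (use val_le_imp_le[OF assms] in blast)

lemma M_eqI:
  assumes "I \<in> carrier M" "J \<in> carrier M" "\<And>P. P \<in> primes K \<Longrightarrow> ideal_val K P I = ideal_val K P J"
  shows "I = J"
  using val_le_imp_le[OF assms(1,2)] val_le_imp_le[OF assms(2,1)] assms(3) by simp

lemma finite_val_support: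
  assumes I: "I \<in> carrier M" shows "finite {P \<in> primes K. ideal_val K P I \<noteq> 0}"
proof (rule finite_subset)
  show "{P \<in> primes K. ideal_val K P I \<noteq> 0} \<subseteq> {J. ideal J (integers K) \<and> I \<subseteq> J}"
    using val_pos_iff[OF _ I] primesD(1) by blast
  show "finite {J. ideal J (integers K) \<and> I \<subseteq> J}"
    using finite_ideals_above I by (simp add: M_carrier)
qed

lemma ex_ideal_val:
  assumes "finite F" "F \<subseteq> primes K"
  shows "\<exists>I\<in>carrier M. \<forall>P\<in>primes K. ideal_val K P I = (if P \<in> F then n P else 0)"
  using assms
proof (induction F)
  case empty
  then show ?case using M.one_closed val_one by (intro bexI[of _ "\<one>\<^bsub>M\<^esub>"]) auto
next
  case (insert Q F)
  then obtain I where I: "I \<in> carrier M" "\<forall>P\<in>primes K. ideal_val K P I = (if P \<in> F then n P else 0)"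
    by auto
  have Q: "Q \<in> primes K" using insert by auto
  have "ideal_val K P (pw Q (n Q) \<otimes>\<^bsub>M\<^esub> I) = (if P \<in> insert Q F then n P else 0)" if P: "P \<in> primes K" for P
    unfolding val_mult[OF P pw_M[OF Q] I(1)] val_pw[OF P Q] using I(2) P insert(2) by auto
  then show ?case using M.m_closed[OF pw_M[OF Q] I(1)] by blast
qed

lemma ex_ideal_val':
  assumes "finite {P \<in> primes K. n P \<noteq> 0}"
  obtains I where "I \<in> carrier M" "\<And>P. P \<in> primes K \<Longrightarrow> ideal_val K P I = n P"
  using ex_ideal_val[OF assms, of n] that by auto

text \<open>Divisibility of ideals is antisymmetric, so the ideal whose valuations are the minima is
  the unique gcd and the choice in \<open>somegcd\<close> has no freedom.\<close>

lemma ideal_gcd_val: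
  assumes I: "I \<in> carrier M" and J: "J \<in> carrier M"
  shows "ideal_gcd K I J \<in> carrier M"
    and "P \<in> primes K \<Longrightarrow> ideal_val K P (ideal_gcd K I J) = min (ideal_val K P I) (ideal_val K P J)"
proof -
  have "finite {P \<in> primes K. min (ideal_val K P I) (ideal_val K P J) \<noteq> 0}"
    by (rule finite_subset[OF _ finite_val_support[OF I]]) auto
  then obtain G where G: "G \<in> carrier M" "\<And>P. P \<in> primes K \<Longrightarrow> ideal_val K P G = min (ideal_val K P I) (ideal_val K P J)"
    using ex_ideal_val'[of "\<lambda>P. min (ideal_val K P I) (ideal_val K P J)"] by blast
  have gcd: "H gcdof\<^bsub>M\<^esub> I J \<longleftrightarrow> H = G" if H: "H \<in> carrier M" for H
  proof
    have *: "G divides\<^bsub>M\<^esub> I" "G divides\<^bsub>M\<^esub> J"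
      using M_divides_iff[OF I G(1)] M_divides_iff[OF J G(1)] le_iff_val[OF G(1) I] le_iff_val[OF G(1) J] G(2) by auto
    have **: "L divides\<^bsub>M\<^esub> G" if "L \<in> carrier M" "L divides\<^bsub>M\<^esub> I" "L divides\<^bsub>M\<^esub> J" for L
      using that M_divides_iff[OF I that(1)] M_divides_iff[OF J that(1)] M_divides_iff[OF G(1) that(1)]
        le_iff_val[OF that(1) I] le_iff_val[OF that(1) J] le_iff_val[OF that(1) G(1)] G(2) by auto
    show "H = G \<Longrightarrow> H gcdof\<^bsub>M\<^esub> I J" using * ** by (auto simp: isgcd_def)
    assume "H gcdof\<^bsub>M\<^esub> I J"
    then have "H divides\<^bsub>M\<^esub> G" "G divides\<^bsub>M\<^esub> H" using * ** G(1) H by (auto simp: isgcd_def)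
    then show "H = G" using M_divides_iff[OF G(1) H] M_divides_iff[OF H G(1)] by blast
  qed
  have "ideal_gcd K I J = G"
    unfolding somegcd_def using gcd G(1) by (intro some_equality) auto
  then show "ideal_gcd K I J \<in> carrier M"
    and "P \<in> primes K \<Longrightarrow> ideal_val K P (ideal_gcd K I J) = min (ideal_val K P I) (ideal_val K P J)"
    using G by auto
qed

lemma ideal_quot_val:
  assumes I: "I \<in> carrier M" and J: "J \<in> carrier M" and d: "J divides\<^bsub>M\<^esub> I"
  shows "ideal_quot K I J \<in> carrier M"
    and "P \<in> primes K \<Longrightarrow> ideal_val K P (ideal_quot K I J) = ideal_val K P I - ideal_val K P J"
proof -
  obtain C where C: "C \<in> carrier M" "I = J \<otimes>\<^bsub>M\<^esub> C" using d unfolding factor_def by blast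
  have eq: "ideal_quot K I J = C"
    unfolding ideal_quot_def using C M_cancel[OF J] by (intro the_equality) auto
  show "ideal_quot K I J \<in> carrier M" using eq C by simp
  show "P \<in> primes K \<Longrightarrow> ideal_val K P (ideal_quot K I J) = ideal_val K P I - ideal_val K P J"
    using eq C val_mult[OF _ J C(1), of P] by simp
qed


section \<open>Valuations of elements\<close>

lemma princ_M: "x \<in> ints K \<Longrightarrow> x \<noteq> 0 \<Longrightarrow> princ x \<in> carrier M"
  using princ_ideal[of x] princ_self[of x] by (auto simp: M_carrier)

lemma princ_mult:
  assumes "x \<in> ints K" "y \<in> ints K"
  shows "princ (x * y) = princ x \<otimes>\<^bsub>M\<^esub> princ y"
proof
  have "ideal (iprod (princ x) (princ y)) (integers K)" using assms by (intro iprod_ideal princ_ideal)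
  then show "princ (x * y) \<subseteq> princ x \<otimes>\<^bsub>M\<^esub> princ y"
    using iprod_mem[OF princ_self princ_self, of x y] by (simp add: princ_le)
  show "princ x \<otimes>\<^bsub>M\<^esub> princ y \<subseteq> princ (x * y)"
    unfolding M_mult
  proof (rule iprod_le[OF princ_ideal[OF ints_mult[OF assms]]])
    fix u v assume "u \<in> princ x" "v \<in> princ y"
    then obtain r s where "u = x * r" "v = y * s" "r \<in> ints K" "s \<in> ints K" unfolding princ_def by blast
    then have "u * v = (x * y) * (r * s)" "r * s \<in> ints K" by simp_all
    then show "u * v \<in> princ (x * y)" unfolding princ_def by blast
  qed
qed

text \<open>The zero ideal lies outside the ideal monoid, so the value is meaningful for nonzero
  \<open>x\<close> only.\<close>

definition ev :: "'a set \<Rightarrow> 'a \<Rightarrow> nat" where "ev P x = ideal_val K P (princ x)"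

lemma mem_pw_iff:
  assumes "P \<in> primes K" "x \<in> ints K" "x \<noteq> 0" shows "x \<in> pw P n \<longleftrightarrow> n \<le> ev P x"
  unfolding ev_def using val_ge_iff[OF assms(1) princ_M[OF assms(2,3)]] princ_le[OF pw_ideal[OF assms(1)]] by simp

lemma ev_mult:
  assumes "P \<in> primes K" "x \<in> ints K" "x \<noteq> 0" "y \<in> ints K" "y \<noteq> 0"
  shows "ev P (x * y) = ev P x + ev P y"
  unfolding ev_def princ_mult[OF assms(2,4)] using assms by (intro val_mult princ_M)

lemma ev_one: "P \<in> primes K \<Longrightarrow> ev P 1 = 0"
  by (simp add: ev_def princ_1 val_one)

lemma ev_prod:
  assumes "finite A" "P \<in> primes K" "\<And>i. i \<in> A \<Longrightarrow> f i \<in> ints K" "\<And>i. i \<in> A \<Longrightarrow> f i \<noteq> 0"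
  shows "ev P (prod f A) = (\<Sum>i\<in>A. ev P (f i))"
  using assms
proof (induction A rule: finite_induct)
  case (insert i A)
  have "prod f A \<in> ints K" "prod f A \<noteq> 0" using insert by (simp_all add: ints_prod)
  then show ?case using insert ev_mult[OF insert.prems(1), of "f i" "prod f A"] by simp
qed (simp add: ev_one)

lemma ev_power:
  assumes "P \<in> primes K" "x \<in> ints K" "x \<noteq> 0"
  shows "ev P (x ^ n) = n * ev P x"
  using assms ev_one by (induction n) (simp_all add: ev_mult)

lemma pw_sub_ints: "P \<in> primes K \<Longrightarrow> x \<in> pw P n \<Longrightarrow> x \<in> ints K"
  using idealD(1)[OF pw_ideal] by blast

lemma pw_0_mem: "P \<in> primes K \<Longrightarrow> 0 \<in> pw P n"
  by (rule idealD(2)[OF pw_ideal])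

lemma pw_leI: "P \<in> primes K \<Longrightarrow> x \<in> pw P n \<Longrightarrow> m \<le> n \<Longrightarrow> x \<in> pw P m"
  using pw_antimono by blast

lemma pw_pos_sub: "P \<in> primes K \<Longrightarrow> x \<in> pw P n \<Longrightarrow> 0 < n \<Longrightarrow> x \<in> P"
  using pw_leI[of P x n 1] pw_1[of P] by (simp add: Suc_le_eq)

lemma ev_pos_iff: "P \<in> primes K \<Longrightarrow> x \<in> ints K \<Longrightarrow> x \<noteq> 0 \<Longrightarrow> 0 < ev P x \<longleftrightarrow> x \<in> P"
  using mem_pw_iff[of P x 1] pw_1[of P] by (simp add: Suc_le_eq)

lemma pw_Inter_zero: "P \<in> primes K \<Longrightarrow> x \<in> ints K \<Longrightarrow> (\<And>n. x \<in> pw P n) \<Longrightarrow> x = 0"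
  using mem_pw_iff[of P x "Suc (ev P x)"] Suc_n_not_le_n by blast

lemma ex_uniformizer:
  assumes P: "P \<in> primes K"
  obtains \<pi> where "\<pi> \<in> ints K" "\<pi> \<noteq> 0" "ev P \<pi> = 1"
proof -
  have "\<not> P \<subseteq> pw P 2"
  proof
    assume "P \<subseteq> pw P 2"
    then have "pw P 1 = pw P 2" using pw_antimono[OF P, of 1 2] pw_1[OF P] by auto
    then show False using injD[OF pw_inj[OF P], of 1 2] by simp
  qed
  then obtain x where x: "x \<in> P" "x \<notin> pw P 2" by blast
  then have "x \<in> ints K" "x \<noteq> 0" using primesD(4)[OF P] pw_0_mem[OF P] by auto
  then show ?thesis using that[of x] x mem_pw_iff[OF P, of x 2] ev_pos_iff[OF P, of x] by auto
qed

text \<open>With \<open>k = ev P a\<close>, no ideal lies strictly between the powers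
  \<open>k + 1\<close> and \<open>k\<close> of \<open>P\<close>: the ideal generated by
  \<open>a\<close> and the smaller power is the larger power times an ideal \<open>C\<close> above
  \<open>P\<close>, and \<open>C = P\<close> would raise the valuation of \<open>a\<close>. The
  lemma supplies the next digit in expansions along elements of prescribed valuation.\<close>

lemma pw_step:
  assumes P: "P \<in> primes K" and a: "a \<in> ints K" "a \<noteq> 0" and y: "y \<in> pw P (ev P a)"
  obtains z where "z \<in> ints K" "y - a * z \<in> pw P (Suc (ev P a))"
proof -
  define k where "k = ev P a"
  have ak: "a \<in> pw P k" "a \<notin> pw P (Suc k)"
    using mem_pw_iff[OF P a, of k] mem_pw_iff[OF P a, of "Suc k"] Suc_n_not_le_n unfolding k_def by blast+
  define J where "J = {x + r * a | x r. x \<in> pw P (Suc k) \<and> r \<in> ints K}"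
  note J = ideal_add_princ[OF pw_ideal[OF P, of "Suc k"] a(1), folded J_def]
  have JM: "J \<in> carrier M" using J(1) nonzero_mono[OF _ pw_ideal[OF P] J(2)] pw_M[OF P, of "Suc k"] by (simp add: M_carrier)
  have "J \<subseteq> pw P k"
  proof
    fix x assume "x \<in> J"
    then obtain w r where "x = w + r * a" "w \<in> pw P (Suc k)" "r \<in> ints K" unfolding J_def by blast
    then show "x \<in> pw P k" using idealD(3,4)[OF pw_ideal[OF P]] ak(1) pw_leI[OF P, of w "Suc k" k] by simp
  qed
  then obtain C where C: "C \<in> carrier M" "J = pw P k \<otimes>\<^bsub>M\<^esub> C" using M_le_imp_factor[OF pw_M[OF P] JM] by blast
  have "pw P k \<otimes>\<^bsub>M\<^esub> P \<subseteq> pw P k \<otimes>\<^bsub>M\<^esub> C" using J(2) C(2) by (simp add: M.nat_pow_Suc)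
  then have "P \<subseteq> C" using M_le_iff[OF pw_M[OF P] prime_M[OF P] C(1)] by blast
  moreover have "C \<noteq> P" using J(3) ak(2) C(2) by (auto simp: M.nat_pow_Suc)
  ultimately have "C = ints K" using primesD(5)[OF P, of C] C(1) by (auto simp: M_carrier)
  then have "J = pw P k" using C(2) M.r_one[OF pw_M[OF P]] by simp
  then have "y \<in> J" using y k_def by simp
  then obtain w r where "y = w + r * a" "w \<in> pw P (Suc k)" "r \<in> ints K" unfolding J_def by blast
  then show ?thesis using that[of r] by (simp add: k_def mult.commute)
qed

end

section \<open>Embeddings and Galois groups\<close>

text \<open>The image may leave \<open>L\<close>, so that automorphisms of a larger field count
  before \<open>L\<close> is known to be stable under them.\<close>

definition emb :: "'a :: field_char_0 set \<Rightarrow> ('a \<Rightarrow> 'a) \<Rightarrow> bool"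
  where "emb L s \<longleftrightarrow> (\<forall>x\<in>L. \<forall>y\<in>L. s (x + y) = s x + s y \<and> s (x * y) = s x * s y) \<and> s 1 = 1"

context sub_field begin

lemma
  assumes "emb K s"
  shows emb_add: "x \<in> K \<Longrightarrow> y \<in> K \<Longrightarrow> s (x + y) = s x + s y"
    and emb_mult: "x \<in> K \<Longrightarrow> y \<in> K \<Longrightarrow> s (x * y) = s x * s y"
    and emb_one: "s 1 = 1"
  using assms by (auto simp: emb_def)

lemma emb_zero: "emb K s \<Longrightarrow> s 0 = 0"
  using emb_add[of s 0 0] by simp

lemma emb_uminus: "emb K s \<Longrightarrow> x \<in> K \<Longrightarrow> s (- x) = - s x"
  using emb_add[of s x "- x"] emb_zero[of s] by (simp add: eq_neg_iff_add_eq_0 add.commute)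

lemma emb_diff: "emb K s \<Longrightarrow> x \<in> K \<Longrightarrow> y \<in> K \<Longrightarrow> s (x - y) = s x - s y"
  using emb_add[of s x "- y"] emb_uminus[of s y] by simp

lemma emb_sum: "emb K s \<Longrightarrow> (\<And>i. i \<in> A \<Longrightarrow> f i \<in> K) \<Longrightarrow> s (sum f A) = (\<Sum>i\<in>A. s (f i))"
  by (induction A rule: infinite_finite_induct) (auto simp: emb_zero emb_add sum_mem)

lemma emb_prod: "emb K s \<Longrightarrow> (\<And>i. i \<in> A \<Longrightarrow> f i \<in> K) \<Longrightarrow> s (prod f A) = (\<Prod>i\<in>A. s (f i))"
  by (induction A rule: infinite_finite_induct) (auto simp: emb_one emb_mult prod_mem)

lemma emb_power: "emb K s \<Longrightarrow> x \<in> K \<Longrightarrow> s (x ^ n) = s x ^ n"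
  by (induction n) (auto simp: emb_one emb_mult)

lemma emb_of_nat: "emb K s \<Longrightarrow> s (of_nat n) = of_nat n"
  by (induction n) (auto simp: emb_zero emb_one emb_add)

lemma emb_of_int: "emb K s \<Longrightarrow> s (of_int n) = of_int n"
  by (cases n rule: int_cases2) (auto simp: emb_of_nat emb_uminus)

lemma emb_eq_0: "emb K s \<Longrightarrow> x \<in> K \<Longrightarrow> s x = 0 \<longleftrightarrow> x = 0"
  using emb_mult[of s x "inverse x"] emb_zero[of s] emb_one[of s] by (cases "x = 0") auto

lemma emb_inj: "emb K s \<Longrightarrow> inj_on s K"
proof (rule inj_onI)
  fix x y assume "emb K s" "x \<in> K" "y \<in> K" "s x = s y"
  then show "x = y" using emb_eq_0[of s "x - y"] emb_diff[of s x y] by simp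
qed

lemma emb_algebraic_int:
  assumes "emb K s" "x \<in> K" "algebraic_int x"
  shows "algebraic_int (s x)"
proof -
  obtain n and c :: "nat \<Rightarrow> int" where "x ^ n = (\<Sum>i<n. of_int (c i) * x ^ i)"
    using algebraic_int_monic[OF assms(3)] by blast
  then have "s (x ^ n) = s (\<Sum>i<n. of_int (c i) * x ^ i)" by simp
  then have "s x ^ n = (\<Sum>i<n. of_int (c i) * s x ^ i)"
    using assms(1,2) by (simp add: emb_power emb_sum emb_mult emb_of_int)
  then show ?thesis by (rule algebraic_int_integral) simp
qed

definition coeffs_in :: "'a poly \<Rightarrow> bool" where "coeffs_in p \<longleftrightarrow> (\<forall>i. poly.coeff p i \<in> K)"

lemma coeffs_in_mult: "coeffs_in p \<Longrightarrow> coeffs_in q \<Longrightarrow> coeffs_in (p * q)"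
  by (auto simp: coeffs_in_def coeff_mult intro!: sum_mem)

lemma coeffs_in_linear: "a \<in> K \<Longrightarrow> coeffs_in [:- a, 1:]"
  by (auto simp: coeffs_in_def coeff_pCons split: nat.split)

lemma coeffs_in_1: "coeffs_in 1"
  by (auto simp: coeffs_in_def coeff_1)

lemma coeffs_in_prod: "(\<And>i. i \<in> A \<Longrightarrow> coeffs_in (f i)) \<Longrightarrow> coeffs_in (prod f A)"
  by (induction A rule: infinite_finite_induct) (auto simp: coeffs_in_1 coeffs_in_mult)

lemma coeffs_in_sum: "(\<And>i. i \<in> A \<Longrightarrow> coeffs_in (f i)) \<Longrightarrow> coeffs_in (sum f A)"
  by (auto simp: coeffs_in_def coeff_sum intro!: sum_mem)

lemma coeffs_in_smult: "c \<in> K \<Longrightarrow> coeffs_in p \<Longrightarrow> coeffs_in (Polynomial.smult c p)"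
  by (auto simp: coeffs_in_def)

lemma poly_mem: "coeffs_in p \<Longrightarrow> x \<in> K \<Longrightarrow> poly p x \<in> K"
  unfolding poly_altdef by (auto simp: coeffs_in_def intro!: sum_mem)

lemma coeff_map_emb: "emb K s \<Longrightarrow> poly.coeff (map_poly s p) i = s (poly.coeff p i)"
  by (simp add: coeff_map_poly emb_zero)

lemma map_emb_mult: "emb K s \<Longrightarrow> coeffs_in p \<Longrightarrow> coeffs_in q \<Longrightarrow> map_poly s (p * q) = map_poly s p * map_poly s q"
  by (rule poly_eqI) (simp add: coeff_map_emb coeff_mult emb_sum emb_mult coeffs_in_def)

lemma map_emb_linear: "emb K s \<Longrightarrow> a \<in> K \<Longrightarrow> map_poly s [:- a, 1:] = [:- s a, 1:]"
  by (rule poly_eqI) (auto simp: coeff_map_emb coeff_pCons emb_uminus emb_one emb_zero split: nat.split)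

lemma map_emb_prod_linear:
  "emb K s \<Longrightarrow> (\<And>i. i \<in> A \<Longrightarrow> f i \<in> K) \<Longrightarrow>
    map_poly s (\<Prod>i\<in>A. [:- f i, 1:]) = (\<Prod>i\<in>A. [:- s (f i), 1:])"
proof (induction A rule: infinite_finite_induct)
  case (insert i A)
  have "map_poly s ([:- f i, 1:] * (\<Prod>i\<in>A. [:- f i, 1:])) = map_poly s [:- f i, 1:] * map_poly s (\<Prod>i\<in>A. [:- f i, 1:])"
    using insert.prems by (intro map_emb_mult coeffs_in_linear coeffs_in_prod) auto
  also have "\<dots> = [:- s (f i), 1:] * (\<Prod>i\<in>A. [:- s (f i), 1:])"
    using insert by (simp only: map_emb_linear insert_iff simp_thms)
  finally show ?case using insert.hyps by (simp only: prod.insert simp_thms)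
qed (auto simp: emb_one)

lemma map_emb_sum:
  "emb K s \<Longrightarrow> (\<And>i. i \<in> A \<Longrightarrow> coeffs_in (f i)) \<Longrightarrow> map_poly s (sum f A) = (\<Sum>i\<in>A. map_poly s (f i))"
  by (rule poly_eqI) (simp add: coeff_map_emb coeff_sum emb_sum coeffs_in_def)

lemma map_emb_smult:
  "emb K s \<Longrightarrow> c \<in> K \<Longrightarrow> coeffs_in p \<Longrightarrow> map_poly s (Polynomial.smult c p) = Polynomial.smult (s c) (map_poly s p)"
  by (rule poly_eqI) (simp add: coeff_map_emb emb_mult coeffs_in_def)

lemma emb_poly:
  assumes "emb K s" "coeffs_in p" "x \<in> K"
  shows "s (poly p x) = poly (map_poly s p) (s x)"
proof -
  have deg: "Polynomial.degree (map_poly s p) = Polynomial.degree p"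
  proof (cases "p = 0")
    case False
    then have "s (Polynomial.lead_coeff p) \<noteq> 0"
      using emb_eq_0[OF assms(1), of "Polynomial.lead_coeff p"] assms(2) by (simp add: coeffs_in_def)
    then show ?thesis by (rule map_poly_degree_eq)
  qed simp
  have "s (poly p x) = (\<Sum>i\<le>Polynomial.degree p. s (poly.coeff p i * x ^ i))"
    unfolding poly_altdef using assms by (intro emb_sum) (auto simp: coeffs_in_def)
  also have "\<dots> = (\<Sum>i\<le>Polynomial.degree p. s (poly.coeff p i) * s x ^ i)"
    using assms by (simp add: emb_mult emb_power coeffs_in_def)
  also have "\<dots> = poly (map_poly s p) (s x)"
    unfolding poly_altdef deg by (simp add: coeff_map_emb[OF assms(1)])
  finally show ?thesis .
qed

end

text \<open>For a single \<open>d\<close> at most one \<open>n\<close> gives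
  \<open>d (x + of_nat n * y) = 0\<close>, because \<open>d x\<close> and \<open>d y\<close> are not
  both zero; some natural number avoids the finitely many exceptions.\<close>

lemma separating_element:
  fixes V :: "'a :: field_char_0 set" and D :: "('a \<Rightarrow> 'a) set"
  assumes "finite D" "z \<in> V" and V: "\<And>x y n. x \<in> V \<Longrightarrow> y \<in> V \<Longrightarrow> x + of_nat n * y \<in> V"
    and "\<And>d. d \<in> D \<Longrightarrow> \<exists>x\<in>V. d x \<noteq> 0"
    and "\<And>d x y n. d \<in> D \<Longrightarrow> x \<in> V \<Longrightarrow> y \<in> V \<Longrightarrow> d (x + of_nat n * y) = d x + of_nat n * (d y :: 'a)"
  shows "\<exists>x\<in>V. \<forall>d\<in>D. d x \<noteq> 0"
  using assms(1,4,5)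
proof (induction D rule: finite_induct)
  case empty
  show ?case using assms(2) by blast
next
  case (insert d D)
  then obtain x where x: "x \<in> V" "\<forall>d\<in>D. d x \<noteq> 0" by auto
  obtain y where y: "y \<in> V" "d y \<noteq> 0" using insert.prems(1) by auto
  define B where "B = (\<lambda>e :: 'a \<Rightarrow> 'a. {n :: nat. e x + of_nat n * e y = 0})"
  have "finite (B e)" if e: "e \<in> insert d D" for e
  proof -
    have ne: "e x \<noteq> 0 \<or> e y \<noteq> 0" using e x(2) y(2) by auto
    have "m = n" if "m \<in> B e" "n \<in> B e" for m n
    proof -
      have "e x + of_nat m * e y = 0" "e x + of_nat n * e y = 0" using that by (auto simp: B_def)
      then have "of_nat m * e y = of_nat n * e y" "e y \<noteq> 0" using ne by (metis add_left_cancel, auto)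
      then show ?thesis by simp
    qed
    then have "B e \<subseteq> {n} " if "n \<in> B e" for n using that by blast
    then have "B e = {} \<or> (\<exists>n. B e \<subseteq> {n})" by blast
    then show ?thesis by (elim disjE exE) (simp, erule finite_subset, simp)
  qed
  then have "finite (\<Union>e\<in>insert d D. B e)" using insert.hyps by blast
  then obtain n where n: "n \<notin> (\<Union>e\<in>insert d D. B e)" using ex_new_if_finite infinite_UNIV_nat by blast
  have "e (x + of_nat n * y) \<noteq> 0" if e: "e \<in> insert d D" for e
    using n e insert.prems(2)[OF e x(1) y(1), of n] by (auto simp: B_def)
  then show ?case using V[OF x(1) y(1)] by blast
qed

section \<open>Galois groups as groups of bijections\<close>

lemma Gal_iff:
  "\<sigma> \<in> carrier (Gal K L) \<longleftrightarrow> \<sigma> \<in> Bij L \<and> (\<forall>x\<in>L. \<forall>y\<in>L. \<sigma> (x + y) = \<sigma> x + \<sigma> y) \<and>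
     (\<forall>x\<in>L. \<forall>y\<in>L. \<sigma> (x * y) = \<sigma> x * \<sigma> y) \<and> \<sigma> 1 = 1 \<and> (\<forall>x\<in>K. \<sigma> x = x)"
  unfolding Gal_def Ring.ring_hom_def Bij_def bij_betw_def by auto

lemma Gal_mult: "\<sigma> \<in> carrier (Gal K L) \<Longrightarrow> \<tau> \<in> carrier (Gal K L) \<Longrightarrow> \<sigma> \<otimes>\<^bsub>Gal K L\<^esub> \<tau> = compose L \<sigma> \<tau>"
  by (simp add: Gal_def BijGroup_def)

lemma Gal_one: "\<one>\<^bsub>Gal K L\<^esub> = (\<lambda>x\<in>L. x)"
  by (simp add: Gal_def BijGroup_def)

locale subfield_pair = sub_field L for L :: "'a :: field_char_0 set" +
  fixes K :: "'a set"
  assumes sub: "K \<subseteq> L"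
begin

abbreviation G where "G \<equiv> carrier (Gal K L)"

lemma gal_bij: "\<sigma> \<in> G \<Longrightarrow> bij_betw \<sigma> L L"
  and gal_emb: "\<sigma> \<in> G \<Longrightarrow> emb L \<sigma>"
  and gal_fix: "\<sigma> \<in> G \<Longrightarrow> x \<in> K \<Longrightarrow> \<sigma> x = x"
  and gal_ext: "\<sigma> \<in> G \<Longrightarrow> \<sigma> \<in> extensional L"
  unfolding Gal_iff Bij_def emb_def by auto

lemma gal_mem: "\<sigma> \<in> G \<Longrightarrow> x \<in> L \<Longrightarrow> \<sigma> x \<in> L"
  using gal_bij bij_betwE by blast

lemma gal_inj: "\<sigma> \<in> G \<Longrightarrow> x \<in> L \<Longrightarrow> y \<in> L \<Longrightarrow> \<sigma> x = \<sigma> y \<Longrightarrow> x = y"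
  using gal_bij[of \<sigma>] by (auto simp: bij_betw_def dest: inj_onD)

lemma gal_surj: "\<sigma> \<in> G \<Longrightarrow> y \<in> L \<Longrightarrow> \<exists>x\<in>L. y = \<sigma> x"
  using gal_bij[of \<sigma>] by (auto simp: bij_betw_def)

lemma galI:
  assumes "bij_betw \<sigma> L L" "emb L \<sigma>" "\<And>x. x \<in> K \<Longrightarrow> \<sigma> x = x" "\<sigma> \<in> extensional L"
  shows "\<sigma> \<in> G"
  using assms unfolding Gal_iff Bij_def emb_def by auto

lemma one_G: "(\<lambda>x\<in>L. x) \<in> G"
  using sub by (intro galI) (auto simp: emb_def bij_betw_def inj_on_def)

lemma compose_G: "\<sigma> \<in> G \<Longrightarrow> \<tau> \<in> G \<Longrightarrow> compose L \<sigma> \<tau> \<in> G"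
proof (rule galI)
  assume *: "\<sigma> \<in> G" "\<tau> \<in> G"
  show "bij_betw (compose L \<sigma> \<tau>) L L" using bij_betw_compose[OF gal_bij[OF *(2)] gal_bij[OF *(1)]] .
  show "emb L (compose L \<sigma> \<tau>)" using * gal_mem[OF *(2)]
    by (simp add: emb_def compose_def emb_add[OF gal_emb] emb_mult[OF gal_emb] emb_one[OF gal_emb])
  show "compose L \<sigma> \<tau> x = x" if "x \<in> K" for x
    using that sub gal_fix[OF *(1) that] gal_fix[OF *(2) that] by (auto simp: compose_def)
qed (simp add: compose_def)

lemma inv_G:
  assumes "\<sigma> \<in> G"
  shows "(\<lambda>x\<in>L. inv_into L \<sigma> x) \<in> G"
proof (rule galI)
  have *: "\<And>y. y \<in> L \<Longrightarrow> inv_into L \<sigma> y \<in> L" "\<And>y. y \<in> L \<Longrightarrow> \<sigma> (inv_into L \<sigma> y) = y"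
      "\<And>y. y \<in> L \<Longrightarrow> inv_into L \<sigma> (\<sigma> y) = y"
    using gal_bij[OF assms] by (auto simp: bij_betw_def inv_into_into f_inv_into_f)
  have "bij_betw (inv_into L \<sigma>) L L" using gal_bij[OF assms] by (rule bij_betw_inv_into)
  then show "bij_betw (\<lambda>x\<in>L. inv_into L \<sigma> x) L L"
    by (subst bij_betw_cong[of L _ "inv_into L \<sigma>"]) auto
  show "emb L (\<lambda>x\<in>L. inv_into L \<sigma> x)"
    unfolding emb_def
  proof (intro conjI ballI)
    fix x y assume xy: "x \<in> L" "y \<in> L"
    have "\<sigma> (inv_into L \<sigma> x + inv_into L \<sigma> y) = x + y"
      "\<sigma> (inv_into L \<sigma> x * inv_into L \<sigma> y) = x * y"
      using xy * by (simp_all add: emb_add[OF gal_emb[OF assms]] emb_mult[OF gal_emb[OF assms]])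
    then show "(\<lambda>x\<in>L. inv_into L \<sigma> x) (x + y) = (\<lambda>x\<in>L. inv_into L \<sigma> x) x + (\<lambda>x\<in>L. inv_into L \<sigma> x) y"
      "(\<lambda>x\<in>L. inv_into L \<sigma> x) (x * y) = (\<lambda>x\<in>L. inv_into L \<sigma> x) x * (\<lambda>x\<in>L. inv_into L \<sigma> x) y"
      using *(3)[of "inv_into L \<sigma> x + inv_into L \<sigma> y"] *(3)[of "inv_into L \<sigma> x * inv_into L \<sigma> y"] xy *(1)
      by simp_all
  next
    show "(\<lambda>x\<in>L. inv_into L \<sigma> x) 1 = 1"
      using *(3)[of 1] emb_one[OF gal_emb[OF assms]] by simp
  qed
  show "(\<lambda>x\<in>L. inv_into L \<sigma> x) x = x" if "x \<in> K" for x
  proof -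
    have "x \<in> L" using that sub by blast
    then show ?thesis using *(3)[of x] gal_fix[OF assms that] by simp
  qed
qed simp

lemma subgroup_G: "subgroup G (BijGroup L)"
proof (rule group.subgroupI[OF group_BijGroup])
  show "G \<subseteq> carrier (BijGroup L)" by (auto simp: Gal_iff BijGroup_def)
  show "G \<noteq> {}" using one_G by blast
  show "inv\<^bsub>BijGroup L\<^esub> \<sigma> \<in> G" if "\<sigma> \<in> G" for \<sigma>
    using inv_G[OF that] that inv_BijGroup[of \<sigma> L] by (simp add: Gal_iff)
  show "\<sigma> \<otimes>\<^bsub>BijGroup L\<^esub> \<tau> \<in> G" if "\<sigma> \<in> G" "\<tau> \<in> G" for \<sigma> \<tau>
    using compose_G[OF that] that by (simp add: BijGroup_def Gal_iff)
qed

lemma group_Gal: "group (Gal K L)"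
proof -
  have "group ((BijGroup L)\<lparr>carrier := G\<rparr>)"
    by (rule subgroup.subgroup_is_group[OF subgroup_G group_BijGroup])
  moreover have "(BijGroup L)\<lparr>carrier := G\<rparr> = Gal K L" by (simp add: Gal_def)
  ultimately show ?thesis by simp
qed

end

sublocale subfield_pair \<subseteq> Gal: group "Gal K L"
  by (rule group_Gal)

context subfield_pair begin

lemma mult_app: "\<sigma> \<in> G \<Longrightarrow> \<tau> \<in> G \<Longrightarrow> x \<in> L \<Longrightarrow> (\<sigma> \<otimes>\<^bsub>Gal K L\<^esub> \<tau>) x = \<sigma> (\<tau> x)"
  by (simp add: Gal_mult compose_def)

lemma one_app: "x \<in> L \<Longrightarrow> \<one>\<^bsub>Gal K L\<^esub> x = x"
  by (simp add: Gal_one)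

lemma inv_app: "\<sigma> \<in> G \<Longrightarrow> x \<in> L \<Longrightarrow> (inv\<^bsub>Gal K L\<^esub> \<sigma>) (\<sigma> x) = x"
  "\<sigma> \<in> G \<Longrightarrow> x \<in> L \<Longrightarrow> \<sigma> ((inv\<^bsub>Gal K L\<^esub> \<sigma>) x) = x"
  using mult_app[of "inv\<^bsub>Gal K L\<^esub> \<sigma>" \<sigma> x] mult_app[of \<sigma> "inv\<^bsub>Gal K L\<^esub> \<sigma>" x] one_app[of x]
  by simp_all

lemma gal_eqI: "\<sigma> \<in> G \<Longrightarrow> \<tau> \<in> G \<Longrightarrow> (\<And>x. x \<in> L \<Longrightarrow> \<sigma> x = \<tau> x) \<Longrightarrow> \<sigma> = \<tau>"
  using gal_ext by (intro extensionalityI[of \<sigma> L \<tau>]) auto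

lemma fixed_field_generate:
  assumes "S \<subseteq> G" shows "fixed_field L (generate (Gal K L) S) = fixed_field L S"
proof
  show "fixed_field L (generate (Gal K L) S) \<subseteq> fixed_field L S"
    by (auto simp: fixed_field_def intro: generate.incl)
  show "fixed_field L S \<subseteq> fixed_field L (generate (Gal K L) S)"
  proof
    fix x assume x: "x \<in> fixed_field L S"
    then have xL: "x \<in> L" by (simp add: fixed_field_def)
    have "h x = x" if "h \<in> generate (Gal K L) S" for h
      using that
    proof (induction rule: generate.induct)
      case one
      then show ?case using one_app[OF xL] .
    next
      case (incl h)
      then show ?case using x by (simp add: fixed_field_def)
    next
      case (inv h)
      then have "h x = x" "h \<in> G" using x assms by (auto simp: fixed_field_def)
      then show ?case using inv_app(1)[OF _ xL, of h] by simp
    next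
      case (eng h1 h2)
      then have "h1 \<in> G" "h2 \<in> G" using Gal.generate_in_carrier[OF assms] by blast+
      then show ?case using mult_app[OF _ _ xL] eng by simp
    qed
    then show "x \<in> fixed_field L (generate (Gal K L) S)" using xL by (simp add: fixed_field_def)
  qed
qed

end

section \<open>Finite Galois extensions: finiteness, primitive elements, Artin's theorem\<close>

locale galois = K: nfield K for K :: "'a :: field_char_0 set" +
  fixes L :: "'a set"
  assumes gal: "finite_galois K L"

lemma finite_galois_number_field:
  assumes "number_field K" "finite_galois K L" shows "number_field L"
  using assms Omega.telescopic_base_dim(1)[OF subfield_Rats, of K L]
  unfolding number_field_def finite_galois_def by blast

sublocale galois \<subseteq> L: nfield L
  using K.nf gal finite_galois_number_field by unfold_locales

sublocale galois \<subseteq> subfield_pair L K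
  using gal by unfold_locales (simp add: finite_galois_def)

context galois begin

lemma fixed_G: "x \<in> L \<Longrightarrow> (\<And>\<sigma>. \<sigma> \<in> G \<Longrightarrow> \<sigma> x = x) \<Longrightarrow> x \<in> K"
  using gal unfolding finite_galois_def fixed_field_def by blast

text \<open>An integer multiple of \<open>v\<close> is a root of a monic integer polynomial, which
  every automorphism fixes; the multiples of the conjugates are roots of it as well.\<close>

lemma conjugates_finite:
  assumes v: "v \<in> L" shows "finite ((\<lambda>\<sigma>. \<sigma> v) ` G)"
proof -
  obtain m :: int where m: "m \<noteq> 0" "algebraic_int (of_int m * v)"
    using number_field_algebraic[OF L.nf v] by blast
  obtain p :: "int poly" where p: "poly (map_poly of_int p) (of_int m * v) = 0" "Polynomial.lead_coeff p = 1"
    using m(2) unfolding algebraic_int_altdef_ipoly by blast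
  define q where "q = map_poly (of_int :: int \<Rightarrow> 'a) p"
  have "q \<noteq> 0" using p(2) unfolding q_def by auto
  then have "finite {y. poly q y = 0}" by (rule poly_roots_finite)
  then have "finite ((\<lambda>y. y / of_int m) ` {y. poly q y = 0})" by (rule finite_imageI)
  moreover have "(\<lambda>\<sigma>. \<sigma> v) ` G \<subseteq> (\<lambda>y. y / of_int m) ` {y. poly q y = 0}"
  proof
    fix y assume "y \<in> (\<lambda>\<sigma>. \<sigma> v) ` G"
    then obtain \<sigma> where \<sigma>: "\<sigma> \<in> G" "y = \<sigma> v" by blast
    note E = gal_emb[OF \<sigma>(1)]
    have c: "L.coeffs_in q" unfolding L.coeffs_in_def q_def by (simp add: coeff_map_poly)
    have "map_poly \<sigma> q = q"
      by (rule poly_eqI) (simp add: L.coeff_map_emb[OF E] q_def coeff_map_poly L.emb_of_int[OF E])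
    then have "\<sigma> (poly q (of_int m * v)) = poly q (\<sigma> (of_int m * v))"
      using L.emb_poly[OF E c, of "of_int m * v"] v by simp
    then have "poly q (of_int m * y) = 0"
      using p(1) v \<sigma>(2) by (simp add: q_def L.emb_zero[OF E] L.emb_mult[OF E] L.emb_of_int[OF E])
    moreover have "y = of_int m * y / of_int m" using m(1) by simp
    ultimately show "y \<in> (\<lambda>y. y / of_int m) ` {y. poly q y = 0}" by blast
  qed
  ultimately show ?thesis by (rule finite_subset[rotated])
qed

text \<open>An automorphism is determined by its values on a finite spanning family, and each value
  is one of finitely many conjugates.\<close>

lemma finite_G: "finite G"
proof -
  have fd: "Omega.finite_dimension K L" and K: "subfield K \<Omega>"
    using gal K.subfield_K by (auto simp: finite_galois_def)
  then obtain n where "Omega.dimension n K L" unfolding Omega.finite_dimension_def by blast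
  then obtain Vs where Vs: "set Vs \<subseteq> carrier \<Omega>" "Omega.Span K Vs = L"
    using Omega.exists_base[OF K] by metis
  have VL: "v \<in> L" if "v \<in> set Vs" for v
    using Omega.Span_base_incl[OF K Vs(1)] Vs(2) that by blast
  define f where "f = (\<lambda>\<sigma> :: 'a \<Rightarrow> 'a. map \<sigma> Vs)"
  have "inj_on f G"
  proof (rule inj_onI)
    fix \<sigma> \<tau> assume st: "\<sigma> \<in> G" "\<tau> \<in> G" "f \<sigma> = f \<tau>"
    show "\<sigma> = \<tau>"
    proof (rule gal_eqI[OF st(1,2)])
      fix x assume "x \<in> L"
      then obtain Ks where Ks: "set Ks \<subseteq> K" "length Ks = length Vs" "x = Omega.combine Ks Vs"
        using Omega.Span_eq_combine_set_length_version[OF K Vs(1)] Vs(2) by blast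
      have kK: "Ks ! i \<in> K" if "i < length Vs" for i using that Ks(1,2) nth_mem[of i Ks] by auto
      then have kl: "Ks ! i \<in> K" "Ks ! i \<in> L" "Vs ! i \<in> L" "\<sigma> (Vs ! i) = \<tau> (Vs ! i)" if "i < length Vs" for i
        using that sub VL st(3) by (auto simp: f_def)
      have *: "\<rho> x = (\<Sum>i<length Vs. Ks ! i * \<rho> (Vs ! i))" if \<rho>: "\<rho> \<in> G" for \<rho>
        unfolding Ks(3) Omega_combine[OF Ks(2)] using kl
        by (subst L.emb_sum[OF gal_emb[OF \<rho>]])
          (simp_all add: L.emb_mult[OF gal_emb[OF \<rho>]] gal_fix[OF \<rho>])
      show "\<sigma> x = \<tau> x" unfolding *[OF st(1)] *[OF st(2)] using kl by simp
    qed
  qed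
  moreover have "f ` G \<subseteq> {xs. set xs \<subseteq> (\<Union>v\<in>set Vs. (\<lambda>\<sigma>. \<sigma> v) ` G) \<and> length xs = length Vs}"
    by (auto simp: f_def) blast
  moreover have "finite {xs. set xs \<subseteq> (\<Union>v\<in>set Vs. (\<lambda>\<sigma>. \<sigma> v) ` G) \<and> length xs = length Vs}"
    using conjugates_finite VL by (intro finite_lists_length_eq) auto
  ultimately show ?thesis using finite_imageD finite_subset by blast
qed

lemma bij_left_mult: "\<sigma> \<in> G \<Longrightarrow> bij_betw (\<lambda>\<tau>. \<sigma> \<otimes>\<^bsub>Gal K L\<^esub> \<tau>) G G"
  using Gal.inj_on_multc by (intro bij_betwI[of _ _ _ "\<lambda>\<tau>. inv\<^bsub>Gal K L\<^esub> \<sigma> \<otimes>\<^bsub>Gal K L\<^esub> \<tau>"])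
    (auto simp: Gal.m_assoc[symmetric])

text \<open>\<open>separating_element\<close> is applied to the differences of distinct
  automorphisms. Distinctness of the conjugates is the form in which a primitive element is
  used.\<close>

lemma primitive_element: "\<exists>\<theta>\<in>L. inj_on (\<lambda>\<sigma>. \<sigma> \<theta>) G"
proof -
  define D where "D = (\<lambda>(\<sigma>, \<tau>). (\<lambda>x. \<sigma> x - \<tau> x :: 'a)) ` {(\<sigma>, \<tau>). \<sigma> \<in> G \<and> \<tau> \<in> G \<and> \<sigma> \<noteq> \<tau>}"
  have "{(\<sigma>, \<tau>). \<sigma> \<in> G \<and> \<tau> \<in> G \<and> \<sigma> \<noteq> \<tau>} \<subseteq> G \<times> G" by blast
  then have "finite D" unfolding D_def using finite_G finite_subset by blast
  have "\<exists>x\<in>L. \<forall>d\<in>D. d x \<noteq> 0"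
  proof (rule separating_element[OF \<open>finite D\<close>, of 0])
    fix d assume "d \<in> D"
    then obtain \<sigma> \<tau> where st: "\<sigma> \<in> G" "\<tau> \<in> G" "\<sigma> \<noteq> \<tau>" "d = (\<lambda>x. \<sigma> x - \<tau> x)" by (auto simp: D_def)
    then show "\<exists>x\<in>L. d x \<noteq> 0" using gal_eqI[OF st(1,2)] by auto
    fix x y n assume "x \<in> L" "y \<in> L"
    then show "d (x + of_nat n * y) = d x + of_nat n * d y"
      by (simp add: st(4) L.emb_add[OF gal_emb] L.emb_mult[OF gal_emb] L.emb_of_nat[OF gal_emb] st(1,2) algebra_simps)
  qed simp_all
  then obtain \<theta> where \<theta>: "\<theta> \<in> L" "\<And>d. d \<in> D \<Longrightarrow> d \<theta> \<noteq> 0" by blast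
  have "inj_on (\<lambda>\<sigma>. \<sigma> \<theta>) G"
  proof (rule inj_onI, rule ccontr)
    fix \<sigma> \<tau> assume "\<sigma> \<in> G" "\<tau> \<in> G" "\<sigma> \<theta> = \<tau> \<theta>" "\<sigma> \<noteq> \<tau>"
    then have "(\<lambda>x. \<sigma> x - \<tau> x) \<in> D" unfolding D_def by (intro image_eqI[of _ _ "(\<sigma>, \<tau>)"]) auto
    then show False using \<theta>(2) \<open>\<sigma> \<theta> = \<tau> \<theta>\<close> by force
  qed
  then show ?thesis using \<theta>(1) by blast
qed

lemma coeffs_in_K:
  assumes c: "L.coeffs_in p" and fix': "\<And>\<sigma>. \<sigma> \<in> G \<Longrightarrow> map_poly \<sigma> p = p"
  shows "K.coeffs_in p"
  unfolding K.coeffs_in_def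
proof
  fix i
  show "poly.coeff p i \<in> K"
  proof (rule fixed_G)
    show "poly.coeff p i \<in> L" using c by (simp add: L.coeffs_in_def)
    show "\<sigma> (poly.coeff p i) = poly.coeff p i" if "\<sigma> \<in> G" for \<sigma>
      using fix'[OF that] L.coeff_map_emb[OF gal_emb[OF that], of p i] by simp
  qed
qed

text \<open>Left multiplication by an element of \<Gamma> is injective and \<Gamma> is finite, so it
  permutes the linear factors.\<close>

lemma orbit_poly:
  assumes x: "x \<in> L" and \<Gamma>: "\<Gamma> \<subseteq> G" "\<And>\<sigma> \<tau>. \<sigma> \<in> \<Gamma> \<Longrightarrow> \<tau> \<in> \<Gamma> \<Longrightarrow> \<sigma> \<otimes>\<^bsub>Gal K L\<^esub> \<tau> \<in> \<Gamma>"
    and \<sigma>: "\<sigma> \<in> \<Gamma>"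
  shows "L.coeffs_in (\<Prod>\<tau>\<in>\<Gamma>. [:- \<tau> x, 1:])"
    and "map_poly \<sigma> (\<Prod>\<tau>\<in>\<Gamma>. [:- \<tau> x, 1:]) = (\<Prod>\<tau>\<in>\<Gamma>. [:- \<tau> x, 1:])"
proof -
  have \<sigma>G: "\<sigma> \<in> G" using \<sigma> \<Gamma> by blast
  have m: "\<tau> x \<in> L" if "\<tau> \<in> \<Gamma>" for \<tau> using gal_mem x \<Gamma>(1) that by blast
  show "L.coeffs_in (\<Prod>\<tau>\<in>\<Gamma>. [:- \<tau> x, 1:])" using m by (intro L.coeffs_in_prod L.coeffs_in_linear)
  have "map_poly \<sigma> (\<Prod>\<tau>\<in>\<Gamma>. [:- \<tau> x, 1:]) = (\<Prod>\<tau>\<in>\<Gamma>. [:- \<sigma> (\<tau> x), 1:])"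
    using m by (rule L.map_emb_prod_linear[OF gal_emb[OF \<sigma>G]])
  also have "\<dots> = (\<Prod>\<tau>\<in>\<Gamma>. [:- (\<sigma> \<otimes>\<^bsub>Gal K L\<^esub> \<tau>) x, 1:])"
    using \<Gamma>(1) x \<sigma>G by (intro prod.cong) (auto simp: mult_app)
  also have "\<dots> = (\<Prod>\<tau>\<in>\<Gamma>. [:- \<tau> x, 1:])"
  proof (rule prod.reindex_bij_betw)
    have inj: "inj_on (\<lambda>\<tau>. \<sigma> \<otimes>\<^bsub>Gal K L\<^esub> \<tau>) \<Gamma>"
      using bij_left_mult[OF \<sigma>G] \<Gamma>(1) by (meson bij_betw_def inj_on_subset)
    moreover have "(\<lambda>\<tau>. \<sigma> \<otimes>\<^bsub>Gal K L\<^esub> \<tau>) ` \<Gamma> \<subseteq> \<Gamma>" using \<Gamma>(2)[OF \<sigma>] by blast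
    ultimately have "(\<lambda>\<tau>. \<sigma> \<otimes>\<^bsub>Gal K L\<^esub> \<tau>) ` \<Gamma> = \<Gamma>"
      using finite_G \<Gamma>(1) finite_subset endo_inj_surj by metis
    then show "bij_betw (\<lambda>\<tau>. \<sigma> \<otimes>\<^bsub>Gal K L\<^esub> \<tau>) \<Gamma> \<Gamma>" using inj by (simp add: bij_betw_def)
  qed
  finally show "map_poly \<sigma> (\<Prod>\<tau>\<in>\<Gamma>. [:- \<tau> x, 1:]) = (\<Prod>\<tau>\<in>\<Gamma>. [:- \<tau> x, 1:])" .
qed

text \<open>The orbit polynomial of \<open>x\<close> under \<Gamma> has coefficients in
  \<open>K\<close>, so an embedding over \<open>K\<close> sends the root \<open>x\<close> to another
  root. A general \<Gamma> with fixed field \<open>K\<close> makes the lemma usable for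
  \<open>Artin\<close>.\<close>

lemma embedding_in_orbit:
  assumes x: "x \<in> L" and \<Gamma>: "\<Gamma> \<subseteq> G" "\<And>\<sigma> \<tau>. \<sigma> \<in> \<Gamma> \<Longrightarrow> \<tau> \<in> \<Gamma> \<Longrightarrow> \<sigma> \<otimes>\<^bsub>Gal K L\<^esub> \<tau> \<in> \<Gamma>" "\<one>\<^bsub>Gal K L\<^esub> \<in> \<Gamma>"
    and fixed: "\<And>y. y \<in> L \<Longrightarrow> (\<And>\<sigma>. \<sigma> \<in> \<Gamma> \<Longrightarrow> \<sigma> y = y) \<Longrightarrow> y \<in> K"
    and s: "emb L s" "\<And>y. y \<in> K \<Longrightarrow> s y = y"
  shows "\<exists>\<tau>\<in>\<Gamma>. s x = \<tau> x"
proof -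
  define p where "p = (\<Prod>\<tau>\<in>\<Gamma>. [:- \<tau> x, 1:])"
  have fin: "finite \<Gamma>" using \<Gamma>(1) finite_G by (rule finite_subset)
  note O = orbit_poly[OF x \<Gamma>(1,2), folded p_def]
  have c: "L.coeffs_in p" using O(1) \<Gamma>(3) by blast
  have cK: "poly.coeff p i \<in> K" for i
  proof (rule fixed)
    show "poly.coeff p i \<in> L" using c by (simp add: L.coeffs_in_def)
    show "\<sigma> (poly.coeff p i) = poly.coeff p i" if "\<sigma> \<in> \<Gamma>" for \<sigma>
      using O(2)[OF _ _ that] L.coeff_map_emb[OF gal_emb, of \<sigma> p i] that \<Gamma>(1,2) by auto
  qed
  have "map_poly s p = p"
    by (rule poly_eqI) (simp add: L.coeff_map_emb[OF s(1)] s(2) cK)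
  then have "s (poly p x) = poly p (s x)" using L.emb_poly[OF s(1) c x] by simp
  moreover have "poly p x = 0"
    unfolding p_def poly_prod using fin \<Gamma>(3) one_app[OF x] by (auto intro!: bexI[of _ "\<one>\<^bsub>Gal K L\<^esub>"])
  ultimately have "poly p (s x) = 0" using L.emb_zero[OF s(1)] by simp
  then show ?thesis unfolding p_def poly_prod using fin by auto
qed

lemma embedding_conjugate:
  assumes "x \<in> L" "emb L s" "\<And>y. y \<in> K \<Longrightarrow> s y = y"
  shows "\<exists>\<tau>\<in>G. s x = \<tau> x"
  using assms fixed_G by (intro embedding_in_orbit) auto

text \<open>Any automorphism agrees at a primitive element with a member of \<Gamma>, hence is that
  member. The result serves to lift automorphisms in towers.\<close>

lemma Artin:
  assumes \<Gamma>: "\<Gamma> \<subseteq> G" "\<And>\<sigma> \<tau>. \<sigma> \<in> \<Gamma> \<Longrightarrow> \<tau> \<in> \<Gamma> \<Longrightarrow> \<sigma> \<otimes>\<^bsub>Gal K L\<^esub> \<tau> \<in> \<Gamma>" "\<one>\<^bsub>Gal K L\<^esub> \<in> \<Gamma>"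
    and fixed: "\<And>y. y \<in> L \<Longrightarrow> (\<And>\<sigma>. \<sigma> \<in> \<Gamma> \<Longrightarrow> \<sigma> y = y) \<Longrightarrow> y \<in> K"
  shows "\<Gamma> = G"
proof
  obtain \<theta> where \<theta>: "\<theta> \<in> L" "inj_on (\<lambda>\<sigma>. \<sigma> \<theta>) G" using primitive_element by blast
  show "G \<subseteq> \<Gamma>"
  proof
    fix \<sigma> assume \<sigma>: "\<sigma> \<in> G"
    have "\<exists>\<tau>\<in>\<Gamma>. \<sigma> \<theta> = \<tau> \<theta>"
      using embedding_in_orbit[OF \<theta>(1) \<Gamma> fixed gal_emb[OF \<sigma>] gal_fix[OF \<sigma>]] by blast
    then show "\<sigma> \<in> \<Gamma>" using \<theta>(2) \<sigma> \<Gamma>(1) by (metis inj_onD subsetD)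
  qed
qed fact

end

section \<open>Primes in extensions\<close>

context nfield begin

text \<open>Take \<open>u\<close> in all primes of \<open>S\<close> but not in \<open>P\<close>, and
  \<open>w = 1 - r * u\<close> in \<open>P\<close>. Then \<open>1 - w ^ n\<close> is close to 1 at
  \<open>P\<close> and, being a multiple of \<open>1 - w\<close>, still lies in every prime of
  \<open>S\<close>.\<close>

lemma crt_elt:
  assumes P: "P \<in> primes K" and S: "finite S" "S \<subseteq> primes K" "P \<notin> S"
  obtains e where "e \<in> ints K" "\<And>R. R \<in> S \<Longrightarrow> e \<in> R" "1 - e \<in> pw P n"
proof -
  have "\<forall>R\<in>S. \<exists>b. b \<in> R \<and> b \<notin> P"
    using prime_sub_eq[OF _ P] S(2,3) by (metis subsetI subsetD)
  from bchoice[OF this] obtain b where b: "\<And>R. R \<in> S \<Longrightarrow> b R \<in> R" "\<And>R. R \<in> S \<Longrightarrow> b R \<notin> P" by blast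
  have bi: "b R \<in> ints K" if "R \<in> S" for R using primesD(4)[of R] b(1) S(2) that by blast
  define u where "u = prod b S"
  have u: "u \<in> ints K" unfolding u_def using bi by (rule ints_prod)
  have "u \<notin> P" using prime_prod_mem[OF S(1) P, of b] bi b(2) unfolding u_def by blast
  then obtain r where r: "r \<in> ints K" "1 - r * u \<in> P" using prime_coprime_elt[OF P u] by blast
  define w where "w = 1 - r * u"
  have w: "w \<in> P" "w \<in> ints K" using r u by (simp_all add: w_def)
  have wn: "w ^ n \<in> pw P n"
  proof (induction n)
    case (Suc n)
    then have "w ^ n * w \<in> pw P (n + Suc 0)" using w(1) pw_1[OF P] by (intro pw_mult_mem[OF P]) simp_all
    then show ?case by (simp add: mult.commute)
  qed simp
  show ?thesis
  proof (rule that[of "1 - w ^ n"])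
    show "1 - w ^ n \<in> ints K" using w(2) by simp
    show "1 - (1 - w ^ n) \<in> pw P n" using wn by simp
    fix R assume R: "R \<in> S"
    then have RI: "ideal R (integers K)" using S(2) primesD(1) by blast
    have "u = b R * prod b (S - {R})" unfolding u_def using S(1) R by (rule prod.remove)
    moreover have "prod b (S - {R}) \<in> ints K" using bi by (intro ints_prod) auto
    ultimately have "u \<in> R" using idealD(5)[OF RI _ b(1)[OF R]] by simp
    then have "1 - w \<in> R" using idealD(4)[OF RI r(1)] by (simp add: w_def)
    moreover have "(\<Sum>i<n. w ^ i) \<in> ints K" using w(2) by (intro ints_sum) simp
    ultimately have "(1 - w) * (\<Sum>i<n. w ^ i) \<in> R" using idealD(5)[OF RI] by blast
    then show "1 - w ^ n \<in> R" by (simp add: one_diff_power_eq)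
  qed
qed

end

section \<open>Primes below and above in an extension\<close>

locale nfext = K: nfield K + L: nfield L for K L :: "'a :: field_char_0 set" +
  assumes KL: "K \<subseteq> L"
begin

lemma ints_sub: "x \<in> ints K \<Longrightarrow> x \<in> ints L"
  using KL by (auto simp: ints_iff)

lemma ints_down: "x \<in> ints L \<Longrightarrow> x \<in> K \<Longrightarrow> x \<in> ints K"
  by (simp add: ints_iff)

lemma contraction:
  assumes P: "P \<in> primes L" shows "P \<inter> ints K \<in> primes K"
proof (rule K.primeI)
  note PD = L.primesD[OF P]
  show "ideal (P \<inter> ints K) (integers K)"
    using L.idealD[OF PD(1)] ints_sub by (intro K.idealI') auto
  obtain a where a: "a \<in> P" "a \<noteq> 0" "a \<in> ints L" using L.ideal_nonzero[OF PD(1,2)] by blast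
  obtain m :: nat where m: "m > 0" "of_nat m \<in> L.princ a" using L.nat_in_princ[OF a(3,2)] by blast
  have "of_nat m \<in> P" using L.princ_le[OF PD(1), of a] a(1) m(2) by blast
  then have mem: "of_nat m \<in> P \<inter> ints K" using K.ints_of_nat by blast
  show "P \<inter> ints K \<noteq> {0}"
  proof
    assume "P \<inter> ints K = {0}"
    with mem have "of_nat m \<in> {0 :: 'a}" by (rule subst[rotated])
    then show False using m(1) by simp
  qed
  show "1 \<notin> P \<inter> ints K" using PD(3) by simp
  show "x \<in> P \<inter> ints K \<or> y \<in> P \<inter> ints K" if "x \<in> ints K" "y \<in> ints K" "x * y \<in> P \<inter> ints K" for x y
    using that PD(6)[of x y] ints_sub by auto
qed

lemma contraction_above: "P \<in> primes L \<Longrightarrow> P \<in> primes_above K L (P \<inter> ints K)"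
  by (simp add: primes_above_def)

text \<open>A fraction \<gamma> carries \<open>p\<close> into the integers of \<open>K\<close>
  without being integral. Its denominators in \<open>L\<close> form an ideal \<open>A\<close> that
  contains \<open>p\<close> and omits 1, so \<open>p\<close> does not generate the unit ideal of
  \<open>L\<close>.\<close>

lemma ex_prime_over:
  assumes p: "p \<in> primes K" shows "\<exists>P. P \<in> primes_above K L p"
proof -
  obtain \<gamma> x y where g: "\<gamma> \<in> K" "\<gamma> \<notin> ints K" "\<forall>x\<in>p. \<gamma> * x \<in> ints K"
    and "x \<in> p" "y \<in> p" "x + \<gamma> * y = 1"
    by (rule K.prime_inverse[OF p])
  define A where "A = {z \<in> ints L. \<gamma> * z \<in> ints L}"
  have A: "ideal A (integers L)"
    by (rule L.idealI') (auto simp: A_def distrib_left mult.left_commute)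
  have pA: "p \<subseteq> A" using g(3) K.primesD(4)[OF p] ints_sub by (auto simp: A_def)
  obtain a where "a \<in> p" "a \<noteq> 0" using K.ideal_nonzero[OF K.primesD(1,2)[OF p]] by blast
  then have "a \<in> A" "a \<noteq> 0" using pA by blast+
  then have A0: "A \<noteq> {0}" by auto
  have "1 \<notin> A" using g(1,2) ints_down by (auto simp: A_def)
  then obtain P where P: "P \<in> primes L" "A \<subseteq> P" using L.ex_prime_above[OF A A0] by blast
  have "p \<subseteq> P \<inter> ints K" using pA P(2) K.primesD(4)[OF p] by blast
  then have "P \<inter> ints K = p" using K.prime_sub_eq[OF p contraction[OF P(1)]] by simp
  then show ?thesis using P(1) by (auto simp: primes_above_def)
qed

end

sublocale galois \<subseteq> nfext K L
  using sub by unfold_locales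

section \<open>Galois action on ideals and primes\<close>

context galois begin

lemma gal_ints: "\<sigma> \<in> G \<Longrightarrow> x \<in> ints L \<Longrightarrow> \<sigma> x \<in> ints L"
  using gal_mem L.emb_algebraic_int[OF gal_emb] by (simp add: ints_iff)

lemma gal_ints_surj: "\<sigma> \<in> G \<Longrightarrow> y \<in> ints L \<Longrightarrow> \<exists>x\<in>ints L. y = \<sigma> x"
  by (rule bexI[of _ "(inv\<^bsub>Gal K L\<^esub> \<sigma>) y"]) (simp_all add: inv_app(2) L.ints_mem gal_ints)

lemma gal_add: "\<sigma> \<in> G \<Longrightarrow> x \<in> ints L \<Longrightarrow> y \<in> ints L \<Longrightarrow> \<sigma> (x + y) = \<sigma> x + \<sigma> y"
  and gal_diff: "\<sigma> \<in> G \<Longrightarrow> x \<in> ints L \<Longrightarrow> y \<in> ints L \<Longrightarrow> \<sigma> (x - y) = \<sigma> x - \<sigma> y"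
  and gal_mult: "\<sigma> \<in> G \<Longrightarrow> x \<in> ints L \<Longrightarrow> y \<in> ints L \<Longrightarrow> \<sigma> (x * y) = \<sigma> x * \<sigma> y"
  by (simp_all add: L.emb_add[OF gal_emb] L.emb_diff[OF gal_emb] L.emb_mult[OF gal_emb] L.ints_mem)

lemma gal_power: "\<sigma> \<in> G \<Longrightarrow> x \<in> ints L \<Longrightarrow> \<sigma> (x ^ n) = \<sigma> x ^ n"
  by (simp add: L.emb_power[OF gal_emb] L.ints_mem)

lemma gal_0: "\<sigma> \<in> G \<Longrightarrow> \<sigma> 0 = 0" and gal_1: "\<sigma> \<in> G \<Longrightarrow> \<sigma> 1 = 1"
  by (simp_all add: L.emb_zero[OF gal_emb] L.emb_one[OF gal_emb])

lemma gal_eq_0: "\<sigma> \<in> G \<Longrightarrow> x \<in> ints L \<Longrightarrow> \<sigma> x = 0 \<longleftrightarrow> x = 0"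
  by (simp add: L.emb_eq_0[OF gal_emb] L.ints_mem)

lemma image_ideal:
  assumes \<sigma>: "\<sigma> \<in> G" and I: "ideal I (integers L)" shows "ideal (\<sigma> ` I) (integers L)"
proof (rule L.idealI')
  note ID = L.idealD[OF I]
  show "\<sigma> ` I \<subseteq> ints L" using ID(1) gal_ints[OF \<sigma>] by blast
  show "0 \<in> \<sigma> ` I" using ID(2) gal_0[OF \<sigma>] by (metis imageI)
  show "x + y \<in> \<sigma> ` I" if xy: "x \<in> \<sigma> ` I" "y \<in> \<sigma> ` I" for x y
  proof -
    obtain u v where "x = \<sigma> u" "y = \<sigma> v" "u \<in> I" "v \<in> I" using xy by blast
    then show ?thesis using gal_add[OF \<sigma>, of u v] ID(1) ID(3)[of u v] by (metis imageI subsetD)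
  qed
  show "r * x \<in> \<sigma> ` I" if r: "r \<in> ints L" and x: "x \<in> \<sigma> ` I" for r x
  proof -
    obtain u s where "x = \<sigma> u" "u \<in> I" "s \<in> ints L" "r = \<sigma> s" using x gal_ints_surj[OF \<sigma> r] by blast
    then show ?thesis using gal_mult[OF \<sigma>, of s u] ID(1) ID(4)[of s u] by (metis imageI subsetD)
  qed
qed

lemma image_mem_iff:
  assumes \<sigma>: "\<sigma> \<in> G" and I: "I \<subseteq> ints L" and x: "x \<in> ints L" shows "\<sigma> x \<in> \<sigma> ` I \<longleftrightarrow> x \<in> I"
proof
  assume "\<sigma> x \<in> \<sigma> ` I"
  then obtain u where u: "\<sigma> x = \<sigma> u" "u \<in> I" by blast
  then have "x = u" using gal_inj[OF \<sigma>, of x u] I x L.ints_mem by blast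
  then show "x \<in> I" using u by simp
qed blast

lemma image_prime:
  assumes \<sigma>: "\<sigma> \<in> G" and P: "P \<in> primes L" shows "\<sigma> ` P \<in> primes L"
proof (rule L.primeI)
  note PD = L.primesD[OF P]
  show "ideal (\<sigma> ` P) (integers L)" by (rule image_ideal[OF \<sigma> PD(1)])
  obtain a where a: "a \<in> P" "a \<noteq> 0" "a \<in> ints L" using L.ideal_nonzero[OF PD(1,2)] by blast
  then have mem: "\<sigma> a \<in> \<sigma> ` P" "\<sigma> a \<noteq> 0" using gal_eq_0[OF \<sigma>] by auto
  show "\<sigma> ` P \<noteq> {0}"
  proof
    assume "\<sigma> ` P = {0}"
    with mem(1) have "\<sigma> a \<in> {0}" by (rule subst[rotated])
    then show False using mem(2) by simp
  qed
  show "1 \<notin> \<sigma> ` P" using image_mem_iff[OF \<sigma> PD(4), of 1] gal_1[OF \<sigma>] PD(3) by simp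
  fix x y assume xy: "x \<in> ints L" "y \<in> ints L" "x * y \<in> \<sigma> ` P"
  obtain u v where uv: "x = \<sigma> u" "u \<in> ints L" "y = \<sigma> v" "v \<in> ints L"
    using gal_ints_surj[OF \<sigma>] xy by blast
  then have "\<sigma> (u * v) \<in> \<sigma> ` P" using gal_mult[OF \<sigma>] xy(3) by simp
  then have "u * v \<in> P" using image_mem_iff[OF \<sigma> PD(4), of "u * v"] uv by simp
  then show "x \<in> \<sigma> ` P \<or> y \<in> \<sigma> ` P" using PD(6)[OF uv(2,4)] uv by blast
qed

lemma image_iprod:
  assumes \<sigma>: "\<sigma> \<in> G" and I: "ideal I (integers L)" and J: "ideal J (integers L)"
  shows "\<sigma> ` L.iprod I J = L.iprod (\<sigma> ` I) (\<sigma> ` J)"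
proof
  have sub: "L.iprod I J \<subseteq> ints L" by (rule L.idealD(1)[OF L.iprod_ideal[OF I J]])
  show "\<sigma> ` L.iprod I J \<subseteq> L.iprod (\<sigma> ` I) (\<sigma> ` J)"
  proof
    fix z assume "z \<in> \<sigma> ` L.iprod I J"
    then obtain y where "y \<in> L.iprod I J" "z = \<sigma> y" by blast
    then have "\<sigma> y \<in> L.iprod (\<sigma> ` I) (\<sigma> ` J) \<and> y \<in> ints L"
    proof (induction arbitrary: z rule: ideal_prod.induct)
      case (prod i j)
      then have "i \<in> ints L" "j \<in> ints L" using L.idealD(1) I J by blast+
      then show ?case using gal_mult[OF \<sigma>] L.iprod_mem[of "\<sigma> i" "\<sigma> ` I" "\<sigma> j" "\<sigma> ` J"] prod by simp
    next
      case (sum s t)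
      then have st: "\<sigma> s \<in> L.iprod (\<sigma> ` I) (\<sigma> ` J)" "s \<in> ints L" "\<sigma> t \<in> L.iprod (\<sigma> ` I) (\<sigma> ` J)" "t \<in> ints L"
        by blast+
      then show ?case
        using L.idealD(3)[OF L.iprod_ideal[OF image_ideal[OF \<sigma> I] image_ideal[OF \<sigma> J]] st(1,3)]
        by (simp add: gal_add[OF \<sigma>])
    qed
    then show "z \<in> L.iprod (\<sigma> ` I) (\<sigma> ` J)" using \<open>z = \<sigma> y\<close> by simp
  qed
  show "L.iprod (\<sigma> ` I) (\<sigma> ` J) \<subseteq> \<sigma> ` L.iprod I J"
  proof (rule L.iprod_le[OF image_ideal[OF \<sigma> L.iprod_ideal[OF I J]]])
    fix x y assume "x \<in> \<sigma> ` I" "y \<in> \<sigma> ` J"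
    then obtain u v where uv: "x = \<sigma> u" "u \<in> I" "y = \<sigma> v" "v \<in> J" by blast
    then have "u \<in> ints L" "v \<in> ints L" using L.idealD(1) I J by blast+
    then have "x * y = \<sigma> (u * v)" using gal_mult[OF \<sigma>] uv by simp
    then show "x * y \<in> \<sigma> ` L.iprod I J" using L.iprod_mem[OF uv(2,4)] by blast
  qed
qed

lemma image_ints: "\<sigma> \<in> G \<Longrightarrow> \<sigma> ` ints L = ints L"
  using gal_ints gal_ints_surj by blast

lemma image_pw:
  assumes \<sigma>: "\<sigma> \<in> G" and P: "P \<in> primes L" shows "\<sigma> ` L.pw P n = L.pw (\<sigma> ` P) n"
proof (induction n)
  case 0
  then show ?case using image_ints[OF \<sigma>] by simp
next
  case (Suc n)
  then show ?case using image_iprod[OF \<sigma> L.pw_ideal[OF P] L.primesD(1)[OF P]]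
    by (simp add: L.M.nat_pow_Suc)
qed

lemma image_inv: "\<sigma> \<in> G \<Longrightarrow> P \<subseteq> ints L \<Longrightarrow> (inv\<^bsub>Gal K L\<^esub> \<sigma>) ` (\<sigma> ` P) = P"
  "\<sigma> \<in> G \<Longrightarrow> P \<subseteq> ints L \<Longrightarrow> \<sigma> ` ((inv\<^bsub>Gal K L\<^esub> \<sigma>) ` P) = P"
proof -
  assume \<sigma>: "\<sigma> \<in> G" and P: "P \<subseteq> ints L"
  have "(inv\<^bsub>Gal K L\<^esub> \<sigma>) (\<sigma> x) = x" "\<sigma> ((inv\<^bsub>Gal K L\<^esub> \<sigma>) x) = x" if "x \<in> P" for x
    using inv_app[OF \<sigma>, of x] P that L.ints_mem by auto
  then show "(inv\<^bsub>Gal K L\<^esub> \<sigma>) ` (\<sigma> ` P) = P" "\<sigma> ` ((inv\<^bsub>Gal K L\<^esub> \<sigma>) ` P) = P"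
    by (simp_all add: image_image)
qed

text \<open>If \<open>Q\<close> were not conjugate to \<open>P\<close>, some \<open>x\<close> would
  lie in \<open>Q\<close> and in no conjugate of \<open>P\<close>. Its norm lies in \<open>Q\<close>
  and in \<open>K\<close>, hence in \<open>p\<close> and in \<open>P\<close>, and then a conjugate
  of \<open>x\<close> lies in \<open>P\<close>.\<close>

lemma primes_transitive:
  assumes P: "P \<in> primes_above K L p" and Q: "Q \<in> primes_above K L p"
  shows "\<exists>\<sigma>\<in>G. Q = \<sigma> ` P"
proof (rule ccontr)
  assume neg: "\<not> (\<exists>\<sigma>\<in>G. Q = \<sigma> ` P)"
  have PL: "P \<in> primes L" "P \<inter> ints K = p" and QL: "Q \<in> primes L" "Q \<inter> ints K = p"
    using P Q by (auto simp: primes_above_def)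
  define S where "S = (\<lambda>\<sigma>. \<sigma> ` P) ` G"
  have S: "finite S" "S \<subseteq> primes L" "Q \<notin> S"
    unfolding S_def using finite_G image_prime PL neg by auto
  have "\<exists>e. e \<in> ints L \<and> (\<forall>T\<in>insert Q S - {R}. e \<in> T) \<and> 1 - e \<in> R" if R: "R \<in> S" for R
  proof -
    have RL: "R \<in> primes L" using R S(2) by blast
    have "insert Q S - {R} \<subseteq> primes L" using S QL by blast
    then show ?thesis
      using L.crt_elt[OF RL, of "insert Q S - {R}" "Suc 0"] S(1) L.pw_1[OF RL]
      by (metis Diff_iff finite_Diff finite_insert singletonI)
  qed
  then have "\<forall>R\<in>S. \<exists>e. e \<in> ints L \<and> (\<forall>T\<in>insert Q S - {R}. e \<in> T) \<and> 1 - e \<in> R" by blast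
  from bchoice[OF this] obtain e where e: "\<And>R. R \<in> S \<Longrightarrow> e R \<in> ints L"
    "\<And>R T. R \<in> S \<Longrightarrow> T \<in> insert Q S \<Longrightarrow> T \<noteq> R \<Longrightarrow> e R \<in> T" "\<And>R. R \<in> S \<Longrightarrow> 1 - e R \<in> R" by blast
  \<comment> \<open>All terms lie in \<open>Q\<close>, whereas modulo a conjugate \<open>R\<close>
    of \<open>P\<close> only the term \<open>e R\<close> remains, and it is congruent to 1.\<close>
  define x where "x = sum e S"
  have x: "x \<in> ints L" unfolding x_def using e(1) by (rule L.ints_sum)
  have xQ: "x \<in> Q" unfolding x_def
    using e(2)[of _ Q] S(3) by (intro L.ideal_sum[OF L.primesD(1)[OF QL(1)]]) auto
  have xR: "x \<notin> R" if R: "R \<in> S" for R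
  proof
    assume "x \<in> R"
    have RL: "R \<in> primes L" using R S(2) by blast
    note RI = L.primesD(1)[OF RL]
    have "sum e (S - {R}) \<in> R" using e(2)[of _ R] R by (intro L.ideal_sum[OF RI]) auto
    moreover have "x = e R + sum e (S - {R})" unfolding x_def using S(1) R by (rule sum.remove)
    ultimately have "e R \<in> R" using L.idealD(7)[OF RI \<open>x \<in> R\<close>, of "sum e (S - {R})"] by simp
    from L.idealD(3)[OF RI e(3)[OF R] this] show False using L.primesD(3)[OF RL] by simp
  qed
  define N where "N = (\<Prod>\<sigma>\<in>G. \<sigma> x)"
  have Ni: "N \<in> ints L" unfolding N_def using gal_ints x by (intro L.ints_prod) blast
  have "N \<in> K"
  proof (rule fixed_G)
    show "N \<in> L" using Ni by (rule L.ints_mem)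
    fix \<tau> assume \<tau>: "\<tau> \<in> G"
    have "\<tau> N = (\<Prod>\<sigma>\<in>G. \<tau> (\<sigma> x))" unfolding N_def
      using L.ints_mem[OF x] gal_mem by (intro L.emb_prod[OF gal_emb[OF \<tau>]]) blast
    also have "\<dots> = (\<Prod>\<sigma>\<in>G. (\<tau> \<otimes>\<^bsub>Gal K L\<^esub> \<sigma>) x)"
      using mult_app[OF \<tau>] L.ints_mem[OF x] by (intro prod.cong) auto
    also have "\<dots> = N" unfolding N_def by (rule prod.reindex_bij_betw[OF bij_left_mult[OF \<tau>]])
    finally show "\<tau> N = N" .
  qed
  then have NK: "N \<in> ints K" using ints_down Ni by blast
  have "N = \<one>\<^bsub>Gal K L\<^esub> x * (\<Prod>\<sigma>\<in>G - {\<one>\<^bsub>Gal K L\<^esub>}. \<sigma> x)"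
    unfolding N_def using finite_G Gal.one_closed by (rule prod.remove)
  moreover have "(\<Prod>\<sigma>\<in>G - {\<one>\<^bsub>Gal K L\<^esub>}. \<sigma> x) \<in> ints L" using gal_ints x by (intro L.ints_prod) blast
  ultimately have "N \<in> Q"
    using L.idealD(5)[OF L.primesD(1)[OF QL(1)] _ xQ] one_app[OF L.ints_mem[OF x]] by simp
  then have "N \<in> P" using NK PL(2) QL(2) by blast
  then obtain \<sigma> where \<sigma>: "\<sigma> \<in> G" "\<sigma> x \<in> P"
    using L.prime_prod_mem[OF finite_G PL(1), of "\<lambda>\<sigma>. \<sigma> x"] gal_ints x unfolding N_def by blast
  have "(inv\<^bsub>Gal K L\<^esub> \<sigma>) (\<sigma> x) \<in> (inv\<^bsub>Gal K L\<^esub> \<sigma>) ` P" using \<sigma>(2) by blast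
  then have "x \<in> (inv\<^bsub>Gal K L\<^esub> \<sigma>) ` P" using inv_app(1)[OF \<sigma>(1) L.ints_mem[OF x]] by simp
  then show False using xR[of "(inv\<^bsub>Gal K L\<^esub> \<sigma>) ` P"] Gal.inv_closed[OF \<sigma>(1)] unfolding S_def by blast
qed

end

section \<open>Towers of Galois extensions\<close>

locale galois_tower = bot: galois K L + top: galois K L' for K L L' :: "'a :: field_char_0 set" +
  assumes LL': "L \<subseteq> L'"

sublocale galois_tower \<subseteq> ext: nfext L L'
  using LL' by unfold_locales

context galois_tower begin

lemma top_emb: "\<tau> \<in> top.G \<Longrightarrow> emb L \<tau>"
  using top.gal_emb[of \<tau>] LL' unfolding emb_def by blast

text \<open>Normality of \<open>L\<close>: \<tau> restricts to an embedding of \<open>L\<close> over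
  \<open>K\<close>, so the image of \<open>x\<close> is a conjugate of \<open>x\<close> under the
  Galois group of \<open>L\<close>.\<close>

lemma res_mem: "\<tau> \<in> top.G \<Longrightarrow> x \<in> L \<Longrightarrow> \<tau> x \<in> L"
  using bot.embedding_conjugate[of x \<tau>] top_emb[of \<tau>] top.gal_fix[of \<tau>] bot.gal_mem by fastforce

definition res where "res \<tau> = restrict \<tau> L"

lemma res_app: "x \<in> L \<Longrightarrow> res \<tau> x = \<tau> x"
  by (simp add: res_def)

lemma res_G:
  assumes \<tau>: "\<tau> \<in> top.G" shows "res \<tau> \<in> bot.G"
proof (rule bot.galI)
  have inj: "inj_on \<tau> L" using top.gal_bij[OF \<tau>] LL' by (meson bij_betw_def inj_on_subset)
  have "\<tau> ` L = L"
  proof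
    show "\<tau> ` L \<subseteq> L" using res_mem[OF \<tau>] by blast
    show "L \<subseteq> \<tau> ` L"
    proof
      fix y assume y: "y \<in> L"
      then have "y = \<tau> ((inv\<^bsub>Gal K L'\<^esub> \<tau>) y)" using top.inv_app(2)[OF \<tau>] LL' by auto
      moreover have "(inv\<^bsub>Gal K L'\<^esub> \<tau>) y \<in> L" using res_mem[OF top.Gal.inv_closed[OF \<tau>] y] .
      ultimately show "y \<in> \<tau> ` L" by blast
    qed
  qed
  then have "bij_betw \<tau> L L" using inj by (simp add: bij_betw_def)
  then show "bij_betw (res \<tau>) L L" by (subst bij_betw_cong[of L _ \<tau>]) (simp_all add: res_def)
  show "emb L (res \<tau>)" using top_emb[OF \<tau>] by (simp add: emb_def res_def)
  show "res \<tau> x = x" if "x \<in> K" for x using that bot.sub top.gal_fix[OF \<tau> that] by (auto simp: res_def)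
  show "res \<tau> \<in> extensional L" by (simp add: res_def)
qed

lemma res_mult:
  assumes "\<sigma> \<in> top.G" "\<tau> \<in> top.G"
  shows "res (\<sigma> \<otimes>\<^bsub>Gal K L'\<^esub> \<tau>) = res \<sigma> \<otimes>\<^bsub>Gal K L\<^esub> res \<tau>"
proof (rule bot.gal_eqI)
  show "res (\<sigma> \<otimes>\<^bsub>Gal K L'\<^esub> \<tau>) \<in> bot.G" "res \<sigma> \<otimes>\<^bsub>Gal K L\<^esub> res \<tau> \<in> bot.G"
    using assms by (simp_all add: res_G)
  fix x assume x: "x \<in> L"
  then have "x \<in> L'" using LL' by blast
  then show "res (\<sigma> \<otimes>\<^bsub>Gal K L'\<^esub> \<tau>) x = (res \<sigma> \<otimes>\<^bsub>Gal K L\<^esub> res \<tau>) x"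
    using x assms res_mem[OF assms(2)] by (simp add: bot.mult_app res_G res_app top.mult_app)
qed

lemma res_one: "res \<one>\<^bsub>Gal K L'\<^esub> = \<one>\<^bsub>Gal K L\<^esub>"
proof (rule bot.gal_eqI)
  show "res \<one>\<^bsub>Gal K L'\<^esub> x = \<one>\<^bsub>Gal K L\<^esub> x" if "x \<in> L" for x
    using that LL' top.one_app[of x] bot.one_app[of x] by (auto simp: res_app)
qed (simp_all add: res_G)

text \<open>The restrictions are closed under multiplication and have fixed field \<open>K\<close>,
  so \<open>Artin\<close> applies.\<close>

lemma res_surj: "res ` top.G = bot.G"
proof (rule bot.Artin)
  show "res ` top.G \<subseteq> bot.G" using res_G by blast
  show "\<sigma> \<otimes>\<^bsub>Gal K L\<^esub> \<tau> \<in> res ` top.G" if "\<sigma> \<in> res ` top.G" "\<tau> \<in> res ` top.G" for \<sigma> \<tau>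
    using that res_mult[symmetric] by auto
  show "\<one>\<^bsub>Gal K L\<^esub> \<in> res ` top.G" using res_one by (metis image_eqI top.Gal.one_closed)
  fix y assume y: "y \<in> L" "\<And>\<sigma>. \<sigma> \<in> res ` top.G \<Longrightarrow> \<sigma> y = y"
  show "y \<in> K"
  proof (rule top.fixed_G)
    show "y \<in> L'" using y LL' by blast
    show "\<tau> y = y" if "\<tau> \<in> top.G" for \<tau> using y(2)[OF imageI[OF that]] y(1) by (simp add: res_app)
  qed
qed

text \<open>The Galois group of \<open>L'\<close> over \<open>L\<close>, kept inside that of
  \<open>L'\<close> over \<open>K\<close> so that its elements can be multiplied with arbitrary
  lifts.\<close>

definition H where "H = {s \<in> top.G. res s = \<one>\<^bsub>Gal K L\<^esub>}"

lemma H_app: "s \<in> H \<Longrightarrow> x \<in> L \<Longrightarrow> s x = x"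
  unfolding H_def using res_app[of x s] bot.one_app[of x] by auto

text \<open>Evaluating an interpolation polynomial over \<open>K\<close> at a primitive element of \<open>L\<close> exhibits \<open>y\<close> as an element of \<open>L\<close>.\<close>

lemma fixed_H:
  assumes y: "y \<in> L'" "\<And>s. s \<in> H \<Longrightarrow> s y = y"
  shows "y \<in> L"
proof -
  obtain \<theta> where \<theta>: "\<theta> \<in> L" "inj_on (\<lambda>\<sigma>. \<sigma> \<theta>) bot.G" using bot.primitive_element by blast
  have \<theta>': "\<rho> \<theta> \<in> L'" "\<rho> \<theta> \<in> L" if "\<rho> \<in> bot.G" for \<rho> using bot.gal_mem[OF that \<theta>(1)] LL' by auto
  define F where "F = (\<lambda>\<sigma>. \<Prod>\<rho>\<in>bot.G - {\<sigma>}. [:- \<rho> \<theta>, 1:])"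
  \<comment> \<open>Among the conjugates of \<theta>, \<open>F \<sigma>\<close> is nonzero only at
    \<open>\<sigma> \<theta>\<close>. The whole group permutes the summands of \<open>W\<close>,
    which puts the coefficients into \<open>K\<close>, and at \<theta> only the summands with
    \<open>s\<close> in \<open>H\<close> survive.\<close>
  define W where "W = (\<Sum>s\<in>top.G. Polynomial.smult (s y) (F (res s)))"
  have cF: "top.L.coeffs_in (F \<sigma>)" for \<sigma>
    unfolding F_def using \<theta>' by (intro top.L.coeffs_in_prod top.L.coeffs_in_linear) blast
  have sy: "s y \<in> L'" if "s \<in> top.G" for s using top.gal_mem[OF that y(1)] .
  have cW: "top.L.coeffs_in W"
    unfolding W_def using sy cF by (intro top.L.coeffs_in_sum top.L.coeffs_in_smult) blast+
  have mapF: "map_poly \<tau> (F (res s)) = F (res (\<tau> \<otimes>\<^bsub>Gal K L'\<^esub> s))" if \<tau>: "\<tau> \<in> top.G" and s: "s \<in> top.G" for \<tau> s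
  proof -
    note r\<tau> = res_G[OF \<tau>]
    have "map_poly \<tau> (F (res s)) = (\<Prod>\<rho>\<in>bot.G - {res s}. [:- \<tau> (\<rho> \<theta>), 1:])"
      unfolding F_def using \<theta>' by (intro top.L.map_emb_prod_linear[OF top.gal_emb[OF \<tau>]]) blast
    also have "\<dots> = (\<Prod>\<rho>\<in>bot.G - {res s}. [:- (res \<tau> \<otimes>\<^bsub>Gal K L\<^esub> \<rho>) \<theta>, 1:])"
      using \<theta> \<theta>' by (intro prod.cong) (auto simp: bot.mult_app[OF r\<tau>] res_app)
    also have "\<dots> = (\<Prod>\<rho>\<in>bot.G - {res \<tau> \<otimes>\<^bsub>Gal K L\<^esub> res s}. [:- \<rho> \<theta>, 1:])"
      using bij_betw_DiffI[OF bot.bij_left_mult[OF r\<tau>], of "{res s}" "{res \<tau> \<otimes>\<^bsub>Gal K L\<^esub> res s}"] res_G[OF s] bot.Gal.m_closed[OF r\<tau> res_G[OF s]]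
      by (intro prod.reindex_bij_betw) (simp add: bij_betw_def)
    finally show ?thesis unfolding F_def res_mult[OF \<tau> s] .
  qed
  have "map_poly \<tau> W = W" if \<tau>: "\<tau> \<in> top.G" for \<tau>
  proof -
    have "map_poly \<tau> W = (\<Sum>s\<in>top.G. map_poly \<tau> (Polynomial.smult (s y) (F (res s))))"
      unfolding W_def using sy cF
      by (intro top.L.map_emb_sum[OF top.gal_emb[OF \<tau>]] top.L.coeffs_in_smult) blast+
    also have "\<dots> = (\<Sum>s\<in>top.G. Polynomial.smult ((\<tau> \<otimes>\<^bsub>Gal K L'\<^esub> s) y) (F (res (\<tau> \<otimes>\<^bsub>Gal K L'\<^esub> s))))"
      using sy cF mapF[OF \<tau>]
      by (intro sum.cong) (simp_all add: top.L.map_emb_smult[OF top.gal_emb[OF \<tau>]] top.mult_app[OF \<tau> _ y(1)])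
    also have "\<dots> = W" unfolding W_def by (rule sum.reindex_bij_betw[OF top.bij_left_mult[OF \<tau>]])
    finally show ?thesis .
  qed
  then have "bot.K.coeffs_in W" by (rule top.coeffs_in_K[OF cW])
  then have "bot.L.coeffs_in W" using bot.sub by (auto simp: bot.K.coeffs_in_def bot.L.coeffs_in_def)
  then have WL: "poly W \<theta> \<in> L" using \<theta>(1) by (rule bot.L.poly_mem)
  define c where "c = poly (F \<one>\<^bsub>Gal K L\<^esub>) \<theta>"
  have c_eq: "c = (\<Prod>\<rho>\<in>bot.G - {\<one>\<^bsub>Gal K L\<^esub>}. \<theta> - \<rho> \<theta>)" by (simp add: c_def F_def poly_prod)
  have cL: "c \<in> L" unfolding c_eq using \<theta>(1) \<theta>' by (intro bot.L.prod_mem bot.L.diff_mem) auto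
  have c0: "c \<noteq> 0"
  proof
    assume "c = 0"
    then obtain \<rho> where \<rho>: "\<rho> \<in> bot.G" "\<rho> \<noteq> \<one>\<^bsub>Gal K L\<^esub>" "\<theta> = \<rho> \<theta>"
      unfolding c_eq using bot.finite_G by auto
    have "\<rho> \<theta> = \<one>\<^bsub>Gal K L\<^esub> \<theta>" using \<rho>(3) bot.one_app[OF \<theta>(1)] by simp
    then show False using inj_onD[OF \<theta>(2)] \<rho>(1,2) by blast
  qed
  have zero: "poly (F (res s)) \<theta> = 0" if s: "s \<in> top.G - H" for s
  proof -
    have "\<one>\<^bsub>Gal K L\<^esub> \<in> bot.G - {res s}" using s by (auto simp: H_def)
    then show ?thesis unfolding F_def poly_prod using bot.finite_G bot.one_app[OF \<theta>(1)]
      by (intro prod_zero) (auto intro!: bexI[of _ "\<one>\<^bsub>Gal K L\<^esub>"])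
  qed
  have HG: "H \<subseteq> top.G" by (auto simp: H_def)
  have "poly W \<theta> = (\<Sum>s\<in>top.G. s y * poly (F (res s)) \<theta>)" by (simp add: W_def poly_sum)
  also have "\<dots> = (\<Sum>s\<in>H. s y * poly (F (res s)) \<theta>)"
    using zero HG top.finite_G by (intro sum.mono_neutral_right) auto
  also have "\<dots> = (\<Sum>s\<in>H. y * c)" using y(2) by (intro sum.cong) (auto simp: H_def c_def)
  also have "\<dots> = of_nat (card H) * (y * c)" by simp
  finally have eq: "poly W \<theta> = of_nat (card H) * (y * c)" .
  have "\<one>\<^bsub>Gal K L'\<^esub> \<in> H" using res_one by (simp add: H_def)
  then have "card H \<noteq> 0" using finite_subset[OF HG top.finite_G] by auto
  then have "y = poly W \<theta> / (of_nat (card H) * c)" using eq c0 by simp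
  then show ?thesis using WL cL by (metis bot.L.divide_mem bot.L.mult_mem bot.L.of_nat_mem)
qed

end

section \<open>Ramification groups and conductors\<close>

context galois begin

text \<open>For positive \<open>n\<close> this is the lower ramification group of index
  \<open>n - 1\<close>; its elements preserve \<open>P\<close> by \<open>acts_image\<close>.\<close>

definition acts :: "'a set \<Rightarrow> nat \<Rightarrow> ('a \<Rightarrow> 'a) set"
  where "acts P n = {\<sigma> \<in> G. \<forall>x\<in>ints L. \<sigma> x - x \<in> L.pw P n}"

lemma acts_G: "acts P n \<subseteq> G"
  by (auto simp: acts_def)

lemma one_acts: "P \<in> primes L \<Longrightarrow> \<one>\<^bsub>Gal K L\<^esub> \<in> acts P n"
  using one_app L.ints_mem L.pw_0_mem by (auto simp: acts_def)

lemma acts_antimono: "P \<in> primes L \<Longrightarrow> m \<le> n \<Longrightarrow> acts P n \<subseteq> acts P m"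
  using L.pw_leI by (auto simp: acts_def)

lemma acts_inv:
  assumes "\<sigma> \<in> acts P n" "P \<in> primes L" shows "inv\<^bsub>Gal K L\<^esub> \<sigma> \<in> acts P n"
proof -
  have \<sigma>: "\<sigma> \<in> G" using assms acts_G by blast
  have "(inv\<^bsub>Gal K L\<^esub> \<sigma>) x - x \<in> L.pw P n" if x: "x \<in> ints L" for x
  proof -
    define y where "y = (inv\<^bsub>Gal K L\<^esub> \<sigma>) x"
    have y: "y \<in> ints L" using gal_ints[OF Gal.inv_closed[OF \<sigma>] x] by (simp add: y_def)
    have "\<sigma> y = x" using inv_app(2)[OF \<sigma> L.ints_mem[OF x]] by (simp add: y_def)
    then have "- (x - y) \<in> L.pw P n"
      using assms(1) y L.idealD(6)[OF L.pw_ideal[OF assms(2)], of "x - y"] by (auto simp: acts_def)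
    then show ?thesis by (simp add: y_def)
  qed
  then show ?thesis using \<sigma> by (simp add: acts_def)
qed

lemma acts_mult:
  assumes "\<sigma> \<in> acts P n" "\<tau> \<in> acts P n" "P \<in> primes L" shows "\<sigma> \<otimes>\<^bsub>Gal K L\<^esub> \<tau> \<in> acts P n"
proof -
  have G: "\<sigma> \<in> G" "\<tau> \<in> G" using assms acts_G by blast+
  have "(\<sigma> \<otimes>\<^bsub>Gal K L\<^esub> \<tau>) x - x \<in> L.pw P n" if x: "x \<in> ints L" for x
  proof -
    have "\<sigma> (\<tau> x) - \<tau> x \<in> L.pw P n" "\<tau> x - x \<in> L.pw P n"
      using assms(1,2) gal_ints[OF G(2) x] x by (auto simp: acts_def)
    from L.idealD(3)[OF L.pw_ideal[OF assms(3)] this] show ?thesis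
      using mult_app[OF G L.ints_mem[OF x]] by simp
  qed
  then show ?thesis using G by (simp add: acts_def)
qed

text \<open>Displacements in \<open>P\<close> send \<open>P\<close> into itself, and the image is
  again a maximal ideal.\<close>

lemma acts_image:
  assumes \<sigma>: "\<sigma> \<in> acts P n" and P: "P \<in> primes L" and n: "0 < n" shows "\<sigma> ` P = P"
proof -
  have sub: "\<tau> ` P \<subseteq> P" if \<tau>: "\<tau> \<in> acts P n" for \<tau>
  proof
    fix y assume "y \<in> \<tau> ` P"
    then obtain x where x: "x \<in> P" "y = \<tau> x" by blast
    then have "\<tau> x - x \<in> P" using \<tau> L.pw_pos_sub[OF P _ n] L.primesD(4)[OF P] by (auto simp: acts_def)
    then have "\<tau> x - x + x \<in> P" using L.idealD(3)[OF L.primesD(1)[OF P]] x by blast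
    then show "y \<in> P" using x by simp
  qed
  have "\<sigma> \<in> G" using \<sigma> acts_G by blast
  then show ?thesis using L.prime_sub_eq[OF image_prime P sub[OF \<sigma>]] P by blast
qed

lemma ram_lower_eq:
  assumes P: "P \<in> primes L" and t: "0 \<le> t"
  shows "ram_lower K L P t = acts P (nat (\<lceil>t\<rceil> + 1))"
proof -
  have "0 < nat (\<lceil>t\<rceil> + 1)" using t by linarith
  then show ?thesis using acts_image[OF _ P] unfolding ram_lower_def decomposition_group_def acts_def by blast
qed

text \<open>Denominators are cleared from a moved element. A moved integer bounds the exponents
  \<open>n\<close> for which a nontrivial automorphism can lie in \<open>acts P n\<close>.\<close>

lemma moved_int:
  assumes \<sigma>: "\<sigma> \<in> G" "\<sigma> \<noteq> \<one>\<^bsub>Gal K L\<^esub>" shows "\<exists>x\<in>ints L. \<sigma> x \<noteq> x"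
proof -
  obtain x where x: "x \<in> L" "\<sigma> x \<noteq> x"
    using gal_eqI[OF \<sigma>(1) Gal.one_closed] \<sigma>(2) one_app by metis
  obtain m :: int where m: "m \<noteq> 0" "algebraic_int (of_int m * x)"
    using number_field_algebraic[OF L.nf x(1)] by blast
  have "\<sigma> (of_int m * x) = of_int m * \<sigma> x"
    using x(1) by (simp add: L.emb_mult[OF gal_emb[OF \<sigma>(1)]] L.emb_of_int[OF gal_emb[OF \<sigma>(1)]])
  then have "\<sigma> (of_int m * x) \<noteq> of_int m * x" using x(2) m(1) by simp
  moreover have "of_int m * x \<in> ints L" using m(2) x(1) by (simp add: ints_iff)
  ultimately show ?thesis by blast
qed

text \<open>Serre's function \<open>i\<close>. For the identity every exponent qualifies and the
  value is unspecified, so the identity is treated apart throughout.\<close>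

definition idx :: "'a set \<Rightarrow> ('a \<Rightarrow> 'a) \<Rightarrow> nat" where "idx P \<sigma> = (GREATEST n. \<sigma> \<in> acts P n)"

lemma idx_ge_iff:
  assumes P: "P \<in> primes L" and \<sigma>: "\<sigma> \<in> G" "\<sigma> \<noteq> \<one>\<^bsub>Gal K L\<^esub>"
  shows "n \<le> idx P \<sigma> \<longleftrightarrow> \<sigma> \<in> acts P n"
proof -
  obtain x where x: "x \<in> ints L" "\<sigma> x \<noteq> x" using moved_int[OF \<sigma>] by blast
  define b where "b = L.ev P (\<sigma> x - x)"
  have b: "n \<le> b" if "\<sigma> \<in> acts P n" for n
    using that x L.mem_pw_iff[OF P, of "\<sigma> x - x" n] gal_ints[OF \<sigma>(1) x(1)] by (auto simp: acts_def b_def)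
  have "\<sigma> \<in> acts P 0" using \<sigma>(1) gal_ints[OF \<sigma>(1)] by (auto simp: acts_def)
  then have max: "\<sigma> \<in> acts P (idx P \<sigma>)"
    unfolding idx_def by (rule GreatestI_nat[where P = "\<lambda>n. \<sigma> \<in> acts P n"]) (use b in blast)
  show ?thesis
  proof
    show "n \<le> idx P \<sigma> \<Longrightarrow> \<sigma> \<in> acts P n" using max acts_antimono[OF P] by blast
    show "\<sigma> \<in> acts P n \<Longrightarrow> n \<le> idx P \<sigma>"
      unfolding idx_def by (rule Greatest_le_nat[where P = "\<lambda>n. \<sigma> \<in> acts P n"]) (use b in blast)+
  qed
qed

definition inertia :: "'a set \<Rightarrow> ('a \<Rightarrow> 'a) set" where "inertia P = acts P (Suc 0)"

text \<open>The identity, whose index would be infinite, is split off; sums of indices run over this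
  set.\<close>

definition ri :: "'a set \<Rightarrow> ('a \<Rightarrow> 'a) set" where "ri P = inertia P - {\<one>\<^bsub>Gal K L\<^esub>}"

lemma finite_inertia: "finite (inertia P)" and finite_ri: "finite (ri P)"
  using finite_subset[OF acts_G finite_G] by (simp_all add: inertia_def ri_def)

lemma card_inertia: "P \<in> primes L \<Longrightarrow> card (inertia P) = Suc (card (ri P))"
  unfolding ri_def using one_acts finite_inertia card_Suc_Diff1 by (metis inertia_def)

lemma riD: "\<sigma> \<in> ri P \<Longrightarrow> \<sigma> \<in> G \<and> \<sigma> \<noteq> \<one>\<^bsub>Gal K L\<^esub>"
  using acts_G by (auto simp: ri_def inertia_def)

lemma idx_pos: "P \<in> primes L \<Longrightarrow> \<sigma> \<in> ri P \<Longrightarrow> 1 \<le> idx P \<sigma>"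
  using idx_ge_iff[of P \<sigma> 1] riD[of \<sigma> P] by (simp add: ri_def inertia_def)

text \<open>The shift by 1 is the one between exponents of \<open>P\<close> and lower indices; the
  ceiling disappears because indices are integers.\<close>

lemma ram_lower_idx:
  assumes P: "P \<in> primes L" and t: "0 \<le> t"
  shows "ram_lower K L P t = insert \<one>\<^bsub>Gal K L\<^esub> {\<sigma> \<in> ri P. t \<le> real (idx P \<sigma>) - 1}"
proof -
  have le: "nat (\<lceil>t\<rceil> + 1) \<le> k \<longleftrightarrow> t \<le> real k - 1" for k
  proof -
    have "nat (\<lceil>t\<rceil> + 1) \<le> k \<longleftrightarrow> \<lceil>t\<rceil> \<le> int k - 1" using t by linarith
    also have "\<dots> \<longleftrightarrow> t \<le> real_of_int (int k - 1)" by (rule ceiling_le_iff)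
    also have "real_of_int (int k - 1) = real k - 1" by simp
    finally show ?thesis .
  qed
  have "0 < nat (\<lceil>t\<rceil> + 1)" using t by linarith
  then have sub: "acts P (nat (\<lceil>t\<rceil> + 1)) \<subseteq> inertia P"
    unfolding inertia_def by (intro acts_antimono[OF P] Suc_leI)
  show ?thesis
    unfolding ram_lower_eq[OF P t]
  proof (intro Set.set_eqI iffI)
    fix \<sigma> assume \<sigma>: "\<sigma> \<in> acts P (nat (\<lceil>t\<rceil> + 1))"
    show "\<sigma> \<in> insert \<one>\<^bsub>Gal K L\<^esub> {\<sigma> \<in> ri P. t \<le> real (idx P \<sigma>) - 1}"
    proof (cases "\<sigma> = \<one>\<^bsub>Gal K L\<^esub>")
      case False
      then have "\<sigma> \<in> ri P" using \<sigma> sub by (auto simp: ri_def)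
      then show ?thesis using \<sigma> idx_ge_iff[OF P, of \<sigma>] riD le by blast
    qed simp
  next
    fix \<sigma> assume "\<sigma> \<in> insert \<one>\<^bsub>Gal K L\<^esub> {\<sigma> \<in> ri P. t \<le> real (idx P \<sigma>) - 1}"
    then show "\<sigma> \<in> acts P (nat (\<lceil>t\<rceil> + 1))" using idx_ge_iff[OF P, of \<sigma>] riD le one_acts[OF P] by blast
  qed
qed

lemma card_ram_lower:
  assumes P: "P \<in> primes L" and t: "0 \<le> t"
  shows "real (card (ram_lower K L P t)) = 1 + (\<Sum>\<sigma>\<in>ri P. if t \<le> real (idx P \<sigma>) - 1 then 1 else 0)"
proof -
  have "card (ram_lower K L P t) = Suc (card {\<sigma> \<in> ri P. t \<le> real (idx P \<sigma>) - 1})"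
    unfolding ram_lower_idx[OF P t] using finite_ri by (subst card_insert_disjoint) (auto simp: ri_def)
  also have "card {\<sigma> \<in> ri P. t \<le> real (idx P \<sigma>) - 1} = (\<Sum>\<sigma>\<in>ri P. if t \<le> real (idx P \<sigma>) - 1 then 1 else 0)"
    using finite_ri by (simp add: sum.If_cases Int_def)
  finally show ?thesis by (simp add: of_nat_sum if_distrib cong: if_cong)
qed

lemma ram_lower_0: "P \<in> primes L \<Longrightarrow> ram_lower K L P 0 = inertia P"
  using ram_lower_eq[of P 0] by (simp add: inertia_def)

section \<open>Herbrand's functions as finite sums\<close>

lemma integral_step:
  assumes "0 \<le> u" "0 \<le> c"
  shows "((\<lambda>t. if t \<le> c then 1 else 0) has_integral min u c) {0..u :: real}"
proof -
  have "((\<lambda>_. 1 :: real) has_integral min u c) {0..min u c}"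
    using has_integral_const_real[of "1 :: real" 0 "min u c"] assms by simp
  then have "((\<lambda>t. if t \<in> {0..min u c} then 1 else 0) has_integral min u c) {0..u}"
    by (subst has_integral_restrict) auto
  then show ?thesis by (rule has_integral_eq[rotated]) auto
qed

text \<open>The order of a lower ramification group counts automorphisms, so the integral is a sum
  of integrals of step functions: the identity contributes \<open>u\<close>, and every other element
  the length of the part of \<open>{0..u}\<close> on which it stays in the group.\<close>

lemma herbrand_phi_eq:
  assumes P: "P \<in> primes L" and u: "0 \<le> u"
  shows "herbrand_phi K L P u * real (card (inertia P)) = u + (\<Sum>\<sigma>\<in>ri P. min u (real (idx P \<sigma>) - 1))"
proof -
  define g where "g = real (card (inertia P))"
  have g: "g \<noteq> 0" using card_inertia[OF P] by (simp add: g_def)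
  have "((\<lambda>t. 1 + (\<Sum>\<sigma>\<in>ri P. if t \<le> real (idx P \<sigma>) - 1 then 1 else 0)) has_integral
      (u + (\<Sum>\<sigma>\<in>ri P. min u (real (idx P \<sigma>) - 1)))) {0..u}"
  proof (intro has_integral_add has_integral_sum finite_ri integral_step u)
    show "((\<lambda>t. 1 :: real) has_integral u) {0..u}" using has_integral_const_real[of "1 :: real" 0 u] u by simp
    show "0 \<le> real (idx P \<sigma>) - 1" if "\<sigma> \<in> ri P" for \<sigma> using idx_pos[OF P that] by simp
  qed
  then have "((\<lambda>t. real (card (ram_lower K L P t))) has_integral
      (u + (\<Sum>\<sigma>\<in>ri P. min u (real (idx P \<sigma>) - 1)))) {0..u}"
    by (rule has_integral_eq[rotated]) (use card_ram_lower[OF P] in auto)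
  then have "((\<lambda>t. real (card (ram_lower K L P t)) / g) has_integral
      (u + (\<Sum>\<sigma>\<in>ri P. min u (real (idx P \<sigma>) - 1))) / g) {0..u}"
    by (rule has_integral_divide)
  then have "herbrand_phi K L P u = (u + (\<Sum>\<sigma>\<in>ri P. min u (real (idx P \<sigma>) - 1))) / g"
    unfolding herbrand_phi_def ram_lower_0[OF P] g_def by (rule integral_unique)
  then show ?thesis using g by (simp add: g_def)
qed

lemma card_inertia_pos: "P \<in> primes L \<Longrightarrow> 0 < real (card (inertia P))"
  using card_inertia by simp

lemma herbrand_phi_strict_mono:
  assumes P: "P \<in> primes L" and u: "0 \<le> u" "u < v"
  shows "herbrand_phi K L P u < herbrand_phi K L P v"
proof -
  have "u + (\<Sum>\<sigma>\<in>ri P. min u (real (idx P \<sigma>) - 1)) < v + (\<Sum>\<sigma>\<in>ri P. min v (real (idx P \<sigma>) - 1))"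
    using u by (intro add_less_le_mono sum_mono) auto
  then have "herbrand_phi K L P u * real (card (inertia P)) < herbrand_phi K L P v * real (card (inertia P))"
    using herbrand_phi_eq[OF P] u by simp
  then show ?thesis using card_inertia_pos[OF P] by (simp add: mult_less_cancel_right)
qed

lemma herbrand_phi_0: "P \<in> primes L \<Longrightarrow> herbrand_phi K L P 0 = 0"
  by (simp add: herbrand_phi_def)

lemma ex_herbrand_psi:
  assumes P: "P \<in> primes L" and v: "0 \<le> v"
  shows "\<exists>!u. 0 \<le> u \<and> herbrand_phi K L P u = v"
proof -
  define g where "g = real (card (inertia P))"
  have g: "g > 0" using card_inertia_pos[OF P] by (simp add: g_def)
  define f where "f = (\<lambda>u. u + (\<Sum>\<sigma>\<in>ri P. min u (real (idx P \<sigma>) - 1)))"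
  have f0: "f 0 = 0" using idx_pos[OF P] by (auto simp: f_def intro!: sum.neutral)
  have fge: "u \<le> f u" if "0 \<le> u" for u
    using that idx_pos[OF P] by (auto simp: f_def intro!: sum_nonneg)
  \<comment> \<open>Since \<open>f u\<close> is at least \<open>u\<close>, the value
    \<open>v * g\<close> is reached on this interval.\<close>
  have "continuous_on {0..v * g} f" unfolding f_def by (intro continuous_intros)
  moreover have "f 0 \<le> v * g" "v * g \<le> f (v * g)" "0 \<le> v * g" using f0 fge v g by auto
  ultimately obtain u where u: "0 \<le> u" "f u = v * g" using IVT'[of f 0 "v * g" "v * g"] by auto
  have eq: "herbrand_phi K L P u = v"
    using herbrand_phi_eq[OF P u(1)] u(2) g by (simp add: f_def g_def)
  show ?thesis
  proof (rule ex1I[of _ u])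
    fix w assume w: "0 \<le> w \<and> herbrand_phi K L P w = v"
    then show "w = u"
      using herbrand_phi_strict_mono[OF P, of u w] herbrand_phi_strict_mono[OF P, of w u] eq u(1)
      by (cases u w rule: linorder_cases) auto
  qed (use u eq in simp)
qed

lemma herbrand_psi:
  assumes "P \<in> primes L" "0 \<le> v"
  shows "0 \<le> herbrand_psi K L P v" "herbrand_phi K L P (herbrand_psi K L P v) = v"
  using theI'[OF ex_herbrand_psi[OF assms]] unfolding herbrand_psi_def by auto

lemma ram_upper_0: "P \<in> primes L \<Longrightarrow> ram_upper K L P 0 = inertia P"
  using the1_equality[OF ex_herbrand_psi[of P 0], of 0] herbrand_phi_0[of P] ram_lower_0[of P]
  by (simp add: ram_upper_def herbrand_psi_def)

lemma ram_upper_G: "P \<in> primes L \<Longrightarrow> 0 \<le> v \<Longrightarrow> ram_upper K L P v \<subseteq> G"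
  unfolding ram_upper_def ram_lower_def decomposition_group_def by blast

text \<open>As \<phi> is strictly increasing, triviality at \<open>e\<close> means that \<phi> stays
  below \<open>e\<close> at \<open>idx P s - 1\<close> for every \<open>s\<close>. At an element of
  largest index every minimum in \<open>herbrand_phi_eq\<close> is
  \<open>idx P \<sigma> - 1\<close>, which leaves an inequality between natural numbers without
  \<psi>.\<close>

lemma ram_upper_trivial_iff:
  assumes P: "P \<in> primes L"
  shows "ram_upper K L P (real e) = {\<one>\<^bsub>Gal K L\<^esub>} \<longleftrightarrow>
    (\<forall>s\<in>ri P. idx P s + (\<Sum>\<sigma>\<in>ri P. idx P \<sigma>) < (e + 1) * card (inertia P))"
proof -
  define u where "u = herbrand_psi K L P (real e)"
  have u: "0 \<le> u" "herbrand_phi K L P u = real e" using herbrand_psi[OF P, of "real e"] by (simp_all add: u_def)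
  define c where "c = (\<lambda>s. real (idx P s) - 1)"
  have c: "0 \<le> c s" if "s \<in> ri P" for s using idx_pos[OF P that] by (simp add: c_def)
  have "ram_upper K L P (real e) = {\<one>\<^bsub>Gal K L\<^esub>} \<longleftrightarrow> (\<forall>s\<in>ri P. \<not> u \<le> c s)"
    unfolding ram_upper_def u_def[symmetric] ram_lower_idx[OF P u(1)] c_def ri_def by blast
  also have "\<dots> \<longleftrightarrow> (\<forall>s\<in>ri P. c s < u)" by (simp add: not_le)
  also have "\<dots> \<longleftrightarrow> (\<forall>s\<in>ri P. herbrand_phi K L P (c s) < real e)"
  proof (rule ball_cong[OF refl])
    fix s assume s: "s \<in> ri P"
    show "c s < u \<longleftrightarrow> herbrand_phi K L P (c s) < real e"
      using herbrand_phi_strict_mono[OF P c[OF s], of u] herbrand_phi_strict_mono[OF P u(1), of "c s"] u(2)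
      by (cases u "c s" rule: linorder_cases) auto
  qed
  also have "\<dots> \<longleftrightarrow> (\<forall>s\<in>ri P. idx P s + (\<Sum>\<sigma>\<in>ri P. idx P \<sigma>) < (e + 1) * card (inertia P))"
  proof (cases "ri P = {}")
    case False
    define M where "M = Max (idx P ` ri P)"
    have "M \<in> idx P ` ri P" unfolding M_def using False finite_ri by (intro Max_in) auto
    then obtain m where m: "m \<in> ri P" "idx P m = M" by auto
    have max: "idx P s \<le> idx P m" if "s \<in> ri P" for s
      using that finite_ri unfolding m(2) M_def by (intro Max_ge) auto
    have "herbrand_phi K L P (c m) * real (card (inertia P)) = c m + (\<Sum>\<sigma>\<in>ri P. real (idx P \<sigma>) - 1)"
      unfolding herbrand_phi_eq[OF P c[OF m(1)]] using max by (intro arg_cong2[where f = "(+)"] sum.cong) (auto simp: c_def)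
    \<comment> \<open>One unit is lost for \<open>m\<close> and one for each element of
      \<open>ri P\<close>, in all the order of the inertia group; moved to the other side it turns
      \<open>e\<close> into \<open>e + 1\<close>.\<close>
    also have "\<dots> = real (idx P m) + (\<Sum>\<sigma>\<in>ri P. real (idx P \<sigma>)) - real (card (inertia P))"
      by (simp add: c_def sum_subtractf card_inertia[OF P])
    finally have phi_m: "herbrand_phi K L P (c m) * real (card (inertia P)) =
        real (idx P m) + (\<Sum>\<sigma>\<in>ri P. real (idx P \<sigma>)) - real (card (inertia P))" .
    have "herbrand_phi K L P (c m) < real e \<longleftrightarrow>
        herbrand_phi K L P (c m) * real (card (inertia P)) < real e * real (card (inertia P))"
      by (rule mult_less_cancel_right_pos[OF card_inertia_pos[OF P], symmetric])
    also have "\<dots> \<longleftrightarrow>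
        real (idx P m) + (\<Sum>\<sigma>\<in>ri P. real (idx P \<sigma>)) < (real e + 1) * real (card (inertia P))"
      unfolding phi_m distrib_right by linarith
    also have "\<dots> \<longleftrightarrow> real (idx P m + (\<Sum>\<sigma>\<in>ri P. idx P \<sigma>)) < real ((e + 1) * card (inertia P))"
      by (simp only: of_nat_add of_nat_mult of_nat_sum of_nat_1)
    also have "\<dots> \<longleftrightarrow> idx P m + (\<Sum>\<sigma>\<in>ri P. idx P \<sigma>) < (e + 1) * card (inertia P)"
      by (rule of_nat_less_iff)
    finally have key: "herbrand_phi K L P (c m) < real e \<longleftrightarrow>
        idx P m + (\<Sum>\<sigma>\<in>ri P. idx P \<sigma>) < (e + 1) * card (inertia P)" .
    have "herbrand_phi K L P (c s) \<le> herbrand_phi K L P (c m)" if "s \<in> ri P" for s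
      using herbrand_phi_strict_mono[OF P c[OF that], of "c m"] max[OF that] by (cases "idx P s = idx P m") (auto simp: c_def)
    then have "(\<forall>s\<in>ri P. herbrand_phi K L P (c s) < real e) \<longleftrightarrow> herbrand_phi K L P (c m) < real e"
      using m(1) by (meson le_less_trans)
    also note key
    also have "idx P m + (\<Sum>\<sigma>\<in>ri P. idx P \<sigma>) < (e + 1) * card (inertia P) \<longleftrightarrow>
        (\<forall>s\<in>ri P. idx P s + (\<Sum>\<sigma>\<in>ri P. idx P \<sigma>) < (e + 1) * card (inertia P))"
      using m(1) max by (meson add_le_mono1 le_less_trans)
    finally show ?thesis .
  qed simp
  finally show ?thesis .
qed

lemma ex_ram_upper_trivial: "P \<in> primes L \<Longrightarrow> \<exists>e. ram_upper K L P (real e) = {\<one>\<^bsub>Gal K L\<^esub>}"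
proof -
  assume P: "P \<in> primes L"
  define B where "B = 2 * (\<Sum>\<sigma>\<in>ri P. idx P \<sigma>)"
  have "idx P s + (\<Sum>\<sigma>\<in>ri P. idx P \<sigma>) < (B + 1) * card (inertia P)" if "s \<in> ri P" for s
  proof -
    have "idx P s \<le> (\<Sum>\<sigma>\<in>ri P. idx P \<sigma>)" using that finite_ri by (intro member_le_sum) auto
    then have "idx P s + (\<Sum>\<sigma>\<in>ri P. idx P \<sigma>) < B + 1" by (simp add: B_def)
    also have "\<dots> \<le> (B + 1) * card (inertia P)" using card_inertia[OF P] by simp
    finally show ?thesis .
  qed
  then show ?thesis using ram_upper_trivial_iff[OF P] by blast
qed

section \<open>Conjugate primes and local conductor exponents\<close>

lemma acts_conj:
  assumes \<sigma>: "\<sigma> \<in> G" and P: "P \<in> primes L" and \<tau>: "\<tau> \<in> acts P n"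
  shows "\<sigma> \<otimes>\<^bsub>Gal K L\<^esub> \<tau> \<otimes>\<^bsub>Gal K L\<^esub> inv\<^bsub>Gal K L\<^esub> \<sigma> \<in> acts (\<sigma> ` P) n"
proof -
  have \<tau>G: "\<tau> \<in> G" using \<tau> acts_G by blast
  have "(\<sigma> \<otimes>\<^bsub>Gal K L\<^esub> \<tau> \<otimes>\<^bsub>Gal K L\<^esub> inv\<^bsub>Gal K L\<^esub> \<sigma>) x - x \<in> L.pw (\<sigma> ` P) n" if x: "x \<in> ints L" for x
  proof -
    define y where "y = (inv\<^bsub>Gal K L\<^esub> \<sigma>) x"
    have y: "y \<in> ints L" using gal_ints[OF Gal.inv_closed[OF \<sigma>] x] by (simp add: y_def)
    have \<sigma>y: "\<sigma> y = x" using inv_app(2)[OF \<sigma> L.ints_mem[OF x]] by (simp add: y_def)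
    have "(\<sigma> \<otimes>\<^bsub>Gal K L\<^esub> \<tau> \<otimes>\<^bsub>Gal K L\<^esub> inv\<^bsub>Gal K L\<^esub> \<sigma>) x = \<sigma> (\<tau> y)"
      using mult_app[OF Gal.m_closed[OF \<sigma> \<tau>G] Gal.inv_closed[OF \<sigma>] L.ints_mem[OF x]]
        mult_app[OF \<sigma> \<tau>G L.ints_mem[OF y]] by (simp add: y_def)
    then have "(\<sigma> \<otimes>\<^bsub>Gal K L\<^esub> \<tau> \<otimes>\<^bsub>Gal K L\<^esub> inv\<^bsub>Gal K L\<^esub> \<sigma>) x - x = \<sigma> (\<tau> y - y)"
      using gal_diff[OF \<sigma> gal_ints[OF \<tau>G y] y] \<sigma>y by simp
    moreover have "\<tau> y - y \<in> L.pw P n" using \<tau> y by (auto simp: acts_def)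
    ultimately show ?thesis using image_pw[OF \<sigma> P, of n] by (metis imageI)
  qed
  then show ?thesis using \<sigma> \<tau>G by (simp add: acts_def)
qed

lemma acts_conj_image:
  assumes \<sigma>: "\<sigma> \<in> G" and P: "P \<in> primes L"
  shows "acts (\<sigma> ` P) n = (\<lambda>\<tau>. \<sigma> \<otimes>\<^bsub>Gal K L\<^esub> \<tau> \<otimes>\<^bsub>Gal K L\<^esub> inv\<^bsub>Gal K L\<^esub> \<sigma>) ` acts P n"
proof
  show "(\<lambda>\<tau>. \<sigma> \<otimes>\<^bsub>Gal K L\<^esub> \<tau> \<otimes>\<^bsub>Gal K L\<^esub> inv\<^bsub>Gal K L\<^esub> \<sigma>) ` acts P n \<subseteq> acts (\<sigma> ` P) n"
    using acts_conj[OF assms] by blast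
  show "acts (\<sigma> ` P) n \<subseteq> (\<lambda>\<tau>. \<sigma> \<otimes>\<^bsub>Gal K L\<^esub> \<tau> \<otimes>\<^bsub>Gal K L\<^esub> inv\<^bsub>Gal K L\<^esub> \<sigma>) ` acts P n"
  proof
    fix \<rho> assume \<rho>: "\<rho> \<in> acts (\<sigma> ` P) n"
    then have \<rho>G: "\<rho> \<in> G" using acts_G by blast
    have "inv\<^bsub>Gal K L\<^esub> \<sigma> \<otimes>\<^bsub>Gal K L\<^esub> \<rho> \<otimes>\<^bsub>Gal K L\<^esub> \<sigma> \<in> acts P n"
      using acts_conj[OF Gal.inv_closed[OF \<sigma>] image_prime[OF \<sigma> P] \<rho>] image_inv(1)[OF \<sigma> L.primesD(4)[OF P]] \<sigma> by simp
    moreover have "\<rho> = \<sigma> \<otimes>\<^bsub>Gal K L\<^esub> (inv\<^bsub>Gal K L\<^esub> \<sigma> \<otimes>\<^bsub>Gal K L\<^esub> \<rho> \<otimes>\<^bsub>Gal K L\<^esub> \<sigma>) \<otimes>\<^bsub>Gal K L\<^esub> inv\<^bsub>Gal K L\<^esub> \<sigma>"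
    proof -
      have "\<sigma> \<otimes>\<^bsub>Gal K L\<^esub> (inv\<^bsub>Gal K L\<^esub> \<sigma> \<otimes>\<^bsub>Gal K L\<^esub> \<rho>) = \<rho>"
        using \<sigma> \<rho>G by (simp add: Gal.m_assoc[symmetric])
      then show ?thesis using \<sigma> \<rho>G by (simp add: Gal.m_assoc)
    qed
    ultimately show "\<rho> \<in> (\<lambda>\<tau>. \<sigma> \<otimes>\<^bsub>Gal K L\<^esub> \<tau> \<otimes>\<^bsub>Gal K L\<^esub> inv\<^bsub>Gal K L\<^esub> \<sigma>) ` acts P n" by blast
  qed
qed

text \<open>Conjugation carries the lower groups of \<open>P\<close> to those of its image and
  preserves their orders, so both primes have the same \<phi> and \<psi>.\<close>

lemma ram_upper_conj:
  assumes \<sigma>: "\<sigma> \<in> G" and P: "P \<in> primes L"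
  shows "ram_upper K L (\<sigma> ` P) (real e) = {\<one>\<^bsub>Gal K L\<^esub>} \<longleftrightarrow> ram_upper K L P (real e) = {\<one>\<^bsub>Gal K L\<^esub>}"
proof -
  define c where "c = (\<lambda>\<tau>. \<sigma> \<otimes>\<^bsub>Gal K L\<^esub> \<tau> \<otimes>\<^bsub>Gal K L\<^esub> inv\<^bsub>Gal K L\<^esub> \<sigma>)"
  have inj: "inj_on c G"
    unfolding c_def using \<sigma> by (intro inj_onI) simp
  have c1: "c \<one>\<^bsub>Gal K L\<^esub> = \<one>\<^bsub>Gal K L\<^esub>" using \<sigma> by (simp add: c_def)
  have low: "ram_lower K L (\<sigma> ` P) t = c ` ram_lower K L P t" if "0 \<le> t" for t
    using ram_lower_eq[OF P that] ram_lower_eq[OF image_prime[OF \<sigma> P] that] acts_conj_image[OF \<sigma> P]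
    unfolding c_def by simp
  have card: "card (ram_lower K L (\<sigma> ` P) t) = card (ram_lower K L P t)" if "0 \<le> t" for t
    unfolding low[OF that] ram_lower_eq[OF P that]
    by (rule card_image) (rule inj_on_subset[OF inj acts_G])
  have phi: "herbrand_phi K L (\<sigma> ` P) u = herbrand_phi K L P u" for u
    unfolding herbrand_phi_def by (rule Henstock_Kurzweil_Integration.integral_cong) (simp add: card)
  have psi: "herbrand_psi K L (\<sigma> ` P) v = herbrand_psi K L P v" for v
    unfolding herbrand_psi_def phi ..
  have "ram_upper K L (\<sigma> ` P) (real e) = c ` ram_upper K L P (real e)"
    unfolding ram_upper_def psi using low herbrand_psi(1)[OF P, of "real e"] by simp
  moreover have "c ` A = {\<one>\<^bsub>Gal K L\<^esub>} \<longleftrightarrow> A = {\<one>\<^bsub>Gal K L\<^esub>}" if "A \<subseteq> G" for A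
  proof -
    have "c ` A = c ` {\<one>\<^bsub>Gal K L\<^esub>} \<longleftrightarrow> A = {\<one>\<^bsub>Gal K L\<^esub>}" using that by (intro inj_on_image_eq_iff[OF inj]) auto
    then show ?thesis using c1 by simp
  qed
  ultimately show ?thesis using ram_upper_G[OF P, of "real e"] by simp
qed

text \<open>The local conductor exponent, read off at a prime of \<open>L\<close>; it depends only
  on the prime below by \<open>cexp_eq\<close>.\<close>

definition cexp :: "'a set \<Rightarrow> nat"
  where "cexp P = (LEAST e. ram_upper K L P (real e) = {\<one>\<^bsub>Gal K L\<^esub>})"

lemma ram_upper_cexp: "P \<in> primes L \<Longrightarrow> ram_upper K L P (real (cexp P)) = {\<one>\<^bsub>Gal K L\<^esub>}"
  unfolding cexp_def using LeastI_ex[OF ex_ram_upper_trivial] .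

lemma cexp_eq:
  assumes "P \<in> primes_above K L p" "Q \<in> primes_above K L p" shows "cexp P = cexp Q"
proof -
  obtain \<sigma> where "\<sigma> \<in> G" "Q = \<sigma> ` P" using primes_transitive[OF assms] by blast
  then show ?thesis using ram_upper_conj assms(1) by (simp add: cexp_def primes_above_def)
qed

text \<open>For each \<sigma> other than the identity one nonzero displacement is chosen. If
  \<sigma> is in the inertia group of \<open>P\<close>, then \<open>P\<close> divides that
  displacement, which has finitely many prime divisors.\<close>

lemma finite_ramified: "finite {P \<in> primes L. inertia P \<noteq> {\<one>\<^bsub>Gal K L\<^esub>}}"
proof -
  have "\<forall>\<sigma>\<in>G - {\<one>\<^bsub>Gal K L\<^esub>}. \<exists>x. x \<in> ints L \<and> \<sigma> x \<noteq> x" using moved_int by blast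
  from bchoice[OF this] obtain x where x: "\<And>\<sigma>. \<sigma> \<in> G - {\<one>\<^bsub>Gal K L\<^esub>} \<Longrightarrow> x \<sigma> \<in> ints L \<and> \<sigma> (x \<sigma>) \<noteq> x \<sigma>" by blast
  define I where "I = (\<lambda>\<sigma>. L.princ (\<sigma> (x \<sigma>) - x \<sigma>))"
  have I: "I \<sigma> \<in> carrier (ideal_monoid L)" if "\<sigma> \<in> G - {\<one>\<^bsub>Gal K L\<^esub>}" for \<sigma>
    unfolding I_def using x[OF that] gal_ints that by (intro L.princ_M L.ints_diff) auto
  have "{P \<in> primes L. inertia P \<noteq> {\<one>\<^bsub>Gal K L\<^esub>}} \<subseteq>
      (\<Union>\<sigma>\<in>G - {\<one>\<^bsub>Gal K L\<^esub>}. {P \<in> primes L. ideal_val L P (I \<sigma>) \<noteq> 0})"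
  proof
    fix P assume "P \<in> {P \<in> primes L. inertia P \<noteq> {\<one>\<^bsub>Gal K L\<^esub>}}"
    then have P: "P \<in> primes L" and "inertia P \<noteq> {\<one>\<^bsub>Gal K L\<^esub>}" by blast+
    then obtain \<sigma> where \<sigma>: "\<sigma> \<in> inertia P" "\<sigma> \<noteq> \<one>\<^bsub>Gal K L\<^esub>" using one_acts[OF P] unfolding inertia_def by blast
    then have \<sigma>G: "\<sigma> \<in> G - {\<one>\<^bsub>Gal K L\<^esub>}" using acts_G unfolding inertia_def by blast
    have "\<sigma> (x \<sigma>) - x \<sigma> \<in> L.pw P (Suc 0)" using \<sigma>(1) x[OF \<sigma>G] unfolding inertia_def acts_def by blast
    then have "I \<sigma> \<subseteq> P" unfolding I_def using L.princ_le[OF L.primesD(1)[OF P]] L.pw_1[OF P] by blast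
    then have "ideal_val L P (I \<sigma>) \<noteq> 0" using L.val_pos_iff[OF P I[OF \<sigma>G]] by simp
    then show "P \<in> (\<Union>\<sigma>\<in>G - {\<one>\<^bsub>Gal K L\<^esub>}. {P \<in> primes L. ideal_val L P (I \<sigma>) \<noteq> 0})" using P \<sigma>G by blast
  qed
  moreover have "finite (\<Union>\<sigma>\<in>G - {\<one>\<^bsub>Gal K L\<^esub>}. {P \<in> primes L. ideal_val L P (I \<sigma>) \<noteq> 0})"
    using finite_G L.finite_val_support[OF I] by (intro finite_UN_I) blast+
  ultimately show ?thesis by (rule finite_subset)
qed

lemma cexp_pos_iff: "P \<in> primes L \<Longrightarrow> 0 < cexp P \<longleftrightarrow> inertia P \<noteq> {\<one>\<^bsub>Gal K L\<^esub>}"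
  using ram_upper_cexp[of P] ram_upper_0[of P] Least_le[of "\<lambda>e. ram_upper K L P (real e) = {\<one>\<^bsub>Gal K L\<^esub>}" 0]
  unfolding cexp_def[symmetric] by (cases "cexp P = 0") auto

text \<open>The definite description is justified here: primes over the same prime of
  \<open>K\<close> have equal exponents, almost all exponents vanish, and valuations determine an
  ideal.\<close>

lemma conductor:
  shows "conductor K L \<in> carrier (ideal_monoid K)"
    and "P \<in> primes L \<Longrightarrow> ideal_val K (P \<inter> ints K) (conductor K L) = cexp P"
proof -
  define ov where "ov = (\<lambda>p. SOME P. P \<in> primes_above K L p)"
  have ov: "ov p \<in> primes_above K L p" if "p \<in> primes K" for p
    unfolding ov_def using someI_ex[OF ex_prime_over[OF that]] .
  have "{p \<in> primes K. cexp (ov p) \<noteq> 0} \<subseteq> (\<lambda>P. P \<inter> ints K) ` {P \<in> primes L. inertia P \<noteq> {\<one>\<^bsub>Gal K L\<^esub>}}"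
  proof
    fix p assume p: "p \<in> {p \<in> primes K. cexp (ov p) \<noteq> 0}"
    then have "ov p \<in> primes L" "ov p \<inter> ints K = p" using ov by (auto simp: primes_above_def)
    then show "p \<in> (\<lambda>P. P \<inter> ints K) ` {P \<in> primes L. inertia P \<noteq> {\<one>\<^bsub>Gal K L\<^esub>}}"
      using p cexp_pos_iff[of "ov p"] by (intro image_eqI[of _ _ "ov p"]) auto
  qed
  then have "finite {p \<in> primes K. cexp (ov p) \<noteq> 0}"
    using finite_ramified by (rule finite_subset[OF _ finite_imageI])
  then obtain f where f: "f \<in> carrier (ideal_monoid K)" "\<And>p. p \<in> primes K \<Longrightarrow> ideal_val K p f = cexp (ov p)"
    using K.ex_ideal_val'[of "\<lambda>p. cexp (ov p)"] by blast
  have "conductor K L = f"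
    unfolding conductor_def cexp_def[symmetric]
  proof (rule the_equality)
    show "f \<in> carrier (ideal_monoid K) \<and> (\<forall>p\<in>primes K. \<forall>P\<in>primes_above K L p. ideal_val K p f = cexp P)"
      using f cexp_eq[OF ov] by (intro conjI ballI) simp_all
    fix g assume g: "g \<in> carrier (ideal_monoid K) \<and> (\<forall>p\<in>primes K. \<forall>P\<in>primes_above K L p. ideal_val K p g = cexp P)"
    show "g = f"
    proof (rule K.M_eqI)
      show "ideal_val K p g = ideal_val K p f" if "p \<in> primes K" for p
        using g f(2)[OF that] ov[OF that] that by simp
    qed (use f g in simp_all)
  qed
  then show "conductor K L \<in> carrier (ideal_monoid K)" using f(1) by simp
  assume P: "P \<in> primes L"
  then show "ideal_val K (P \<inter> ints K) (conductor K L) = cexp P"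
    using \<open>conductor K L = f\<close> f(2)[OF contraction[OF P]] cexp_eq[OF ov[OF contraction[OF P]] contraction_above[OF P]]
    by simp
qed

end

section \<open>Residue fields and local generators\<close>

context nfield begin

lemma frobenius_add:
  assumes p: "Factorial_Ring.prime (p :: nat)" "of_nat p \<in> P" and P: "P \<in> primes K" and ab: "a \<in> ints K" "b \<in> ints K"
  shows "(a + b) ^ p - (a ^ p + b ^ p) \<in> P"
proof -
  have p0: "0 < p" using prime_gt_0_nat[OF p(1)] .
  have "(a + b) ^ p = (\<Sum>k\<le>p. of_nat (p choose k) * a ^ k * b ^ (p - k))" by (rule binomial_ring)
  also have "{..p} = insert 0 (insert p {0<..<p})" using p0 by auto
  also have "(\<Sum>k\<in>\<dots>. of_nat (p choose k) * a ^ k * b ^ (p - k)) =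
      a ^ p + b ^ p + (\<Sum>k\<in>{0<..<p}. of_nat (p choose k) * a ^ k * b ^ (p - k))"
    using p0 by simp
  finally have "(a + b) ^ p - (a ^ p + b ^ p) = (\<Sum>k\<in>{0<..<p}. of_nat (p choose k) * a ^ k * b ^ (p - k))"
    by simp
  also have "\<dots> \<in> P"
  proof (rule ideal_sum[OF primesD(1)[OF P]])
    fix k assume k: "k \<in> {0<..<p}"
    then have "p dvd (p choose k)" using p(1) by (intro dvd_choose_prime) auto
    then obtain q where "p choose k = p * q" by blast
    then have "of_nat (p choose k) * a ^ k * b ^ (p - k) = of_nat p * (of_nat q * a ^ k * b ^ (p - k))" by simp
    moreover have "of_nat q * a ^ k * b ^ (p - k) \<in> ints K" using ab by simp
    then have "of_nat p * (of_nat q * a ^ k * b ^ (p - k)) \<in> P" by (rule idealD(5)[OF primesD(1)[OF P] _ p(2)])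
    ultimately show "of_nat (p choose k) * a ^ k * b ^ (p - k) \<in> P" by (simp only:)
  qed
  finally show ?thesis .
qed

text \<open>Additivity of the power \<open>p\<close> modulo \<open>P\<close> puts
  \<open>(a - b) ^ p\<close> into \<open>P\<close>.\<close>

lemma frobenius_inj:
  assumes p: "Factorial_Ring.prime (p :: nat)" "of_nat p \<in> P" and P: "P \<in> primes K"
    and ab: "a \<in> ints K" "b \<in> ints K" "a ^ p - b ^ p \<in> P"
  shows "a - b \<in> P"
proof -
  have "(a - b + b) ^ p - ((a - b) ^ p + b ^ p) \<in> P" using ab by (intro frobenius_add[OF p P]) simp_all
  from idealD(7)[OF primesD(1)[OF P] ab(3) this] have "(a - b) ^ p \<in> P" by simp
  then show ?thesis using prime_power_mem[OF P ints_diff[OF ab(1,2)]] by blast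
qed

lemma power_diff_mem:
  assumes P: "P \<in> primes K" and ab: "a \<in> ints K" "b \<in> ints K" "a - b \<in> pw P k"
  shows "a ^ n - b ^ n \<in> pw P k"
proof (induction n)
  case (Suc n)
  have "a ^ Suc n - b ^ Suc n = a * (a ^ n - b ^ n) + b ^ n * (a - b)" by (simp add: algebra_simps)
  moreover have "a * (a ^ n - b ^ n) \<in> pw P k" using idealD(4)[OF pw_ideal[OF P] ab(1) Suc] .
  moreover have "b ^ n * (a - b) \<in> pw P k" using idealD(4)[OF pw_ideal[OF P] ints_power[OF ab(2)] ab(3)] .
  ultimately show ?case using idealD(3)[OF pw_ideal[OF P]] by simp
qed (simp add: pw_0_mem[OF P])

lemma residue_char:
  assumes P: "P \<in> primes K"
  obtains p :: nat where "Factorial_Ring.prime p" "of_nat p \<in> P"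
proof -
  note PD = primesD[OF P]
  obtain a where a: "a \<in> P" "a \<noteq> 0" "a \<in> ints K" using ideal_nonzero[OF PD(1,2)] by blast
  obtain m0 :: nat where m0: "m0 > 0" "of_nat m0 \<in> princ a" using nat_in_princ[OF a(3,2)] by blast
  then have ex: "0 < m0 \<and> of_nat m0 \<in> P" using princ_le[OF PD(1), of a] a(1) by blast
  define m where "m = (LEAST m. 0 < m \<and> of_nat m \<in> P)"
  have m: "0 < m \<and> of_nat m \<in> P" unfolding m_def by (rule LeastI[of "\<lambda>m. 0 < m \<and> of_nat m \<in> P", OF ex])
  have "m \<noteq> 1" using m PD(3) by auto
  then obtain p where p: "Factorial_Ring.prime p" "p dvd m" using prime_factor_nat by blast
  then obtain k where k: "m = p * k" by blast
  then have "of_nat p * of_nat k \<in> P" using m by simp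
  then have "of_nat p \<in> P \<or> of_nat k \<in> P" using PD(6)[OF ints_of_nat ints_of_nat] by blast
  moreover have "of_nat k \<notin> P"
  proof
    assume "of_nat k \<in> P"
    moreover have "0 < k" "k < m" using k m prime_gt_1_nat[OF p(1)] by auto
    ultimately show False using not_less_Least[of k "\<lambda>m. 0 < m \<and> of_nat m \<in> P"] unfolding m_def by blast
  qed
  ultimately show ?thesis using that p(1) by blast
qed

text \<open>The multiplicative group of the finite residue field is cyclic. The conclusion is
  phrased by congruences so that later arguments stay in the ring of integers.\<close>

lemma residue_generator:
  assumes P: "P \<in> primes K"
  obtains x where "x \<in> ints K" "x \<notin> P" "\<And>y. y \<in> ints K \<Longrightarrow> y \<notin> P \<Longrightarrow> \<exists>j :: nat. y - x ^ j \<in> P"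
proof -
  note PD = primesD[OF P]
  define R where "R = integers K"
  have max: "maximalideal P R" using P by (simp add: primes_def R_def)
  interpret ideal P R using PD(1) by (simp add: R_def)
  have cr: "cring R" using domain.axioms(1)[OF domain_integers] by (simp add: R_def)
  define Q where "Q = R Quot P"
  interpret Q: field Q unfolding Q_def by (rule maximalideal.quotient_is_field[OF max cr])
  define h where "h = (\<lambda>x. P +>\<^bsub>R\<^esub> x)"
  have hom: "h \<in> Ring.ring_hom R Q" unfolding Q_def h_def by (rule rcos_ring_hom)
  have carr: "carrier Q = h ` ints K"
    unfolding Q_def FactRing_def h_def A_RCOSETS_def' by (auto simp: R_def)
  have eq: "h x = h y \<longleftrightarrow> x - y \<in> P" if "x \<in> ints K" "y \<in> ints K" for x y
    using quotient_eq_iff_same_a_r_cos[OF is_ideal, of x y] that unfolding h_def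
    by (simp add: R_def a_minus_def integers_a_inv)
  have pow: "h (x ^ n) = h x [^]\<^bsub>Q\<^esub> n" if x: "x \<in> ints K" for x n
  proof (induction n)
    case 0
    then show ?case using ring_hom_one[OF hom] by (simp add: R_def)
  next
    case (Suc n)
    have "h (x ^ Suc n) = h (x ^ n) \<otimes>\<^bsub>Q\<^esub> h x"
      using ring_hom_mult[OF hom, of "x ^ n" x] x by (simp add: R_def mult.commute)
    then show ?case using Suc by (simp add: Q.nat_pow_Suc)
  qed
  have zero: "\<zero>\<^bsub>Q\<^esub> = h 0"
    using Ring.ring_hom_zero[OF hom] cr Q.ring_axioms by (simp add: R_def cring_def)
  obtain S where S: "finite S" "S \<subseteq> ints K" "\<And>z. z \<in> ints K \<Longrightarrow> \<exists>s\<in>S. z - s \<in> P"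
    using finite_representatives[OF PD(1,2)] by blast
  have "carrier Q \<subseteq> h ` S"
  proof
    fix q assume "q \<in> carrier Q"
    then obtain z where z: "z \<in> ints K" "q = h z" using carr by blast
    then obtain s where "s \<in> S" "z - s \<in> P" using S(3) by blast
    then have "q = h s" using eq[of z s] z S(2) by blast
    then show "q \<in> h ` S" using \<open>s \<in> S\<close> by blast
  qed
  then have "finite (carrier Q)" using S(1) finite_surj by blast
  from Q.finite_field_mult_group_has_gen[OF this] obtain g where
    g: "g \<in> carrier (Multiplicative_Group.mult_of Q)" "carrier (Multiplicative_Group.mult_of Q) = {g [^]\<^bsub>Q\<^esub> i |i :: nat. i \<in> UNIV}" by (elim bexE)
  obtain x where x: "x \<in> ints K" "g = h x" using g(1) carr by auto
  show ?thesis
  proof (rule that[OF x(1)])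
    have "h x \<noteq> h 0" using g(1) x(2) zero by simp
    then show "x \<notin> P" using eq[OF x(1) ints_zero] by simp
    fix y assume y: "y \<in> ints K" "y \<notin> P"
    then have "h y \<noteq> \<zero>\<^bsub>Q\<^esub>" using eq[OF y(1) ints_zero] zero by simp
    then have "h y \<in> carrier (Multiplicative_Group.mult_of Q)" using carr y(1) by simp
    then have "h y \<in> {g [^]\<^bsub>Q\<^esub> i |i :: nat. i \<in> UNIV}" by (simp only: g(2))
    then obtain j :: nat where "h y = g [^]\<^bsub>Q\<^esub> j" by blast
    also have "\<dots> = h (x ^ j)" by (simp add: pow[OF x(1)] x(2))
    finally show "\<exists>j :: nat. y - x ^ j \<in> P" using eq[OF y(1) ints_power[OF x(1)]] by blast
  qed
qed

text \<open>If the residue characteristic divided the order \<open>N\<close> of \<open>x\<close>,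
  injectivity of the power \<open>p\<close> would give a smaller order. Hence the derivative of
  \<open>X ^ N - 1\<close> at \<open>x\<close> is a unit modulo \<open>P\<close>.\<close>

lemma residue_order:
  assumes P: "P \<in> primes K" and p: "Factorial_Ring.prime (p :: nat)" "of_nat p \<in> P"
    and x: "x \<in> ints K" "x \<notin> P" "\<And>y. y \<in> ints K \<Longrightarrow> y \<notin> P \<Longrightarrow> \<exists>j :: nat. y - x ^ j \<in> P"
  obtains N where "0 < N" "x ^ N - 1 \<in> P" "of_nat N \<notin> P"
proof -
  note PD = primesD[OF P]
  obtain y where y: "y \<in> ints K" "1 - y * x \<in> P" using prime_coprime_elt[OF P x(1,2)] by blast
  have "y \<notin> P"
  proof
    assume "y \<in> P"
    then have "1 - y * x + y * x \<in> P" using idealD(3)[OF PD(1) y(2)] idealD(5)[OF PD(1) x(1)] by blast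
    then show False using PD(3) by simp
  qed
  then obtain j :: nat where j: "y - x ^ j \<in> P" using x(3) y(1) by blast
  have "(1 - y * x) + (y - x ^ j) * x \<in> P" using idealD(3)[OF PD(1) y(2)] idealD(5)[OF PD(1) x(1) j] by blast
  then have "- (1 - x ^ Suc j) \<in> P" using idealD(6)[OF PD(1), of "1 - x ^ Suc j"] by (simp add: algebra_simps)
  then have ex: "0 < Suc j \<and> x ^ Suc j - 1 \<in> P" by simp
  define N where "N = (LEAST N. 0 < N \<and> x ^ N - 1 \<in> P)"
  have N: "0 < N \<and> x ^ N - 1 \<in> P"
    unfolding N_def by (rule LeastI[of "\<lambda>N. 0 < N \<and> x ^ N - 1 \<in> P", OF ex])
  have "of_nat N \<notin> P"
  proof
    assume NP: "of_nat N \<in> P"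
    have "p dvd N"
    proof (rule ccontr)
      assume "\<not> p dvd N"
      then have "gcd N p = 1" using p(1) by (metis coprime_commute coprime_iff_gcd_eq_1 prime_imp_coprime)
      then obtain u v where "N * u = p * v + 1" using bezout_nat[of N p] N by auto
      then have "of_nat N * of_nat u - of_nat p * of_nat v = (1 :: 'a)"
        by (metis add_diff_cancel_left' of_nat_1 of_nat_add of_nat_mult)
      moreover have "of_nat N * of_nat u - of_nat p * of_nat v \<in> P"
        using idealD(5)[OF PD(1) ints_of_nat] idealD(7)[OF PD(1)] NP p(2) by blast
      ultimately show False using PD(3) by simp
    qed
    then obtain M where M: "N = M * p" by (metis dvd_div_mult_self)
    have "(x ^ M) ^ p - 1 ^ p \<in> P" using N M by (simp add: power_mult)
    then have "x ^ M - 1 \<in> P" using frobenius_inj[OF p P ints_power[OF x(1)] ints_one] by blast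
    moreover have "0 < M" "M < N" using M N prime_gt_1_nat[OF p(1)] by auto
    ultimately show False using not_less_Least[of M "\<lambda>N. 0 < N \<and> x ^ N - 1 \<in> P"] unfolding N_def by blast
  qed
  then show ?thesis using that N by blast
qed

lemma power_add_expand:
  assumes "a \<in> ints K" "b \<in> ints K"
  shows "\<exists>c\<in>ints K. (a + b) ^ Suc n = a ^ Suc n + of_nat (Suc n) * a ^ n * b + b * b * c"
proof (induction n)
  case 0
  show ?case by (rule bexI[of _ 0]) auto
next
  case (Suc n)
  then obtain c where c: "c \<in> ints K" "(a + b) ^ Suc n = a ^ Suc n + of_nat (Suc n) * a ^ n * b + b * b * c" by blast
  have "(a + b) ^ Suc (Suc n) = (a + b) * (a + b) ^ Suc n" by simp
  also have "\<dots> = a ^ Suc (Suc n) + of_nat (Suc (Suc n)) * a ^ Suc n * b + b * b * (of_nat (Suc n) * a ^ n + (a + b) * c)"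
    unfolding c(2) by (simp add: algebra_simps)
  finally show ?case using assms c(1) by (intro bexI[of _ "of_nat (Suc n) * a ^ n + (a + b) * c"]) simp_all
qed

text \<open>A single \<open>x\<close> yields both the residue field, by its powers, and a
  uniformizer, by \<open>x ^ N - 1\<close>. If the first choice has valuation at least 2 there,
  adding \<pi> changes \<open>x ^ N - 1\<close> modulo the square of \<open>P\<close> by
  \<open>N * x ^ (N - 1) * \<pi>\<close>, which has valuation exactly 1.\<close>

lemma ex_local_generator:
  assumes P: "P \<in> primes K"
  obtains x N where "x \<in> ints K" "x \<notin> P" "\<And>y. y \<in> ints K \<Longrightarrow> y \<notin> P \<Longrightarrow> \<exists>j :: nat. y - x ^ j \<in> P"
    "x ^ N - 1 \<in> P" "x ^ N - 1 \<notin> pw P 2"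
proof -
  note PD = primesD[OF P]
  obtain x where x: "x \<in> ints K" "x \<notin> P" "\<And>y. y \<in> ints K \<Longrightarrow> y \<notin> P \<Longrightarrow> \<exists>j :: nat. y - x ^ j \<in> P"
    using residue_generator[OF P] by blast
  obtain p :: nat where p: "Factorial_Ring.prime p" "of_nat p \<in> P" using residue_char[OF P] by blast
  obtain N where N: "0 < N" "x ^ N - 1 \<in> P" "of_nat N \<notin> P" using residue_order[OF P p x] by blast
  show ?thesis
  proof (cases "x ^ N - 1 \<in> pw P 2")
    case False
    then show ?thesis using that[OF x N(2)] by blast
  next
    case True
    obtain \<pi> where \<pi>: "\<pi> \<in> ints K" "\<pi> \<noteq> 0" "ev P \<pi> = 1" using ex_uniformizer[OF P] by blast
    have \<pi>P: "\<pi> \<in> P" using ev_pos_iff[OF P \<pi>(1,2)] \<pi>(3) by simp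
    have xx: "x + \<pi> - x \<in> pw P (Suc 0)" using \<pi>P pw_1[OF P] by simp
    obtain c where c: "c \<in> ints K"
      "(x + \<pi>) ^ Suc (N - 1) = x ^ Suc (N - 1) + of_nat (Suc (N - 1)) * x ^ (N - 1) * \<pi> + \<pi> * \<pi> * c"
      using power_add_expand[OF x(1) \<pi>(1), of "N - 1"] by blast
    then have eq: "(x + \<pi>) ^ N - 1 = (x ^ N - 1) + of_nat N * x ^ (N - 1) * \<pi> + \<pi> * \<pi> * c" using N(1) by simp
    have two: "Suc 0 + Suc 0 = 2" by simp
    have "\<pi> \<in> pw P (Suc 0)" using \<pi>P pw_1[OF P] by simp
    from pw_mult_mem[OF P this this] have \<pi>2: "\<pi> * \<pi> * c \<in> pw P 2"
      unfolding two by (rule idealD(5)[OF pw_ideal[OF P] c(1)])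
    have x0: "x \<noteq> 0" "(of_nat N :: 'a) \<noteq> 0" using x(2) N(1) idealD(2)[OF PD(1)] by auto
    have "ev P (of_nat N * x ^ (N - 1) * \<pi>) = ev P (of_nat N) + (N - 1) * ev P x + 1"
      using x0 x(1) \<pi> by (simp add: ev_mult[OF P] ev_power[OF P])
    moreover have "ev P (of_nat N) = 0" "ev P x = 0"
      using ev_pos_iff[OF P ints_of_nat x0(2)] ev_pos_iff[OF P x(1) x0(1)] N(3) x(2) by auto
    ultimately have "of_nat N * x ^ (N - 1) * \<pi> \<notin> pw P 2"
      using mem_pw_iff[OF P, of "of_nat N * x ^ (N - 1) * \<pi>" 2] x0 \<pi> x(1) by simp
    moreover have "of_nat N * x ^ (N - 1) * \<pi> = ((x + \<pi>) ^ N - 1) - (x ^ N - 1) - \<pi> * \<pi> * c" using eq by simp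
    ultimately have n2: "(x + \<pi>) ^ N - 1 \<notin> pw P 2" using idealD(7)[OF pw_ideal[OF P]] True \<pi>2 by metis
    have xi: "x + \<pi> \<in> ints K" using x \<pi> by simp
    have cong: "(x + \<pi>) ^ n - x ^ n \<in> P" for n using power_diff_mem[OF P xi x(1) xx] pw_1[OF P] by simp
    show ?thesis
    proof (rule that[OF xi _ _ _ n2])
      show "x + \<pi> \<notin> P" using idealD(7)[OF PD(1) _ \<pi>P, of "x + \<pi>"] x(2) by auto
      show "(x + \<pi>) ^ N - 1 \<in> P" using idealD(3)[OF PD(1) cong[of N] N(2)] by simp
      fix y assume "y \<in> ints K" "y \<notin> P"
      then obtain j :: nat where j: "y - x ^ j \<in> P" using x(3) by blast
      from idealD(7)[OF PD(1) this cong[of j]] have "y - (x + \<pi>) ^ j \<in> P" by simp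
      then show "\<exists>j :: nat. y - (x + \<pi>) ^ j \<in> P" by blast
    qed
  qed
qed

end

context galois begin

text \<open>The witness lies in all conjugates of \<open>P\<close> other than \<open>P\<close>, so that a small displacement forces \<open>s\<close>
  into the decomposition group, and polynomials in it approximate all integers modulo powers of \<open>P\<close>.\<close>

lemma ex_minimal_displacement:
  assumes P: "P \<in> primes L"
  obtains x where "x \<in> ints L" "\<And>s n. s \<in> G \<Longrightarrow> s x - x \<in> L.pw P n \<Longrightarrow> s \<in> acts P n"
proof -
  note PD = L.primesD[OF P]
  obtain x1 N where x1: "x1 \<in> ints L" "x1 \<notin> P" "\<And>y. y \<in> ints L \<Longrightarrow> y \<notin> P \<Longrightarrow> \<exists>j :: nat. y - x1 ^ j \<in> P"
    "x1 ^ N - 1 \<in> P" "x1 ^ N - 1 \<notin> L.pw P 2" using L.ex_local_generator[OF P] by blast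
  define S where "S = (\<lambda>s. s ` P) ` G - {P}"
  have S: "finite S" "S \<subseteq> primes L" "P \<notin> S"
    unfolding S_def using finite_G image_prime P by auto
  obtain e where e: "e \<in> ints L" "\<And>R. R \<in> S \<Longrightarrow> e \<in> R" "1 - e \<in> L.pw P 2"
    using L.crt_elt[OF P S] by blast
  define x where "x = x1 * e"
  have x: "x \<in> ints L" using x1 e by (simp add: x_def)
  have "- x1 * (1 - e) \<in> L.pw P 2"
    by (rule L.idealD(4)[OF L.pw_ideal[OF P] _ e(3)]) (use x1(1) in simp)
  \<comment> \<open>Agreement modulo the square of \<open>P\<close> keeps both the residue class of
    \<open>x1\<close> and the valuation 1 of \<open>x1 ^ N - 1\<close>.\<close>
  then have xx1: "x - x1 \<in> L.pw P 2" by (simp add: x_def algebra_simps)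
  have pow_cong2: "x ^ n - x1 ^ n \<in> L.pw P 2" for n by (rule L.power_diff_mem[OF P x x1(1) xx1])
  have pow_cong: "x ^ n - x1 ^ n \<in> P" for n using L.pw_pos_sub[OF P pow_cong2] by simp
  have xP: "x \<notin> P"
  proof
    assume "x \<in> P"
    from L.idealD(7)[OF PD(1) this pow_cong[of 1]] show False using x1(2) by simp
  qed
  define \<rho> where "\<rho> = x ^ N - 1"
  have \<rho>: "\<rho> \<in> ints L" using x by (simp add: \<rho>_def)
  have \<rho>eq: "\<rho> = (x ^ N - x1 ^ N) + (x1 ^ N - 1)" by (simp add: \<rho>_def)
  have "\<rho> \<in> P" unfolding \<rho>eq using L.idealD(3)[OF PD(1) pow_cong x1(4)] .
  have "\<rho> \<notin> L.pw P 2"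
  proof
    assume "\<rho> \<in> L.pw P 2"
    from L.idealD(7)[OF L.pw_ideal[OF P] this pow_cong2[of N]] show False using x1(5) by (simp add: \<rho>eq)
  qed
  then have "\<rho> \<noteq> 0" using L.pw_0_mem[OF P] by auto
  then have ev\<rho>: "L.ev P \<rho> = 1"
    using L.mem_pw_iff[OF P \<rho>, of 2] L.ev_pos_iff[OF P \<rho>] \<open>\<rho> \<in> P\<close> \<open>\<rho> \<notin> L.pw P 2\<close> by simp
  show ?thesis
  proof (rule that[OF x])
    fix s n assume s: "s \<in> G" and sx: "s x - x \<in> L.pw P n"
    show "s \<in> acts P n"
    proof (cases "n = 0")
      case True
      then show ?thesis using s gal_ints[OF s] by (auto simp: acts_def)
    next
      case False
      have "s x - x \<in> P" using L.pw_pos_sub[OF P sx] False by simp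
      have sP: "s ` P = P"
      proof (rule ccontr)
        assume ne: "s ` P \<noteq> P"
        define R where "R = (inv\<^bsub>Gal K L\<^esub> s) ` P"
        have "s ` R = P" unfolding R_def by (rule image_inv(2)[OF s PD(4)])
        then have "R \<noteq> P" using ne by auto
        then have "R \<in> S" unfolding S_def R_def using Gal.inv_closed[OF s] by blast
        then have "x \<in> R" unfolding x_def
          using L.idealD(4)[OF _ x1(1) e(2)] S(2) L.primesD(1) by blast
        then have "s x \<in> P" using \<open>s ` R = P\<close> by blast
        from L.idealD(7)[OF PD(1) this \<open>s x - x \<in> P\<close>] show False using xP by simp
      qed
      \<comment> \<open>\<open>A\<close> is the ring on which \<open>s\<close> acts trivially modulo
        the power \<open>n\<close> of \<open>P\<close>. It contains \<open>x\<close>, \<rho> and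
        that power itself, so approximation by its elements shows that it contains every
        integer.\<close>
      define A where "A = {y \<in> ints L. s y - y \<in> L.pw P n}"
      note I = L.idealD[OF L.pw_ideal[OF P, of n]]
      have A_add: "y + z \<in> A" if "y \<in> A" "z \<in> A" for y z
      proof -
        have eq: "s (y + z) - (y + z) = (s y - y) + (s z - z)" using that by (simp add: A_def gal_add[OF s])
        have "s (y + z) - (y + z) \<in> L.pw P n" unfolding eq by (rule I(3)) (use that in \<open>simp_all add: A_def\<close>)
        then show ?thesis using that by (simp add: A_def)
      qed
      have A_mult: "y * z \<in> A" if "y \<in> A" "z \<in> A" for y z
      proof -
        have "s (y * z) - y * z = s y * (s z - z) + z * (s y - y)"
          using that by (simp add: A_def gal_mult[OF s] algebra_simps)
        moreover have "s y * (s z - z) \<in> L.pw P n" "z * (s y - y) \<in> L.pw P n"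
          using that I(4) gal_ints[OF s] by (simp_all add: A_def)
        ultimately show ?thesis using that I(3) by (simp add: A_def)
      qed
      have A0: "0 \<in> A" and A1: "1 \<in> A" using I(2) by (simp_all add: A_def gal_0[OF s] gal_1[OF s])
      have Am1: "- 1 \<in> A"
        using I(2) L.emb_uminus[OF gal_emb[OF s], of 1] by (simp add: A_def gal_1[OF s])
      have Ax: "x \<in> A" using x sx by (simp add: A_def)
      have A_pow: "y ^ j \<in> A" if "y \<in> A" for y j
        by (induction j) (use that A1 A_mult in auto)
      have A\<rho>: "\<rho> \<in> A" using A_add[OF A_pow[OF Ax] Am1] by (simp add: \<rho>_def)
      have A_pw: "y \<in> A" if "y \<in> L.pw P n" for y
      proof -
        have "s y \<in> L.pw P n" using image_pw[OF s P, of n] sP that by (metis imageI)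
        then show ?thesis using that I(1,7) by (auto simp: A_def)
      qed
      have approx: "\<exists>r\<in>A. y - r \<in> L.pw P m" if y: "y \<in> ints L" for y m
      proof (induction m)
        case 0
        show ?case using y A0 by (intro bexI[of _ 0]) simp_all
      next
        case (Suc m)
        then obtain r where r: "r \<in> A" "y - r \<in> L.pw P m" by blast
        \<comment> \<open>Digit step: \<open>\<rho> ^ m\<close> has valuation \<open>m\<close>, and
          the digit is 0 or a power of \<open>x\<close>.\<close>
        have \<rho>m: "\<rho> ^ m \<in> ints L" "\<rho> ^ m \<noteq> 0" "L.ev P (\<rho> ^ m) = m"
          using \<rho> \<open>\<rho> \<noteq> 0\<close> L.ev_power[OF P \<rho> \<open>\<rho> \<noteq> 0\<close>] ev\<rho> by simp_all
        obtain z where z: "z \<in> ints L" "y - r - \<rho> ^ m * z \<in> L.pw P (Suc m)"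
          using L.pw_step[OF P \<rho>m(1,2), of "y - r"] r(2) unfolding \<rho>m(3) by blast
        obtain a where a: "a \<in> A" "z - a \<in> P"
        proof (cases "z \<in> P")
          case True
          then show ?thesis using that[of 0] A0 by simp
        next
          case False
          then obtain j :: nat where "z - x1 ^ j \<in> P" using x1(3) z(1) by blast
          from L.idealD(7)[OF PD(1) this pow_cong[of j]] have "z - x ^ j \<in> P" by simp
          then show ?thesis using that A_pow[OF Ax] by blast
        qed
        have "\<rho> ^ m \<in> L.pw P m" using L.mem_pw_iff[OF P \<rho>m(1,2)] \<rho>m(3) by simp
        moreover have "z - a \<in> L.pw P (Suc 0)" using a(2) L.pw_1[OF P] by simp
        ultimately have "\<rho> ^ m * (z - a) \<in> L.pw P (m + Suc 0)" by (rule L.pw_mult_mem[OF P])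
        then have "\<rho> ^ m * (z - a) \<in> L.pw P (Suc m)" by simp
        from L.idealD(3)[OF L.pw_ideal[OF P] z(2) this] have "y - (r + \<rho> ^ m * a) \<in> L.pw P (Suc m)"
          by (simp add: algebra_simps)
        moreover have "r + \<rho> ^ m * a \<in> A" using A_add[OF r(1) A_mult[OF A_pow[OF A\<rho>] a(1)]] .
        ultimately show ?case by blast
      qed
      have "y \<in> A" if y: "y \<in> ints L" for y
      proof -
        obtain r where "r \<in> A" "y - r \<in> L.pw P n" using approx[OF y] by blast
        from A_add[OF A_pw[OF this(2)] this(1)] show ?thesis by simp
      qed
      then show ?thesis using s by (auto simp: A_def acts_def)
    qed
  qed
qed

end

text \<open>For \<open>j < card A\<close> the polynomial interpolating the values
  \<open>f s ^ j\<close> is \<open>X ^ j\<close> itself, and the sum is its coefficient of degree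
  \<open>card A - 1\<close>.\<close>

lemma lagrange_power_sum:
  fixes f :: "'b \<Rightarrow> 'a :: field"
  assumes A: "finite A" "inj_on f A" and j: "j < card A"
  shows "(\<Sum>s\<in>A. f s ^ j / (\<Prod>k\<in>A - {s}. f s - f k)) = (if Suc j = card A then 1 else 0)"
proof -
  define el where "el = (\<lambda>s. \<Prod>k\<in>A - {s}. [:- f k, 1:])"
  define w where "w = (\<lambda>s. \<Prod>k\<in>A - {s}. f s - f k)"
  define q where "q = (\<Sum>s\<in>A. Polynomial.smult (f s ^ j / w s) (el s)) - Polynomial.monom 1 j"
  have deg: "Polynomial.degree (el s) = card A - 1" if "s \<in> A" for s
    unfolding el_def using A(1) that by (subst degree_prod_eq_sum_degree) (auto simp: card_Diff_singleton)
  have w0: "w s \<noteq> 0" if "s \<in> A" for s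
    unfolding w_def using A that by (auto dest: inj_onD)
  have val: "poly (el s) (f t) = (if s = t then w t else 0)" if st: "s \<in> A" "t \<in> A" for s t
  proof (cases "s = t")
    case False
    then have "t \<in> A - {s}" using st by blast
    then have "(\<Prod>k\<in>A - {s}. f t - f k) = 0" using A(1) by (intro prod_zero) auto
    then show ?thesis using False by (simp add: el_def poly_prod)
  qed (simp add: el_def poly_prod w_def)
  have root: "poly q (f t) = 0" if t: "t \<in> A" for t
  proof -
    have "(\<Sum>s\<in>A. f s ^ j / w s * poly (el s) (f t)) = (\<Sum>s\<in>A. if s = t then f t ^ j else 0)"
      using val[OF _ t] w0[OF t] by (intro sum.cong) auto
    also have "\<dots> = f t ^ j" using A(1) t by simp
    finally show ?thesis by (simp add: q_def poly_sum poly_monom)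
  qed
  have "q = 0"
  proof (rule ccontr)
    assume q0: "q \<noteq> 0"
    have "Polynomial.degree q \<le> card A - 1"
      unfolding q_def
    proof (intro degree_diff_le degree_sum_le A(1))
      show "Polynomial.degree (Polynomial.smult (f s ^ j / w s) (el s)) \<le> card A - 1" if "s \<in> A" for s
        using degree_smult_le[of "f s ^ j / w s" "el s"] deg[OF that] by simp
      show "Polynomial.degree (Polynomial.monom (1 :: 'a) j) \<le> card A - 1"
        using degree_monom_le[of "1 :: 'a" j] j by simp
    qed
    moreover have "card (f ` A) \<le> card {x. poly q x = 0}"
      using root poly_roots_finite[OF q0] by (intro card_mono) auto
    moreover have "card {x. poly q x = 0} \<le> Polynomial.degree q" by (rule poly_roots_degree[OF q0])
    ultimately show False using card_image[OF A(2)] j by linarith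
  qed
  have lc: "poly.coeff (el s) (card A - 1) = 1" if "s \<in> A" for s
  proof -
    have "Polynomial.lead_coeff (el s) = 1" unfolding el_def by (rule monic_prod) simp
    then show ?thesis unfolding deg[OF that] .
  qed
  have "0 = poly.coeff q (card A - 1)" using \<open>q = 0\<close> by simp
  also have "\<dots> = (\<Sum>s\<in>A. f s ^ j / w s) - (if Suc j = card A then 1 else 0)"
  proof -
    have "j = card A - 1 \<longleftrightarrow> Suc j = card A" using j by arith
    then show ?thesis unfolding q_def using lc by (simp add: coeff_sum)
  qed
  finally show ?thesis by (simp add: w_def)
qed

section \<open>Order of inertia against ramification index\<close>

context galois begin

text \<open>All conjugates of \<open>w\<close> under \<Gamma> agree modulo \<open>P\<close>, so
  their elementary symmetric function of degree \<open>k\<close> is congruent to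
  \<open>(card \<Gamma> choose k) * w ^ k\<close>. For \<open>k\<close> the largest power of
  \<open>p\<close> dividing \<open>card \<Gamma>\<close> the binomial coefficient is prime to
  \<open>p\<close>; if \<open>w\<close> is a \<open>k\<close>-th root of \<open>y\<close> modulo
  \<open>P\<close>, dividing by this coefficient modulo \<open>p\<close> gives a fixed element in
  the class of \<open>y\<close>.\<close>

lemma residue_fixed:
  assumes P: "P \<in> primes L" and \<Gamma>: "\<Gamma> \<subseteq> inertia P" "\<And>\<sigma> \<tau>. \<sigma> \<in> \<Gamma> \<Longrightarrow> \<tau> \<in> \<Gamma> \<Longrightarrow> \<sigma> \<otimes>\<^bsub>Gal K L\<^esub> \<tau> \<in> \<Gamma>"
    "\<one>\<^bsub>Gal K L\<^esub> \<in> \<Gamma>" and y: "y \<in> ints L"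
  obtains t where "t \<in> ints L" "\<And>\<sigma>. \<sigma> \<in> \<Gamma> \<Longrightarrow> \<sigma> t = t" "y - t \<in> P"
proof -
  note PD = L.primesD[OF P]
  have \<Gamma>G: "\<Gamma> \<subseteq> G" using \<Gamma>(1) acts_G by (auto simp: inertia_def)
  have fin: "finite \<Gamma>" using finite_subset[OF \<Gamma>G finite_G] .
  have disp: "\<sigma> x - x \<in> P" if "\<sigma> \<in> \<Gamma>" "x \<in> ints L" for \<sigma> x
    using that \<Gamma>(1) L.pw_1[OF P] by (auto simp: inertia_def acts_def)
  obtain p :: nat where p: "Factorial_Ring.prime p" "of_nat p \<in> P" using L.residue_char[OF P] by blast
  obtain x where x: "x \<in> ints L" "x \<notin> P" "\<And>y. y \<in> ints L \<Longrightarrow> y \<notin> P \<Longrightarrow> \<exists>j :: nat. y - x ^ j \<in> P"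
    using L.residue_generator[OF P] by blast
  obtain N where N: "0 < N" "x ^ N - 1 \<in> P" "of_nat N \<notin> P" using L.residue_order[OF P p x] by blast
  have pN: "gcd p N = 1"
  proof -
    have "\<not> p dvd N"
    proof
      assume "p dvd N"
      then obtain k where "N = p * k" by blast
      then have "of_nat N = of_nat k * (of_nat p :: 'a)" by simp
      then show False using N(3) L.idealD(4)[OF PD(1) L.ints_of_nat p(2)] by metis
    qed
    then show ?thesis using p(1) by (metis coprime_iff_gcd_eq_1 prime_imp_coprime)
  qed
  \<comment> \<open>The residue field is perfect: the order \<open>N\<close> of its generator is
    prime to \<open>p\<close>, so exponents can be divided by \<open>p\<close> modulo
    \<open>N\<close>.\<close>
  have root: "\<exists>w\<in>ints L. w ^ p - z \<in> P" if z: "z \<in> ints L" for z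
  proof (cases "z \<in> P")
    case True
    then show ?thesis using L.idealD(6)[OF PD(1) True] prime_gt_0_nat[OF p(1)]
      by (intro bexI[of _ 0]) (simp_all add: power_0_left)
  next
    case False
    then obtain j :: nat where j: "z - x ^ j \<in> P" using x(3) z by blast
    obtain u v where uv: "p * u = N * v + 1" using bezout_nat[of p N] prime_gt_0_nat[OF p(1)] pN by auto
    have e: "u * j * p = N * (v * j) + j"
    proof -
      have "u * j * p = (p * u) * j" by simp
      also have "\<dots> = N * (v * j) + j" unfolding uv by (simp add: algebra_simps)
      finally show ?thesis .
    qed
    have "(x ^ N) ^ (v * j) - 1 ^ (v * j) \<in> L.pw P (Suc 0)"
      using N(2) x(1) L.pw_1[OF P] by (intro L.power_diff_mem[OF P]) simp_all
    then have mem: "((x ^ N) ^ (v * j) - 1) * x ^ j \<in> P"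
      using L.idealD(5)[OF PD(1) L.ints_power[OF x(1)]] L.pw_1[OF P] by simp
    have "(x ^ (u * j)) ^ p = (x ^ N) ^ (v * j) * x ^ j"
      by (simp only: power_mult[symmetric] e power_add)
    then have q: "((x ^ N) ^ (v * j) - 1) * x ^ j = (x ^ (u * j)) ^ p - x ^ j"
      by (simp add: left_diff_distrib)
    have "(x ^ (u * j)) ^ p - x ^ j - (z - x ^ j) \<in> P" using L.idealD(7)[OF PD(1) mem j] unfolding q .
    then have "(x ^ (u * j)) ^ p - z \<in> P" by simp
    then show ?thesis using x(1) by (intro bexI[of _ "x ^ (u * j)"]) simp_all
  qed
  have roots: "\<exists>w\<in>ints L. w ^ (p ^ a) - z \<in> P" if z: "z \<in> ints L" for z a
  proof (induction a)
    case 0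
    show ?case using L.idealD(2)[OF PD(1)] z by (intro bexI[of _ z]) simp_all
  next
    case (Suc a)
    then obtain v where v: "v \<in> ints L" "v ^ (p ^ a) - z \<in> P" by blast
    obtain w where w: "w \<in> ints L" "w ^ p - v \<in> P" using root[OF v(1)] by blast
    have "(w ^ p) ^ (p ^ a) - v ^ (p ^ a) \<in> L.pw P (Suc 0)"
      using w v L.pw_1[OF P] by (intro L.power_diff_mem[OF P]) simp_all
    then have "(w ^ p) ^ (p ^ a) - v ^ (p ^ a) \<in> P" using L.pw_1[OF P] by simp
    from L.idealD(3)[OF PD(1) this v(2)] have "w ^ (p ^ Suc a) - z \<in> P" by (simp add: power_mult)
    then show ?case using w(1) by blast
  qed
  define m where "m = card \<Gamma>"
  have m0: "m \<noteq> 0" using fin \<Gamma>(3) by (auto simp: m_def)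
  obtain m' where m': "m = p ^ multiplicity p m * m'" "\<not> p dvd m'"
    using multiplicity_decompose'[of m p] m0 p(1) by (metis not_prime_unit)
  define a where "a = multiplicity p m"
  define C where "C = (m choose p ^ a)"
  have "m' > 0" using m' m0 by (cases m') auto
  \<comment> \<open>Choosing \<open>p ^ a\<close> out of \<open>p ^ a * m'\<close> elements gives a
    number with the same power of \<open>p\<close> as \<open>m'\<close>, that is, none.\<close>
  have "multiplicity p C = multiplicity p m'"
    unfolding C_def using const_p_fac[OF \<open>m' > 0\<close> p(1), of a] m'(1) by (simp add: a_def)
  then have "multiplicity p C = 0" using m'(2) by (simp add: not_dvd_imp_multiplicity_0)
  moreover have "C \<noteq> 0"
  proof -
    have "p ^ a \<le> m" using m'(1) \<open>m' > 0\<close> by (metis a_def le_add1 mult_le_mono2 mult.right_neutral Suc_leI One_nat_def)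
    then show ?thesis by (simp add: C_def)
  qed
  ultimately have "\<not> p dvd C" using p(1) prime_multiplicity_gt_zero_iff[of p C] by auto
  then have "coprime p C" by (rule prime_imp_coprime[OF p(1)])
  then have "gcd C p = 1" using coprime_imp_gcd_eq_1[of p C] gcd.commute[of C p] by argo
  then have "\<exists>u v. C * u = p * v + 1" using bezout_nat[OF \<open>C \<noteq> 0\<close>, of p] by simp
  then obtain u v where uv: "C * u = p * v + 1" by blast
  obtain w where w: "w \<in> ints L" "w ^ (p ^ a) - y \<in> P" using roots[OF y] by blast
  define F where "F = {B. B \<subseteq> \<Gamma> \<and> card B = p ^ a}"
  have "F \<subseteq> Pow \<Gamma>" by (auto simp: F_def)
  then have finF: "finite F" using fin by (simp add: finite_subset)
  define t0 where "t0 = (\<Sum>B\<in>F. \<Prod>\<sigma>\<in>B. \<sigma> w)"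
  have sw: "\<sigma> w \<in> ints L" if "\<sigma> \<in> \<Gamma>" for \<sigma> using gal_ints w(1) \<Gamma>G that by blast
  have t0: "t0 \<in> ints L" unfolding t0_def using sw by (intro L.ints_sum L.ints_prod) (auto simp: F_def)
  have prod_cong: "(\<Prod>\<sigma>\<in>B. \<sigma> w) - w ^ card B \<in> P" if "finite B" "B \<subseteq> \<Gamma>" for B
    using that
  proof (induction B rule: finite_induct)
    case empty
    then show ?case using L.idealD(2)[OF PD(1)] by simp
  next
    case (insert \<sigma> B)
    have "\<sigma> w * ((\<Prod>\<sigma>\<in>B. \<sigma> w) - w ^ card B) \<in> P"
      by (rule L.idealD(4)[OF PD(1)]) (use insert sw in auto)
    moreover have "(\<sigma> w - w) * w ^ card B \<in> P"
      by (rule L.idealD(5)[OF PD(1) _ disp]) (use insert w(1) in auto)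
    ultimately have "\<sigma> w * ((\<Prod>\<sigma>\<in>B. \<sigma> w) - w ^ card B) + (\<sigma> w - w) * w ^ card B \<in> P"
      by (rule L.idealD(3)[OF PD(1)])
    then show ?case using insert by (simp add: algebra_simps)
  qed
  have "(\<Sum>B\<in>F. (\<Prod>\<sigma>\<in>B. \<sigma> w) - w ^ (p ^ a)) \<in> P"
  proof (rule L.ideal_sum[OF PD(1)])
    fix B assume "B \<in> F"
    then have "B \<subseteq> \<Gamma>" "card B = p ^ a" by (simp_all add: F_def)
    then show "(\<Prod>\<sigma>\<in>B. \<sigma> w) - w ^ (p ^ a) \<in> P" using prod_cong[of B] finite_subset[OF _ fin] by simp
  qed
  moreover have "card F = C" unfolding F_def C_def m_def by (rule n_subsets[OF fin])
  ultimately have t0w: "t0 - of_nat C * w ^ (p ^ a) \<in> P" by (simp add: t0_def sum_subtractf)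
  \<comment> \<open>Left multiplication by \<tau> permutes the subsets of \<Gamma> with
    \<open>p ^ a\<close> elements.\<close>
  have fixed: "\<tau> t0 = t0" if \<tau>: "\<tau> \<in> \<Gamma>" for \<tau>
  proof -
    define c where "c = (\<lambda>\<sigma>. \<tau> \<otimes>\<^bsub>Gal K L\<^esub> \<sigma>)"
    have \<tau>G: "\<tau> \<in> G" using \<tau> \<Gamma>G by blast
    note E = gal_emb[OF \<tau>G]
    have inj: "inj_on c \<Gamma>" using bij_left_mult[OF \<tau>G] \<Gamma>G unfolding c_def by (meson bij_betw_def inj_on_subset)
    have im: "c ` \<Gamma> = \<Gamma>" using endo_inj_surj[OF fin _ inj] \<Gamma>(2)[OF \<tau>] by (auto simp: c_def)
    have swL: "\<sigma> w \<in> L" if "\<sigma> \<in> \<Gamma>" for \<sigma> using L.ints_mem[OF sw[OF that]] .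
    have "\<tau> t0 = (\<Sum>B\<in>F. \<tau> (\<Prod>\<sigma>\<in>B. \<sigma> w))"
      unfolding t0_def using swL by (intro L.emb_sum[OF E] L.prod_mem) (auto simp: F_def)
    also have "\<dots> = (\<Sum>B\<in>F. \<Prod>\<sigma>\<in>B. \<tau> (\<sigma> w))"
      using swL by (intro sum.cong L.emb_prod[OF E]) (auto simp: F_def)
    also have "\<dots> = (\<Sum>B\<in>F. \<Prod>\<sigma>\<in>c ` B. \<sigma> w)"
    proof (rule sum.cong[OF refl])
      fix B assume "B \<in> F"
      then have B: "B \<subseteq> \<Gamma>" by (simp add: F_def)
      have "(\<Prod>\<sigma>\<in>c ` B. \<sigma> w) = (\<Prod>\<sigma>\<in>B. c \<sigma> w)" using inj_on_subset[OF inj B] by (rule prod.reindex_cong) simp_all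
      also have "\<dots> = (\<Prod>\<sigma>\<in>B. \<tau> (\<sigma> w))"
        using B \<Gamma>G L.ints_mem[OF w(1)] by (intro prod.cong) (auto simp: c_def mult_app[OF \<tau>G])
      finally show "(\<Prod>\<sigma>\<in>B. \<tau> (\<sigma> w)) = (\<Prod>\<sigma>\<in>c ` B. \<sigma> w)" ..
    qed
    also have "\<dots> = t0" unfolding t0_def
    proof (rule sum.reindex_bij_betw)
      have "inj_on ((`) c) F" using inj_on_image_Pow[OF inj] by (rule inj_on_subset) (auto simp: F_def)
      moreover have "(`) c ` F \<subseteq> F"
      proof
        fix B' assume "B' \<in> (`) c ` F"
        then obtain B where B: "B' = c ` B" "B \<subseteq> \<Gamma>" "card B = p ^ a" by (auto simp: F_def)
        then have "card B' = p ^ a" using card_image[OF inj_on_subset[OF inj B(2)]] by simp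
        then show "B' \<in> F" using B im by (auto simp: F_def)
      qed
      ultimately show "bij_betw ((`) c) F F" using endo_inj_surj[OF finF] by (simp add: bij_betw_def)
    qed
    finally show ?thesis .
  qed
  show ?thesis
  \<comment> \<open>\<open>u\<close> inverts the binomial coefficient \<open>C\<close> modulo
    \<open>p\<close>.\<close>
  proof (rule that[of "of_nat u * t0"])
    show "of_nat u * t0 \<in> ints L" using t0 by simp
    show "\<sigma> (of_nat u * t0) = of_nat u * t0" if "\<sigma> \<in> \<Gamma>" for \<sigma>
    proof -
      have "\<sigma> \<in> G" using that \<Gamma>G by blast
      then show ?thesis using fixed[OF that] t0 L.emb_of_nat[OF gal_emb] by (simp add: gal_mult)
    qed
    have "(of_nat (C * u) :: 'a) = of_nat (p * v + 1)" using uv by simp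
    then have Cu: "of_nat C * of_nat u - of_nat p * of_nat v = (1 :: 'a)"
      unfolding of_nat_mult of_nat_add of_nat_1 by (simp only: add_diff_cancel_left')
    have "- (of_nat u * (t0 - of_nat C * w ^ (p ^ a))) -
        (of_nat C * of_nat u) * (w ^ (p ^ a) - y) - (of_nat v * y) * of_nat p =
        (of_nat C * of_nat u - of_nat p * of_nat v) * y - of_nat u * t0"
      by (simp add: algebra_simps)
    then have eq: "y - of_nat u * t0 = - (of_nat u * (t0 - of_nat C * w ^ (p ^ a))) -
        (of_nat C * of_nat u) * (w ^ (p ^ a) - y) - (of_nat v * y) * of_nat p"
      unfolding Cu by simp
    show "y - of_nat u * t0 \<in> P"
    proof -
      have "of_nat u * (t0 - of_nat C * w ^ (p ^ a)) \<in> P"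
        by (rule L.idealD(4)[OF PD(1) L.ints_of_nat t0w])
      moreover have "(of_nat C * of_nat u) * (w ^ (p ^ a) - y) \<in> P"
        by (rule L.idealD(4)[OF PD(1) _ w(2)]) simp
      moreover have "(of_nat v * y) * of_nat p \<in> P"
        by (rule L.idealD(4)[OF PD(1) _ p(2)]) (use y in simp)
      ultimately show ?thesis
        unfolding eq by (intro L.idealD(7)[OF PD(1) L.idealD(7)[OF PD(1) L.idealD(6)[OF PD(1)]]])
    qed
  qed
qed


text \<open>If \<open>e = v(c)\<close> were smaller than \<open>card \<Gamma>\<close>, then \<open>1, \<pi>, \<dots>, \<pi>\<^sup>e\<^sup>-\<^sup>1\<close> for a local uniformizer \<open>\<pi>\<close> would span
  the integers over the \<open>\<Gamma>\<close>-fixed ones up to high powers of \<open>P\<close>, whereas the trace form dual to the powers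
  of \<open>\<pi>\<close> separates \<open>\<pi>\<^bsup>card \<Gamma> - 1\<^esup>\<close> from them.\<close>

lemma inertia_card_le:
  assumes P: "P \<in> primes L" and \<Gamma>: "\<Gamma> \<subseteq> inertia P" "\<And>\<sigma> \<tau>. \<sigma> \<in> \<Gamma> \<Longrightarrow> \<tau> \<in> \<Gamma> \<Longrightarrow> \<sigma> \<otimes>\<^bsub>Gal K L\<^esub> \<tau> \<in> \<Gamma>"
    "\<one>\<^bsub>Gal K L\<^esub> \<in> \<Gamma>" and c: "c \<in> P" "\<And>\<sigma>. \<sigma> \<in> \<Gamma> \<Longrightarrow> \<sigma> c = c"
  shows "c \<in> L.pw P (card \<Gamma>)"
proof (rule ccontr)
  note PD = L.primesD[OF P]
  define m where "m = card \<Gamma>"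
  assume "c \<notin> L.pw P (card \<Gamma>)"
  then have cm: "c \<notin> L.pw P m" by (simp add: m_def)
  then have c0: "c \<noteq> 0" using L.pw_0_mem[OF P] by auto
  have ci: "c \<in> ints L" using c(1) PD(4) by blast
  define e where "e = L.ev P c"
  have e: "e < m" "0 < e" using L.mem_pw_iff[OF P ci c0, of m] L.ev_pos_iff[OF P ci c0] cm c(1) by (simp_all add: e_def)
  have \<Gamma>G: "\<Gamma> \<subseteq> G" using \<Gamma>(1) acts_G by (auto simp: inertia_def)
  have fin: "finite \<Gamma>" using finite_subset[OF \<Gamma>G finite_G] .
  have \<Gamma>P: "\<sigma> ` P = P" if "\<sigma> \<in> \<Gamma>" for \<sigma>
    using acts_image[OF _ P, of \<sigma> "Suc 0"] \<Gamma>(1) that by (auto simp: inertia_def)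
  have \<Gamma>pw: "\<sigma> r \<in> L.pw P n" if "\<sigma> \<in> \<Gamma>" "r \<in> L.pw P n" for \<sigma> r n
  proof -
    have "\<sigma> \<in> G" using that(1) \<Gamma>G by blast
    then have "\<sigma> ` L.pw P n = L.pw P n" using image_pw[OF _ P, of \<sigma> n] \<Gamma>P[OF that(1)] by simp
    then show ?thesis using that(2) by (metis imageI)
  qed

  \<comment> \<open>Adding a multiple of an element with distinct conjugates makes the conjugates of
    a uniformizer distinct; as that element lies in the square of \<open>P\<close>, the valuation
    stays 1.\<close>
  obtain y where y: "y \<in> L.pw P 2" "inj_on (\<lambda>\<sigma>. \<sigma> y) G"
  proof -
    define D where "D = (\<lambda>(\<sigma>, \<tau>). (\<lambda>x. \<sigma> x - \<tau> x :: 'a)) ` {(\<sigma>, \<tau>). \<sigma> \<in> G \<and> \<tau> \<in> G \<and> \<sigma> \<noteq> \<tau>}"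
    have "{(\<sigma>, \<tau>). \<sigma> \<in> G \<and> \<tau> \<in> G \<and> \<sigma> \<noteq> \<tau>} \<subseteq> G \<times> G" by blast
    then have "finite {(\<sigma>, \<tau>). \<sigma> \<in> G \<and> \<tau> \<in> G \<and> \<sigma> \<noteq> \<tau>}" using finite_G by (simp add: finite_subset)
    then have "finite D" unfolding D_def by (rule finite_imageI)
    obtain \<theta> where \<theta>: "\<theta> \<in> L" "inj_on (\<lambda>\<sigma>. \<sigma> \<theta>) G" using primitive_element by blast
    obtain k :: int where k: "k \<noteq> 0" "algebraic_int (of_int k * \<theta>)"
      using number_field_algebraic[OF L.nf \<theta>(1)] by blast
    obtain p :: nat where p: "Factorial_Ring.prime p" "of_nat p \<in> P" using L.residue_char[OF P] by blast
    have p0: "(of_nat p :: 'a) \<noteq> 0" using prime_gt_0_nat[OF p(1)] by simp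
    have two: "Suc 0 + Suc 0 = 2" by simp
    have p1: "of_nat p \<in> L.pw P (Suc 0)" using p(2) L.pw_1[OF P] by simp
    define q :: 'a where "q = of_nat p * of_nat p"
    have q: "q \<in> L.pw P 2" using L.pw_mult_mem[OF P p1 p1] unfolding two q_def .
    define y where "y = q * (of_int k * \<theta>)"
    have "of_int k * \<theta> \<in> ints L" using k(2) \<theta>(1) by (simp add: ints_iff)
    then have "y \<in> L.pw P 2" unfolding y_def by (rule L.idealD(5)[OF L.pw_ideal[OF P] _ q])
    moreover have "inj_on (\<lambda>\<sigma>. \<sigma> y) G"
    proof (rule inj_onI)
      fix \<sigma> \<tau> assume st: "\<sigma> \<in> G" "\<tau> \<in> G" "\<sigma> y = \<tau> y"
      have *: "\<rho> y = q * of_int k * \<rho> \<theta>" if \<rho>: "\<rho> \<in> G" for \<rho>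
        using \<theta>(1) by (simp add: y_def q_def L.emb_mult[OF gal_emb[OF \<rho>]] L.emb_of_nat[OF gal_emb[OF \<rho>]] L.emb_of_int[OF gal_emb[OF \<rho>]])
      have "\<sigma> \<theta> = \<tau> \<theta>" using st(3) p0 k(1) unfolding *[OF st(1)] *[OF st(2)] by (simp add: q_def)
      then show "\<sigma> = \<tau>" using inj_onD[OF \<theta>(2)] st(1,2) by blast
    qed
    ultimately show ?thesis using that by blast
  qed
  have yi: "y \<in> ints L" using L.pw_sub_ints[OF P y(1)] .
  obtain \<pi>0 where \<pi>0: "\<pi>0 \<in> ints L" "\<pi>0 \<noteq> 0" "L.ev P \<pi>0 = 1" using L.ex_uniformizer[OF P] by blast
  \<comment> \<open>Each pair of distinct automorphisms excludes at most one multiplier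
    \<open>n\<close>.\<close>
  define B where "B = (\<lambda>(\<sigma> :: 'a \<Rightarrow> 'a, \<tau> :: 'a \<Rightarrow> 'a). {n :: nat. \<sigma> \<noteq> \<tau> \<and> \<sigma> \<pi>0 + of_nat n * \<sigma> y = \<tau> \<pi>0 + of_nat n * \<tau> y})"
  have finB: "finite (B s)" if s: "s \<in> G \<times> G" for s
  proof -
    obtain \<sigma> \<tau> where st: "s = (\<sigma>, \<tau>)" "\<sigma> \<in> G" "\<tau> \<in> G" using s by blast
    have "n = n'" if n: "n \<in> B s" "n' \<in> B s" for n n'
    proof -
      have ne: "\<sigma> y - \<tau> y \<noteq> 0" using n(1) inj_onD[OF y(2)] st by (auto simp: B_def)
      have "of_nat n * (\<sigma> y - \<tau> y) = \<tau> \<pi>0 - \<sigma> \<pi>0" "of_nat n' * (\<sigma> y - \<tau> y) = \<tau> \<pi>0 - \<sigma> \<pi>0"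
        using n by (auto simp: B_def st(1) algebra_simps)
      then have "of_nat n * (\<sigma> y - \<tau> y) = of_nat n' * (\<sigma> y - \<tau> y)" by simp
      then show ?thesis using ne by simp
    qed
    then have "B s = {} \<or> (\<exists>n. B s \<subseteq> {n})" by blast
    then show ?thesis by (elim disjE exE) (simp, erule finite_subset, simp)
  qed
  have "finite (\<Union>s\<in>G \<times> G. B s)" using finB finite_G by (intro finite_UN_I) simp_all
  then obtain n0 where n0: "n0 \<notin> (\<Union>s\<in>G \<times> G. B s)" using ex_new_if_finite infinite_UNIV_nat by blast
  define \<pi> where "\<pi> = \<pi>0 + of_nat n0 * y"
  have \<pi>i: "\<pi> \<in> ints L" using \<pi>0(1) yi by (simp add: \<pi>_def)
  have \<pi>app: "\<sigma> \<pi> = \<sigma> \<pi>0 + of_nat n0 * \<sigma> y" if "\<sigma> \<in> G" for \<sigma>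
    using \<pi>0(1) yi that L.emb_of_nat[OF gal_emb[OF that]] by (simp add: \<pi>_def gal_add gal_mult)
  have \<pi>inj: "inj_on (\<lambda>\<sigma>. \<sigma> \<pi>) \<Gamma>"
  proof (rule inj_onI, rule ccontr)
    fix \<sigma> \<tau> assume st: "\<sigma> \<in> \<Gamma>" "\<tau> \<in> \<Gamma>" "\<sigma> \<pi> = \<tau> \<pi>" "\<sigma> \<noteq> \<tau>"
    then have "\<sigma> \<in> G" "\<tau> \<in> G" using \<Gamma>G by blast+
    then have "n0 \<in> B (\<sigma>, \<tau>)" using st \<pi>app by (simp add: B_def)
    then show False using n0 \<open>\<sigma> \<in> G\<close> \<open>\<tau> \<in> G\<close> by blast
  qed
  have n0y: "of_nat n0 * y \<in> L.pw P 2" by (rule L.idealD(4)[OF L.pw_ideal[OF P] L.ints_of_nat y(1)])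
  have "\<pi>0 \<notin> L.pw P 2" "\<pi>0 \<in> P" using L.mem_pw_iff[OF P \<pi>0(1,2)] L.ev_pos_iff[OF P \<pi>0(1,2)] \<pi>0(3) by simp_all
  then have "\<pi> \<notin> L.pw P 2" using L.idealD(7)[OF L.pw_ideal[OF P] _ n0y, of \<pi>] by (auto simp: \<pi>_def)
  have "\<pi> \<in> P" unfolding \<pi>_def
    using L.idealD(3)[OF PD(1) \<open>\<pi>0 \<in> P\<close>] L.pw_pos_sub[OF P n0y] by simp
  have \<pi>0': "\<pi> \<noteq> 0" using \<open>\<pi> \<notin> L.pw P 2\<close> L.pw_0_mem[OF P] by auto
  have ev\<pi>: "L.ev P \<pi> = 1"
    using \<open>\<pi> \<notin> L.pw P 2\<close> \<open>\<pi> \<in> P\<close> L.mem_pw_iff[OF P \<pi>i \<pi>0', of 2] L.ev_pos_iff[OF P \<pi>i \<pi>0'] by simp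

  define T where "T = {t \<in> ints L. \<forall>\<sigma>\<in>\<Gamma>. \<sigma> t = t}"
  have T_add: "s + t \<in> T" if "s \<in> T" "t \<in> T" for s t using that subsetD[OF \<Gamma>G] by (auto simp: T_def gal_add)
  have T_mult: "s * t \<in> T" if "s \<in> T" "t \<in> T" for s t using that subsetD[OF \<Gamma>G] by (auto simp: T_def gal_mult)
  have cT: "c ^ n \<in> T" for n using ci gal_power[OF subsetD[OF \<Gamma>G] ci, of _ n] by (auto simp: T_def c(2))
  have T0: "0 \<in> T" using \<Gamma>G by (auto simp: T_def gal_0)

  \<comment> \<open>The valuation \<open>N\<close> is realized by \<open>c ^ a * \<pi> ^ b\<close>
    with \<open>b < e\<close>, and \<open>residue_fixed\<close> supplies a fixed digit. As
    \<open>c\<close> is fixed too, all digits belonging to one \<open>b\<close> collect into a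
    single coefficient from \<open>T\<close>.\<close>
  have expand: "\<exists>t. (\<forall>i<e. t i \<in> T) \<and> z - (\<Sum>i<e. t i * \<pi> ^ i) \<in> L.pw P N" if z: "z \<in> ints L" for z N
  proof (induction N)
    case 0
    show ?case using z T0 by (intro exI[of _ "\<lambda>_. 0"]) simp
  next
    case (Suc N)
    then obtain t where t: "\<forall>i<e. t i \<in> T" "z - (\<Sum>i<e. t i * \<pi> ^ i) \<in> L.pw P N" by blast
    define a b where "a = N div e" and "b = N mod e"
    have b: "b < e" using e(2) by (simp add: b_def)
    define w where "w = c ^ a * \<pi> ^ b"
    have w: "w \<in> ints L" "w \<noteq> 0" using ci c0 \<pi>i \<pi>0' by (simp_all add: w_def)
    have "L.ev P w = a * e + b"
      unfolding w_def using ci c0 \<pi>i \<pi>0' by (simp add: L.ev_mult[OF P] L.ev_power[OF P] e_def ev\<pi>)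
    then have evw: "L.ev P w = N" by (simp add: a_def b_def)
    obtain u where u: "u \<in> ints L" "z - (\<Sum>i<e. t i * \<pi> ^ i) - w * u \<in> L.pw P (Suc N)"
      using L.pw_step[OF P w, of "z - (\<Sum>i<e. t i * \<pi> ^ i)"] t(2) unfolding evw by blast
    obtain s where s: "s \<in> ints L" "\<And>\<sigma>. \<sigma> \<in> \<Gamma> \<Longrightarrow> \<sigma> s = s" "u - s \<in> P"
      using residue_fixed[OF P \<Gamma> u(1)] by blast
    have sT: "s \<in> T" using s by (simp add: T_def)
    have "w \<in> L.pw P N" using L.mem_pw_iff[OF P w] evw by simp
    moreover have "u - s \<in> L.pw P (Suc 0)" using s(3) L.pw_1[OF P] by simp
    ultimately have "w * (u - s) \<in> L.pw P (N + Suc 0)" by (rule L.pw_mult_mem[OF P])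
    then have wus: "w * (u - s) \<in> L.pw P (Suc N)" by simp
    define t' where "t' = t(b := t b + c ^ a * s)"
    have "(\<Sum>i<e. t' i * \<pi> ^ i) = (\<Sum>i<e. t i * \<pi> ^ i + (if i = b then c ^ a * s * \<pi> ^ b else 0))"
      by (rule sum.cong) (auto simp: t'_def algebra_simps)
    also have "\<dots> = (\<Sum>i<e. t i * \<pi> ^ i) + c ^ a * s * \<pi> ^ b" using b by (simp add: sum.distrib)
    finally have eq: "z - (\<Sum>i<e. t' i * \<pi> ^ i) = z - (\<Sum>i<e. t i * \<pi> ^ i) - w * u + w * (u - s)"
      by (simp add: w_def algebra_simps)
    have "z - (\<Sum>i<e. t' i * \<pi> ^ i) \<in> L.pw P (Suc N)"
      unfolding eq by (rule L.idealD(3)[OF L.pw_ideal[OF P] u(2) wus])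
    moreover have "\<forall>i<e. t' i \<in> T" using t(1) b T_add T_mult cT sT by (auto simp: t'_def)
    ultimately show ?case by blast
  qed

  define W where "W = (\<lambda>\<sigma>. \<Prod>\<tau>\<in>\<Gamma> - {\<sigma>}. \<sigma> \<pi> - \<tau> \<pi>)"
  \<comment> \<open>The product clears all denominators of the Lagrange sums and does not depend on
    the precision \<open>N\<close> chosen below.\<close>
  define \<Delta> where "\<Delta> = prod W \<Gamma>"
  have lag: "(\<Sum>\<sigma>\<in>\<Gamma>. \<sigma> \<pi> ^ j / W \<sigma>) = (if Suc j = m then 1 else 0)" if "j < m" for j
    unfolding W_def m_def by (rule lagrange_power_sum[OF fin \<pi>inj that[unfolded m_def]])
  have Wi: "W \<sigma> \<in> ints L" "W \<sigma> \<noteq> 0" if "\<sigma> \<in> \<Gamma>" for \<sigma>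
  proof -
    show "W \<sigma> \<in> ints L" unfolding W_def using gal_ints[OF _ \<pi>i] \<Gamma>G that by (intro L.ints_prod L.ints_diff) blast+
    show "W \<sigma> \<noteq> 0" unfolding W_def using fin inj_onD[OF \<pi>inj] that by auto
  qed
  have \<Delta>: "\<Delta> \<in> ints L" "\<Delta> \<noteq> 0" unfolding \<Delta>_def using Wi fin by (auto intro: L.ints_prod)
  have "\<Delta> \<in> L.pw P N" for N
  proof -
    \<comment> \<open>The Lagrange sum is 1 on \<open>\<pi> ^ (m - 1)\<close> and 0 on the
      expansion, whose exponents stay below \<open>e < m\<close>. So \<Delta> comes from the
      remainder alone and lies in every power of \<open>P\<close>.\<close>
    obtain t where t: "\<forall>i<e. t i \<in> T" "\<pi> ^ (m - 1) - (\<Sum>i<e. t i * \<pi> ^ i) \<in> L.pw P N"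
      using expand[OF L.ints_power[OF \<pi>i]] by blast
    define r where "r = \<pi> ^ (m - 1) - (\<Sum>i<e. t i * \<pi> ^ i)"
    have tT: "t i \<in> ints L" "\<sigma> \<in> \<Gamma> \<Longrightarrow> \<sigma> (t i) = t i" if "i < e" for i \<sigma> using t(1) that by (auto simp: T_def)
    have \<sigma>r: "\<sigma> r = \<sigma> \<pi> ^ (m - 1) - (\<Sum>i<e. t i * \<sigma> \<pi> ^ i)" if \<sigma>: "\<sigma> \<in> \<Gamma>" for \<sigma>
    proof -
      have \<sigma>G: "\<sigma> \<in> G" using \<sigma> \<Gamma>G by blast
      note E = gal_emb[OF \<sigma>G]
      have tL: "t i * \<pi> ^ i \<in> L" if "i < e" for i using L.ints_mem tT(1)[OF that] \<pi>i by simp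
      have "\<sigma> r = \<sigma> (\<pi> ^ (m - 1)) - \<sigma> (\<Sum>i<e. t i * \<pi> ^ i)"
        unfolding r_def using tL L.ints_mem[OF \<pi>i] by (intro L.emb_diff[OF E] L.power_mem L.sum_mem) auto
      also have "\<sigma> (\<Sum>i<e. t i * \<pi> ^ i) = (\<Sum>i<e. \<sigma> (t i * \<pi> ^ i))" using tL by (intro L.emb_sum[OF E]) auto
      also have "\<dots> = (\<Sum>i<e. t i * \<sigma> \<pi> ^ i)"
        using tT \<sigma> \<pi>i by (intro sum.cong) (auto simp: gal_mult[OF \<sigma>G] gal_power[OF \<sigma>G])
      finally show ?thesis using gal_power[OF \<sigma>G \<pi>i] by simp
    qed
    have "(\<Sum>\<sigma>\<in>\<Gamma>. \<sigma> r / W \<sigma>) = (\<Sum>\<sigma>\<in>\<Gamma>. \<sigma> \<pi> ^ (m - 1) / W \<sigma> - (\<Sum>i<e. t i * (\<sigma> \<pi> ^ i / W \<sigma>)))"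
      by (rule sum.cong) (auto simp: \<sigma>r diff_divide_distrib sum_divide_distrib)
    also have "\<dots> = (\<Sum>\<sigma>\<in>\<Gamma>. \<sigma> \<pi> ^ (m - 1) / W \<sigma>) - (\<Sum>\<sigma>\<in>\<Gamma>. \<Sum>i<e. t i * (\<sigma> \<pi> ^ i / W \<sigma>))"
      by (rule sum_subtractf)
    also have "(\<Sum>\<sigma>\<in>\<Gamma>. \<Sum>i<e. t i * (\<sigma> \<pi> ^ i / W \<sigma>)) = (\<Sum>i<e. t i * (\<Sum>\<sigma>\<in>\<Gamma>. \<sigma> \<pi> ^ i / W \<sigma>))"
      by (subst sum.swap) (simp add: sum_distrib_left)
    also have "\<dots> = 0" using e lag by (intro sum.neutral) auto
    also have "(\<Sum>\<sigma>\<in>\<Gamma>. \<sigma> \<pi> ^ (m - 1) / W \<sigma>) = 1" using lag[of "m - 1"] e by simp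
    finally have "\<Delta> = \<Delta> * (\<Sum>\<sigma>\<in>\<Gamma>. \<sigma> r / W \<sigma>)" by simp
    also have "\<dots> = (\<Sum>\<sigma>\<in>\<Gamma>. prod W (\<Gamma> - {\<sigma>}) * \<sigma> r)"
      unfolding sum_distrib_left
    proof (rule sum.cong[OF refl])
      fix \<sigma> assume \<sigma>: "\<sigma> \<in> \<Gamma>"
      have "\<Delta> = W \<sigma> * prod W (\<Gamma> - {\<sigma>})" unfolding \<Delta>_def using fin \<sigma> by (rule prod.remove)
      then show "\<Delta> * (\<sigma> r / W \<sigma>) = prod W (\<Gamma> - {\<sigma>}) * \<sigma> r" using Wi(2)[OF \<sigma>] by simp
    qed
    also have "\<dots> \<in> L.pw P N"
    proof (rule L.ideal_sum[OF L.pw_ideal[OF P]])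
      fix \<sigma> assume \<sigma>: "\<sigma> \<in> \<Gamma>"
      have "prod W (\<Gamma> - {\<sigma>}) \<in> ints L" using Wi(1) by (intro L.ints_prod) blast
      moreover have "\<sigma> r \<in> L.pw P N" using \<Gamma>pw[OF \<sigma>] t(2) by (simp add: r_def)
      ultimately show "prod W (\<Gamma> - {\<sigma>}) * \<sigma> r \<in> L.pw P N" by (rule L.idealD(4)[OF L.pw_ideal[OF P]])
    qed
    finally show ?thesis .
  qed
  then show False using L.pw_Inter_zero[OF P \<Delta>(1)] \<Delta>(2) by blast
qed

end

section \<open>Conductors in towers\<close>

context galois_tower begin

lemma H_mult: "s \<in> H \<Longrightarrow> t \<in> H \<Longrightarrow> s \<otimes>\<^bsub>Gal K L'\<^esub> t \<in> H"
  by (simp add: H_def res_mult)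

lemma H_one: "\<one>\<^bsub>Gal K L'\<^esub> \<in> H"
  by (simp add: H_def res_one)

section \<open>Lifts of automorphisms and the inertia group of the upper step\<close>

definition fibre :: "('a \<Rightarrow> 'a) \<Rightarrow> ('a \<Rightarrow> 'a) set" where "fibre \<sigma> = {s \<in> top.G. res s = \<sigma>}"

lemma H_fibre: "H = fibre \<one>\<^bsub>Gal K L\<^esub>"
  by (simp add: H_def fibre_def)

lemma fibre_nonempty:
  assumes "\<sigma> \<in> bot.G" obtains s where "s \<in> fibre \<sigma>"
proof -
  have "\<sigma> \<in> res ` top.G" using assms res_surj by simp
  then obtain s where "\<sigma> = res s" "s \<in> top.G" by (rule imageE)
  then show ?thesis by (intro that[of s]) (simp add: fibre_def)
qed

lemma fibre_quot:
  assumes "s \<in> fibre \<sigma>" "t \<in> fibre \<sigma>"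
  shows "inv\<^bsub>Gal K L'\<^esub> s \<otimes>\<^bsub>Gal K L'\<^esub> t \<in> H"
proof -
  define u where "u = inv\<^bsub>Gal K L'\<^esub> s \<otimes>\<^bsub>Gal K L'\<^esub> t"
  have G: "s \<in> top.G" "t \<in> top.G" "res s = \<sigma>" "res t = \<sigma>" using assms by (auto simp: fibre_def)
  have u: "u \<in> top.G" "s \<otimes>\<^bsub>Gal K L'\<^esub> u = t" using G by (simp_all add: u_def top.Gal.m_assoc[symmetric])
  have \<sigma>: "\<sigma> \<in> bot.G" using res_G[OF G(1)] G(3) by simp
  have "\<sigma> \<otimes>\<^bsub>Gal K L\<^esub> res u = \<sigma>" using res_mult[OF G(1) u(1)] u(2) G by simp
  then have "res u = \<one>\<^bsub>Gal K L\<^esub>" using bot.Gal.l_cancel_one[OF \<sigma> res_G[OF u(1)]] by simp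
  then show ?thesis using u(1) by (simp add: H_def u_def)
qed

lemma fibre_bij:
  assumes s: "s \<in> fibre \<sigma>" shows "bij_betw (\<lambda>\<eta>. s \<otimes>\<^bsub>Gal K L'\<^esub> \<eta>) H (fibre \<sigma>)"
proof -
  have sG: "s \<in> top.G" "res s = \<sigma>" using s by (simp_all add: fibre_def)
  have \<sigma>: "\<sigma> \<in> bot.G" using res_G[OF sG(1)] sG(2) by simp
  have HG: "\<eta> \<in> top.G" if "\<eta> \<in> H" for \<eta> using that by (simp add: H_def)
  show ?thesis
  proof (rule bij_betwI[of _ _ _ "\<lambda>t. inv\<^bsub>Gal K L'\<^esub> s \<otimes>\<^bsub>Gal K L'\<^esub> t"])
    show "(\<lambda>\<eta>. s \<otimes>\<^bsub>Gal K L'\<^esub> \<eta>) \<in> H \<rightarrow> fibre \<sigma>"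
      using sG \<sigma> by (auto simp: H_def fibre_def res_mult)
    show "(\<lambda>t. inv\<^bsub>Gal K L'\<^esub> s \<otimes>\<^bsub>Gal K L'\<^esub> t) \<in> fibre \<sigma> \<rightarrow> H"
      using fibre_quot[OF s] by blast
  qed (use sG HG in \<open>auto simp: fibre_def top.Gal.m_assoc[symmetric]\<close>)
qed

text \<open>The inertia group of \<open>L'\<close> over \<open>L\<close> at \<open>P'\<close>; its
  order is the factor in \<open>idx_sum\<close>.\<close>

definition H0 :: "'a set \<Rightarrow> ('a \<Rightarrow> 'a) set" where "H0 P' = H \<inter> top.inertia P'"

lemma finite_H: "finite H" and finite_fibre: "finite (fibre \<sigma>)"
  using top.finite_G by (simp_all add: H_def fibre_def)

lemma card_H0_pos: "P' \<in> primes L' \<Longrightarrow> 0 < card (H0 P')"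
  using H_one top.one_acts[of P' "Suc 0"] finite_H by (auto simp: card_gt_0_iff H0_def top.inertia_def)

text \<open>Elements of \<open>L\<close> are fixed by \<open>H0 P'\<close>, so
  \<open>inertia_card_le\<close> bounds the ramification index of \<open>P'\<close> over
  \<open>L\<close> from below by the order of inertia.\<close>

lemma prime_lift:
  assumes P': "P' \<in> primes L'" and c: "c \<in> P' \<inter> ints L"
  shows "c \<in> top.L.pw P' (card (H0 P'))"
proof (rule top.inertia_card_le[OF P'])
  show "H0 P' \<subseteq> top.inertia P'" by (simp add: H0_def)
  show "\<sigma> \<otimes>\<^bsub>Gal K L'\<^esub> \<tau> \<in> H0 P'" if "\<sigma> \<in> H0 P'" "\<tau> \<in> H0 P'" for \<sigma> \<tau>
    using that H_mult top.acts_mult[OF _ _ P'] by (simp add: H0_def top.inertia_def)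
  show "\<one>\<^bsub>Gal K L'\<^esub> \<in> H0 P'" using H_one top.one_acts[OF P'] by (simp add: H0_def top.inertia_def)
  show "c \<in> P'" using c by blast
  show "\<sigma> c = c" if "\<sigma> \<in> H0 P'" for \<sigma>
    using H_app[of \<sigma> c] that c bot.L.ints_mem[of c] by (simp add: H0_def)
qed

lemma pw_lift:
  assumes P': "P' \<in> primes L'"
  shows "c \<in> bot.L.pw (P' \<inter> ints L) n \<Longrightarrow> c \<in> top.L.pw P' (card (H0 P') * n)"
proof (induction n arbitrary: c)
  case 0
  then show ?case using ext.ints_sub by simp
next
  case (Suc n)
  have "c \<in> bot.L.iprod (bot.L.pw (P' \<inter> ints L) n) (P' \<inter> ints L)" using Suc.prems by simp
  then show ?case
  proof (induction rule: ideal_prod.induct)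
    case (prod i j)
    have "i * j \<in> top.L.pw P' (card (H0 P') * n + card (H0 P'))"
      by (rule top.L.pw_mult_mem[OF P' Suc.IH[OF prod(1)] prime_lift[OF P' prod(2)]])
    then show ?case by (simp add: add.commute)
  next
    case (sum x y)
    show ?case using top.L.idealD(3)[OF top.L.pw_ideal[OF P'] sum(3,4)] by simp
  qed
qed

text \<open>The polynomial \<open>f\<close> with roots \<open>\<eta> x\<close> for \<eta> in
  \<open>H\<close> has integral coefficients in \<open>L\<close>, which \<open>s\<close> moves by
  elements of the power \<open>i\<close> of \<open>P\<close>. Evaluating the difference of the
  transported \<open>f\<close> and \<open>f\<close> at the root \<open>x\<close> of \<open>f\<close>
  leaves the product of \<open>x - t x\<close> over the lifts \<open>t\<close> of \<sigma>. Its
  valuation is at least \<open>card (H0 P') * i\<close>, and each factor contributes at most the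
  index of \<open>t\<close> by the choice of \<open>x\<close>.\<close>

lemma idx_sum:
  assumes P': "P' \<in> primes L'" and \<sigma>: "\<sigma> \<in> bot.G" "\<sigma> \<noteq> \<one>\<^bsub>Gal K L\<^esub>"
  shows "card (H0 P') * bot.idx (P' \<inter> ints L) \<sigma> \<le> (\<Sum>s\<in>fibre \<sigma>. top.idx P' s)"
proof -
  define P where "P = P' \<inter> ints L"
  have P: "P \<in> primes L" unfolding P_def by (rule ext.contraction[OF P'])
  obtain x where x: "x \<in> ints L'" "\<And>s n. s \<in> top.G \<Longrightarrow> s x - x \<in> top.L.pw P' n \<Longrightarrow> s \<in> top.acts P' n"
    using top.ex_minimal_displacement[OF P'] by blast
  have xL: "x \<in> L'" using x(1) by (rule top.L.ints_mem)
  define i where "i = bot.idx P \<sigma>"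
  have act: "\<sigma> \<in> bot.acts P i" using bot.idx_ge_iff[OF P \<sigma>, of i] by (simp add: i_def)
  obtain s where s: "s \<in> fibre \<sigma>" using fibre_nonempty[OF \<sigma>(1)] by blast
  have sG: "s \<in> top.G" "res s = \<sigma>" using s by (simp_all add: fibre_def)
  have HG: "H \<subseteq> top.G" by (auto simp: H_def)
  define f where "f = (\<Prod>\<eta>\<in>H. [:- \<eta> x, 1:])"
  note O = top.orbit_poly[OF xL HG H_mult, folded f_def]
  have fL': "top.L.coeffs_in f" using O(1) H_one by blast
  have "poly.coeff (\<Prod>\<eta>\<in>A. [:- \<eta> x, 1:]) k \<in> ints L'" if "A \<subseteq> H" for A k
    using finite_subset[OF that finite_H] that
  proof (induction A arbitrary: k rule: finite_induct)
    case empty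
    then show ?case by (simp add: coeff_1)
  next
    case (insert \<eta> A)
    have "poly.coeff [:- \<eta> x, 1:] j \<in> ints L'" for j
      using top.gal_ints[OF _ x(1), of \<eta>] insert.prems HG by (auto simp: coeff_pCons split: nat.split)
    then show ?case using insert by (simp add: coeff_mult del: mult_pCons_left)
  qed
  then have fi: "poly.coeff f k \<in> ints L'" for k by (simp add: f_def)
  have fL: "poly.coeff f k \<in> ints L" for k
  proof (rule ext.ints_down[OF fi])
    show "poly.coeff f k \<in> L"
    proof (rule fixed_H)
      show "poly.coeff f k \<in> L'" using fL' by (simp add: top.L.coeffs_in_def)
      fix \<eta> assume \<eta>: "\<eta> \<in> H"
      have "\<eta> \<in> top.G" using \<eta> HG by blast
      then have "\<eta> (poly.coeff f k) = poly.coeff (map_poly \<eta> f) k"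
        using top.L.coeff_map_emb[OF top.gal_emb] by simp
      also have "map_poly \<eta> f = f" using O(2) \<eta> by blast
      finally show "\<eta> (poly.coeff f k) = poly.coeff f k" .
    qed
  qed
  define g where "g = map_poly s f"
  have g: "g = (\<Prod>\<eta>\<in>H. [:- s (\<eta> x), 1:])"
    unfolding g_def f_def using top.gal_mem[OF _ xL] HG by (intro top.L.map_emb_prod_linear[OF top.gal_emb[OF sG(1)]]) blast
  have fx: "poly f x = 0"
    unfolding f_def poly_prod using finite_H H_one top.one_app[OF xL] by (intro prod_zero) (auto intro!: bexI[of _ "\<one>\<^bsub>Gal K L'\<^esub>"])
  have "poly (g - f) x \<in> top.L.pw P' (card (H0 P') * i)"
    unfolding poly_altdef
  proof (rule top.L.ideal_sum[OF top.L.pw_ideal[OF P']])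
    fix k
    have "poly.coeff (g - f) k = s (poly.coeff f k) - poly.coeff f k"
      unfolding g_def using top.L.coeff_map_emb[OF top.gal_emb[OF sG(1)]] by simp
    also have "s (poly.coeff f k) = \<sigma> (poly.coeff f k)" using res_app[OF bot.L.ints_mem[OF fL], of s k] sG(2) by simp
    finally have "poly.coeff (g - f) k \<in> bot.L.pw P i" using act fL by (simp add: bot.acts_def)
    then have "poly.coeff (g - f) k \<in> top.L.pw P' (card (H0 P') * i)" unfolding P_def by (rule pw_lift[OF P'])
    then show "poly.coeff (g - f) k * x ^ k \<in> top.L.pw P' (card (H0 P') * i)"
      by (rule top.L.idealD(5)[OF top.L.pw_ideal[OF P'] top.L.ints_power[OF x(1)]])
  qed
  moreover have "poly (g - f) x = (\<Prod>\<eta>\<in>H. x - (s \<otimes>\<^bsub>Gal K L'\<^esub> \<eta>) x)"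
    unfolding g poly_diff fx poly_prod using HG top.mult_app[OF sG(1) _ xL] by (auto intro!: prod.cong)
  ultimately have mem: "(\<Prod>\<eta>\<in>H. x - (s \<otimes>\<^bsub>Gal K L'\<^esub> \<eta>) x) \<in> top.L.pw P' (card (H0 P') * i)" by simp
  have prod_eq: "(\<Prod>\<eta>\<in>H. x - (s \<otimes>\<^bsub>Gal K L'\<^esub> \<eta>) x) = (\<Prod>t\<in>fibre \<sigma>. x - t x)"
    by (rule prod.reindex_bij_betw[OF fibre_bij[OF s]])
  have t1: "t \<in> top.G" "t \<noteq> \<one>\<^bsub>Gal K L'\<^esub>" if "t \<in> fibre \<sigma>" for t
    using that res_one \<sigma>(2) by (auto simp: fibre_def)
  have xt: "x - t x \<in> ints L'" if "t \<in> fibre \<sigma>" for t using top.gal_ints[OF t1(1)[OF that] x(1)] x(1) by simp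
  have uminus: "t x - x \<in> top.L.pw P' n" if "x - t x \<in> top.L.pw P' n" for t n
    using top.L.idealD(6)[OF top.L.pw_ideal[OF P'] that] by simp
  have nz: "x - t x \<noteq> 0" if t: "t \<in> fibre \<sigma>" for t
  proof
    assume "x - t x = 0"
    then have "t x - x = 0" by simp
    then have "t x - x \<in> top.L.pw P' (Suc (top.idx P' t))" by (simp only: top.L.pw_0_mem[OF P'])
    then have "t \<in> top.acts P' (Suc (top.idx P' t))" by (rule x(2)[OF t1(1)[OF t]])
    then show False using top.idx_ge_iff[OF P' t1[OF t]] Suc_n_not_le_n by blast
  qed
  have ev_le: "top.L.ev P' (x - t x) \<le> top.idx P' t" if t: "t \<in> fibre \<sigma>" for t
  proof -
    have "x - t x \<in> top.L.pw P' (top.L.ev P' (x - t x))" using top.L.mem_pw_iff[OF P' xt[OF t] nz[OF t]] by simp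
    then have "t \<in> top.acts P' (top.L.ev P' (x - t x))" by (intro x(2)[OF t1(1)[OF t]] uminus)
    then show ?thesis using top.idx_ge_iff[OF P' t1[OF t]] by blast
  qed
  have "(\<Prod>t\<in>fibre \<sigma>. x - t x) \<in> ints L'" using xt by (rule top.L.ints_prod)
  moreover have "(\<Prod>t\<in>fibre \<sigma>. x - t x) \<noteq> 0" using nz finite_fibre by simp
  ultimately have "card (H0 P') * i \<le> top.L.ev P' (\<Prod>t\<in>fibre \<sigma>. x - t x)"
    using mem top.L.mem_pw_iff[OF P'] unfolding prod_eq by blast
  also have "\<dots> = (\<Sum>t\<in>fibre \<sigma>. top.L.ev P' (x - t x))" by (rule top.L.ev_prod[OF finite_fibre P' xt nz])
  also have "\<dots> \<le> (\<Sum>t\<in>fibre \<sigma>. top.idx P' t)" by (rule sum_mono[OF ev_le])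
  finally show ?thesis by (simp add: i_def P_def)
qed

section \<open>Descent of trivial ramification groups and growth of conductors\<close>

lemma res_inertia:
  assumes P': "P' \<in> primes L'" and s: "s \<in> top.inertia P'"
  shows "res s \<in> bot.inertia (P' \<inter> ints L)"
proof -
  have sG: "s \<in> top.G" using s top.acts_G by (auto simp: top.inertia_def)
  have "res s x - x \<in> P' \<inter> ints L" if x: "x \<in> ints L" for x
  proof -
    have "s x - x \<in> top.L.pw P' (Suc 0)" using s ext.ints_sub[OF x] by (simp add: top.inertia_def top.acts_def)
    moreover have "res s x - x \<in> ints L" using bot.gal_ints[OF res_G[OF sG] x] x by simp
    ultimately show ?thesis unfolding top.L.pw_1[OF P'] res_app[OF bot.L.ints_mem[OF x]] by blast
  qed
  then show ?thesis
    using res_G[OF sG] bot.L.pw_1[OF ext.contraction[OF P']] by (simp add: bot.inertia_def bot.acts_def)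
qed

text \<open>Inertia upstairs restricts into inertia of \<open>L\<close>, and inertia elements with
  equal restriction differ by elements of \<open>H0 P'\<close>.\<close>

lemma card_top_inertia_le:
  assumes P': "P' \<in> primes L'"
  shows "card (top.inertia P') \<le> card (H0 P') * card (bot.inertia (P' \<inter> ints L))"
proof -
  define I where "I = bot.inertia (P' \<inter> ints L)"
  have "s \<in> (\<Union>\<sigma>\<in>I. fibre \<sigma> \<inter> top.inertia P')" if s: "s \<in> top.inertia P'" for s
  proof (rule UN_I)
    show "res s \<in> I" unfolding I_def by (rule res_inertia[OF P' s])
    have "s \<in> top.G" using s top.acts_G unfolding top.inertia_def by blast
    then show "s \<in> fibre (res s) \<inter> top.inertia P'" using s by (simp add: fibre_def)
  qed
  then have "top.inertia P' \<subseteq> (\<Union>\<sigma>\<in>I. fibre \<sigma> \<inter> top.inertia P')" by (rule subsetI)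
  then have "card (top.inertia P') \<le> card (\<Union>\<sigma>\<in>I. fibre \<sigma> \<inter> top.inertia P')"
    using finite_fibre bot.finite_inertia by (intro card_mono) (auto simp: I_def)
  also have "\<dots> \<le> (\<Sum>\<sigma>\<in>I. card (fibre \<sigma> \<inter> top.inertia P'))"
    using bot.finite_inertia unfolding I_def by (rule card_UN_le)
  also have "\<dots> \<le> (\<Sum>\<sigma>\<in>I. card (H0 P'))"
  proof (rule sum_mono)
    fix \<sigma>
    show "card (fibre \<sigma> \<inter> top.inertia P') \<le> card (H0 P')"
    proof (cases "fibre \<sigma> \<inter> top.inertia P' = {}")
      case False
      then obtain s where s: "s \<in> fibre \<sigma>" "s \<in> top.inertia P'" by blast
      have sG: "s \<in> top.G" using s by (simp add: fibre_def)
      show ?thesis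
      proof (rule card_inj_on_le)
        show "inj_on (\<lambda>t. inv\<^bsub>Gal K L'\<^esub> s \<otimes>\<^bsub>Gal K L'\<^esub> t) (fibre \<sigma> \<inter> top.inertia P')"
          using sG by (intro inj_onI) (auto simp: fibre_def)
        show "(\<lambda>t. inv\<^bsub>Gal K L'\<^esub> s \<otimes>\<^bsub>Gal K L'\<^esub> t) ` (fibre \<sigma> \<inter> top.inertia P') \<subseteq> H0 P'"
          using fibre_quot[OF s(1)] top.acts_mult[OF top.acts_inv[OF s(2)[unfolded top.inertia_def] P'] _ P']
          by (auto simp: H0_def top.inertia_def)
        show "finite (H0 P')" using finite_H by (simp add: H0_def)
      qed
    qed simp
  qed
  finally show ?thesis by (simp add: I_def mult.commute)
qed

text \<open>Let \<open>s\<close> be a lift of \<sigma> with the largest index. For \<eta> in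
  \<open>H\<close> the product of \<open>s\<close> and \<eta> has index at most that of \<eta>,
  since \<eta> is a quotient of two elements with at least that index. So the estimate for \<sigma>
  costs the index of \<open>s\<close> and the indices of \<open>H\<close>, while the estimates for
  all \<tau> cost the lifts of nontrivial inertia elements. These sets are disjoint, and the
  inequality upstairs at \<open>s\<close> yields the one at \<sigma> after division by
  \<open>card (H0 P')\<close>.\<close>

lemma ram_upper_trivial_down:
  assumes P': "P' \<in> primes L'" and e: "ram_upper K L' P' (real e) = {\<one>\<^bsub>Gal K L'\<^esub>}"
  shows "ram_upper K L (P' \<inter> ints L) (real e) = {\<one>\<^bsub>Gal K L\<^esub>}"
proof -
  define P where "P = P' \<inter> ints L"
  have P: "P \<in> primes L" unfolding P_def by (rule ext.contraction[OF P'])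
  define h where "h = card (H0 P')"
  have h: "0 < h" using card_H0_pos[OF P'] by (simp add: h_def)
  have top_lt: "top.idx P' s + (\<Sum>t\<in>top.ri P'. top.idx P' t) < (e + 1) * card (top.inertia P')" if "s \<in> top.ri P'" for s
    using e top.ram_upper_trivial_iff[OF P'] that by blast
  define G1 where "G1 = top.G - {\<one>\<^bsub>Gal K L'\<^esub>}"
  have finG1: "finite G1" using top.finite_G by (simp add: G1_def)
  have zero: "top.idx P' s = 0" if "s \<in> G1" "s \<notin> top.ri P'" for s
    using that top.idx_ge_iff[OF P', of s 1] by (auto simp: G1_def top.ri_def top.inertia_def)
  have riG1: "top.ri P' \<subseteq> G1" using top.riD by (auto simp: G1_def)
  \<comment> \<open>Indices vanish outside the inertia group; sums over all nonidentity elements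
    also admit the lifts that are not in inertia.\<close>
  have sumG1: "(\<Sum>t\<in>top.ri P'. top.idx P' t) = (\<Sum>t\<in>G1. top.idx P' t)"
    using zero by (intro sum.mono_neutral_left[OF finG1 riG1]) blast
  have "bot.idx P \<sigma> + (\<Sum>\<tau>\<in>bot.ri P. bot.idx P \<tau>) < (e + 1) * card (bot.inertia P)" if \<sigma>: "\<sigma> \<in> bot.ri P" for \<sigma>
  proof -
    have \<sigma>G: "\<sigma> \<in> bot.G" "\<sigma> \<noteq> \<one>\<^bsub>Gal K L\<^esub>" using bot.riD[OF \<sigma>] by auto
    have fne: "fibre \<sigma> \<noteq> {}" using fibre_nonempty[OF \<sigma>G(1)] by blast
    obtain s where s: "s \<in> fibre \<sigma>" "\<forall>t\<in>fibre \<sigma>. top.idx P' t \<le> top.idx P' s"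
    proof -
      have "Max (top.idx P' ` fibre \<sigma>) \<in> top.idx P' ` fibre \<sigma>" using fne finite_fibre by (intro Max_in) auto
      then obtain s where s: "s \<in> fibre \<sigma>" "top.idx P' s = Max (top.idx P' ` fibre \<sigma>)" by (metis imageE)
      have "\<forall>t\<in>fibre \<sigma>. top.idx P' t \<le> top.idx P' s" unfolding s(2) using finite_fibre by simp
      then show ?thesis using s(1) by (rule that[rotated])
    qed
    have ne1: "t \<in> G1" if "t \<in> fibre \<tau>" "\<tau> \<noteq> \<one>\<^bsub>Gal K L\<^esub>" for t \<tau>
      using that res_one by (auto simp: fibre_def G1_def)
    have sG: "s \<in> top.G" "s \<noteq> \<one>\<^bsub>Gal K L'\<^esub>" using ne1[OF s(1) \<sigma>G(2)] by (simp_all add: G1_def)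
    have "0 < h * bot.idx P \<sigma>" using h bot.idx_pos[OF P \<sigma>] by simp
    then have "0 < (\<Sum>t\<in>fibre \<sigma>. top.idx P' t)" using idx_sum[OF P' \<sigma>G] unfolding h_def P_def by (rule less_le_trans)
    then obtain t where "t \<in> fibre \<sigma>" "0 < top.idx P' t" by (metis gr0I sum.neutral less_irrefl)
    then have "0 < top.idx P' s" using s(2) by fastforce
    then have sri: "s \<in> top.ri P'" using zero[OF ne1[OF s(1) \<sigma>G(2)]] by auto
    define H1 where "H1 = H - {\<one>\<^bsub>Gal K L'\<^esub>}"
    have "(\<Sum>t\<in>fibre \<sigma>. top.idx P' t) = (\<Sum>\<eta>\<in>H. top.idx P' (s \<otimes>\<^bsub>Gal K L'\<^esub> \<eta>))"
      by (rule sum.reindex_bij_betw[OF fibre_bij[OF s(1)], symmetric])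
    also have "\<dots> = top.idx P' (s \<otimes>\<^bsub>Gal K L'\<^esub> \<one>\<^bsub>Gal K L'\<^esub>) + (\<Sum>\<eta>\<in>H1. top.idx P' (s \<otimes>\<^bsub>Gal K L'\<^esub> \<eta>))"
      unfolding H1_def by (rule sum.remove[OF finite_H H_one])
    also have "\<dots> \<le> top.idx P' s + (\<Sum>\<eta>\<in>H1. top.idx P' \<eta>)"
    proof (intro add_mono sum_mono)
      fix \<eta> assume "\<eta> \<in> H1"
      then have \<eta>: "\<eta> \<in> top.G" "\<eta> \<noteq> \<one>\<^bsub>Gal K L'\<^esub>" "\<eta> \<in> H" by (auto simp: H1_def H_def)
      define t n where "t = s \<otimes>\<^bsub>Gal K L'\<^esub> \<eta>" and "n = top.idx P' t"
      have tf: "t \<in> fibre \<sigma>" unfolding t_def using fibre_bij[OF s(1)] \<eta>(3) by (auto simp: bij_betw_def)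
      have tG: "t \<in> top.G" "t \<noteq> \<one>\<^bsub>Gal K L'\<^esub>" using ne1[OF tf \<sigma>G(2)] by (simp_all add: G1_def)
      have "n \<le> top.idx P' s" using s(2) tf by (simp add: n_def)
      then have "s \<in> top.acts P' n" using top.idx_ge_iff[OF P' sG] by blast
      moreover have "t \<in> top.acts P' n" using top.idx_ge_iff[OF P' tG, of n] by (simp add: n_def)
      ultimately have "inv\<^bsub>Gal K L'\<^esub> s \<otimes>\<^bsub>Gal K L'\<^esub> t \<in> top.acts P' n"
        by (intro top.acts_mult[OF top.acts_inv _ P'] P')
      also have "inv\<^bsub>Gal K L'\<^esub> s \<otimes>\<^bsub>Gal K L'\<^esub> t = \<eta>"
        using sG \<eta> by (simp add: t_def top.Gal.m_assoc[symmetric])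
      finally have "n \<le> top.idx P' \<eta>" using top.idx_ge_iff[OF P' \<eta>(1,2)] by blast
      then show "top.idx P' (s \<otimes>\<^bsub>Gal K L'\<^esub> \<eta>) \<le> top.idx P' \<eta>" by (simp add: n_def t_def)
    qed (use sG in simp)
    finally have 1: "h * bot.idx P \<sigma> \<le> top.idx P' s + (\<Sum>\<eta>\<in>H1. top.idx P' \<eta>)"
      using idx_sum[OF P' \<sigma>G] by (simp add: h_def P_def)
    define U where "U = (\<Union>\<tau>\<in>bot.ri P. fibre \<tau>)"
    have "h * (\<Sum>\<tau>\<in>bot.ri P. bot.idx P \<tau>) \<le> (\<Sum>\<tau>\<in>bot.ri P. \<Sum>t\<in>fibre \<tau>. top.idx P' t)"
      unfolding sum_distrib_left using idx_sum[OF P'] bot.riD by (intro sum_mono) (auto simp: h_def P_def)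
    also have "\<dots> = (\<Sum>t\<in>U. top.idx P' t)"
      unfolding U_def by (rule sum.UNION_disjoint[symmetric]) (use bot.finite_ri finite_fibre in \<open>auto simp: fibre_def\<close>)
    finally have 2: "h * (\<Sum>\<tau>\<in>bot.ri P. bot.idx P \<tau>) \<le> (\<Sum>t\<in>U. top.idx P' t)" .
    have finU: "finite U" using bot.finite_ri finite_fibre by (simp add: U_def)
    have disj: "H1 \<inter> U = {}"
    proof -
      have False if t: "t \<in> H1" "\<tau> \<in> bot.ri P" "t \<in> fibre \<tau>" for t \<tau>
        using t bot.riD[OF t(2)] by (auto simp: H1_def H_fibre fibre_def)
      then show ?thesis unfolding U_def by blast
    qed
    have sub: "H1 \<union> U \<subseteq> G1"
    proof -
      have "t \<in> G1" if "\<tau> \<in> bot.ri P" "t \<in> fibre \<tau>" for t \<tau>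
        using ne1[OF that(2)] bot.riD[OF that(1)] by blast
      then have "U \<subseteq> G1" unfolding U_def by blast
      moreover have "H1 \<subseteq> G1" by (auto simp: H1_def G1_def H_def)
      ultimately show ?thesis by blast
    qed
    have "(\<Sum>\<eta>\<in>H1. top.idx P' \<eta>) + (\<Sum>t\<in>U. top.idx P' t) = (\<Sum>t\<in>H1 \<union> U. top.idx P' t)"
      using finite_H finU disj by (intro sum.union_disjoint[symmetric]) (auto simp: H1_def)
    also have "\<dots> \<le> (\<Sum>t\<in>G1. top.idx P' t)" using sub finG1 by (intro sum_mono2) auto
    finally have "h * (bot.idx P \<sigma> + (\<Sum>\<tau>\<in>bot.ri P. bot.idx P \<tau>)) \<le> top.idx P' s + (\<Sum>t\<in>top.ri P'. top.idx P' t)"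
      using 1 2 unfolding sumG1 distrib_left by linarith
    also have "\<dots> < (e + 1) * card (top.inertia P')" by (rule top_lt[OF sri])
    also have "\<dots> \<le> (e + 1) * (h * card (bot.inertia P))"
      using card_top_inertia_le[OF P'] unfolding h_def P_def by (rule mult_le_mono2)
    finally have "h * (bot.idx P \<sigma> + (\<Sum>\<tau>\<in>bot.ri P. bot.idx P \<tau>)) < h * ((e + 1) * card (bot.inertia P))"
      by (simp only: mult.left_commute)
    then show ?thesis by (rule mult_less_cancel1[THEN iffD1, THEN conjunct2])
  qed
  then show ?thesis using bot.ram_upper_trivial_iff[OF P] unfolding P_def by blast
qed

lemma cexp_mono: "P' \<in> primes L' \<Longrightarrow> bot.cexp (P' \<inter> ints L) \<le> top.cexp P'"
  unfolding bot.cexp_def[of "P' \<inter> ints L"] by (rule Least_le) (rule ram_upper_trivial_down[OF _ top.ram_upper_cexp])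

lemma conductor_val_mono:
  assumes "p \<in> primes K" shows "ideal_val K p (conductor K L) \<le> ideal_val K p (conductor K L')"
proof -
  obtain P' where P': "P' \<in> primes_above K L' p" using top.ex_prime_over[OF assms] by blast
  then have P': "P' \<in> primes L'" "P' \<inter> ints K = p" by (simp_all add: primes_above_def)
  have "(P' \<inter> ints L) \<inter> ints K = p" using P'(2) bot.ints_sub by blast
  then show ?thesis
    using bot.conductor(2)[OF ext.contraction[OF P'(1)]] top.conductor(2)[OF P'(1)] cexp_mono[OF P'(1)] P'(2) by simp
qed

end

section \<open>Quadratic extensions\<close>

definition adjoin :: "'a :: field_char_0 set \<Rightarrow> 'a \<Rightarrow> 'a set"
  where "adjoin L \<alpha> = {x + y * \<alpha> | x y. x \<in> L \<and> y \<in> L}"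

lemma adjoin_mono: "K \<subseteq> L \<Longrightarrow> adjoin K \<alpha> \<subseteq> adjoin L \<alpha>"
  by (auto simp: adjoin_def)

lemma (in sub_field) adjoin_sub: "K \<subseteq> adjoin K \<alpha>"
proof
  fix x assume "x \<in> K"
  then have "x = x + 0 * \<alpha> \<and> x \<in> K \<and> 0 \<in> K" by simp
  then show "x \<in> adjoin K \<alpha>" unfolding adjoin_def by blast
qed

lemma (in nfield) finite_galois_self: "finite_galois K K"
  unfolding finite_galois_def
proof (intro conjI)
  show "Omega.finite_dimension K K"
    using Omega.dimension_one[OF subfield_K] by (rule Omega.finite_dimensionI)
  show "fixed_field K (carrier (Gal K K)) = K" by (auto simp: fixed_field_def Gal_iff)
qed (simp_all add: subfield_K)

text \<open>Since \<open>a\<close> lies in \<open>K\<close> and not merely in \<open>L\<close>,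
  automorphisms of \<open>L\<close> over \<open>K\<close> fix it and extend to the new field with
  either sign of \<alpha>.\<close>

locale quadratic = galois K L for K L :: "'a :: field_char_0 set" +
  fixes \<alpha> a
  assumes sqrt: "\<alpha> * \<alpha> = a" and a: "a \<in> K" and irr: "\<alpha> \<notin> L"
begin

lemma aL: "a \<in> L"
  using a sub by blast

lemma coord_unique:
  assumes "x + y * \<alpha> = u + v * \<alpha>" "x \<in> L" "y \<in> L" "u \<in> L" "v \<in> L" shows "x = u \<and> y = v"
proof (cases "y = v")
  case False
  have "(y - v) * \<alpha> = u - x" using assms(1) by (simp add: algebra_simps)
  then have "\<alpha> = (u - x) / (y - v)" using False by (simp add: field_simps)
  then have "\<alpha> \<in> L" using assms by simp
  then show ?thesis using irr by blast
qed (use assms in simp)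

definition co0 where "co0 z = (THE x. x \<in> L \<and> (\<exists>y\<in>L. z = x + y * \<alpha>))"
definition co1 where "co1 z = (THE y. y \<in> L \<and> (\<exists>x\<in>L. z = x + y * \<alpha>))"

lemma co [simp]:
  assumes "x \<in> L" "y \<in> L" shows "co0 (x + y * \<alpha>) = x" "co1 (x + y * \<alpha>) = y"
  unfolding co0_def co1_def using coord_unique[of x y] assms by (auto intro!: the_equality)

abbreviation Q where "Q \<equiv> adjoin L \<alpha>"

lemma Q_mem: "x \<in> L \<Longrightarrow> y \<in> L \<Longrightarrow> x + y * \<alpha> \<in> Q"
  by (auto simp: adjoin_def)

lemma Q_cases: assumes "z \<in> Q" obtains x y where "z = x + y * \<alpha>" "x \<in> L" "y \<in> L"
  using assms by (auto simp: adjoin_def)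

lemma Q_mult_eq: "(x + y * \<alpha>) * (u + v * \<alpha>) = (x * u + y * v * a) + (x * v + y * u) * \<alpha>"
  by (simp add: sqrt[symmetric] algebra_simps)

lemma subfield_Q: "subfield Q \<Omega>"
  unfolding subfield_Omega_iff
proof (intro conjI ballI)
  show "1 \<in> Q" using L.adjoin_sub[of \<alpha>] L.one_mem by blast
next
  fix z assume "z \<in> Q"
  then obtain x y where z: "z = x + y * \<alpha>" "x \<in> L" "y \<in> L" by (rule Q_cases)
  have "- z = - x + (- y) * \<alpha>" by (simp add: z)
  then show "- z \<in> Q" using Q_mem[of "- x" "- y"] z by simp
  show "inverse z \<in> Q"
  proof (cases "z = 0")
    case True
    then show ?thesis using L.adjoin_sub[of \<alpha>] L.zero_mem by auto
  next
    case False
    \<comment> \<open>The norm of \<open>z\<close> to \<open>L\<close>; dividing the conjugate of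
      \<open>z\<close> by it inverts \<open>z\<close>.\<close>
    define d where "d = x * x - y * y * a"
    have d: "d = z * (x - y * \<alpha>)" by (simp add: d_def z sqrt[symmetric] algebra_simps)
    have "x - y * \<alpha> \<noteq> 0"
    proof
      assume "x - y * \<alpha> = 0"
      then have "x + (- y) * \<alpha> = 0 + 0 * \<alpha>" by simp
      then have "x = 0 \<and> - y = 0" using z by (intro coord_unique) auto
      then show False using False z by simp
    qed
    then have "d \<noteq> 0" using d False by simp
    have "z * (x / d + (- y / d) * \<alpha>) = z * (x - y * \<alpha>) / d" using \<open>d \<noteq> 0\<close> by (simp add: field_simps)
    then have "z * (x / d + (- y / d) * \<alpha>) = 1" using d \<open>d \<noteq> 0\<close> by simp
    then have "inverse z = x / d + (- y / d) * \<alpha>" by (rule inverse_unique)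
    moreover have "d \<in> L" using z aL by (simp add: d_def)
    ultimately show ?thesis using Q_mem[of "x / d" "- y / d"] z by simp
  qed
next
  fix z w assume "z \<in> Q" "w \<in> Q"
  then obtain x y u v where z: "z = x + y * \<alpha>" "x \<in> L" "y \<in> L" and w: "w = u + v * \<alpha>" "u \<in> L" "v \<in> L"
    using Q_cases by metis
  have "z + w = (x + u) + (y + v) * \<alpha>" by (simp add: z w algebra_simps)
  then show "z + w \<in> Q" using Q_mem[OF L.add_mem[OF z(2) w(2)] L.add_mem[OF z(3) w(3)]] by simp
  have "z * w = (x * u + y * v * a) + (x * v + y * u) * \<alpha>" unfolding z(1) w(1) by (rule Q_mult_eq)
  then show "z * w \<in> Q" using Q_mem[of "x * u + y * v * a" "x * v + y * u"] z(2,3) w(2,3) aL by simp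
qed

definition lift where "lift \<sigma> \<epsilon> = (\<lambda>z\<in>Q. \<sigma> (co0 z) + \<epsilon> * \<sigma> (co1 z) * \<alpha>)"

lemma lift_app: "x \<in> L \<Longrightarrow> y \<in> L \<Longrightarrow> lift \<sigma> \<epsilon> (x + y * \<alpha>) = \<sigma> x + \<epsilon> * \<sigma> y * \<alpha>"
  using Q_mem by (simp add: lift_def)

lemma lift_L: "x \<in> L \<Longrightarrow> \<sigma> \<in> G \<Longrightarrow> lift \<sigma> \<epsilon> x = \<sigma> x"
  using lift_app[of x 0 \<sigma> \<epsilon>] gal_0 by simp

lemma lift_Gal:
  assumes \<sigma>: "\<sigma> \<in> G" and \<epsilon>: "\<epsilon> \<in> {1, -1}"
  shows "lift \<sigma> \<epsilon> \<in> carrier (Gal K Q)"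
proof -
  note E = gal_emb[OF \<sigma>]
  interpret Q: sub_field Q by (rule sub_field.intro[OF subfield_Q])
  interpret Q: subfield_pair Q K using sub L.adjoin_sub[of \<alpha>] by unfold_locales blast
  have \<epsilon>L: "\<epsilon> \<in> L" "\<epsilon> * \<epsilon> = 1" using \<epsilon> by auto
  have mem: "lift \<sigma> \<epsilon> z \<in> Q" if "z \<in> Q" for z
    using that Q_cases[OF that] lift_app[of _ _ \<sigma> \<epsilon>] gal_mem[OF \<sigma>] \<epsilon>L(1) by (metis Q_mem L.mult_mem)
  have emb: "emb Q (lift \<sigma> \<epsilon>)"
    unfolding emb_def
  proof (intro conjI ballI)
    show "lift \<sigma> \<epsilon> 1 = 1" using lift_L[OF _ \<sigma>, of 1] gal_1[OF \<sigma>] by simp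
    fix z w assume "z \<in> Q" "w \<in> Q"
    then obtain x y u v where z: "z = x + y * \<alpha>" "x \<in> L" "y \<in> L" and w: "w = u + v * \<alpha>" "u \<in> L" "v \<in> L"
      using Q_cases by metis
    have "z + w = (x + u) + (y + v) * \<alpha>" by (simp add: z w algebra_simps)
    then have "lift \<sigma> \<epsilon> (z + w) = \<sigma> (x + u) + \<epsilon> * \<sigma> (y + v) * \<alpha>"
      using lift_app[OF L.add_mem[OF z(2) w(2)] L.add_mem[OF z(3) w(3)]] by simp
    also have "\<dots> = lift \<sigma> \<epsilon> z + lift \<sigma> \<epsilon> w"
      unfolding z(1) w(1) lift_app[OF z(2,3)] lift_app[OF w(2,3)] L.emb_add[OF E z(2) w(2)] L.emb_add[OF E z(3) w(3)]
      by (simp add: algebra_simps)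
    finally show "lift \<sigma> \<epsilon> (z + w) = lift \<sigma> \<epsilon> z + lift \<sigma> \<epsilon> w" .
    have "z * w = (x * u + y * v * a) + (x * v + y * u) * \<alpha>" unfolding z(1) w(1) by (rule Q_mult_eq)
    then have "lift \<sigma> \<epsilon> (z * w) = \<sigma> (x * u + y * v * a) + \<epsilon> * \<sigma> (x * v + y * u) * \<alpha>"
      using lift_app[of "x * u + y * v * a" "x * v + y * u"] z(2,3) w(2,3) aL by simp
    also have "\<dots> = (\<sigma> x * \<sigma> u + \<sigma> y * \<sigma> v * a) + \<epsilon> * (\<sigma> x * \<sigma> v + \<sigma> y * \<sigma> u) * \<alpha>"
      using z(2,3) w(2,3) aL gal_fix[OF \<sigma> a] by (simp add: L.emb_add[OF E] L.emb_mult[OF E])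
    also have "\<dots> = (\<sigma> x * \<sigma> u + (\<epsilon> * \<sigma> y) * (\<epsilon> * \<sigma> v) * a) + (\<sigma> x * (\<epsilon> * \<sigma> v) + (\<epsilon> * \<sigma> y) * \<sigma> u) * \<alpha>"
    proof -
      have "(\<epsilon> * \<sigma> y) * (\<epsilon> * \<sigma> v) = (\<epsilon> * \<epsilon>) * (\<sigma> y * \<sigma> v)" by (simp only: mult_ac)
      then show ?thesis unfolding \<epsilon>L(2) by (simp add: algebra_simps)
    qed
    also have "\<dots> = lift \<sigma> \<epsilon> z * lift \<sigma> \<epsilon> w"
      unfolding Q_mult_eq[symmetric] z(1) w(1) lift_app[OF z(2,3)] lift_app[OF w(2,3)] ..
    finally show "lift \<sigma> \<epsilon> (z * w) = lift \<sigma> \<epsilon> z * lift \<sigma> \<epsilon> w" .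
  qed
  show ?thesis
  proof (rule Q.galI[OF _ emb])
    have "w \<in> lift \<sigma> \<epsilon> ` Q" if wQ: "w \<in> Q" for w
    proof -
      obtain u v where w: "w = u + v * \<alpha>" "u \<in> L" "v \<in> L" by (rule Q_cases[OF wQ])
      obtain x y where xy: "x \<in> L" "u = \<sigma> x" "y \<in> L" "\<epsilon> * v = \<sigma> y"
        using gal_surj[OF \<sigma>] w \<epsilon>L(1) by (metis L.mult_mem)
      have "lift \<sigma> \<epsilon> (x + y * \<alpha>) = u + \<epsilon> * (\<epsilon> * v) * \<alpha>" using xy by (simp add: lift_app)
      also have "\<dots> = w" using \<epsilon>L(2) by (simp add: w mult.assoc[symmetric])
      finally show ?thesis using Q_mem[OF xy(1,3)] by (metis image_eqI)
    qed
    then have "lift \<sigma> \<epsilon> ` Q = Q" using mem by blast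
    then show "bij_betw (lift \<sigma> \<epsilon>) Q Q" using Q.emb_inj[OF emb] by (simp add: bij_betw_def)
    show "lift \<sigma> \<epsilon> x = x" if "x \<in> K" for x
      using lift_L[OF _ \<sigma>, of x] gal_fix[OF \<sigma> that] that sub by auto
    show "lift \<sigma> \<epsilon> \<in> extensional Q" by (simp add: lift_def)
  qed
qed

text \<open>The lift of the identity with sign -1 forces a fixed element into \<open>L\<close>, and
  the lifts with sign 1 then force it into \<open>K\<close>.\<close>

lemma finite_galois_Q: "finite_galois K Q"
  unfolding finite_galois_def
proof (intro conjI)
  show "K \<subseteq> Q" using sub L.adjoin_sub[of \<alpha>] by blast
  have 1: "Omega.dimension 1 L L" by (rule Omega.dimension_one[OF L.subfield_K])
  have "Omega.line_extension L \<alpha> L = Q"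
  proof (rule Set.set_eqI)
    fix z
    have "z \<in> Omega.line_extension L \<alpha> L \<longleftrightarrow> (\<exists>y\<in>L. \<exists>x\<in>L. z = x + y * \<alpha>)"
      by (simp add: Omega.line_extension_mem_iff add.commute)
    then show "z \<in> Omega.line_extension L \<alpha> L \<longleftrightarrow> z \<in> Q" unfolding adjoin_def by blast
  qed
  then have "Omega.dimension (Suc 1) L Q" using Omega.Suc_dim[OF _ irr 1] by simp
  then have "Omega.finite_dimension L Q" by (rule Omega.finite_dimensionI)
  then show "Omega.finite_dimension K Q"
    by (rule Omega.telescopic_base_dim(1)[OF K.subfield_K L.subfield_K, rotated]) (use gal in \<open>simp add: finite_galois_def\<close>)
  show "fixed_field Q (carrier (Gal K Q)) = K"
  proof
    show "K \<subseteq> fixed_field Q (carrier (Gal K Q))"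
      using \<open>K \<subseteq> Q\<close> by (auto simp: fixed_field_def Gal_iff)
    show "fixed_field Q (carrier (Gal K Q)) \<subseteq> K"
    proof
      fix z assume "z \<in> fixed_field Q (carrier (Gal K Q))"
      then have z: "z \<in> Q" "\<And>\<rho>. \<rho> \<in> carrier (Gal K Q) \<Longrightarrow> \<rho> z = z" by (auto simp: fixed_field_def)
      obtain x y where xy: "z = x + y * \<alpha>" "x \<in> L" "y \<in> L" using z(1) by (rule Q_cases)
      have "x + (- y) * \<alpha> = x + y * \<alpha>"
        using z(2)[OF lift_Gal[OF Gal.one_closed, of "-1"]] xy by (simp add: lift_app one_app)
      then have "- y = y" using coord_unique[of x "- y" x y] xy by simp
      then have y: "y = 0" by simp
      then have "z \<in> L" using xy by simp
      moreover have "\<sigma> z = z" if "\<sigma> \<in> G" for \<sigma>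
        using z(2)[OF lift_Gal[OF that, of 1]] lift_L[OF \<open>z \<in> L\<close> that] by simp
      ultimately show "z \<in> K" by (rule fixed_G)
    qed
  qed
qed (rule subfield_Q)

end

section \<open>Square roots and ramification at a given prime\<close>

lemma (in galois) ex_adjoin_sqrt:
  assumes "\<alpha> * \<alpha> \<in> K" obtains L' where "finite_galois K L'" "L \<subseteq> L'" "adjoin L \<alpha> \<subseteq> L'"
proof (cases "\<alpha> \<in> L")
  case True
  then have "adjoin L \<alpha> \<subseteq> L" by (auto simp: adjoin_def)
  then show ?thesis using gal by (intro that[of L]) auto
next
  case False
  interpret quadratic K L \<alpha> "\<alpha> * \<alpha>" using False assms by unfold_locales auto
  show ?thesis using finite_galois_Q L.adjoin_sub by (intro that[of "adjoin L \<alpha>"]) auto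
qed

text \<open>The valuation of \<open>b * b * a\<close> at \<open>p\<close> is odd, hence not 0. As
  \<open>b\<close> may have denominators, the comparison is made after multiplying by the square of
  an integer.\<close>

lemma (in nfield) square_odd_irrational:
  assumes p: "p \<in> primes K" and a: "a \<in> ints K" "a \<noteq> 0" "ev p a = 1" and b: "b \<in> K" "b * b * a \<in> ints K"
  shows "b * b * a \<in> p"
proof (rule ccontr)
  assume n: "b * b * a \<notin> p"
  define c where "c = b * b * a"
  have "0 \<in> p" by (rule idealD(2)[OF primesD(1)[OF p]])
  then have c: "c \<in> ints K" "c \<noteq> 0" "c \<notin> p" using b n by (auto simp: c_def)
  have b0: "b \<noteq> 0" using c(2) by (auto simp: c_def)
  obtain m :: int where m: "m \<noteq> 0" "algebraic_int (of_int m * b)" using number_field_algebraic[OF nf b(1)] by blast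
  define u v where "u = of_int m * b" and "v = (of_int m :: 'a)"
  have u: "u \<in> ints K" "u \<noteq> 0" and v: "v \<in> ints K" "v \<noteq> 0" using m b b0 by (simp_all add: u_def v_def ints_iff)
  have "u * u * a = v * v * c" by (simp add: u_def v_def c_def algebra_simps)
  then have "ev p (u * u * a) = ev p (v * v * c)" by simp
  then have "2 * ev p u + 1 = 2 * ev p v + ev p c"
    using u v a c by (simp add: ev_mult[OF p])
  moreover have "ev p c = 0" using ev_pos_iff[OF p c(1,2)] c(3) by simp
  ultimately show False by presburger
qed

text \<open>Take \<open>a\<close> of valuation 1 at \<open>p\<close>. The automorphism with sign -1
  displaces an integer by a multiple \<open>w\<close> of \<alpha>, so \<open>w * w\<close> has the
  form \<open>b * b * a\<close> and lies in \<open>p\<close> by parity. Thus it belongs to the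
  inertia group; the factor 2 in \<open>w\<close> does no harm, even at primes above 2.\<close>

lemma (in nfield) ramified_quadratic:
  assumes roots: "\<And>a. a \<in> K \<Longrightarrow> \<exists>\<alpha>. \<alpha> * \<alpha> = (a :: 'a)" and p: "p \<in> primes K"
  obtains \<alpha> where "\<alpha> * \<alpha> \<in> K" "finite_galois K (adjoin K \<alpha>)" "0 < ideal_val K p (conductor K (adjoin K \<alpha>))"
proof -
  obtain a where av: "a \<in> ints K" "a \<noteq> 0" "ev p a = 1" using ex_uniformizer[OF p] by blast
  have aK: "a \<in> K" using av(1) by (rule ints_mem)
  obtain \<alpha> where \<alpha>: "\<alpha> * \<alpha> = a" using roots[OF aK] by blast
  have "\<alpha> \<notin> K"
  proof
    assume "\<alpha> \<in> K"
    then have "inverse \<alpha> \<in> K" "inverse \<alpha> * inverse \<alpha> * a = 1" using \<alpha> av(2) by (auto simp: field_simps)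
    then have "1 \<in> p" using square_odd_irrational[OF p av, of "inverse \<alpha>"] by simp
    then show False using primesD[OF p] by blast
  qed
  interpret quadratic K K \<alpha> a
    using finite_galois_self \<open>\<alpha> \<notin> K\<close> \<alpha> aK by unfold_locales
  interpret Q: galois K Q using finite_galois_Q by unfold_locales
  define \<tau> where "\<tau> = lift \<one>\<^bsub>Gal K K\<^esub> (- 1)"
  have \<tau>: "\<tau> \<in> Q.G" unfolding \<tau>_def by (intro lift_Gal) auto
  have \<tau>app: "\<tau> (x + y * \<alpha>) = x - y * \<alpha>" if "x \<in> K" "y \<in> K" for x y
    using that by (simp add: \<tau>_def lift_app one_app)
  obtain P where P: "P \<in> primes_above K Q p" using Q.ex_prime_over[OF p] by blast
  then have P': "P \<in> primes Q" "P \<inter> ints K = p" by (simp_all add: primes_above_def)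
  note PD = Q.L.primesD[OF P'(1)]
  have "\<tau> z - z \<in> P" if z: "z \<in> ints Q" for z
  proof -
    obtain x y where xy: "z = x + y * \<alpha>" "x \<in> K" "y \<in> K" using Q.L.ints_mem[OF z] by (rule Q_cases)
    define w where "w = \<tau> z - z"
    have wi: "w \<in> ints Q" using Q.gal_ints[OF \<tau> z] z by (simp add: w_def)
    define b where "b = 2 * y"
    have w: "w = - (b * \<alpha>)" unfolding w_def xy(1) \<tau>app[OF xy(2,3)] by (simp add: b_def algebra_simps)
    have ww: "w * w = b * b * a" by (simp add: w \<alpha>[symmetric] algebra_simps)
    have bK: "b \<in> K" using xy of_nat_mem[of 2] by (simp add: b_def)
    have "w * w \<in> ints K" using Q.L.ints_mult[OF wi wi] bK aK by (intro Q.ints_down) (simp_all add: ww)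
    then have "w * w \<in> p" using square_odd_irrational[OF p av bK] by (simp add: ww)
    then have "w * w \<in> P" using P'(2) by blast
    then show ?thesis using PD wi by (auto simp: w_def)
  qed
  then have "\<tau> \<in> Q.inertia P"
    using \<tau> Q.L.pw_1[OF P'(1)] by (simp add: Q.inertia_def Q.acts_def)
  moreover have "\<tau> \<noteq> \<one>\<^bsub>Gal K Q\<^esub>"
  proof
    assume "\<tau> = \<one>\<^bsub>Gal K Q\<^esub>"
    then have "\<tau> (0 + 1 * \<alpha>) = 0 + 1 * \<alpha>" using Q.one_app[OF Q_mem[of 0 1]] by simp
    then have "- \<alpha> = \<alpha>" using \<tau>app[of 0 1] by simp
    then show False using \<open>\<alpha> \<notin> K\<close> zero_mem by simp
  qed
  ultimately have "0 < Q.cexp P" using Q.cexp_pos_iff[OF P'(1)] by auto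
  then have "0 < ideal_val K p (conductor K Q)" using Q.conductor(2)[OF P'(1)] P'(2) by simp
  then show ?thesis using \<alpha> aK finite_galois_Q by (intro that[of \<alpha>]) auto
qed

lemma ex_sqrt_algebraic_closure:
  fixes K :: "'a :: field_char_0 set"
  assumes "algebraic_closure (\<Omega> :: 'a ring) K" "a \<in> K" shows "\<exists>\<alpha>. \<alpha> * \<alpha> = a"
proof -
  interpret A: algebraic_closure "\<Omega> :: 'a ring" K by (rule assms(1))
  interpret sub_field K by (intro sub_field.intro) (rule A.subfield_axioms)
  have "polynomial\<^bsub>\<Omega>\<^esub> K [1, 0, - a]" using assms(2) by (simp add: polynomial_def)
  then have "[1, 0, - a] \<in> carrier (K[X]\<^bsub>\<Omega>\<^esub>)" by (simp add: univ_poly_def)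
  then have "Omega.splitted [1, 0, - a]" by (rule A.roots_over_subfield)
  then have "Omega.roots [1, 0, - a] \<noteq> {#}" unfolding Omega.splitted_def by auto
  then obtain \<alpha> where \<alpha>: "\<alpha> \<in># Omega.roots [1, 0, - a]" by blast
  have "[1, 0, - a] \<in> carrier (poly_ring \<Omega>)" by (simp add: univ_poly_def polynomial_def)
  then have "Omega.is_root [1, 0, - a] \<alpha>" using \<alpha> A.roots_mem_iff_is_root by blast
  then have "\<alpha> * \<alpha> - a = 0" by (simp add: Omega.is_root_def numeral_2_eq_2)
  then show ?thesis by (intro exI[of _ \<alpha>]) simp
qed

section \<open>Idempotents\<close>

context galois begin

abbreviation divisors :: "'a set set"
  where "divisors \<equiv> {d \<in> carrier (ideal_monoid K). d divides\<^bsub>ideal_monoid K\<^esub> conductor K L}"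

lemma divisors_iff:
  "d \<in> divisors \<longleftrightarrow> d \<in> carrier (ideal_monoid K) \<and>
    (\<forall>p\<in>primes K. ideal_val K p d \<le> ideal_val K p (conductor K L))"
  using K.M_divides_iff[OF conductor(1), of d] K.le_iff_val[OF _ conductor(1), of d] by (simp cong: conj_cong)

text \<open>The generators of the group in \<open>ram_field\<close>, indexed by the primes of
  \<open>L\<close> alone; the difference of valuations is the valuation of the quotient of the
  conductor by \<open>d\<close>.\<close>

definition codivisor_gens :: "'a set \<Rightarrow> ('a \<Rightarrow> 'a) set"
  where "codivisor_gens d = (\<Union>P\<in>primes L. ram_upper K L P
    (real (ideal_val K (P \<inter> ints K) (conductor K L) - ideal_val K (P \<inter> ints K) d)))"

lemma codivisor_gens_G: "codivisor_gens d \<subseteq> G"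
  unfolding codivisor_gens_def using ram_upper_G[OF _ of_nat_0_le_iff] by blast

lemma codivisor_field_eq:
  assumes d: "d \<in> divisors" shows "codivisor_field K L d = fixed_field L (codivisor_gens d)"
proof -
  define c where "c = ideal_quot K (conductor K L) d"
  have c: "ideal_val K (P \<inter> ints K) c = ideal_val K (P \<inter> ints K) (conductor K L) - ideal_val K (P \<inter> ints K) d"
    if "P \<in> primes L" for P
    unfolding c_def using K.ideal_quot_val(2)[OF conductor(1) _ _ contraction[OF that]] d by blast
  have "(\<Union>p\<in>primes K. \<Union>P\<in>primes_above K L p. ram_upper K L P (real (ideal_val K p c))) =
      (\<Union>P\<in>primes L. ram_upper K L P (real (ideal_val K (P \<inter> ints K) c)))"
    unfolding primes_above_def using contraction by blast
  also have "\<dots> = codivisor_gens d" unfolding codivisor_gens_def using c by simp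
  finally show ?thesis
    unfolding ram_field_def c_def[symmetric] by (simp only: fixed_field_generate[OF codivisor_gens_G])
qed

text \<open>Fixed fields are fields containing \<open>K\<close>, so the second components of
  \<open>D_monoid\<close> live in groups, where the identity is the only idempotent.\<close>

lemma codivisor_field_pair:
  assumes d: "d \<in> divisors" shows "subfield_pair (codivisor_field K L d) K"
proof -
  define S where "S = codivisor_gens d"
  have SG: "\<sigma> \<in> G" if "\<sigma> \<in> S" for \<sigma> using that codivisor_gens_G by (auto simp: S_def)
  note E = gal_emb[OF SG]
  have inv: "\<sigma> (inverse x) = inverse x" if "\<sigma> \<in> S" "x \<in> L" "\<sigma> x = x" for \<sigma> x
  proof (cases "x = 0")
    case False
    then have "x * \<sigma> (inverse x) = 1"
      using L.emb_mult[OF E[OF that(1)], of x "inverse x"] L.emb_one[OF E[OF that(1)]] that by simp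
    then show ?thesis by (rule inverse_unique[symmetric])
  qed (use that in simp)
  have "subfield (fixed_field L S) \<Omega>"
    unfolding subfield_Omega_iff fixed_field_def
    by (simp add: L.emb_one[OF E] L.emb_add[OF E] L.emb_mult[OF E] L.emb_uminus[OF E] inv) metis
  moreover have "K \<subseteq> fixed_field L S"
    using sub gal_fix SG unfolding fixed_field_def by blast
  ultimately show ?thesis
    unfolding codivisor_field_eq[OF d] S_def
    by (rule subfield_pair.intro[OF sub_field.intro subfield_pair_axioms.intro])
qed

lemma D_monoid_carrier_iff: "(d, \<sigma>) \<in> carrier (D_monoid K L) \<longleftrightarrow>
    d \<in> divisors \<and> \<sigma> \<in> carrier (Gal K (codivisor_field K L d))"
  by (simp add: D_monoid_def)

text \<open>At each prime the first component satisfies \<open>min f (2 * d) = d\<close> for the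
  valuations of conductor and divisor. The second lies in a group, where \<open>\<sigma>\<close> can
  be cancelled from its square.\<close>

lemma D_monoid_idempotent_iff:
  assumes x: "(d, \<sigma>) \<in> carrier (D_monoid K L)"
  shows "(d, \<sigma>) \<otimes>\<^bsub>D_monoid K L\<^esub> (d, \<sigma>) = (d, \<sigma>) \<longleftrightarrow>
    \<sigma> = \<one>\<^bsub>Gal K (codivisor_field K L d)\<^esub> \<and>
    (\<forall>p\<in>primes K. ideal_val K p d = 0 \<or> ideal_val K p d = ideal_val K p (conductor K L))"
proof -
  define f where "f = conductor K L"
  define g where "g = ideal_gcd K f (d \<otimes>\<^bsub>ideal_monoid K\<^esub> d)"
  define F where "F = codivisor_field K L d"
  have d: "d \<in> divisors" and \<sigma>: "\<sigma> \<in> carrier (Gal K F)" using x by (simp_all only: D_monoid_carrier_iff F_def)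
  interpret F: subfield_pair F K unfolding F_def by (rule codivisor_field_pair[OF d])
  have dM: "d \<in> carrier (ideal_monoid K)" using d by blast
  have f: "f \<in> carrier (ideal_monoid K)" unfolding f_def by (rule conductor(1))
  have dd: "d \<otimes>\<^bsub>ideal_monoid K\<^esub> d \<in> carrier (ideal_monoid K)" by (rule K.M.m_closed[OF dM dM])
  have g: "g \<in> carrier (ideal_monoid K)" unfolding g_def by (rule K.ideal_gcd_val(1)[OF f dd])
  have vg: "ideal_val K p g = min (ideal_val K p f) (2 * ideal_val K p d)" if "p \<in> primes K" for p
    unfolding g_def using K.ideal_gcd_val(2)[OF f dd that] K.val_mult[OF that dM dM] by simp
  have le: "ideal_val K p d \<le> ideal_val K p f" if "p \<in> primes K" for p
    using d that unfolding divisors_iff f_def by blast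
  have "g = d \<longleftrightarrow> (\<forall>p\<in>primes K. ideal_val K p g = ideal_val K p d)"
    using K.M_eqI[OF g dM] by blast
  also have "\<dots> \<longleftrightarrow> (\<forall>p\<in>primes K. ideal_val K p d = 0 \<or> ideal_val K p d = ideal_val K p f)"
    using vg le by (intro ball_cong) (auto simp: min_def)
  finally have gd: "g = d \<longleftrightarrow> (\<forall>p\<in>primes K. ideal_val K p d = 0 \<or> ideal_val K p d = ideal_val K p f)" .
  have r: "restrict \<sigma> F = \<sigma>" using F.gal_ext[OF \<sigma>] by (rule extensional_restrict)
  have "(d, \<sigma>) \<otimes>\<^bsub>D_monoid K L\<^esub> (d, \<sigma>) =
      (g, restrict \<sigma> (codivisor_field K L g) \<otimes>\<^bsub>Gal K (codivisor_field K L g)\<^esub> restrict \<sigma> (codivisor_field K L g))"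
    by (simp only: D_monoid_def monoid.simps Let_def prod.case g_def f_def)
  then have "(d, \<sigma>) \<otimes>\<^bsub>D_monoid K L\<^esub> (d, \<sigma>) = (d, \<sigma>) \<longleftrightarrow> g = d \<and> \<sigma> \<otimes>\<^bsub>Gal K F\<^esub> \<sigma> = \<sigma>"
    using r by (auto simp: F_def)
  also have "\<sigma> \<otimes>\<^bsub>Gal K F\<^esub> \<sigma> = \<sigma> \<longleftrightarrow> \<sigma> = \<one>\<^bsub>Gal K F\<^esub>" using F.Gal.l_cancel_one[OF \<sigma> \<sigma>] .
  finally show ?thesis unfolding gd F_def f_def by blast
qed

text \<open>The part of the conductor supported on \<open>S\<close>; the choice is unique because
  valuations determine an ideal.\<close>

definition part_conductor :: "'a set set \<Rightarrow> 'a set"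
  where "part_conductor S = (SOME d. d \<in> carrier (ideal_monoid K) \<and>
    (\<forall>p\<in>primes K. ideal_val K p d = (if p \<in> S then ideal_val K p (conductor K L) else 0)))"

lemma part_conductor:
  shows "part_conductor S \<in> carrier (ideal_monoid K)"
    and "p \<in> primes K \<Longrightarrow> ideal_val K p (part_conductor S) = (if p \<in> S then ideal_val K p (conductor K L) else 0)"
proof -
  have "{p \<in> primes K. (if p \<in> S then ideal_val K p (conductor K L) else 0) \<noteq> 0} \<subseteq>
      {p \<in> primes K. ideal_val K p (conductor K L) \<noteq> 0}" by auto
  then have fin: "finite {p \<in> primes K. (if p \<in> S then ideal_val K p (conductor K L) else 0) \<noteq> 0}"
    by (rule finite_subset[OF _ K.finite_val_support[OF conductor(1)]])
  obtain d where "d \<in> carrier (ideal_monoid K)"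
    "\<And>p. p \<in> primes K \<Longrightarrow> ideal_val K p d = (if p \<in> S then ideal_val K p (conductor K L) else 0)"
    by (rule K.ex_ideal_val'[OF fin]) blast
  then have "\<exists>d. d \<in> carrier (ideal_monoid K) \<and>
    (\<forall>p\<in>primes K. ideal_val K p d = (if p \<in> S then ideal_val K p (conductor K L) else 0))" by (intro exI[of _ d]) simp
  from someI_ex[OF this]
  show "part_conductor S \<in> carrier (ideal_monoid K)"
    and "p \<in> primes K \<Longrightarrow> ideal_val K p (part_conductor S) = (if p \<in> S then ideal_val K p (conductor K L) else 0)"
    unfolding part_conductor_def by blast+
qed

lemma part_conductor_divisor: "part_conductor S \<in> divisors"
  unfolding divisors_iff using part_conductor by simp

definition idem :: "'a set set \<Rightarrow> 'a set \<times> ('a \<Rightarrow> 'a)"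
  where "idem S = (part_conductor S, \<one>\<^bsub>Gal K (codivisor_field K L (part_conductor S))\<^esub>)"

lemma idem_carrier: "idem S \<in> carrier (D_monoid K L)"
proof -
  interpret F: subfield_pair "codivisor_field K L (part_conductor S)" K
    by (rule codivisor_field_pair[OF part_conductor_divisor])
  show ?thesis unfolding idem_def D_monoid_carrier_iff using part_conductor_divisor by blast
qed

lemma idem_idempotent: "idem S \<otimes>\<^bsub>D_monoid K L\<^esub> idem S = idem S"
  using D_monoid_idempotent_iff[OF idem_carrier[of S, unfolded idem_def]] part_conductor
  unfolding idem_def by simp

text \<open>\<open>S\<close> is tested at ramified primes only, since at all others the two
  admissible valuations are both 0.\<close>

lemma idempotent_eq_idem:
  assumes x: "x \<in> carrier (D_monoid K L)" "x \<otimes>\<^bsub>D_monoid K L\<^esub> x = x"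
    and S: "\<And>p. p \<in> primes K \<Longrightarrow> 0 < ideal_val K p (conductor K L) \<Longrightarrow> p \<in> S \<longleftrightarrow> 0 < ideal_val K p (fst x)"
  shows "x = idem S"
proof -
  obtain d \<sigma> where xd: "x = (d, \<sigma>)" by (cases x)
  have d: "d \<in> divisors" using x(1) unfolding xd D_monoid_carrier_iff by blast
  note I = D_monoid_idempotent_iff[OF x(1)[unfolded xd], THEN iffD1, OF x(2)[unfolded xd]]
  have dS: "part_conductor S = d"
  proof (rule K.M_eqI)
    show "part_conductor S \<in> carrier (ideal_monoid K)" by (rule part_conductor(1))
    show "d \<in> carrier (ideal_monoid K)" using d by blast
    fix p assume p: "p \<in> primes K"
    then have "ideal_val K p d = 0 \<or> ideal_val K p d = ideal_val K p (conductor K L)" using I by blast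
    then show "ideal_val K p (part_conductor S) = ideal_val K p d"
      using S[OF p] part_conductor(2)[OF p, of S] by (cases "ideal_val K p (conductor K L) = 0") (auto simp: xd)
  qed
  have "\<sigma> = \<one>\<^bsub>Gal K (codivisor_field K L d)\<^esub>" using I by blast
  then show ?thesis by (simp only: xd idem_def dS)
qed

end

section \<open>Compatibility of the idempotents with transition maps\<close>

context galois_tower begin

text \<open>At a prime in \<open>S\<close> both levels use exponent 0, so the groups are inertia
  groups and restriction maps one into the other. Outside \<open>S\<close> the exponent upstairs is
  the full conductor exponent, where the group is trivial. The inclusion ensures that the identity
  upstairs restricts to the identity below.\<close>

lemma codivisor_field_mono:
  "codivisor_field K L (bot.part_conductor S) \<subseteq> codivisor_field K L' (top.part_conductor S)"
proof
  fix x assume "x \<in> codivisor_field K L (bot.part_conductor S)"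
  then have x: "x \<in> L" "\<sigma> \<in> bot.codivisor_gens (bot.part_conductor S) \<Longrightarrow> \<sigma> x = x" for \<sigma>
    unfolding bot.codivisor_field_eq[OF bot.part_conductor_divisor] by (auto simp: fixed_field_def)
  have "\<tau> x = x" if \<tau>: "\<tau> \<in> top.codivisor_gens (top.part_conductor S)" for \<tau>
  proof -
    obtain P' where P': "P' \<in> primes L'" and \<tau>: "\<tau> \<in> ram_upper K L' P'
        (real (ideal_val K (P' \<inter> ints K) (conductor K L') - ideal_val K (P' \<inter> ints K) (top.part_conductor S)))"
      using \<tau> unfolding top.codivisor_gens_def by (rule UN_E)
    define p where "p = P' \<inter> ints K"
    define P where "P = P' \<inter> ints L"
    have p: "p \<in> primes K" unfolding p_def by (rule top.contraction[OF P'])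
    have P: "P \<in> primes L" unfolding P_def by (rule ext.contraction[OF P'])
    have Pp: "P \<inter> ints K = p" using bot.ints_sub by (auto simp: P_def p_def)
    show ?thesis
    proof (cases "p \<in> S")
      case True
      then have "\<tau> \<in> top.inertia P'"
        using \<tau> top.part_conductor(2)[OF p, of S] top.ram_upper_0[OF P'] unfolding p_def[symmetric] by simp
      then have "res \<tau> \<in> bot.inertia P" unfolding P_def by (rule res_inertia[OF P'])
      then have "res \<tau> \<in> ram_upper K L P
          (real (ideal_val K (P \<inter> ints K) (conductor K L) - ideal_val K (P \<inter> ints K) (bot.part_conductor S)))"
        using True bot.part_conductor(2)[OF p, of S] bot.ram_upper_0[OF P] unfolding Pp by simp
      then have "res \<tau> \<in> bot.codivisor_gens (bot.part_conductor S)"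
        unfolding bot.codivisor_gens_def by (rule UN_I[OF P])
      then have "res \<tau> x = x" by (rule x(2))
      then show ?thesis using res_app[OF x(1), of \<tau>] by simp
    next
      case False
      then have "\<tau> \<in> ram_upper K L' P' (real (top.cexp P'))"
        using \<tau> top.part_conductor(2)[OF p, of S] top.conductor(2)[OF P'] unfolding p_def[symmetric] by simp
      then have "\<tau> = \<one>\<^bsub>Gal K L'\<^esub>" using top.ram_upper_cexp[OF P'] by simp
      then show ?thesis using top.one_app[of x] x(1) LL' by auto
    qed
  qed
  moreover have "x \<in> L'" using x(1) LL' by blast
  ultimately show "x \<in> codivisor_field K L' (top.part_conductor S)"
    unfolding top.codivisor_field_eq[OF top.part_conductor_divisor] fixed_field_def by simp
qed

text \<open>The gcd takes minima of valuations, and by \<open>conductor_val_mono\<close> the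
  conductor of the smaller field gives the minimum at primes of \<open>S\<close>.\<close>

lemma transition_idem: "D_transition K L (top.idem S) = bot.idem S"
proof -
  define g where "g = ideal_gcd K (top.part_conductor S) (conductor K L)"
  have "g = bot.part_conductor S"
  proof (rule bot.K.M_eqI)
    show "g \<in> carrier (ideal_monoid K)"
      unfolding g_def by (rule bot.K.ideal_gcd_val(1)[OF top.part_conductor(1) bot.conductor(1)])
    show "bot.part_conductor S \<in> carrier (ideal_monoid K)" by (rule bot.part_conductor(1))
    fix p assume p: "p \<in> primes K"
    show "ideal_val K p g = ideal_val K p (bot.part_conductor S)"
      unfolding g_def using bot.K.ideal_gcd_val(2)[OF top.part_conductor(1) bot.conductor(1) p, of S]
        top.part_conductor(2)[OF p, of S] bot.part_conductor(2)[OF p, of S] conductor_val_mono[OF p] by simp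
  qed
  moreover have "restrict \<one>\<^bsub>Gal K (codivisor_field K L' (top.part_conductor S))\<^esub> (codivisor_field K L (bot.part_conductor S)) =
      \<one>\<^bsub>Gal K (codivisor_field K L (bot.part_conductor S))\<^esub>"
    unfolding Gal_one using codivisor_field_mono[of S] by (auto simp: restrict_def fun_eq_iff)
  ultimately show ?thesis
    unfolding D_transition_def top.idem_def bot.idem_def g_def by (simp add: Let_def)
qed

end

section \<open>Idempotents of the inverse limit and the correspondence\<close>

lemma DG_carrier_iff:
  "x \<in> carrier (DG K) \<longleftrightarrow> x \<in> (\<Pi>\<^sub>E L\<in>{L. finite_galois K L}. carrier (D_monoid K L)) \<and>
    (\<forall>L L'. finite_galois K L \<and> finite_galois K L' \<and> L \<subseteq> L' \<longrightarrow> D_transition K L (x L') = x L)"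
  unfolding DG_def Let_def by simp

lemma DG_mult: "x \<otimes>\<^bsub>DG K\<^esub> y = (\<lambda>L\<in>{L. finite_galois K L}. x L \<otimes>\<^bsub>D_monoid K L\<^esub> y L)"
  unfolding DG_def Let_def by simp

lemma DG_idempotent_iff:
  "x \<in> idempotents (DG K) \<longleftrightarrow> x \<in> carrier (DG K) \<and>
    (\<forall>L. finite_galois K L \<longrightarrow> x L \<otimes>\<^bsub>D_monoid K L\<^esub> x L = x L)"
proof -
  have "x \<otimes>\<^bsub>DG K\<^esub> x = x \<longleftrightarrow> (\<forall>L. finite_galois K L \<longrightarrow> x L \<otimes>\<^bsub>D_monoid K L\<^esub> x L = x L)"
    if "x \<in> carrier (DG K)"
  proof
    assume "x \<otimes>\<^bsub>DG K\<^esub> x = x"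
    then have *: "(x \<otimes>\<^bsub>DG K\<^esub> x) L = x L" for L by (rule fun_cong)
    show "\<forall>L. finite_galois K L \<longrightarrow> x L \<otimes>\<^bsub>D_monoid K L\<^esub> x L = x L"
    proof (intro allI impI)
      fix L assume "finite_galois K L"
      then show "x L \<otimes>\<^bsub>D_monoid K L\<^esub> x L = x L" using *[of L] unfolding DG_mult by simp
    qed
  next
    assume R: "\<forall>L. finite_galois K L \<longrightarrow> x L \<otimes>\<^bsub>D_monoid K L\<^esub> x L = x L"
    have "x \<in> extensional {L. finite_galois K L}" using that unfolding DG_carrier_iff by (simp add: PiE_def)
    then show "x \<otimes>\<^bsub>DG K\<^esub> x = x"
      unfolding DG_mult using R by (intro extensionalityI[of _ "{L. finite_galois K L}"]) auto
  qed
  then show ?thesis unfolding idempotents_def by blast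
qed

context nfield begin

text \<open>The existential over levels is forced: at a level where \<open>p\<close> is unramified
  every component has valuation 0 at \<open>p\<close>.\<close>

definition prime_set :: "('a set \<Rightarrow> 'a set \<times> ('a \<Rightarrow> 'a)) \<Rightarrow> 'a set set"
  where "prime_set x = {p \<in> primes K. \<exists>L. finite_galois K L \<and> 0 < ideal_val K p (fst (x L))}"

definition prime_idem :: "'a set set \<Rightarrow> 'a set \<Rightarrow> 'a set \<times> ('a \<Rightarrow> 'a)"
  where "prime_idem S = (\<lambda>L\<in>{L. finite_galois K L}. galois.idem K L S)"

lemma galoisI: "finite_galois K L \<Longrightarrow> galois K L"
  by unfold_locales

lemma prime_idem_idempotent: "prime_idem S \<in> idempotents (DG K)"
proof -
  have "prime_idem S \<in> carrier (DG K)"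
    unfolding DG_carrier_iff
  proof (intro conjI allI impI)
    show "prime_idem S \<in> (\<Pi>\<^sub>E L\<in>{L. finite_galois K L}. carrier (D_monoid K L))"
      unfolding prime_idem_def by (rule restrict_PiE_iff[THEN iffD2]) (simp add: galois.idem_carrier[OF galoisI])
    fix L L' assume LL: "finite_galois K L \<and> finite_galois K L' \<and> L \<subseteq> L'"
    interpret galois_tower K L L' using LL by unfold_locales auto
    show "D_transition K L (prime_idem S L') = prime_idem S L"
      using LL transition_idem by (simp add: prime_idem_def)
  qed
  then show ?thesis
    unfolding DG_idempotent_iff by (simp add: prime_idem_def galois.idem_idempotent[OF galoisI])
qed

lemma val_transition:
  assumes x: "x \<in> carrier (DG K)" and L: "finite_galois K L" "finite_galois K L'" "L \<subseteq> L'" and p: "p \<in> primes K"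
  shows "ideal_val K p (fst (x L)) = min (ideal_val K p (fst (x L'))) (ideal_val K p (conductor K L))"
proof -
  interpret galois_tower K L L' using L by unfold_locales auto
  obtain d \<sigma> where d: "x L' = (d, \<sigma>)" by (cases "x L'")
  have "x L' \<in> carrier (D_monoid K L')" using x L(2) unfolding DG_carrier_iff by blast
  then have dM: "d \<in> carrier (ideal_monoid K)" unfolding d top.D_monoid_carrier_iff by blast
  have "D_transition K L (x L') = x L" using x L unfolding DG_carrier_iff by blast
  then have "fst (x L) = ideal_gcd K d (conductor K L)"
    unfolding D_transition_def d by (metis (no_types, lifting) case_prod_conv fst_conv)
  then show ?thesis using ideal_gcd_val(2)[OF dM bot.conductor(1) p] d by simp
qed

text \<open>Positivity travels from \<open>L1\<close> up to a field shared with
  \<open>adjoin K \<alpha>\<close>, down to \<open>adjoin K \<alpha>\<close>, up to a field shared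
  with \<open>L\<close> and down to \<open>L\<close>. Going up it persists because the lower value
  is a minimum; going down it persists because \<open>p\<close> is ramified in
  \<open>adjoin K \<alpha>\<close> and in \<open>L\<close>.\<close>

lemma prime_set_iff:
  assumes roots: "\<And>a. a \<in> K \<Longrightarrow> \<exists>\<alpha>. \<alpha> * \<alpha> = (a :: 'a)" and x: "x \<in> carrier (DG K)"
    and L: "finite_galois K L" and p: "p \<in> primes K" "0 < ideal_val K p (conductor K L)"
  shows "p \<in> prime_set x \<longleftrightarrow> 0 < ideal_val K p (fst (x L))"
proof
  assume "p \<in> prime_set x"
  then obtain L1 where L1: "finite_galois K L1" "0 < ideal_val K p (fst (x L1))" unfolding prime_set_def by blast
  obtain \<alpha> where \<alpha>: "\<alpha> * \<alpha> \<in> K" "finite_galois K (adjoin K \<alpha>)" "0 < ideal_val K p (conductor K (adjoin K \<alpha>))"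
    by (rule ramified_quadratic[OF roots p(1)])
  have up: "\<exists>L'. finite_galois K L' \<and> M \<subseteq> L' \<and> adjoin K \<alpha> \<subseteq> L'" if M: "finite_galois K M" for M
  proof -
    interpret galois K M by (rule galoisI[OF M])
    obtain L' where "finite_galois K L'" "M \<subseteq> L'" "adjoin M \<alpha> \<subseteq> L'" by (rule ex_adjoin_sqrt[OF \<alpha>(1)])
    then show ?thesis using adjoin_mono[OF sub, of \<alpha>] by blast
  qed
  obtain L2 where L2: "finite_galois K L2" "L1 \<subseteq> L2" "adjoin K \<alpha> \<subseteq> L2" using up[OF L1(1)] by blast
  obtain L3 where L3: "finite_galois K L3" "L \<subseteq> L3" "adjoin K \<alpha> \<subseteq> L3" using up[OF L] by blast
  have "0 < ideal_val K p (fst (x L2))" using val_transition[OF x L1(1) L2(1,2) p(1)] L1(2) by simp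
  then have "0 < ideal_val K p (fst (x (adjoin K \<alpha>)))" using val_transition[OF x \<alpha>(2) L2(1,3) p(1)] \<alpha>(3) by simp
  then have "0 < ideal_val K p (fst (x L3))" using val_transition[OF x \<alpha>(2) L3(1,3) p(1)] by simp
  then show "0 < ideal_val K p (fst (x L))" using val_transition[OF x L L3(1,2) p(1)] p(2) by simp
qed (use L p in \<open>auto simp: prime_set_def\<close>)

end

theorem theorem5p7:
  fixes K :: "'a :: field_char_0 set"
  assumes "algebraic_closure (\<Omega> :: 'a ring) K"
    and "number_field K"
  shows "\<exists>\<Phi>. bij_betw \<Phi> (idempotents (DG K)) (Pow (primes K))"
proof -
  interpret nfield K using assms(2) by (rule nfield.intro)
  note roots = ex_sqrt_algebraic_closure[OF assms(1)]
  have "bij_betw prime_set (idempotents (DG K)) (Pow (primes K))"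
  proof (rule bij_betwI[of _ _ _ prime_idem])
    show "prime_set \<in> idempotents (DG K) \<rightarrow> Pow (primes K)" by (auto simp: prime_set_def)
    show "prime_idem \<in> Pow (primes K) \<rightarrow> idempotents (DG K)" using prime_idem_idempotent by blast
  next
    fix x assume x: "x \<in> idempotents (DG K)"
    then have xD: "x \<in> carrier (DG K)" unfolding DG_idempotent_iff by blast
    have "x L = galois.idem K L (prime_set x)" if L: "finite_galois K L" for L
    proof (rule galois.idempotent_eq_idem[OF galoisI[OF L]])
      show "x L \<in> carrier (D_monoid K L)" using xD L unfolding DG_carrier_iff by blast
      show "x L \<otimes>\<^bsub>D_monoid K L\<^esub> x L = x L" using x L unfolding DG_idempotent_iff by blast
    qed (rule prime_set_iff[OF roots xD L])
    moreover have "x \<in> extensional {L. finite_galois K L}" using xD unfolding DG_carrier_iff by (simp add: PiE_def)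
    ultimately show "prime_idem (prime_set x) = x"
      unfolding prime_idem_def by (intro extensionalityI[of _ "{L. finite_galois K L}"]) auto
  next
    fix S assume S: "S \<in> Pow (primes K)"
    have val: "ideal_val K p (fst (prime_idem S L)) = (if p \<in> S then ideal_val K p (conductor K L) else 0)"
      if "finite_galois K L" "p \<in> primes K" for L p
      using that galois.part_conductor(2)[OF galoisI[OF that(1)] that(2)]
      by (simp add: prime_idem_def galois.idem_def[OF galoisI])
    show "prime_set (prime_idem S) = S"
    proof
      show "prime_set (prime_idem S) \<subseteq> S"
        using val unfolding prime_set_def by (auto split: if_splits)
      show "S \<subseteq> prime_set (prime_idem S)"
      proof
        fix p assume p: "p \<in> S"
        then have pK: "p \<in> primes K" using S by blast
        \<comment> \<open>Membership of \<open>p\<close> needs a level at which \<open>p\<close>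
          ramifies; a quadratic extension provides one.\<close>
        obtain \<alpha> where \<alpha>: "\<alpha> * \<alpha> \<in> K" "finite_galois K (adjoin K \<alpha>)" "0 < ideal_val K p (conductor K (adjoin K \<alpha>))"
          by (rule ramified_quadratic[OF roots pK])
        then have "0 < ideal_val K p (fst (prime_idem S (adjoin K \<alpha>)))" using val[OF \<alpha>(2) pK] p by simp
        then show "p \<in> prime_set (prime_idem S)" unfolding prime_set_def using pK \<alpha>(2) by blast
      qed
    qed
  qed
  then show ?thesis by (intro exI[of _ prime_set])
qed

end
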